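(* Let $T>0$. For $\eta\in M_G^{2,0}(0,T)$ of the form $\eta_t=\sum_{j=0}^{N-1}\xi_j\mathbf{I}_{[t_j,t_{j+1})}(t)$ set $$I(\eta)=\int_0^T\eta(s)\,dB_s:=\sum_{j=0}^{N-1}\xi_j(B_{t_{j+1}}-B_{t_j}).$$ Then $I:M_G^{2,0}(0,T)\to L_G^2(\mathcal{F}_T)$ is a linear continuous mapping and thus can be continuously extended to $I:M_G^2(0,T)\to L_G^2(\mathcal{F}_T)$. In fact, for $\eta\in M_G^{2,0}(0,T)$, $$\mathbb{E}\Big[\int_0^T\eta(s)\,dB_s\Big]=0,\qquad \mathbb{E}\Big[\Big(\int_0^T\eta(s)\,dB_s\Big)^2\Big]\le\int_0^T\mathbb{E}[(\eta(t))^2]\,dt .$$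
   Context: Fix $\sigma_0\in[0,1]$ and $G(a)=\frac12(a^+-\sigma_0^2a^-)$, $a\in\mathbb{R}$. $lip(\mathbb{R}^m)$ is the space of bounded Lipschitz real functions on $\mathbb{R}^m$. For $\varphi\in lip(\mathbb{R})$, $P_t^G(\varphi)(x):=u(t,x)$, where $u$ is the unique bounded continuous viscosity solution on $[0,\infty)\times\mathbb{R}$ of $\partial_tu-G(\partial^2_{xx}u)=0$, $u(0,x)=\varphi(x)$. $\Omega=C_0(\mathbb{R}^+)$ is the space of continuous real paths $\omega$ with $\omega_0=0$, and $B_t(\omega)=\omega_t$. $L^0_{ip}(\mathcal{F}_T)$ is the set of random variables $\varphi(B_{t_1},\dots,B_{t_m})$, $m\ge1$, $t_1,\dots,t_m\in[0,T]$, $\varphi\in lip(\mathbb{R}^m)$; $L^0_{ip}(\mathcal{F})=\bigcup_{n\ge 1} L^0_{ip}(\mathcal{F}_n)$. The $G$-expectation $\mathbb{E}$ is defined on $L^0_{ip}(\mathcal{F})$ as follows: for $X=\varphi(B_{t_1},B_{t_2}-B_{t_1},\dots,B_{t_m}-B_{t_{m-1}})$ with $0\le t_1<\dots<t_m$, put $\varphi_0=\varphi$, $\varphi_k(x_1,\dots,x_{m-k})=P^G_{t_{m-k+1}-t_{m-k}}(\varphi_{k-1}(x_1,\dots,x_{m-k},\cdot))(0)$ for $1\le k\le m$ (with $t_0=0$), and $\mathbb{E}[X]=\varphi_m$; the conditional expectation is $\mathbb{E}[X|\mathcal{F}_{t_j}]=\varphi_{m-j}(B_{t_1},\dots,B_{t_j}-B_{t_{j-1}})$.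 It is known that $\mathbb{E}$ is a well-defined monotone, sub-additive, positively homogeneous, constant-preserving functional. $L_G^1(\mathcal{F}_T)$ and $L_G^1(\mathcal{F})$ are the completions of $L^0_{ip}(\mathcal{F}_T)$ and $L^0_{ip}(\mathcal{F})$ (modulo null elements) under $\|X\|=\mathbb{E}[|X|]$; $\mathbb{E}$, $\mathbb{E}[\cdot|\mathcal{F}_t]$ and the lattice operations extend continuously. For $p\ge 1$, $L_G^p(\mathcal{F}_t)=\{X\in L_G^1(\mathcal{F}_t):|X|^p\in L_G^1(\mathcal{F}_t)\}$ with norm $\mathbb{E}[|X|^p]^{1/p}$. Products and powers of elements are understood as $L_G^1$-limits of the products and powers of their truncations $(X\wedge N)\vee(-N)$. For $p\ge1$, $M_G^{p,0}(0,T)$ is the set of processes $\eta_t=\sum_{j=0}^{N-1}\xi_j\mathbf{I}_{[t_j,t_{j+1})}(t)$ with $0=t_0<\dots<t_N=T$ and $\xi_j\in L_G^p(\mathcal{F}_{t_j})$, and $M_G^p(0,T)$ is its completion under $\left(\frac1T\int_0^T\mathbb{E}[|\eta_t|^p]dt\right)^{1/p}$. *)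

theory Defs
  imports "HOL-Analysis.Analysis" "HOL-Library.Going_To_Filter"
begin

definition Gfun :: "real \<Rightarrow> real \<Rightarrow> real" where
  "Gfun \<sigma>\<^sub>0 a = (max a 0 - \<sigma>\<^sub>0\<^sup>2 * max (- a) 0) / 2"

text \<open>Vectors of $R^m$ are lists of length $m$, because the backward recursion defining the
  expectation changes the dimension. Only the values on lists of length $m$ matter.\<close>

definition lip :: "nat \<Rightarrow> (real list \<Rightarrow> real) set" where
  "lip m = {\<phi>. (\<exists>M. \<forall>x. length x = m \<longrightarrow> \<bar>\<phi> x\<bar> \<le> M) \<and>
     (\<exists>C. \<forall>x y. length x = m \<longrightarrow> length y = m \<longrightarrow>
        \<bar>\<phi> x - \<phi> y\<bar> \<le> C * L2_set (\<lambda>i. x ! i - y ! i) {..<m})}"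

text \<open>\<open>test_function \<psi> a c\<close>: \<open>\<psi>\<close> is of class $C^{1,2}$ on $(0,\infty)\times R$, with
  time derivative \<open>a\<close> and second space derivative \<open>c\<close>.\<close>

definition test_function ::
  "(real \<Rightarrow> real \<Rightarrow> real) \<Rightarrow> (real \<Rightarrow> real \<Rightarrow> real) \<Rightarrow> (real \<Rightarrow> real \<Rightarrow> real) \<Rightarrow> bool" where
  "test_function \<psi> a c \<longleftrightarrow> (\<exists>b.
     (\<forall>t>0. \<forall>x. ((\<lambda>s. \<psi> s x) has_real_derivative a t x) (at t) \<and>
        (\<psi> t has_real_derivative b t x) (at x) \<and>
        (b t has_real_derivative c t x) (at x)) \<and>
     continuous_on ({0<..} \<times> UNIV) (\<lambda>(t, x). a t x) \<and>
     continuous_on ({0<..} \<times> UNIV) (\<lambda>(t, x). b t x) \<and>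
     continuous_on ({0<..} \<times> UNIV) (\<lambda>(t, x). c t x))"

definition viscosity_subsolution :: "real \<Rightarrow> (real \<Rightarrow> real \<Rightarrow> real) \<Rightarrow> bool" where
  "viscosity_subsolution \<sigma>\<^sub>0 u \<longleftrightarrow> (\<forall>\<psi> a c t x. test_function \<psi> a c \<longrightarrow> t > 0 \<longrightarrow>
     (\<forall>\<^sub>F (s, y) in nhds (t, x). u s y - \<psi> s y \<le> u t x - \<psi> t x) \<longrightarrow>
     a t x - Gfun \<sigma>\<^sub>0 (c t x) \<le> 0)"

definition viscosity_supersolution :: "real \<Rightarrow> (real \<Rightarrow> real \<Rightarrow> real) \<Rightarrow> bool" where
  "viscosity_supersolution \<sigma>\<^sub>0 u \<longleftrightarrow> (\<forall>\<psi> a c t x. test_function \<psi> a c \<longrightarrow> t > 0 \<longrightarrow>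
     (\<forall>\<^sub>F (s, y) in nhds (t, x). u s y - \<psi> s y \<ge> u t x - \<psi> t x) \<longrightarrow>
     a t x - Gfun \<sigma>\<^sub>0 (c t x) \<ge> 0)"

definition G_heat_solution :: "real \<Rightarrow> (real \<Rightarrow> real) \<Rightarrow> (real \<Rightarrow> real \<Rightarrow> real) \<Rightarrow> bool" where
  "G_heat_solution \<sigma>\<^sub>0 \<phi> u \<longleftrightarrow>
     continuous_on ({0..} \<times> UNIV) (\<lambda>(t, x). u t x) \<and>
     (\<exists>M. \<forall>t\<ge>0. \<forall>x. \<bar>u t x\<bar> \<le> M) \<and>
     viscosity_subsolution \<sigma>\<^sub>0 u \<and> viscosity_supersolution \<sigma>\<^sub>0 u \<and>
     (\<forall>x. u 0 x = \<phi> x)"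

text \<open>The description is taken of the value at \<open>(t, x)\<close> and not of \<open>u\<close>, since \<open>u\<close> is
  unconstrained at negative times.\<close>

definition PG :: "real \<Rightarrow> real \<Rightarrow> (real \<Rightarrow> real) \<Rightarrow> real \<Rightarrow> real" where
  "PG \<sigma>\<^sub>0 t \<phi> x = (THE r. \<exists>u. G_heat_solution \<sigma>\<^sub>0 \<phi> u \<and> r = u t x)"

text \<open>Paths are set to \<open>0\<close> at negative times, so that a path is determined by its values
  on $[0,\infty)$.\<close>

typedef cpath = "{w :: real \<Rightarrow> real. continuous_on {0..} w \<and> w 0 = 0 \<and> (\<forall>t<0. w t = 0)}"
  by (rule exI[of _ "\<lambda>_. 0"]) auto

definition B :: "real \<Rightarrow> cpath \<Rightarrow> real" where
  "B t \<omega> = Rep_cpath \<omega> t"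

definition Lip :: "real \<Rightarrow> (cpath \<Rightarrow> real) set" where
  "Lip T = {X. \<exists>m ts \<phi>. m \<ge> 1 \<and> length ts = m \<and> set ts \<subseteq> {0..T} \<and> \<phi> \<in> lip m \<and>
     X = (\<lambda>\<omega>. \<phi> (map (\<lambda>t. B t \<omega>) ts))}"

definition Lip_all :: "(cpath \<Rightarrow> real) set" where
  "Lip_all = (\<Union>n\<in>{1::nat..}. Lip (real n))"

text \<open>For \<open>ts = [t\<^sub>1, \<dots>, t\<^sub>m]\<close>, \<open>backward \<sigma>\<^sub>0 ts \<phi> k\<close> is $\varphi_k$;
  the list \<open>0 # ts\<close> realises the convention $t_0=0$.\<close>

primrec backward ::
  "real \<Rightarrow> real list \<Rightarrow> (real list \<Rightarrow> real) \<Rightarrow> nat \<Rightarrow> real list \<Rightarrow> real" where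
  "backward \<sigma>\<^sub>0 ts \<phi> 0 = \<phi>"
| "backward \<sigma>\<^sub>0 ts \<phi> (Suc k) = (\<lambda>xs.
     PG \<sigma>\<^sub>0 ((0 # ts) ! (length ts - k) - (0 # ts) ! (length ts - Suc k))
        (\<lambda>y. backward \<sigma>\<^sub>0 ts \<phi> k (xs @ [y])) 0)"

definition increments :: "real list \<Rightarrow> cpath \<Rightarrow> real list" where
  "increments ts \<omega> = map (\<lambda>i. B ((0 # ts) ! Suc i) \<omega> - B ((0 # ts) ! i) \<omega>) [0..<length ts]"

definition gexp :: "real \<Rightarrow> (cpath \<Rightarrow> real) \<Rightarrow> real" where
  "gexp \<sigma>\<^sub>0 X = (THE r. \<exists>ts \<phi>. ts \<noteq> [] \<and> sorted_wrt (<) ts \<and> hd ts \<ge> 0 \<and> \<phi> \<in> lip (length ts) \<and>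
     X = (\<lambda>\<omega>. \<phi> (increments ts \<omega>)) \<and> r = backward \<sigma>\<^sub>0 ts \<phi> (length ts) [])"

text \<open>\<open>is_completion V p j\<close>: the Banach space \<open>'b\<close>, together with the map \<open>j\<close>, is the completion
  modulo null elements of the space \<open>V\<close> of functions under the seminorm \<open>p\<close>. It is unique
  up to isometric isomorphism, and \<open>j X = j Y\<close> iff \<open>X - Y\<close> is a null element.\<close>

definition is_completion ::
  "('a \<Rightarrow> 'c::real_vector) set \<Rightarrow> (('a \<Rightarrow> 'c) \<Rightarrow> real) \<Rightarrow> (('a \<Rightarrow> 'c) \<Rightarrow> 'b::banach) \<Rightarrow> bool" where
  "is_completion V p j \<longleftrightarrow>
     (\<forall>X\<in>V. \<forall>Y\<in>V. \<forall>a b. j (\<lambda>w. a *\<^sub>R X w + b *\<^sub>R Y w) = a *\<^sub>R j X + b *\<^sub>R j Y) \<and>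
     (\<forall>X\<in>V. norm (j X) = p X) \<and>
     closure (j ` V) = UNIV"

text \<open>\<open>cont_ext j V F X\<close> is the common limit of \<open>F x\<^sub>n\<close> over all sequences \<open>x\<^sub>n\<close> in \<open>V\<close>
  with \<open>j x\<^sub>n\<close> converging to \<open>X\<close>.\<close>

definition cont_ext ::
  "('v \<Rightarrow> 'l::topological_space) \<Rightarrow> 'v set \<Rightarrow> ('v \<Rightarrow> 'b::t2_space) \<Rightarrow> 'l \<Rightarrow> 'b" where
  "cont_ext j V F X = Lim (j going_to nhds X within V) F"

definition is_LG1 :: "real \<Rightarrow> ((cpath \<Rightarrow> real) \<Rightarrow> 'l::banach) \<Rightarrow> bool" where
  "is_LG1 \<sigma>\<^sub>0 j \<longleftrightarrow> is_completion Lip_all (\<lambda>X. gexp \<sigma>\<^sub>0 (\<lambda>\<omega>. \<bar>X \<omega>\<bar>)) j"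

text \<open>From here on \<open>j\<close> is the embedding of the cylinder random variables into their
  completion \<open>'l\<close>.\<close>

definition LG1 :: "((cpath \<Rightarrow> real) \<Rightarrow> 'l::banach) \<Rightarrow> real \<Rightarrow> 'l set" where
  "LG1 j T = closure (j ` Lip T)"

definition LE :: "real \<Rightarrow> ((cpath \<Rightarrow> real) \<Rightarrow> 'l::banach) \<Rightarrow> 'l \<Rightarrow> real" where
  "LE \<sigma>\<^sub>0 j X = cont_ext j Lip_all (gexp \<sigma>\<^sub>0) X"

definition Lsup :: "((cpath \<Rightarrow> real) \<Rightarrow> 'l::banach) \<Rightarrow> 'l \<Rightarrow> 'l \<Rightarrow> 'l" where
  "Lsup j X Y = cont_ext (\<lambda>(x, y). (j x, j y)) (Lip_all \<times> Lip_all)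
     (\<lambda>(x, y). j (\<lambda>\<omega>. max (x \<omega>) (y \<omega>))) (X, Y)"

definition Linf :: "((cpath \<Rightarrow> real) \<Rightarrow> 'l::banach) \<Rightarrow> 'l \<Rightarrow> 'l \<Rightarrow> 'l" where
  "Linf j X Y = cont_ext (\<lambda>(x, y). (j x, j y)) (Lip_all \<times> Lip_all)
     (\<lambda>(x, y). j (\<lambda>\<omega>. min (x \<omega>) (y \<omega>))) (X, Y)"

definition Ltrunc :: "((cpath \<Rightarrow> real) \<Rightarrow> 'l::banach) \<Rightarrow> nat \<Rightarrow> 'l \<Rightarrow> 'l" where
  "Ltrunc j N X = Lsup j (Linf j X (j (\<lambda>_. real N))) (j (\<lambda>_. - real N))"

text \<open>Multiplication and powers are continuous for the $L_G^1$ norm only on bounded sets, so for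
  elements bounded by \<open>N\<close> they are extended from the cylinder variables bounded by \<open>N\<close>.\<close>

definition Lip_bdd :: "nat \<Rightarrow> (cpath \<Rightarrow> real) set" where
  "Lip_bdd N = {X \<in> Lip_all. \<forall>\<omega>. \<bar>X \<omega>\<bar> \<le> real N}"

definition bdd_mult :: "((cpath \<Rightarrow> real) \<Rightarrow> 'l::banach) \<Rightarrow> nat \<Rightarrow> 'l \<Rightarrow> 'l \<Rightarrow> 'l" where
  "bdd_mult j N X Y = cont_ext (\<lambda>(x, y). (j x, j y)) (Lip_bdd N \<times> Lip_bdd N)
     (\<lambda>(x, y). j (\<lambda>\<omega>. x \<omega> * y \<omega>)) (X, Y)"

definition bdd_pow :: "((cpath \<Rightarrow> real) \<Rightarrow> 'l::banach) \<Rightarrow> real \<Rightarrow> nat \<Rightarrow> 'l \<Rightarrow> 'l" where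
  "bdd_pow j p N X = cont_ext j (Lip_bdd N) (\<lambda>x. j (\<lambda>\<omega>. \<bar>x \<omega>\<bar> powr p)) X"

definition Lmult :: "((cpath \<Rightarrow> real) \<Rightarrow> 'l::banach) \<Rightarrow> 'l \<Rightarrow> 'l \<Rightarrow> 'l" where
  "Lmult j X Y = lim (\<lambda>N. bdd_mult j N (Ltrunc j N X) (Ltrunc j N Y))"

text \<open>\<open>Lpow j p X\<close> is $|X|^p$; in particular \<open>Lpow j 2 X\<close> is $X^2$.\<close>

definition Lpow :: "((cpath \<Rightarrow> real) \<Rightarrow> 'l::banach) \<Rightarrow> real \<Rightarrow> 'l \<Rightarrow> 'l" where
  "Lpow j p X = lim (\<lambda>N. bdd_pow j p N (Ltrunc j N X))"

text \<open>$|X|^p\in L_G^1({\cal F}_t)$ includes that the limit defining $|X|^p$ exists.\<close>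

definition LGp :: "((cpath \<Rightarrow> real) \<Rightarrow> 'l::banach) \<Rightarrow> real \<Rightarrow> real \<Rightarrow> 'l set" where
  "LGp j p t = {X \<in> LG1 j t.
     convergent (\<lambda>N. bdd_pow j p N (Ltrunc j N X)) \<and> Lpow j p X \<in> LG1 j t}"

definition LGp_norm :: "real \<Rightarrow> ((cpath \<Rightarrow> real) \<Rightarrow> 'l::banach) \<Rightarrow> real \<Rightarrow> 'l \<Rightarrow> real" where
  "LGp_norm \<sigma>\<^sub>0 j p X = LE \<sigma>\<^sub>0 j (Lpow j p X) powr (1 / p)"

text \<open>$B_t$ itself is unbounded, hence not a cylinder random variable in the above sense; it is
  the $L_G^1$-limit of its truncations.\<close>

definition LB :: "((cpath \<Rightarrow> real) \<Rightarrow> 'l::banach) \<Rightarrow> real \<Rightarrow> 'l" where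
  "LB j t = lim (\<lambda>N::nat. j (\<lambda>\<omega>. max (min (B t \<omega>) (real N)) (- real N)))"

definition simple_repr ::
  "((cpath \<Rightarrow> real) \<Rightarrow> 'l::banach) \<Rightarrow> real \<Rightarrow> real \<Rightarrow> nat \<Rightarrow> (nat \<Rightarrow> real) \<Rightarrow> (nat \<Rightarrow> 'l) \<Rightarrow> bool" where
  "simple_repr j p T N ts \<xi> \<longleftrightarrow> ts 0 = 0 \<and> ts N = T \<and>
     (\<forall>i<N. ts i < ts (Suc i)) \<and> (\<forall>i<N. \<xi> i \<in> LGp j p (ts i))"

definition simple_process :: "nat \<Rightarrow> (nat \<Rightarrow> real) \<Rightarrow> (nat \<Rightarrow> 'l::real_vector) \<Rightarrow> real \<Rightarrow> 'l" where
  "simple_process N ts \<xi> t = (\<Sum>i<N. indicat_real {ts i..<ts (Suc i)} t *\<^sub>R \<xi> i)"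

definition MGp0 :: "((cpath \<Rightarrow> real) \<Rightarrow> 'l::banach) \<Rightarrow> real \<Rightarrow> real \<Rightarrow> (real \<Rightarrow> 'l) set" where
  "MGp0 j p T = {\<eta>. \<exists>N ts \<xi>. simple_repr j p T N ts \<xi> \<and> \<eta> = simple_process N ts \<xi>}"

definition MGp_norm ::
  "real \<Rightarrow> ((cpath \<Rightarrow> real) \<Rightarrow> 'l::banach) \<Rightarrow> real \<Rightarrow> real \<Rightarrow> (real \<Rightarrow> 'l) \<Rightarrow> real" where
  "MGp_norm \<sigma>\<^sub>0 j p T \<eta> =
     (1 / T * integral {0..T} (\<lambda>t. LE \<sigma>\<^sub>0 j (Lpow j p (\<eta> t)))) powr (1 / p)"

definition is_MGp ::
  "real \<Rightarrow> ((cpath \<Rightarrow> real) \<Rightarrow> 'l::banach) \<Rightarrow> real \<Rightarrow> real \<Rightarrow> ((real \<Rightarrow> 'l) \<Rightarrow> 'm::banach) \<Rightarrow> bool" where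
  "is_MGp \<sigma>\<^sub>0 j p T k \<longleftrightarrow> is_completion (MGp0 j p T) (MGp_norm \<sigma>\<^sub>0 j p T) k"

definition ito_sum ::
  "((cpath \<Rightarrow> real) \<Rightarrow> 'l::banach) \<Rightarrow> nat \<Rightarrow> (nat \<Rightarrow> real) \<Rightarrow> (nat \<Rightarrow> 'l) \<Rightarrow> 'l" where
  "ito_sum j N ts \<xi> = (\<Sum>i<N. Lmult j (\<xi> i) (LB j (ts (Suc i)) - LB j (ts i)))"

definition ito :: "((cpath \<Rightarrow> real) \<Rightarrow> 'l::banach) \<Rightarrow> real \<Rightarrow> (real \<Rightarrow> 'l) \<Rightarrow> 'l" where
  "ito j T \<eta> = (THE Z. \<exists>N ts \<xi>. simple_repr j 2 T N ts \<xi> \<and> \<eta> = simple_process N ts \<xi> \<and>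
     Z = ito_sum j N ts \<xi>)"

end

theory Submission
  imports Defs "HOL-Probability.Probability"
begin

text \<open>Since \<open>G a = sup {c a / 2 | \<sigma>\<^sub>0\<^sup>2 \<le> c \<le> 1}\<close>, the \<open>G\<close>-heat equation has the comparison principle: a viscosity
  supersolution dominates its Gaussian averages with variances \<open>\<sigma>\<^sub>0\<^sup>2\<close> and \<open>1\<close>, a property inherited by
  its Steklov means, which are smooth and can be tested with. Solutions are limits of the scheme
  which takes the larger of two symmetric random walk steps, and the properties of the
  semigroup \<open>P\<^sup>G\<close> are read off the scheme. The backward recursion then gives a sublinear expectation
  for which \<open>B\<^sub>t - B\<^sub>s\<close> is independent of the past up to \<open>s\<close>, has mean zero, as has its negative, and
  second moment at most \<open>t - s\<close>. Hence in \<open>E[(Z + \<xi> (B\<^sub>t - B\<^sub>s))\<^sup>2]\<close> the mixed term drops out and the last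
  square contributes at most \<open>(t - s) E[\<xi>\<^sup>2]\<close>; the bound for the integral follows by summation. As
  \<open>B\<^sub>t\<close> is unbounded, all this is done with truncated increments, whose means are \<open>O(1/N)\<close>.\<close>

section \<open>The comparison principle\<close>

text \<open>\<open>PG\<close>, \<open>gexp\<close> and \<open>ito\<close> are definite descriptions,
  so they have usable values only once existence and uniqueness are proved: of the viscosity
  solution, of the value over all representations of a cylinder variable, of the sum over all
  partitions. Uniqueness of the solution is the hardest point. Only the supersolution is
  regularised: as \<open>G\<close> is a maximum of two linear functions, the supersolution
  inequality splits into two linear heat inequalities, which survive averaging over translations,
  and the smooth supersolution so obtained serves as test function for the subsolution. For
  subsolutions there is no such splitting. Existence uses the comparison once more, to identify the
  upper limit of the scheme, a subsolution, with its lower limit, a supersolution. A second obstacle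
  is that membership in \<open>LGp\<close> and products are defined by truncations and the norm
  \<open>E[|X|]\<close>, whereas the estimates need cylinder variables that are Cauchy for
  \<open>E[X\<^sup>2]\<close>; the two descriptions are shown to agree before any integral is
  treated.\<close>

lemma test_functionI:
  assumes "\<And>t x. t > 0 \<Longrightarrow> ((\<lambda>s. \<psi> s x) has_real_derivative a t x) (at t)"
    and "\<And>t x. t > 0 \<Longrightarrow> (\<psi> t has_real_derivative b t x) (at x)"
    and "\<And>t x. t > 0 \<Longrightarrow> (b t has_real_derivative c t x) (at x)"
    and "continuous_on ({0<..} \<times> UNIV) (\<lambda>(t, x). a t x)"
    and "continuous_on ({0<..} \<times> UNIV) (\<lambda>(t, x). b t x)"
    and "continuous_on ({0<..} \<times> UNIV) (\<lambda>(t, x). c t x)"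
  shows "test_function \<psi> a c"
  unfolding test_function_def using assms by blast

lemma test_function_add:
  assumes "test_function \<psi> a c" "test_function \<psi>' a' c'"
  shows "test_function (\<lambda>t x. \<psi> t x + \<psi>' t x) (\<lambda>t x. a t x + a' t x) (\<lambda>t x. c t x + c' t x)"
proof -
  obtain b where b: "\<forall>t>0. \<forall>x. ((\<lambda>s. \<psi> s x) has_real_derivative a t x) (at t) \<and>
        (\<psi> t has_real_derivative b t x) (at x) \<and> (b t has_real_derivative c t x) (at x)"
     "continuous_on ({0<..} \<times> UNIV) (\<lambda>(t, x). a t x)"
     "continuous_on ({0<..} \<times> UNIV) (\<lambda>(t, x). b t x)"
     "continuous_on ({0<..} \<times> UNIV) (\<lambda>(t, x). c t x)"
    using assms(1) unfolding test_function_def by blast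
  obtain b' where b': "\<forall>t>0. \<forall>x. ((\<lambda>s. \<psi>' s x) has_real_derivative a' t x) (at t) \<and>
        (\<psi>' t has_real_derivative b' t x) (at x) \<and> (b' t has_real_derivative c' t x) (at x)"
     "continuous_on ({0<..} \<times> UNIV) (\<lambda>(t, x). a' t x)"
     "continuous_on ({0<..} \<times> UNIV) (\<lambda>(t, x). b' t x)"
     "continuous_on ({0<..} \<times> UNIV) (\<lambda>(t, x). c' t x)"
    using assms(2) unfolding test_function_def by blast
  show ?thesis
  proof (rule test_functionI[where b = "\<lambda>t x. b t x + b' t x"])
    show "((\<lambda>s. \<psi> s x + \<psi>' s x) has_real_derivative a t x + a' t x) (at t)" if "t > 0" for t x
      using b(1) b'(1) that by (auto intro!: DERIV_add)
    show "((\<lambda>x. \<psi> t x + \<psi>' t x) has_real_derivative b t x + b' t x) (at x)" if "t > 0" for t x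
      using b(1) b'(1) that by (auto intro!: DERIV_add)
    show "((\<lambda>x. b t x + b' t x) has_real_derivative c t x + c' t x) (at x)" if "t > 0" for t x
      using b(1) b'(1) that by (auto intro!: DERIV_add)
  qed (use b(2-4) b'(2-4) in \<open>auto simp: case_prod_unfold intro: continuous_on_add\<close>)
qed

lemma test_function_uminus:
  assumes "test_function \<psi> a c"
  shows "test_function (\<lambda>t x. - \<psi> t x) (\<lambda>t x. - a t x) (\<lambda>t x. - c t x)"
proof -
  obtain b where b: "\<forall>t>0. \<forall>x. ((\<lambda>s. \<psi> s x) has_real_derivative a t x) (at t) \<and>
        (\<psi> t has_real_derivative b t x) (at x) \<and> (b t has_real_derivative c t x) (at x)"
     "continuous_on ({0<..} \<times> UNIV) (\<lambda>(t, x). a t x)"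
     "continuous_on ({0<..} \<times> UNIV) (\<lambda>(t, x). b t x)"
     "continuous_on ({0<..} \<times> UNIV) (\<lambda>(t, x). c t x)"
    using assms(1) unfolding test_function_def by blast
  show ?thesis
  proof (rule test_functionI[where b = "\<lambda>t x. - b t x"])
    show "((\<lambda>s. - \<psi> s x) has_real_derivative - a t x) (at t)" if "t > 0" for t x
      using b(1) that by (auto intro!: DERIV_minus)
    show "((\<lambda>x. - \<psi> t x) has_real_derivative - b t x) (at x)" if "t > 0" for t x
      using b(1) that by (auto intro!: DERIV_minus)
    show "((\<lambda>x. - b t x) has_real_derivative - c t x) (at x)" if "t > 0" for t x
      using b(1) that by (auto intro!: DERIV_minus)
  qed (use b(2-4) in \<open>auto simp: case_prod_unfold intro: continuous_on_minus\<close>)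
qed

lemma test_function_quadratic:
  "test_function (\<lambda>t x. p + q * (t - \<tau>) + k * (t - \<tau>)\<^sup>2 + m * (x - z)\<^sup>2) (\<lambda>t x. q + 2 * k * (t - \<tau>)) (\<lambda>t x. 2 * m)"
proof (rule test_functionI[where b = "\<lambda>t x. 2 * m * (x - z)"])
  fix t x :: real
  show "((\<lambda>s. p + q * (s - \<tau>) + k * (s - \<tau>)\<^sup>2 + m * (x - z)\<^sup>2) has_real_derivative q + 2 * k * (t - \<tau>)) (at t)"
    by (auto intro!: derivative_eq_intros)
  show "((\<lambda>x. p + q * (t - \<tau>) + k * (t - \<tau>)\<^sup>2 + m * (x - z)\<^sup>2) has_real_derivative 2 * m * (x - z)) (at x)"
    by (auto intro!: derivative_eq_intros)
  show "((\<lambda>x. 2 * m * (x - z)) has_real_derivative 2 * m) (at x)"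
    by (auto intro!: derivative_eq_intros)
qed (auto simp: case_prod_unfold intro!: continuous_intros)

text \<open>As \<open>\<sigma>\<^sub>0\<^sup>2 \<le> 1\<close>, the larger slope wins on the
  positive half line and the smaller one on the negative. A supersolution for \<open>G\<close>
  therefore satisfies one linear heat inequality for each of the two slopes.\<close>

lemma Gfun_eq_max:
  assumes "0 \<le> \<sigma>\<^sub>0" "\<sigma>\<^sub>0 \<le> 1"
  shows "Gfun \<sigma>\<^sub>0 a = max (a / 2) (\<sigma>\<^sub>0\<^sup>2 * a / 2)"
proof -
  have s: "\<sigma>\<^sub>0\<^sup>2 \<le> 1" using assms by (simp add: power_le_one)
  show ?thesis
  proof (cases "a \<ge> 0")
    case True
    then have "\<sigma>\<^sub>0\<^sup>2 * a \<le> a" using s by (simp add: mult_left_le_one_le)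
    then show ?thesis using True by (simp add: Gfun_def)
  next
    case False
    then have "\<sigma>\<^sub>0\<^sup>2 * a \<ge> 1 * a" using s by (intro mult_right_mono_neg) auto
    then show ?thesis using False by (simp add: Gfun_def)
  qed
qed

text \<open>Adding a penalty \<open>e * x\<^sup>2\<close> raises the second derivative by
  \<open>2 * e\<close>; in \<open>G\<close> this costs at most \<open>e\<close>, because the largest
  slope of \<open>G\<close> is 1/2.\<close>

lemma Gfun_shift:
  assumes "0 \<le> \<sigma>\<^sub>0" "\<sigma>\<^sub>0 \<le> 1" "e \<ge> 0"
  shows "Gfun \<sigma>\<^sub>0 (c + 2 * e) \<le> Gfun \<sigma>\<^sub>0 c + e"
proof -
  have "\<sigma>\<^sub>0\<^sup>2 * e \<le> e" using assms by (simp add: power_le_one mult_left_le_one_le)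
  then show ?thesis using assms by (auto simp: Gfun_eq_max max_def algebra_simps add_divide_distrib)
qed

text \<open>The penalty \<open>\<eta> (x\<^sup>2 + 2 t)\<close> is a strict supersolution and makes \<open>w - \<Psi>\<close> coercive
  on the whole half space, so that no terminal time has to be dealt with.\<close>

lemma smooth_comparison:
  fixes w \<Psi> :: "real \<Rightarrow> real \<Rightarrow> real" and H :: "real \<Rightarrow> real"
  assumes sub: "\<And>\<psi> a c t x. test_function \<psi> a c \<Longrightarrow> t > 0 \<Longrightarrow>
      (\<forall>\<^sub>F (s, y) in nhds (t, x). w s y - \<psi> s y \<le> w t x - \<psi> t x) \<Longrightarrow> a t x \<le> H (c t x)"
    and H: "\<And>c e. e \<ge> 0 \<Longrightarrow> H (c + 2 * e) \<le> H c + e"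
    and cw: "continuous_on ({0..} \<times> UNIV) (\<lambda>(t, x). w t x)"
    and bw: "\<And>t x. t \<ge> 0 \<Longrightarrow> w t x \<le> M"
    and test: "test_function \<Psi> a c"
    and cP: "continuous_on ({0..} \<times> UNIV) (\<lambda>(t, x). \<Psi> t x)"
    and bP: "\<And>t x. t \<ge> \<tau> \<Longrightarrow> - K \<le> \<Psi> t x"
    and super: "\<And>t x. t > \<tau> \<Longrightarrow> H (c t x) \<le> a t x"
    and init: "\<And>x. w \<tau> x \<le> \<Psi> \<tau> x" and "0 \<le> \<tau>" and "\<tau> \<le> t"
  shows "w t x \<le> \<Psi> t x"
proof (rule ccontr)
  assume "\<not> w t x \<le> \<Psi> t x"
  then have pos: "w t x - \<Psi> t x > 0" by simp
  \<comment> \<open>\<open>Q\<close> is the penalty per unit of \<open>\<eta>\<close> at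
    \<open>(t, x)\<close> plus one. With \<open>\<eta> * Q\<close> equal to the violation,
    \<open>f (t, x) = \<eta>\<close> remains positive.\<close>
  define Q where "Q = x\<^sup>2 + 2 * (t - \<tau>) + 1"
  have Q: "Q > 0" using \<open>\<tau> \<le> t\<close> by (simp add: Q_def add_nonneg_pos)
  define \<eta> where "\<eta> = (w t x - \<Psi> t x) / Q"
  have \<eta>: "\<eta> > 0" using pos Q by (simp add: \<eta>_def)
  define f where "f = (\<lambda>(s, y). w s y - \<Psi> s y - \<eta> * (y\<^sup>2 + 2 * (s - \<tau>)))"
  have ftx: "f (t, x) > 0"
  proof -
    have "\<eta> * Q = w t x - \<Psi> t x" using Q by (simp add: \<eta>_def)
    then have "f (t, x) = \<eta>" by (simp add: f_def Q_def algebra_simps)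
    then show ?thesis using \<eta> by simp
  qed
  \<comment> \<open>Outside the box the penalty is at least \<open>R * \<eta> > M + K\<close>, which
    makes \<open>f\<close> negative there; the other summands put \<open>(t, x)\<close> into the
    box.\<close>
  define R where "R = max 1 ((M + K) / \<eta>) + x\<^sup>2 + t + 1"
  have R: "R \<ge> 1" "R * \<eta> > M + K" "t \<le> \<tau> + R" "\<bar>x\<bar> \<le> R"
  proof -
    have t0: "t \<ge> 0" using \<open>0 \<le> \<tau>\<close> \<open>\<tau> \<le> t\<close> by simp
    show "R \<ge> 1" using t0 by (simp add: R_def)
    have "R > (M + K) / \<eta>" using t0 unfolding R_def by (smt (verit) zero_le_power2)
    then show "R * \<eta> > M + K" using \<eta> by (simp add: divide_less_eq)
    show "t \<le> \<tau> + R" using \<open>0 \<le> \<tau>\<close> unfolding R_def by (smt (verit) zero_le_power2)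
    have "\<bar>x\<bar> \<le> x\<^sup>2 + 1"
      using zero_le_power2[of "\<bar>x\<bar> - 1"] by (simp add: power2_diff)
    then show "\<bar>x\<bar> \<le> R" using t0 unfolding R_def by linarith
  qed
  define D where "D = {\<tau>..\<tau> + R} \<times> {-R..R}"
  have D0: "D \<subseteq> {0..} \<times> UNIV" using \<open>0 \<le> \<tau>\<close> by (auto simp: D_def)
  have "continuous_on D f"
    unfolding f_def case_prod_unfold
    by (intro continuous_intros continuous_on_subset[OF cw[unfolded case_prod_unfold] D0]
        continuous_on_subset[OF cP[unfolded case_prod_unfold] D0])
  moreover have "compact D" by (auto simp: D_def compact_Times)
  moreover have tD: "(t, x) \<in> D" using R \<open>\<tau> \<le> t\<close> by (auto simp: D_def abs_le_iff)
  ultimately obtain p where p: "p \<in> D" "\<And>q. q \<in> D \<Longrightarrow> f q \<le> f p"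
    using continuous_attains_sup[of D f] by blast
  obtain s y where sy: "p = (s, y)" by (cases p)
  have fp: "f p > 0" using p(2)[OF tD] ftx by simp
  have out: "f (s', y') \<le> f p" if "s' \<ge> \<tau>" for s' y'
  proof (cases "(s', y') \<in> D")
    case False
    have "y'\<^sup>2 + 2 * (s' - \<tau>) \<ge> R"
    proof (cases "s' \<le> \<tau> + R")
      case True
      then have "\<bar>y'\<bar> \<ge> R" using False that by (auto simp: D_def)
      then have "y'\<^sup>2 \<ge> R" using R(1)
        using mult_mono[of 1 "\<bar>y'\<bar>" R "\<bar>y'\<bar>"] by (simp add: power2_eq_square flip: power2_abs)
      then show ?thesis using that by simp
    next
      case False
      then show ?thesis using R(1) by (smt (verit) zero_le_power2)
    qed
    then have "\<eta> * (y'\<^sup>2 + 2 * (s' - \<tau>)) \<ge> R * \<eta>" using \<eta> by simp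
    then have "f (s', y') \<le> M + K - R * \<eta>"
      using bw[of s' y'] bP[of s' y'] that \<open>0 \<le> \<tau>\<close> by (simp add: f_def)
    then show ?thesis using R(2) fp by linarith
  qed (use p in auto)
  have s: "s > \<tau>"
  proof (rule ccontr)
    assume "\<not> s > \<tau>"
    then have "s = \<tau>" using p(1) by (auto simp: sy D_def)
    moreover have "0 \<le> \<eta> * y\<^sup>2" using \<eta> by simp
    ultimately have "f p \<le> 0" using init[of y] by (simp add: sy f_def)
    then show False using fp by simp
  qed
  \<comment> \<open>\<open>w - \<psi>\<close> has a local maximum at \<open>(s, y)\<close>. The
    penalty adds \<open>2 * \<eta>\<close> to the time derivative, but at most \<open>\<eta>\<close>
    to the value of \<open>H\<close>, which is the contradiction.\<close>
  define \<psi> where "\<psi> = (\<lambda>t x. \<Psi> t x + (0 + 2 * \<eta> * (t - \<tau>) + 0 * (t - \<tau>)\<^sup>2 + \<eta> * (x - 0)\<^sup>2))"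
  have tf: "test_function \<psi> (\<lambda>t x. a t x + (2 * \<eta> + 2 * 0 * (t - \<tau>))) (\<lambda>t x. c t x + 2 * \<eta>)"
    unfolding \<psi>_def by (rule test_function_add[OF test test_function_quadratic])
  have ev: "\<forall>\<^sub>F (s', y') in nhds (s, y). w s' y' - \<psi> s' y' \<le> w s y - \<psi> s y"
  proof -
    have "open ({\<tau><..} \<times> (UNIV :: real set))" by (intro open_Times) auto
    then have "\<forall>\<^sub>F q in nhds (s, y). q \<in> {\<tau><..} \<times> UNIV"
      using s by (intro eventually_nhds_in_open) auto
    then show ?thesis
    proof eventually_elim
      case (elim q)
      obtain s' y' where q: "q = (s', y')" by (cases q)
      then have "w s' y' - \<psi> s' y' \<le> w s y - \<psi> s y"
        using out[of s' y'] elim by (auto simp: sy f_def \<psi>_def algebra_simps)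
      then show ?case by (simp add: q)
    qed
  qed
  have "a s y + 2 * \<eta> \<le> H (c s y + 2 * \<eta>)"
    using sub[OF tf _ ev] s \<open>0 \<le> \<tau>\<close> by simp
  also have "\<dots> \<le> H (c s y) + \<eta>" using H \<eta> by simp
  also have "\<dots> \<le> a s y + \<eta>" using super s by simp
  finally show False using \<eta> by simp
qed

section \<open>Explicit heat solutions and Gaussian averages\<close>

definition cos_sum :: "real \<Rightarrow> (real \<times> real \<times> real) list \<Rightarrow> real \<Rightarrow> real \<Rightarrow> real" where
  "cos_sum \<kappa> l s x = (\<Sum>(c, \<xi>, b)\<leftarrow>l. c * exp (- (\<xi>\<^sup>2 * \<kappa>\<^sup>2 * s / 2)) * cos (\<xi> * x + b))"

text \<open>The expectation of \<open>f (x + \<kappa> * W\<^sub>s)\<close> for a Brownian motion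
  \<open>W\<close>, hence the heat semigroup with generator \<open>\<kappa>\<^sup>2 / 2\<close>
  times the second derivative. For \<open>\<kappa> = 0\<close>, the degenerate case of
  \<open>\<sigma>\<^sub>0\<close>, it is the identity.\<close>

definition gauss_avg :: "real \<Rightarrow> real \<Rightarrow> (real \<Rightarrow> real) \<Rightarrow> real \<Rightarrow> real" where
  "gauss_avg \<kappa> s f x = (\<integral>z. f (x + \<kappa> * sqrt s * z) \<partial>std_normal_distribution)"

text \<open>Differentiating a cosine multiplies it by its frequency and shifts its phase by
  \<open>pi / 2\<close>, so cosine sums are closed under derivatives. The exponential factors make
  them exact solutions of the heat equation.\<close>

lemma cos_sum_derivs:
  fixes \<kappa> :: real
  defines "dx \<equiv> map (\<lambda>(c, \<xi>, b). (c * \<xi>, \<xi>, b + pi / 2))"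
  shows "(cos_sum \<kappa> l s has_real_derivative cos_sum \<kappa> (dx l) s x) (at x)"
    and "((\<lambda>s. cos_sum \<kappa> l s x) has_real_derivative \<kappa>\<^sup>2 / 2 * cos_sum \<kappa> (dx (dx l)) s x) (at s)"
proof -
  have c1: "cos (\<xi> * x + (b + pi / 2)) = - sin (\<xi> * x + b)" for \<xi> b
    by (simp add: cos_add sin_add algebra_simps)
  have c2: "cos (\<xi> * x + (b + pi / 2 + pi / 2)) = - cos (\<xi> * x + b)" for \<xi> b
    by (simp add: cos_add sin_add algebra_simps)
  show "(cos_sum \<kappa> l s has_real_derivative cos_sum \<kappa> (dx l) s x) (at x)"
    unfolding cos_sum_def dx_def
    by (induction l) (auto intro!: derivative_eq_intros simp: c1)
  show "((\<lambda>s. cos_sum \<kappa> l s x) has_real_derivative \<kappa>\<^sup>2 / 2 * cos_sum \<kappa> (dx (dx l)) s x) (at s)"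
  proof (induction l)
    case (Cons a l)
    obtain k \<xi> b where a: "a = (k, \<xi>, b)" by (cases a)
    have "((\<lambda>s. k * exp (- (\<xi>\<^sup>2 * \<kappa>\<^sup>2 * s / 2)) * cos (\<xi> * x + b)) has_real_derivative
        \<kappa>\<^sup>2 / 2 * (k * \<xi> * \<xi> * exp (- (\<xi>\<^sup>2 * \<kappa>\<^sup>2 * s / 2)) * cos (\<xi> * x + (b + pi / 2 + pi / 2)))) (at s)"
      unfolding c2 by (auto intro!: derivative_eq_intros simp: power2_eq_square)
    from DERIV_add[OF this Cons] show ?case
      by (simp add: a cos_sum_def dx_def distrib_left)
  qed (simp add: cos_sum_def dx_def)
qed

lemma continuous_on_cos_sum:
  "continuous_on A (\<lambda>(t, x). cos_sum \<kappa> l (t - \<tau>) x)"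
  unfolding cos_sum_def case_prod_unfold
  by (induction l) (auto intro!: continuous_intros simp: case_prod_unfold)

lemma test_function_cos_sum:
  obtains c where "test_function (\<lambda>t x. cos_sum \<kappa> l (t - \<tau>) x) (\<lambda>t x. \<kappa>\<^sup>2 / 2 * c t x) c"
proof
  let ?dx = "map (\<lambda>(c, \<xi>, b). (c * \<xi>, \<xi>, b + pi / 2))"
  show "test_function (\<lambda>t x. cos_sum \<kappa> l (t - \<tau>) x)
     (\<lambda>t x. \<kappa>\<^sup>2 / 2 * cos_sum \<kappa> (?dx (?dx l)) (t - \<tau>) x) (\<lambda>t x. cos_sum \<kappa> (?dx (?dx l)) (t - \<tau>) x)"
  proof (rule test_functionI[where b = "\<lambda>t x. cos_sum \<kappa> (?dx l) (t - \<tau>) x"])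
    fix t x :: real
    show "((\<lambda>s. cos_sum \<kappa> l (s - \<tau>) x) has_real_derivative
       \<kappa>\<^sup>2 / 2 * cos_sum \<kappa> (?dx (?dx l)) (t - \<tau>) x) (at t)"
      using DERIV_shift[of "\<lambda>s. cos_sum \<kappa> l s x" _ t "- \<tau>"] cos_sum_derivs(2)[of \<kappa> l x "t - \<tau>"]
      by simp
    show "(cos_sum \<kappa> l (t - \<tau>) has_real_derivative cos_sum \<kappa> (?dx l) (t - \<tau>) x) (at x)"
      "(cos_sum \<kappa> (?dx l) (t - \<tau>) has_real_derivative cos_sum \<kappa> (?dx (?dx l)) (t - \<tau>) x) (at x)"
      by (rule cos_sum_derivs(1))+
  qed (use continuous_on_cos_sum in \<open>auto simp: case_prod_unfold intro!: continuous_intros\<close>)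
qed

lemma cos_sum_bounded:
  obtains C where "\<And>s x. s \<ge> 0 \<Longrightarrow> \<bar>cos_sum \<kappa> l s x\<bar> \<le> C"
proof
  fix s x :: real assume s: "s \<ge> 0"
  show "\<bar>cos_sum \<kappa> l s x\<bar> \<le> (\<Sum>(c, \<xi>, b)\<leftarrow>l. \<bar>c\<bar>)"
  proof (induction l)
    case (Cons a l)
    obtain c \<xi> b where a: "a = (c, \<xi>, b)" by (cases a)
    have "\<bar>exp (- (\<xi>\<^sup>2 * \<kappa>\<^sup>2 * s / 2)) * cos (\<xi> * x + b)\<bar> \<le> 1 * 1"
      unfolding abs_mult using s by (intro mult_mono) auto
    then have "\<bar>c * exp (- (\<xi>\<^sup>2 * \<kappa>\<^sup>2 * s / 2)) * cos (\<xi> * x + b)\<bar> \<le> \<bar>c\<bar>"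
      using mult_left_mono[of "\<bar>exp (- (\<xi>\<^sup>2 * \<kappa>\<^sup>2 * s / 2)) * cos (\<xi> * x + b)\<bar>" 1 "\<bar>c\<bar>"]
      by (simp add: abs_mult mult.assoc)
    then show ?case using Cons by (simp add: cos_sum_def a)
  qed (simp add: cos_sum_def)
qed

interpretation std_normal: real_distribution std_normal_distribution
  by (rule real_dist_normal_dist)

text \<open>Real and imaginary part of the characteristic function
  \<open>exp (- u\<^sup>2 / 2)\<close> of the normal law; the sine integral vanishes because that
  function is real.\<close>

lemma gauss_cos:
  "(\<integral>z. cos (a + u * z) \<partial>std_normal_distribution) = exp (- (u\<^sup>2 / 2)) * cos a"
proof -
  have int: "integrable std_normal_distribution (\<lambda>z. iexp (u * z))"
    by (rule std_normal.integrable_iexp) auto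
  have ch: "(\<integral>z. iexp (u * z) \<partial>std_normal_distribution) = complex_of_real (exp (- (u\<^sup>2) / 2))"
    using fun_cong[OF char_std_normal_distribution, of u] by (simp add: char_def)
  have 1: "(\<integral>z. cos (u * z) \<partial>std_normal_distribution) = exp (- (u\<^sup>2 / 2))"
    using integral_Re[OF int] unfolding ch by (simp add: Re_exp)
  have 2: "(\<integral>z. sin (u * z) \<partial>std_normal_distribution) = 0"
    using integral_Im[OF int] unfolding ch by (simp add: Im_exp)
  have i1: "integrable std_normal_distribution (\<lambda>z. cos (u * z))"
    by (rule std_normal.integrable_const_bound[where B = 1]) auto
  have i2: "integrable std_normal_distribution (\<lambda>z. sin (u * z))"
    by (rule std_normal.integrable_const_bound[where B = 1]) auto
  show ?thesis
    unfolding cos_add by (simp add: 1 2 i1 i2)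
qed

lemma integrable_bounded_std_normal:
  fixes f :: "real \<Rightarrow> real"
  assumes "f \<in> borel_measurable borel" "\<And>z. \<bar>f z\<bar> \<le> C"
  shows "integrable std_normal_distribution (\<lambda>z. f (x + k * z))"
  using assms by (intro std_normal.integrable_const_bound[where B = C]) auto

text \<open>By linearity this reduces to \<open>gauss_cos\<close> with frequency
  \<open>\<xi> * \<kappa> * sqrt s\<close>. It turns the comparison with explicit heat solutions
  into a statement on Gaussian averages.\<close>

lemma gauss_avg_cos_sum:
  assumes "s \<ge> 0"
  shows "gauss_avg \<kappa> s (cos_sum \<kappa> l 0) x = cos_sum \<kappa> l s x"
proof (induction l)
  case (Cons a l)
  obtain c \<xi> b where a: "a = (c, \<xi>, b)" by (cases a)
  obtain C where C: "\<And>s x. s \<ge> 0 \<Longrightarrow> \<bar>cos_sum \<kappa> l s x\<bar> \<le> C" using cos_sum_bounded by blast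
  have "continuous_on UNIV (cos_sum \<kappa> l 0)"
    by (intro continuous_at_imp_continuous_on ballI DERIV_isCont[OF cos_sum_derivs(1)])
  then have i: "integrable std_normal_distribution (\<lambda>z. cos_sum \<kappa> l 0 (x + \<kappa> * sqrt s * z))"
    using C by (intro integrable_bounded_std_normal[where C = C]) (auto simp: borel_measurable_continuous_onI)
  have j: "integrable std_normal_distribution (\<lambda>z. c * cos (\<xi> * (x + \<kappa> * sqrt s * z) + b))"
    by (intro integrable_bounded_std_normal[where C = "\<bar>c\<bar>" and f = "\<lambda>y. c * cos (\<xi> * y + b)"])
      (auto simp: abs_mult mult_left_le)
  have k: "(\<integral>z. cos (\<xi> * (x + \<kappa> * sqrt s * z) + b) \<partial>std_normal_distribution)
      = exp (- (\<xi>\<^sup>2 * \<kappa>\<^sup>2 * s / 2)) * cos (\<xi> * x + b)"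
    using gauss_cos[of "\<xi> * x + b" "\<xi> * \<kappa> * sqrt s"] assms
    by (simp add: algebra_simps power_mult_distrib)
  have "gauss_avg \<kappa> s (cos_sum \<kappa> (a # l) 0) x
      = (\<integral>z. c * cos (\<xi> * (x + \<kappa> * sqrt s * z) + b) + cos_sum \<kappa> l 0 (x + \<kappa> * sqrt s * z) \<partial>std_normal_distribution)"
    by (simp add: gauss_avg_def cos_sum_def a)
  also have "\<dots> = cos_sum \<kappa> (a # l) s x"
    using Cons i j k by (simp add: gauss_avg_def a) (simp add: cos_sum_def)
  finally show ?case .
qed (simp add: cos_sum_def gauss_avg_def)

text \<open>Induction over \<open>n\<close>: the product of a cosine with \<open>sin (w * x)\<close>
  is half the sum of two cosines whose frequencies are shifted by \<open>w\<close> up and down. One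
  list serves every \<open>\<kappa>\<close>, since \<open>\<kappa>\<close> has no effect at time
  0.\<close>

lemma sin_power_cos_sum:
  obtains l where "\<And>\<kappa> x. c * sin (w * x) ^ n = cos_sum \<kappa> l 0 x"
proof -
  have "\<exists>l. \<forall>\<kappa> x. c * sin (w * x) ^ n = cos_sum \<kappa> l 0 x"
  proof (induction n)
    case 0
    show ?case by (rule exI[of _ "[(c, 0, 0)]"]) (simp add: cos_sum_def)
  next
    case (Suc n)
    then obtain l where l: "\<And>\<kappa> x. c * sin (w * x) ^ n = cos_sum \<kappa> l 0 x" by blast
    define l' where "l' = concat (map (\<lambda>(c, \<xi>, b). [(c / 2, \<xi> + w, b - pi / 2), (c / 2, \<xi> - w, b + pi / 2)]) l)"
    have *: "cos_sum \<kappa> l 0 x * sin (w * x) = cos_sum \<kappa> l' 0 x" for \<kappa> x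
    proof -
      have e: "c * cos (\<xi> * x + b) * sin (w * x)
         = c / 2 * cos ((\<xi> + w) * x + (b - pi / 2)) + c / 2 * cos ((\<xi> - w) * x + (b + pi / 2))" for c \<xi> b
      proof -
        have 1: "cos ((\<xi> + w) * x + (b - pi / 2)) = sin ((\<xi> * x + b) + w * x)"
          by (subst sin_cos_eq) (simp add: algebra_simps cos_diff cos_add sin_diff)
        have 2: "cos ((\<xi> - w) * x + (b + pi / 2)) = - sin ((\<xi> * x + b) - w * x)"
          by (simp add: algebra_simps cos_diff cos_add sin_diff sin_add)
        show ?thesis unfolding 1 2 sin_add sin_diff by (simp add: algebra_simps)
      qed
      show ?thesis unfolding cos_sum_def l'_def
        by (induction l) (auto simp: e distrib_right)
    qed
    show ?case
    proof (rule exI[of _ l'], intro allI)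
      fix \<kappa> x
      have "c * sin (w * x) ^ Suc n = (c * sin (w * x) ^ n) * sin (w * x)" by simp
      also have "\<dots> = cos_sum \<kappa> l' 0 x" unfolding l[of _ \<kappa>] * ..
      finally show "c * sin (w * x) ^ Suc n = cos_sum \<kappa> l' 0 x" .
    qed
  qed
  then show ?thesis using that by blast
qed

text \<open>With \<open>F y = f ((2 R / \<pi>) arcsin y)\<close>, the periodic function \<open>F (sin (\<pi> x / (2 R)))\<close>
  extends \<open>f\<close> from \<open>[-R, R]\<close>; a polynomial approximating \<open>F\<close> yields the cosine sum.\<close>

lemma cos_sum_approx:
  fixes f :: "real \<Rightarrow> real"
  assumes f: "continuous_on UNIV f" and M: "\<And>x. \<bar>f x\<bar> \<le> M" and "R > 0" "e > 0"
  obtains l where "\<And>\<kappa> x. \<bar>x\<bar> \<le> R \<Longrightarrow> \<bar>cos_sum \<kappa> l 0 x - f x\<bar> \<le> e"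
    and "\<And>\<kappa> x. \<bar>cos_sum \<kappa> l 0 x\<bar> \<le> M + e"
proof -
  define F where "F = (\<lambda>y. f (2 * R / pi * arcsin y))"
  have "continuous_on {-1..1} F"
    unfolding F_def
    by (intro continuous_on_compose2[OF f] continuous_intros) auto
  then obtain g where g: "real_polynomial_function g" "\<And>y. y \<in> {-1..1} \<Longrightarrow> \<bar>F y - g y\<bar> < e"
    using Stone_Weierstrass_real_polynomial_function[of "{-1..1}" F e] \<open>e > 0\<close> by auto
  obtain a n where an: "g = (\<lambda>x. \<Sum>i\<le>n. a i * x ^ i)"
    using g(1) unfolding real_polynomial_function_iff_sum by blast
  define w where "w = pi / (2 * R)"
  have "\<exists>l. \<forall>\<kappa> x. (\<Sum>i\<le>m. a i * sin (w * x) ^ i) = cos_sum \<kappa> l 0 x" for m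
  proof (induction m)
    case 0
    obtain l where "\<And>\<kappa> x. a 0 * sin (w * x) ^ 0 = cos_sum \<kappa> l 0 x" using sin_power_cos_sum by blast
    then show ?case by auto
  next
    case (Suc m)
    then obtain l where l: "\<And>\<kappa> x. (\<Sum>i\<le>m. a i * sin (w * x) ^ i) = cos_sum \<kappa> l 0 x" by blast
    obtain l' where l': "\<And>\<kappa> x. a (Suc m) * sin (w * x) ^ Suc m = cos_sum \<kappa> l' 0 x" using sin_power_cos_sum by blast
    have "(\<Sum>i\<le>Suc m. a i * sin (w * x) ^ i) = cos_sum \<kappa> (l @ l') 0 x" for \<kappa> x
      by (simp only: sum.atMost_Suc l[of _ \<kappa>] l'[of _ \<kappa>]) (simp add: cos_sum_def)
    then show ?case by blast
  qed
  then obtain l where l: "\<And>\<kappa> x. g (sin (w * x)) = cos_sum \<kappa> l 0 x" unfolding an by blast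
  have d: "\<bar>F (sin (w * x)) - cos_sum \<kappa> l 0 x\<bar> < e" for \<kappa> x
    unfolding l[symmetric] by (rule g(2)) auto
  show ?thesis
  proof
    fix \<kappa> x :: real assume "\<bar>x\<bar> \<le> R"
    then have "arcsin (sin (w * x)) = w * x"
      using \<open>R > 0\<close> mult_left_mono[of "-R" x pi] by (intro arcsin_sin) (auto simp: w_def field_simps abs_le_iff)
    then have "F (sin (w * x)) = f x" using \<open>R > 0\<close> by (simp add: F_def w_def)
    then show "\<bar>cos_sum \<kappa> l 0 x - f x\<bar> \<le> e" using d[of x \<kappa>] by simp
  next
    fix \<kappa> x :: real
    have "\<bar>F (sin (w * x))\<bar> \<le> M" unfolding F_def by (rule M)
    then show "\<bar>cos_sum \<kappa> l 0 x\<bar> \<le> M + e" using d[of x \<kappa>] by linarith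
  qed
qed

lemma continuous_on_slice:
  fixes f :: "'a::topological_space \<Rightarrow> 'b::topological_space \<Rightarrow> 'c::topological_space"
  assumes "continuous_on (A \<times> UNIV) (\<lambda>(t, x). f t x)" "t \<in> A"
  shows "continuous_on UNIV (f t)"
proof -
  have "continuous_on UNIV (\<lambda>x::'b. (t, x))" by (intro continuous_on_Pair continuous_on_const continuous_on_id)
  then have "continuous_on UNIV (\<lambda>x. case (t, x) of (t, x) \<Rightarrow> f t x)"
    by (rule continuous_on_compose2[OF assms(1)]) (use assms(2) in auto)
  then show ?thesis by simp
qed

lemma test_function_const_quadratic:
  "test_function (\<lambda>t x. p + q * (t - \<tau>) + m * (x - z)\<^sup>2) (\<lambda>t x. q) (\<lambda>t x. 2 * m)"
  using test_function_quadratic[of p q \<tau> 0 m z] by simp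

lemma std_normal_moments:
  "integrable std_normal_distribution (\<lambda>z. z)" "(\<integral>z. z \<partial>std_normal_distribution) = 0"
  "integrable std_normal_distribution (\<lambda>z. z\<^sup>2)" "(\<integral>z. z\<^sup>2 \<partial>std_normal_distribution) = 1"
  "integrable std_normal_distribution (\<lambda>z. z ^ 4)" "(\<integral>z. z ^ 4 \<partial>std_normal_distribution) = 3"
proof -
  show "integrable std_normal_distribution (\<lambda>z. z)"
    using integrable_std_normal_distribution_moment[of 1] by simp
  show "(\<integral>z. z \<partial>std_normal_distribution) = 0"
    using integral_std_normal_distribution_moment_odd[of 1] by simp
  show "integrable std_normal_distribution (\<lambda>z. z\<^sup>2)" "integrable std_normal_distribution (\<lambda>z. z ^ 4)"
    by (rule integrable_std_normal_distribution_moment)+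
  show "(\<integral>z. z\<^sup>2 \<partial>std_normal_distribution) = 1"
    using std_normal_distribution_even_moments(1)[of 1] by simp
  show "(\<integral>z. z ^ 4 \<partial>std_normal_distribution) = 3"
    using std_normal_distribution_even_moments(1)[of 2] by (simp add: fact_numeral)
qed

lemma integral_quadratic_std_normal:
  fixes x k :: real
  shows "integrable std_normal_distribution (\<lambda>z. (x + k * z)\<^sup>2)"
    and "(\<integral>z. (x + k * z)\<^sup>2 \<partial>std_normal_distribution) = x\<^sup>2 + k\<^sup>2"
proof -
  have e: "(x + k * z)\<^sup>2 = x\<^sup>2 + 2 * x * k * z + k\<^sup>2 * z\<^sup>2" for z
    by (simp add: power2_eq_square algebra_simps)
  show "integrable std_normal_distribution (\<lambda>z. (x + k * z)\<^sup>2)"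
    unfolding e by (intro Bochner_Integration.integrable_add integrable_mult_right std_normal_moments) auto
  show "(\<integral>z. (x + k * z)\<^sup>2 \<partial>std_normal_distribution) = x\<^sup>2 + k\<^sup>2"
    unfolding e using std_normal_moments std_normal.prob_space
    by (simp add: Bochner_Integration.integral_add)
qed

text \<open>A supersolution for \<open>G\<close> is one for the linear operator
  \<open>\<kappa>\<^sup>2 * c / 2\<close>, which lies below \<open>G\<close>. The slice
  \<open>v \<tau>\<close> is approximated by a cosine sum on \<open>[-R, R]\<close>, the exact heat
  flow of the sum is compared with \<open>v\<close> by \<open>smooth_comparison\<close> applied to
  \<open>- v\<close>, and \<open>R\<close> tends to infinity; the error turns out to be of order
  \<open>1 / R\<close>.\<close>

lemma supersolution_ge_gauss_avg:
  assumes super: "viscosity_supersolution \<sigma>\<^sub>0 v"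
    and \<kappa>: "0 \<le> \<kappa>" "\<kappa> \<le> 1" "\<And>c. \<kappa>\<^sup>2 * c / 2 \<le> Gfun \<sigma>\<^sub>0 c"
    and cv: "continuous_on ({0..} \<times> UNIV) (\<lambda>(t, x). v t x)"
    and M: "\<And>t x. t \<ge> 0 \<Longrightarrow> \<bar>v t x\<bar> \<le> M"
    and "\<tau> \<ge> 0" "s \<ge> 0"
  shows "gauss_avg \<kappa> s (v \<tau>) x \<le> v (\<tau> + s) x"
proof -
  have M0: "M \<ge> 0" using M[of 0 0] by simp
  have k1: "\<kappa>\<^sup>2 \<le> 1" using \<kappa> by (simp add: power_le_one)
  define Q where "Q = x\<^sup>2 + \<kappa>\<^sup>2 * s"
  have Q0: "Q \<ge> 0" using \<open>s \<ge> 0\<close> by (simp add: Q_def)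
  have cvt: "continuous_on UNIV (v \<tau>)"
    by (rule continuous_on_slice[OF cv]) (use \<open>\<tau> \<ge> 0\<close> in auto)
  have bound: "gauss_avg \<kappa> s (v \<tau>) x - v (\<tau> + s) x \<le> (2 + 2 * (2 * M + 1) * Q) / R" if R: "R \<ge> 1" for R
  proof -
    define e where "e = 1 / R"
    have e: "e > 0" "e \<le> 1" using R by (auto simp: e_def)
    obtain l where l: "\<And>\<kappa> x. \<bar>x\<bar> \<le> R \<Longrightarrow> \<bar>cos_sum \<kappa> l 0 x - v \<tau> x\<bar> \<le> e"
      "\<And>\<kappa> x. \<bar>cos_sum \<kappa> l 0 x\<bar> \<le> M + e"
      using cos_sum_approx[OF cvt M[OF \<open>\<tau> \<ge> 0\<close>], of R e] R e(1) by (smt (verit))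
    \<comment> \<open>\<open>K * y\<^sup>2\<close> is at least the largest possible discrepancy
      \<open>2 * M + e\<close> as soon as \<open>\<bar>y\<bar> \<ge> R\<close>, and yet
      \<open>K\<close> tends to 0 as \<open>R\<close> grows.\<close>
    define K where "K = (2 * M + e) / R\<^sup>2"
    have K0: "K \<ge> 0" using M0 e by (simp add: K_def)
    have near: "\<bar>cos_sum \<kappa> l 0 y - v \<tau> y\<bar> \<le> e + K * y\<^sup>2" for y
    proof (cases "\<bar>y\<bar> \<le> R")
      case True
      have "0 \<le> K * y\<^sup>2" using K0 by simp
      then show ?thesis using l(1)[OF True, of \<kappa>] by linarith
    next
      case False
      then have "R\<^sup>2 \<le> y\<^sup>2" using R by (simp add: abs_le_square_iff[symmetric])
      then have "(2 * M + e) * 1 \<le> (2 * M + e) * (y\<^sup>2 / R\<^sup>2)"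
        using R M0 e by (intro mult_left_mono) (auto simp: divide_simps)
      then have "2 * M + e \<le> K * y\<^sup>2" by (simp add: K_def)
      then show ?thesis using l(2)[of \<kappa> y] M[OF \<open>\<tau> \<ge> 0\<close>, of y] e by linarith
    qed
    obtain c where tf: "test_function (\<lambda>t x. cos_sum \<kappa> l (t - \<tau>) x) (\<lambda>t x. \<kappa>\<^sup>2 / 2 * c t x) c"
      using test_function_cos_sum by blast
    obtain C where C: "\<And>s x. s \<ge> 0 \<Longrightarrow> \<bar>cos_sum \<kappa> l s x\<bar> \<le> C" using cos_sum_bounded by blast
    \<comment> \<open>The heat flow of \<open>K * x\<^sup>2\<close> is
      \<open>K * x\<^sup>2 + K * \<kappa>\<^sup>2 * (t - \<tau>)\<close>; with this term the barrier
      solves the linear equation exactly.\<close>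
    define \<Psi> where "\<Psi> = (\<lambda>t x. - cos_sum \<kappa> l (t - \<tau>) x + (e + K * \<kappa>\<^sup>2 * (t - \<tau>) + K * (x - 0)\<^sup>2))"
    have "- v (\<tau> + s) x \<le> \<Psi> (\<tau> + s) x"
    proof (rule smooth_comparison[where w = "\<lambda>t x. - v t x" and H = "\<lambda>c. \<kappa>\<^sup>2 * c / 2" and M = M and K = C and \<tau> = \<tau>
          and \<Psi> = \<Psi> and a = "\<lambda>t x. - (\<kappa>\<^sup>2 / 2 * c t x) + K * \<kappa>\<^sup>2" and c = "\<lambda>t x. - c t x + 2 * K"])
      fix \<psi> a c t x
      assume t: "test_function \<psi> a c" "0 < t"
        and ev: "\<forall>\<^sub>F (s, y) in nhds (t, x). - v s y - \<psi> s y \<le> - v t x - \<psi> t x"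
      have "\<forall>\<^sub>F (s, y) in nhds (t, x). v s y - (- \<psi> s y) \<ge> v t x - (- \<psi> t x)"
        using ev by (auto elim: eventually_mono simp: case_prod_unfold)
      then have "- a t x - Gfun \<sigma>\<^sub>0 (- c t x) \<ge> 0"
        using super test_function_uminus[OF t(1)] t(2) unfolding viscosity_supersolution_def by blast
      then show "a t x \<le> \<kappa>\<^sup>2 * c t x / 2" using \<kappa>(3)[of "- c t x"] by simp
    next
      show "\<kappa>\<^sup>2 * (c + 2 * e) / 2 \<le> \<kappa>\<^sup>2 * c / 2 + e" if "e \<ge> 0" for c e
        using mult_right_mono[OF k1 that] by (simp add: algebra_simps add_divide_distrib)
      show "continuous_on ({0..} \<times> UNIV) (\<lambda>(t, x). - v t x)"
        using cv by (auto simp: case_prod_unfold intro: continuous_intros)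
      show "- v t x \<le> M" if "t \<ge> 0" for t x using M[OF that, of x] by linarith
      show "test_function \<Psi> (\<lambda>t x. - (\<kappa>\<^sup>2 / 2 * c t x) + K * \<kappa>\<^sup>2) (\<lambda>t x. - c t x + 2 * K)"
        unfolding \<Psi>_def
        by (rule test_function_add[OF test_function_uminus[OF tf] test_function_const_quadratic])
      show "continuous_on ({0..} \<times> UNIV) (\<lambda>(t, x). \<Psi> t x)"
        unfolding \<Psi>_def case_prod_unfold
        using continuous_on_cos_sum[unfolded case_prod_unfold, of _ \<kappa> l \<tau>]
        by (intro continuous_intros) auto
      show "- C \<le> \<Psi> t x" if "t \<ge> \<tau>" for t x
      proof -
        have "0 \<le> K * \<kappa>\<^sup>2 * (t - \<tau>)" "0 \<le> K * (x - 0)\<^sup>2" using K0 that by auto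
        then show ?thesis using C[of "t - \<tau>" x] that e by (simp add: \<Psi>_def)
      qed
      show "\<kappa>\<^sup>2 * (- c t x + 2 * K) / 2 \<le> - (\<kappa>\<^sup>2 / 2 * c t x) + K * \<kappa>\<^sup>2" for t x
        by (simp add: field_simps)
      show "- v \<tau> x \<le> \<Psi> \<tau> x" for x using near[of x] by (simp add: \<Psi>_def)
    qed (use \<open>\<tau> \<ge> 0\<close> \<open>s \<ge> 0\<close> in auto)
    then have 1: "cos_sum \<kappa> l s x \<le> v (\<tau> + s) x + e + K * Q"
      by (simp add: \<Psi>_def Q_def algebra_simps)
    have iv: "integrable std_normal_distribution (\<lambda>z. v \<tau> (x + \<kappa> * sqrt s * z))"
      using cvt M[OF \<open>\<tau> \<ge> 0\<close>] by (intro integrable_bounded_std_normal) (auto intro: borel_measurable_continuous_onI)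
    have "continuous_on UNIV (cos_sum \<kappa> l 0)"
      by (intro continuous_at_imp_continuous_on ballI DERIV_isCont[OF cos_sum_derivs(1)])
    then have ic: "integrable std_normal_distribution (\<lambda>z. cos_sum \<kappa> l 0 (x + \<kappa> * sqrt s * z))"
      using l(2) by (intro integrable_bounded_std_normal) (auto intro: borel_measurable_continuous_onI)
    \<comment> \<open>The approximation error \<open>e + K * y\<^sup>2\<close> enters a second time,
      now averaged; its average is \<open>e + K * Q\<close>.\<close>
    have "gauss_avg \<kappa> s (v \<tau>) x \<le> (\<integral>z. cos_sum \<kappa> l 0 (x + \<kappa> * sqrt s * z)
        + (e + K * (x + \<kappa> * sqrt s * z)\<^sup>2) \<partial>std_normal_distribution)"
      unfolding gauss_avg_def
    proof (rule integral_mono)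
      show "v \<tau> (x + \<kappa> * sqrt s * z) \<le> cos_sum \<kappa> l 0 (x + \<kappa> * sqrt s * z) + (e + K * (x + \<kappa> * sqrt s * z)\<^sup>2)" for z
        using near[of "x + \<kappa> * sqrt s * z"] by linarith
    qed (intro Bochner_Integration.integrable_add ic iv integrable_mult_right integral_quadratic_std_normal | simp)+
    also have "\<dots> = gauss_avg \<kappa> s (cos_sum \<kappa> l 0) x + (e + K * (x\<^sup>2 + (\<kappa> * sqrt s)\<^sup>2))"
      using ic integral_quadratic_std_normal[of x "\<kappa> * sqrt s"] std_normal.prob_space
      by (simp add: gauss_avg_def)
    also have "\<dots> = cos_sum \<kappa> l s x + (e + K * Q)"
      using \<open>s \<ge> 0\<close> by (simp add: gauss_avg_cos_sum Q_def power_mult_distrib)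
    finally have 2: "gauss_avg \<kappa> s (v \<tau>) x - v (\<tau> + s) x \<le> 2 * e + 2 * (K * Q)" using 1 by simp
    have "K * Q \<le> ((2 * M + 1) / R) * Q"
    proof (rule mult_right_mono[OF _ Q0])
      have "R * 1 \<le> R\<^sup>2" using R unfolding power2_eq_square by (intro mult_left_mono) auto
      then show "K \<le> (2 * M + 1) / R" unfolding K_def using R e M0 by (intro frac_le) auto
    qed
    moreover have "(2 + 2 * (2 * M + 1) * Q) / R = 2 * e + 2 * (((2 * M + 1) / R) * Q)"
      by (simp add: e_def add_divide_distrib algebra_simps)
    ultimately show ?thesis using 2 by linarith
  qed
  define C where "C = 2 + 2 * (2 * M + 1) * Q"
  have "C > 0" using M0 Q0 by (simp add: C_def add_pos_nonneg)
  show ?thesis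
  proof (rule ccontr)
    assume "\<not> ?thesis"
    then have d: "gauss_avg \<kappa> s (v \<tau>) x - v (\<tau> + s) x > 0" by simp
    define R where "R = 1 + C / (gauss_avg \<kappa> s (v \<tau>) x - v (\<tau> + s) x)"
    have "R \<ge> 1" using d \<open>C > 0\<close> by (simp add: R_def)
    moreover have "C / R < gauss_avg \<kappa> s (v \<tau>) x - v (\<tau> + s) x"
    proof -
      have "R * (gauss_avg \<kappa> s (v \<tau>) x - v (\<tau> + s) x) > C"
        using d by (simp add: R_def distrib_right)
      then show ?thesis using \<open>R \<ge> 1\<close> by (simp add: divide_less_eq mult.commute)
    qed
    ultimately show False using bound[of R] by (simp add: C_def)
  qed
qed

lemma second_order_taylor:
  fixes f :: "real \<Rightarrow> real"
  assumes "\<And>z. (f has_real_derivative f' z) (at z)" "\<And>z. (f' has_real_derivative f'' z) (at z)"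
  obtains z where "\<bar>z - x\<bar> \<le> \<bar>y - x\<bar>" "f y = f x + f' x * (y - x) + f'' z / 2 * (y - x)\<^sup>2"
proof (cases "y = x")
  case False
  define diff where "diff = (\<lambda>n::nat. if n = 0 then f else if n = 1 then f' else f'')"
  have "\<exists>z. (if y < x then y < z \<and> z < x else x < z \<and> z < y) \<and>
    f y = (\<Sum>k<2. diff k x / fact k * (y - x) ^ k) + diff 2 z / fact 2 * (y - x) ^ 2"
  proof (rule Taylor[where a = "min x y" and b = "max x y"])
    show "\<forall>m z. m < 2 \<and> min x y \<le> z \<and> z \<le> max x y \<longrightarrow> (diff m has_real_derivative diff (Suc m) z) (at z)"
      using assms by (auto simp: diff_def less_2_cases_iff)
  qed (use False in \<open>auto simp: diff_def\<close>)
  then obtain z where "if y < x then y < z \<and> z < x else x < z \<and> z < y"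
    "f y = f x + f' x * (y - x) + f'' z / 2 * (y - x)\<^sup>2"
    by (auto simp: diff_def numeral_2_eq_2)
  then show ?thesis using that[of z] by (auto split: if_splits)
qed (use that[of x] in simp)

text \<open>A Taylor expansion of \<open>V t\<close> at \<open>x\<close> is averaged: the linear
  term drops out, the quadratic one contributes \<open>\<kappa>\<^sup>2 * s * m / 2\<close>, and
  division by \<open>s\<close> followed by \<open>s\<close> to 0 yields the time derivative. As the
  expansion is only local, a quartic term makes it a global lower bound; its average is of order
  \<open>s\<^sup>2\<close>.\<close>

lemma gauss_avg_le_imp_supersolution:
  assumes tf: "test_function V a c" and M: "\<And>t x. t \<ge> 0 \<Longrightarrow> \<bar>V t x\<bar> \<le> M"
    and cV: "\<And>t. t \<ge> 0 \<Longrightarrow> continuous_on UNIV (V t)"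
    and avg: "\<And>t s x. t \<ge> 0 \<Longrightarrow> s \<ge> 0 \<Longrightarrow> gauss_avg \<kappa> s (V t) x \<le> V (t + s) x"
    and t: "t > 0"
  shows "\<kappa>\<^sup>2 * c t x / 2 \<le> a t x"
proof -
  obtain b where b: "\<And>t x. t > 0 \<Longrightarrow> ((\<lambda>s. V s x) has_real_derivative a t x) (at t)"
     "\<And>t x. t > 0 \<Longrightarrow> (V t has_real_derivative b t x) (at x)"
     "\<And>t x. t > 0 \<Longrightarrow> (b t has_real_derivative c t x) (at x)"
     and cc: "continuous_on ({0<..} \<times> UNIV) (\<lambda>(t, x). c t x)"
    using tf unfolding test_function_def by blast
  have M0: "M \<ge> 0" using M[of 0 0] by simp
  have step: "\<kappa>\<^sup>2 * (c t x - e) / 2 \<le> a t x" if e: "e > 0" for e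
  proof -
    define m where "m = c t x - e"
    have "continuous_on UNIV (c t)"
      by (rule continuous_on_slice[OF cc]) (use t in auto)
    then have "isCont (c t) x" by (simp add: continuous_on_eq_continuous_at)
    then obtain r where r: "r > 0" "\<And>y. \<bar>y - x\<bar> < r \<Longrightarrow> \<bar>c t y - c t x\<bar> < e"
      using e unfolding continuous_at_eps_delta by (metis dist_real_def)
    have near: "V t y \<ge> V t x + b t x * (y - x) + m / 2 * (y - x)\<^sup>2" if y: "\<bar>y - x\<bar> < r" for y
    proof -
      obtain z where z: "\<bar>z - x\<bar> \<le> \<bar>y - x\<bar>"
        "V t y = V t x + b t x * (y - x) + c t z / 2 * (y - x)\<^sup>2"
        by (rule second_order_taylor[OF b(2)[OF t] b(3)[OF t], of x y])
      have "m \<le> c t z" using r(2)[of z] z(1) y by (simp add: m_def)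
      then have "m / 2 * (y - x)\<^sup>2 \<le> c t z / 2 * (y - x)\<^sup>2" by (intro mult_right_mono) auto
      then show ?thesis using z(2) by simp
    qed
    \<comment> \<open>The three summands let \<open>K * d ^ 4\<close> absorb, for
      \<open>d \<ge> r\<close>, the oscillation of \<open>V\<close>, the linear and the quadratic
      term of the expansion, respectively.\<close>
    define K where "K = 2 * M / r ^ 4 + \<bar>b t x\<bar> / r ^ 3 + \<bar>m\<bar> / (2 * r\<^sup>2)"
    have K0: "K \<ge> 0" using M0 r by (simp add: K_def)
    have low: "V t y \<ge> V t x + b t x * (y - x) + m / 2 * (y - x)\<^sup>2 - K * (y - x) ^ 4" for y
    proof (cases "\<bar>y - x\<bar> < r")
      case True
      have "0 \<le> K * (y - x) ^ 4" using K0 by simp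
      then show ?thesis using near[OF True] by linarith
    next
      case False
      define d where "d = \<bar>y - x\<bar>"
      have d: "d \<ge> r" "d \<ge> 0" using False by (auto simp: d_def)
      have i: "1 \<le> d / r" using d r by simp
      have "2 * M * 1 \<le> 2 * M * (d / r) ^ 4"
        using M0 one_le_power[OF i, of 4] by (intro mult_left_mono) auto
      moreover have "\<bar>b t x\<bar> * d * 1 \<le> \<bar>b t x\<bar> * d * (d / r) ^ 3"
        using d one_le_power[OF i, of 3] by (intro mult_left_mono) auto
      moreover have "\<bar>m\<bar> / 2 * d\<^sup>2 * 1 \<le> \<bar>m\<bar> / 2 * d\<^sup>2 * (d / r)\<^sup>2"
        using d one_le_power[OF i, of 2] by (intro mult_left_mono) auto
      moreover have "K * d ^ 4 = 2 * M * (d / r) ^ 4 + \<bar>b t x\<bar> * d * (d / r) ^ 3 + \<bar>m\<bar> / 2 * d\<^sup>2 * (d / r)\<^sup>2"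
        using r by (simp add: K_def field_simps power4_eq_xxxx power3_eq_cube power2_eq_square)
      ultimately have 1: "2 * M + \<bar>b t x\<bar> * d + \<bar>m\<bar> / 2 * d\<^sup>2 \<le> K * d ^ 4" by simp
      have d2: "d\<^sup>2 = (y - x)\<^sup>2" "d ^ 4 = (y - x) ^ 4" by (auto simp: d_def)
      have "b t x * (y - x) \<le> \<bar>b t x\<bar> * d" unfolding d_def by (metis abs_ge_self abs_mult)
      moreover have "m / 2 * (y - x)\<^sup>2 \<le> \<bar>m\<bar> / 2 * d\<^sup>2" unfolding d2 by (intro mult_right_mono) auto
      moreover have "V t x - V t y \<le> 2 * M" using M[of t x] M[of t y] t by (smt (verit))
      ultimately show ?thesis using 1 unfolding d2 by linarith
    qed
    \<comment> \<open>The 3 is the fourth moment of the normal law.\<close>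
    have quot: "\<kappa>\<^sup>2 * m / 2 - 3 * K * \<kappa> ^ 4 * s \<le> (V (t + s) x - V t x) / s" if s: "s > 0" for s
    proof -
      define k where "k = \<kappa> * sqrt s"
      have k: "k\<^sup>2 = \<kappa>\<^sup>2 * s" "k ^ 4 = \<kappa> ^ 4 * s\<^sup>2"
        using s by (simp_all add: k_def power_mult_distrib)
          (metis power2_eq_square power4_eq_xxxx real_sqrt_pow2 less_imp_le mult.assoc)
      have iV: "integrable std_normal_distribution (\<lambda>z. V t (x + k * z))"
        using cV[of t] M[of t] t by (intro integrable_bounded_std_normal) (auto intro: borel_measurable_continuous_onI)
      have i2: "integrable std_normal_distribution
         (\<lambda>z. V t x + (b t x * k) * z + (m / 2 * k\<^sup>2) * z\<^sup>2 - (K * k ^ 4) * z ^ 4)"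
        by (intro Bochner_Integration.integrable_add Bochner_Integration.integrable_diff integrable_mult_right std_normal_moments) auto
      have "V t x + m / 2 * k\<^sup>2 - 3 * K * k ^ 4
        = (\<integral>z. V t x + (b t x * k) * z + (m / 2 * k\<^sup>2) * z\<^sup>2 - (K * k ^ 4) * z ^ 4 \<partial>std_normal_distribution)"
        using std_normal_moments std_normal.prob_space by simp
      also have "\<dots> \<le> gauss_avg \<kappa> s (V t) x"
        unfolding gauss_avg_def k_def[symmetric]
      proof (rule integral_mono[OF i2 iV])
        show "V t x + (b t x * k) * z + (m / 2 * k\<^sup>2) * z\<^sup>2 - (K * k ^ 4) * z ^ 4 \<le> V t (x + k * z)" for z
          using low[of "x + k * z"] by (simp add: power_mult_distrib mult.assoc)
      qed
      also have "\<dots> \<le> V (t + s) x" using avg t s by simp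
      finally show ?thesis using s unfolding k by (simp add: field_simps power2_eq_square)
    qed
    have "((\<lambda>s. (V (t + s) x - V t x) / s) \<longlongrightarrow> a t x) (at_right 0)"
      using b(1)[OF t, of x] unfolding DERIV_def by (rule filterlim_mono) (auto simp: at_le)
    moreover have "((\<lambda>s. \<kappa>\<^sup>2 * m / 2 - 3 * K * \<kappa> ^ 4 * s) \<longlongrightarrow> \<kappa>\<^sup>2 * m / 2 - 3 * K * \<kappa> ^ 4 * 0) (at_right 0)"
      by (intro tendsto_intros)
    ultimately have "\<kappa>\<^sup>2 * m / 2 - 3 * K * \<kappa> ^ 4 * 0 \<le> a t x"
      using quot by (intro tendsto_le[OF trivial_limit_at_right_real]) (auto simp: eventually_at_right_less eventually_at_filter)
    then show ?thesis by (simp add: m_def)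
  qed
  show ?thesis
  proof (rule field_le_epsilon)
    fix e :: real assume "e > 0"
    \<comment> \<open>The denominator \<open>1 + \<kappa>\<^sup>2\<close> keeps the loss
      \<open>X\<close> at most \<open>e\<close> for every \<open>\<kappa>\<close>.\<close>
    define X where "X = \<kappa>\<^sup>2 * (e / (1 + \<kappa>\<^sup>2))"
    have "\<kappa>\<^sup>2 * (c t x - e / (1 + \<kappa>\<^sup>2)) / 2 \<le> a t x"
      using \<open>e > 0\<close> by (intro step) (auto simp: add_pos_nonneg)
    moreover have "\<kappa>\<^sup>2 * (c t x - e / (1 + \<kappa>\<^sup>2)) / 2 = \<kappa>\<^sup>2 * c t x / 2 - X / 2"
      by (simp add: X_def right_diff_distrib diff_divide_distrib)
    moreover have "X \<le> e"
    proof -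
      have "\<kappa>\<^sup>2 * e \<le> (1 + \<kappa>\<^sup>2) * e" using \<open>e > 0\<close> by (intro mult_right_mono) auto
      then show ?thesis by (simp add: X_def divide_le_eq add_pos_nonneg mult.commute)
    qed
    ultimately show "\<kappa>\<^sup>2 * c t x / 2 \<le> a t x + e" using \<open>e > 0\<close> by linarith
  qed
qed

section \<open>Steklov means: smoothing by averages over segments\<close>

definition seg_avg :: "real \<Rightarrow> real \<Rightarrow> (real \<Rightarrow> real \<Rightarrow> real) \<Rightarrow> real \<Rightarrow> real \<Rightarrow> real" where
  "seg_avg d e f t x = integral {0..1} (\<lambda>r. f (t + d * r) (x + e * r))"

lemma continuous_on_seg:
  fixes f :: "real \<Rightarrow> real \<Rightarrow> real"
  assumes f: "continuous_on UNIV (\<lambda>(t, x). f t x)"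
  shows "continuous_on A (\<lambda>r. f (t + d * r) (x + e * r))"
proof -
  have "continuous_on A (\<lambda>r. (t + d * r, x + e * r))" by (intro continuous_intros)
  then have "continuous_on A (\<lambda>r. case (t + d * r, x + e * r) of (t, x) \<Rightarrow> f t x)"
    by (rule continuous_on_compose2[OF f]) auto
  then show ?thesis by simp
qed

lemma continuous_on_seg_avg:
  fixes f :: "real \<Rightarrow> real \<Rightarrow> real"
  assumes f: "continuous_on UNIV (\<lambda>(t, x). f t x)"
  shows "continuous_on UNIV (\<lambda>(t, x). seg_avg d e f t x)"
proof -
  have "continuous_on (UNIV \<times> cbox 0 1) (\<lambda>(p :: real \<times> real, r). f (fst p + d * r) (snd p + e * r))"
  proof -
    have "continuous_on (UNIV \<times> cbox 0 1) (\<lambda>q :: (real \<times> real) \<times> real. (fst (fst q) + d * snd q, snd (fst q) + e * snd q))"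
      by (intro continuous_intros)
    then have "continuous_on (UNIV \<times> cbox 0 1) (\<lambda>q :: (real \<times> real) \<times> real. case (fst (fst q) + d * snd q, snd (fst q) + e * snd q) of (t, x) \<Rightarrow> f t x)"
      by (rule continuous_on_compose2[OF f]) auto
    then show ?thesis by (simp add: case_prod_unfold)
  qed
  then have "continuous_on UNIV (\<lambda>p :: real \<times> real. integral (cbox 0 1) (\<lambda>r. f (fst p + d * r) (snd p + e * r)))"
    by (rule integral_continuous_on_param)
  then show ?thesis by (simp add: seg_avg_def case_prod_unfold)
qed

lemma seg_avg_bounded:
  fixes f :: "real \<Rightarrow> real \<Rightarrow> real"
  assumes f: "continuous_on UNIV (\<lambda>(t, x). f t x)"
    and b: "\<And>r. r \<in> {0..1} \<Longrightarrow> \<bar>f (t + d * r) (x + e * r) - k\<bar> \<le> C"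
  shows "\<bar>seg_avg d e f t x - k\<bar> \<le> C"
proof -
  have i: "(\<lambda>r. f (t + d * r) (x + e * r)) integrable_on {0..1}"
    by (intro integrable_continuous_real continuous_on_seg[OF f])
  have "seg_avg d e f t x \<le> integral {0..1} (\<lambda>r::real. k + C)"
    unfolding seg_avg_def by (intro integral_le i) (use b in \<open>force simp: abs_le_iff\<close>)+
  moreover have "integral {0..1} (\<lambda>r::real. k - C) \<le> seg_avg d e f t x"
    unfolding seg_avg_def by (intro integral_le i) (use b in \<open>force simp: abs_le_iff\<close>)+
  ultimately show ?thesis by (simp add: abs_le_iff)
qed

text \<open>Fubini on the unit square. Any of the iterated averages can thus be moved to the
  outside, where it can be differentiated.\<close>

lemma seg_avg_swap:
  fixes f :: "real \<Rightarrow> real \<Rightarrow> real"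
  assumes f: "continuous_on UNIV (\<lambda>(t, x). f t x)"
  shows "seg_avg d e (seg_avg d' e' f) = seg_avg d' e' (seg_avg d e f)"
proof (intro ext)
  fix t x
  have "continuous_on (cbox (0, 0) (1, 1)) (\<lambda>q :: real \<times> real. (t + d * fst q + d' * snd q, x + e * fst q + e' * snd q))"
    by (intro continuous_intros)
  then have "continuous_on (cbox (0, 0) (1, 1)) (\<lambda>q :: real \<times> real. case (t + d * fst q + d' * snd q, x + e * fst q + e' * snd q) of (t, x) \<Rightarrow> f t x)"
    by (rule continuous_on_compose2[OF f]) auto
  then have c: "continuous_on (cbox (0, 0) (1, 1)) (\<lambda>(r, r'). f (t + d * r + d' * r') (x + e * r + e' * r'))"
    by (simp add: case_prod_unfold)
  show "seg_avg d e (seg_avg d' e' f) t x = seg_avg d' e' (seg_avg d e f) t x"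
    using integral_swap_continuous[OF c] by (simp add: seg_avg_def add_ac)
qed

text \<open>With an antiderivative \<open>F\<close> of \<open>f\<close> the average is a difference
  quotient of \<open>F\<close>. So averaging over a segment makes a merely continuous function
  differentiable, with a difference quotient of \<open>f\<close> as derivative.\<close>

lemma segment_integral_deriv:
  fixes f :: "real \<Rightarrow> real"
  assumes f: "continuous_on UNIV f" and "\<delta> > 0"
  shows "((\<lambda>x. integral {0..1} (\<lambda>r. f (x + \<delta> * r))) has_real_derivative (f (x + \<delta>) - f x) / \<delta>) (at x)"
proof -
  obtain F where F: "\<And>x. (F has_vector_derivative f x) (at x)"
  proof -
    have "\<And>x. isCont f x" using f by (simp add: continuous_on_eq_continuous_at)
    then have "\<exists>F. \<forall>x :: real. - \<infinity> < ereal x \<longrightarrow> ereal x < \<infinity> \<longrightarrow> (F has_vector_derivative f x) (at x)"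
      by (intro einterval_antiderivative) auto
    then show ?thesis using that by auto
  qed
  have D: "(F has_real_derivative f x) (at x)" for x
    using F by (simp add: has_real_derivative_iff_has_vector_derivative)
  have e: "integral {0..1} (\<lambda>r. f (x + \<delta> * r)) = (F (x + \<delta>) - F x) / \<delta>" for x
  proof (rule integral_unique)
    have "((\<lambda>r. f (x + \<delta> * r)) has_integral (F (x + \<delta> * 1) / \<delta> - F (x + \<delta> * 0) / \<delta>)) {0..1}"
    proof (rule fundamental_theorem_of_calculus)
      fix r :: real
      have "((\<lambda>r. F (x + \<delta> * r) / \<delta>) has_real_derivative f (x + \<delta> * r) * \<delta> / \<delta>) (at r within {0..1})"
        by (rule DERIV_cdivide, rule DERIV_chain'[where g = F], auto intro!: derivative_eq_intros D)
      then show "((\<lambda>r. F (x + \<delta> * r) / \<delta>) has_vector_derivative f (x + \<delta> * r)) (at r within {0..1})"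
        using \<open>\<delta> > 0\<close> by (simp add: has_real_derivative_iff_has_vector_derivative)
    qed simp
    then show "((\<lambda>r. f (x + \<delta> * r)) has_integral (F (x + \<delta>) - F x) / \<delta>) {0..1}"
      by (simp add: diff_divide_distrib)
  qed
  have "((\<lambda>x. F (x + \<delta>)) has_real_derivative f (x + \<delta>)) (at x)"
    using D[of "x + \<delta>"] by (simp add: DERIV_shift)
  then show ?thesis unfolding e by (intro DERIV_cdivide DERIV_diff D)
qed

text \<open>Gaussian averaging acts in \<open>x\<close> only and commutes, by Fubini, with averaging
  over translations; the inequality is then used at every shifted point. The shifts go forward in
  time (\<open>d \<ge> 0\<close>), so the times stay in the range of the assumption.\<close>

lemma gauss_avg_seg_avg_le:
  fixes f :: "real \<Rightarrow> real \<Rightarrow> real"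
  assumes f: "continuous_on UNIV (\<lambda>(t, x). f t x)" and M: "\<And>t x. \<bar>f t x\<bar> \<le> M"
    and avg: "\<And>t s x. t \<ge> 0 \<Longrightarrow> s \<ge> 0 \<Longrightarrow> gauss_avg \<kappa> s (f t) x \<le> f (t + s) x"
    and "d \<ge> 0" "t \<ge> 0" "s \<ge> 0"
  shows "gauss_avg \<kappa> s (seg_avg d e f t) x \<le> seg_avg d e f (t + s) x"
proof -
  let ?U = "restrict_space lborel {0..1::real}" and ?N = std_normal_distribution
  have U: "finite_measure ?U" by (rule finite_measureI) (simp add: emeasure_restrict_space)
  interpret P: pair_sigma_finite ?U ?N
    by (intro pair_sigma_finite.intro finite_measure.sigma_finite_measure[OF U] std_normal.sigma_finite_measure_axioms)
  interpret PF: finite_measure "?U \<Otimes>\<^sub>M ?N"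
    by (intro finite_measure_pair_measure U) unfold_locales
  have eq: "integral {0..1} g = (\<integral>r. g r \<partial>?U)" if "continuous_on UNIV g" for g :: "real \<Rightarrow> real"
  proof -
    have "set_integrable lborel {0..1} g"
      using that by (intro borel_integrable_atLeastAtMost') (auto intro: continuous_on_subset)
    then show ?thesis
      by (simp add: set_borel_integral_eq_integral(2)[symmetric] set_lebesgue_integral_def integral_restrict_space)
  qed
  define F where "F = (\<lambda>r z. f (t + d * r) (x + \<kappa> * sqrt s * z + e * r))"
  have "continuous_on UNIV (\<lambda>q :: real \<times> real. (t + d * fst q, x + \<kappa> * sqrt s * snd q + e * fst q))"
    by (intro continuous_intros)
  then have "continuous_on UNIV (\<lambda>q :: real \<times> real. case (t + d * fst q, x + \<kappa> * sqrt s * snd q + e * fst q) of (t, x) \<Rightarrow> f t x)"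
    by (rule continuous_on_compose2[OF f]) auto
  then have cF: "continuous_on UNIV (\<lambda>(r, z). F r z)" by (simp add: F_def case_prod_unfold)
  then have m1: "(\<lambda>(r, z). F r z) \<in> borel_measurable (borel \<Otimes>\<^sub>M borel)"
    by (simp add: borel_prod borel_measurable_continuous_onI)
  have "(\<lambda>r. r) \<in> measurable ?U borel" by (intro measurable_restrict_space1) simp
  then have "(\<lambda>q. fst q) \<in> measurable (?U \<Otimes>\<^sub>M ?N) borel" by (rule measurable_compose[OF measurable_fst])
  moreover have "(\<lambda>z. z) \<in> measurable ?N borel" by simp
  then have "(\<lambda>q. snd q) \<in> measurable (?U \<Otimes>\<^sub>M ?N) borel" by (rule measurable_compose[OF measurable_snd])
  ultimately have "(\<lambda>q. (fst q, snd q)) \<in> measurable (?U \<Otimes>\<^sub>M ?N) (borel \<Otimes>\<^sub>M borel)"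
    by (rule measurable_Pair)
  from measurable_compose[OF this m1]
  have mF: "(\<lambda>(r, z). F r z) \<in> borel_measurable (?U \<Otimes>\<^sub>M ?N)" by (simp add: case_prod_unfold)
  have iF: "integrable (?U \<Otimes>\<^sub>M ?N) (\<lambda>(r, z). F r z)"
    by (rule PF.integrable_const_bound[OF _ mF, where B = M]) (auto simp: F_def M)
  have cs: "continuous_on UNIV (\<lambda>r. f (t + d * r) (y + e * r))" for t y by (rule continuous_on_seg[OF f])
  have "gauss_avg \<kappa> s (seg_avg d e f t) x = (\<integral>z. (\<integral>r. F r z \<partial>?U) \<partial>?N)"
    unfolding gauss_avg_def seg_avg_def F_def by (simp add: eq[OF cs])
  also have "\<dots> = (\<integral>r. (\<integral>z. F r z \<partial>?N) \<partial>?U)" by (rule P.Fubini_integral[OF iF])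
  also have "\<dots> = (\<integral>r. gauss_avg \<kappa> s (f (t + d * r)) (x + e * r) \<partial>?U)"
    unfolding gauss_avg_def F_def by (simp add: add_ac)
  also have "\<dots> \<le> (\<integral>r. f (t + s + d * r) (x + e * r) \<partial>?U)"
  proof (rule integral_mono_AE)
    have "integrable ?U (\<lambda>r. \<integral>z. F r z \<partial>?N)" by (rule P.integrable_fst'[OF iF, simplified])
    then show "integrable ?U (\<lambda>r. gauss_avg \<kappa> s (f (t + d * r)) (x + e * r))"
      unfolding gauss_avg_def F_def by (simp add: add_ac)
    have "set_integrable lborel {0..1} (\<lambda>r. f (t + s + d * r) (x + e * r))"
      by (intro borel_integrable_atLeastAtMost' continuous_on_seg[OF f])
    then show "integrable ?U (\<lambda>r. f (t + s + d * r) (x + e * r))"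
      by (simp add: set_integrable_def integrable_restrict_space)
    have "gauss_avg \<kappa> s (f (t + d * r)) (x + e * r) \<le> f (t + s + d * r) (x + e * r)" if "r \<in> {0..1}" for r
      using avg[of "t + d * r" s "x + e * r"] that \<open>d \<ge> 0\<close> \<open>t \<ge> 0\<close> \<open>s \<ge> 0\<close> by (simp add: add_ac)
    then show "AE r in ?U. gauss_avg \<kappa> s (f (t + d * r)) (x + e * r) \<le> f (t + s + d * r) (x + e * r)"
      by (auto intro!: AE_I2 simp: space_restrict_space)
  qed
  also have "\<dots> = seg_avg d e f (t + s) x" unfolding seg_avg_def by (simp add: eq[OF cs])
  finally show ?thesis .
qed

text \<open>One average in time and two in space, matching the derivatives demanded by
  \<open>test_function\<close>.\<close>

definition steklov :: "real \<Rightarrow> (real \<Rightarrow> real \<Rightarrow> real) \<Rightarrow> real \<Rightarrow> real \<Rightarrow> real" where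
  "steklov \<delta> f = seg_avg 0 \<delta> (seg_avg 0 \<delta> (seg_avg \<delta> 0 f))"

lemma seg_avg_deriv_space:
  assumes f: "continuous_on UNIV (\<lambda>(t, x). f t x :: real)" and "\<delta> > 0"
  shows "(seg_avg 0 \<delta> f t has_real_derivative (f t (x + \<delta>) - f t x) / \<delta>) (at x)"
proof -
  have "continuous_on UNIV (f t)" by (rule continuous_on_slice[of UNIV]) (use f in auto)
  from segment_integral_deriv[OF this \<open>\<delta> > 0\<close>] show ?thesis by (simp add: seg_avg_def[abs_def])
qed

lemma seg_avg_deriv_time:
  assumes f: "continuous_on UNIV (\<lambda>(t, x). f t x :: real)" and "\<delta> > 0"
  shows "((\<lambda>s. seg_avg \<delta> 0 f s x) has_real_derivative (f (t + \<delta>) x - f t x) / \<delta>) (at t)"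
proof -
  have "continuous_on UNIV (\<lambda>t. (t, x))" by (intro continuous_intros)
  then have "continuous_on UNIV (\<lambda>t. case (t, x) of (t, x) \<Rightarrow> f t x)"
    by (rule continuous_on_compose2[OF f]) auto
  then have "continuous_on UNIV (\<lambda>t. f t x)" by simp
  from segment_integral_deriv[OF this \<open>\<delta> > 0\<close>] show ?thesis by (simp add: seg_avg_def[abs_def])
qed

lemma continuous_on_shift:
  fixes f :: "real \<Rightarrow> real \<Rightarrow> real"
  assumes f: "continuous_on UNIV (\<lambda>(t, x). f t x)"
  shows "continuous_on UNIV (\<lambda>(t, x). f (t + d) (x + e))"
proof -
  have "continuous_on UNIV (\<lambda>q :: real \<times> real. (fst q + d, snd q + e))" by (intro continuous_intros)
  then have "continuous_on UNIV (\<lambda>q :: real \<times> real. case (fst q + d, snd q + e) of (t, x) \<Rightarrow> f t x)"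
    by (rule continuous_on_compose2[OF f]) auto
  then show ?thesis by (simp add: case_prod_unfold)
qed

text \<open>Each average trades one derivative for a difference quotient. In space the two outer
  averages are differentiated in turn; for the time derivative the time average is first moved to
  the outside, and \<open>X\<close> is what it then averages.\<close>

lemma test_function_steklov:
  fixes f :: "real \<Rightarrow> real \<Rightarrow> real"
  assumes f: "continuous_on UNIV (\<lambda>(t, x). f t x)" and "\<delta> > 0"
  obtains a c where "test_function (steklov \<delta> f) a c"
proof
  define X where "X = seg_avg 0 \<delta> (seg_avg 0 \<delta> f)"
  define Y where "Y = seg_avg \<delta> 0 f"
  define Z where "Z = seg_avg 0 \<delta> Y"
  note c = continuous_on_seg_avg
  have cX: "continuous_on UNIV (\<lambda>(t, x). X t x)" unfolding X_def by (intro c f)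
  have cY: "continuous_on UNIV (\<lambda>(t, x). Y t x)" unfolding Y_def by (intro c f)
  have cZ: "continuous_on UNIV (\<lambda>(t, x). Z t x)" unfolding Z_def by (intro c cY)
  have WX: "steklov \<delta> f = seg_avg \<delta> 0 X"
    unfolding steklov_def X_def
    by (simp add: seg_avg_swap[OF f, of 0 \<delta> \<delta> 0] seg_avg_swap[OF c[OF f, of 0 \<delta>], of 0 \<delta> \<delta> 0])
  have WZ: "steklov \<delta> f = seg_avg 0 \<delta> Z" by (simp add: steklov_def Z_def Y_def)
  show "test_function (steklov \<delta> f) (\<lambda>t x. (X (t + \<delta>) x - X t x) / \<delta>)
     (\<lambda>t x. ((Y t (x + \<delta> + \<delta>) - Y t (x + \<delta>)) / \<delta> - (Y t (x + \<delta>) - Y t x) / \<delta>) / \<delta>)"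
  proof (rule test_functionI[where b = "\<lambda>t x. (Z t (x + \<delta>) - Z t x) / \<delta>"])
    fix t x :: real
    show "((\<lambda>s. steklov \<delta> f s x) has_real_derivative (X (t + \<delta>) x - X t x) / \<delta>) (at t)"
      unfolding WX by (rule seg_avg_deriv_time[OF cX \<open>\<delta> > 0\<close>])
    show "(steklov \<delta> f t has_real_derivative (Z t (x + \<delta>) - Z t x) / \<delta>) (at x)"
      unfolding WZ by (rule seg_avg_deriv_space[OF cZ \<open>\<delta> > 0\<close>])
    have D: "(Z t has_real_derivative (Y t (x + \<delta>) - Y t x) / \<delta>) (at x)" for x
      unfolding Z_def by (rule seg_avg_deriv_space[OF cY \<open>\<delta> > 0\<close>])
    have "((\<lambda>x. Z t (x + \<delta>)) has_real_derivative (Y t (x + \<delta> + \<delta>) - Y t (x + \<delta>)) / \<delta>) (at x)"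
      using D[of "x + \<delta>"] by (simp add: DERIV_shift)
    then show "((\<lambda>x. (Z t (x + \<delta>) - Z t x) / \<delta>) has_real_derivative
        ((Y t (x + \<delta> + \<delta>) - Y t (x + \<delta>)) / \<delta> - (Y t (x + \<delta>) - Y t x) / \<delta>) / \<delta>) (at x)"
      by (intro DERIV_cdivide DERIV_diff D)
  next
    note s = continuous_on_shift[unfolded case_prod_unfold]
    note cs = cX cY cZ
    show "continuous_on ({0<..} \<times> UNIV) (\<lambda>(t, x). (X (t + \<delta>) x - X t x) / \<delta>)"
      using s[OF cX[unfolded case_prod_unfold], of \<delta> 0] cX \<open>\<delta> > 0\<close>
      unfolding case_prod_unfold by (auto intro!: continuous_intros elim: continuous_on_subset)
    show "continuous_on ({0<..} \<times> UNIV) (\<lambda>(t, x). (Z t (x + \<delta>) - Z t x) / \<delta>)"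
      using s[OF cZ[unfolded case_prod_unfold], of 0 \<delta>] cZ \<open>\<delta> > 0\<close>
      unfolding case_prod_unfold by (auto intro!: continuous_intros elim: continuous_on_subset)
    show "continuous_on ({0<..} \<times> UNIV) (\<lambda>(t, x). ((Y t (x + \<delta> + \<delta>) - Y t (x + \<delta>)) / \<delta> - (Y t (x + \<delta>) - Y t x) / \<delta>) / \<delta>)"
      using s[OF cY[unfolded case_prod_unfold], of 0 \<delta>] s[OF cY[unfolded case_prod_unfold], of 0 "\<delta> + \<delta>"] cY \<open>\<delta> > 0\<close>
      unfolding case_prod_unfold by (auto intro!: continuous_intros elim: continuous_on_subset simp: add.assoc)
  qed
qed

lemma continuous_on_steklov:
  fixes f :: "real \<Rightarrow> real \<Rightarrow> real"
  assumes f: "continuous_on UNIV (\<lambda>(t, x). f t x)"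
  shows "continuous_on UNIV (\<lambda>(t, x). steklov \<delta> f t x)"
  unfolding steklov_def by (intro continuous_on_seg_avg f)

lemma steklov_close:
  fixes f :: "real \<Rightarrow> real \<Rightarrow> real"
  assumes f: "continuous_on UNIV (\<lambda>(t, x). f t x)" and "\<delta> > 0"
    and b: "\<And>s y. \<bar>s - t\<bar> \<le> \<delta> \<Longrightarrow> \<bar>y - x\<bar> \<le> 2 * \<delta> \<Longrightarrow> \<bar>f s y - k\<bar> \<le> C"
  shows "\<bar>steklov \<delta> f t x - k\<bar> \<le> C"
  unfolding steklov_def
proof (intro seg_avg_bounded continuous_on_seg_avg f b)
  fix r r' r'' :: real assume r: "r \<in> {0..1}" "r' \<in> {0..1}" "r'' \<in> {0..1}"
  have "\<delta> * r'' \<le> \<delta> * 1" "0 \<le> \<delta> * r''" "\<delta> * r' \<le> \<delta> * 1" "0 \<le> \<delta> * r'" "\<delta> * r \<le> \<delta> * 1" "0 \<le> \<delta> * r"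
    using \<open>\<delta> > 0\<close> r by (auto intro!: mult_left_mono)
  then show "\<bar>t + 0 * r + 0 * r' + \<delta> * r'' - t\<bar> \<le> \<delta>" "\<bar>x + \<delta> * r + \<delta> * r' + 0 * r'' - x\<bar> \<le> 2 * \<delta>"
    by auto
qed

text \<open>Being above all its Gaussian averages is preserved under the Steklov means, and for a smooth
  function it is the classical supersolution property; this is where the convexity of \<open>G\<close> enters.\<close>

lemma comparison:
  assumes \<sigma>: "0 \<le> \<sigma>\<^sub>0" "\<sigma>\<^sub>0 \<le> 1"
    and sub: "viscosity_subsolution \<sigma>\<^sub>0 w" and super: "viscosity_supersolution \<sigma>\<^sub>0 v"
    and cw: "continuous_on ({0..} \<times> UNIV) (\<lambda>(t, x). w t x)"
    and cv: "continuous_on ({0..} \<times> UNIV) (\<lambda>(t, x). v t x)"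
    and bw: "\<And>t x. t \<ge> 0 \<Longrightarrow> \<bar>w t x\<bar> \<le> M" and bv: "\<And>t x. t \<ge> 0 \<Longrightarrow> \<bar>v t x\<bar> \<le> M"
    and init: "\<And>x. w 0 x \<le> v 0 x" and "t \<ge> 0"
  shows "w t x \<le> v t x"
proof (rule ccontr)
  assume "\<not> w t x \<le> v t x"
  \<comment> \<open>Three errors of size \<open>d\<close> will occur: the distance of the Steklov
    mean from \<open>v\<close>, the constant added to the barrier, and the penalty at
    \<open>(t, x)\<close>. The violation is \<open>4 * d\<close>.\<close>
  define d where "d = (w t x - v t x) / 4"
  have d: "d > 0" using \<open>\<not> w t x \<le> v t x\<close> by (simp add: d_def)
  have M0: "M \<ge> 0" using bw[of 0 0] by simp
  \<comment> \<open>Freezing \<open>v\<close> at its initial value for negative times gives a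
    continuous function on the whole plane, as the averages require.\<close>
  define V where "V = (\<lambda>t x. v (max 0 t) x)"
  have cV: "continuous_on UNIV (\<lambda>(t, x). V t x)"
  proof -
    have "continuous_on UNIV (\<lambda>q :: real \<times> real. (max 0 (fst q), snd q))" by (intro continuous_intros)
    then have "continuous_on UNIV (\<lambda>q :: real \<times> real. case (max 0 (fst q), snd q) of (t, x) \<Rightarrow> v t x)"
      by (rule continuous_on_compose2[OF cv]) auto
    then show ?thesis by (simp add: case_prod_unfold V_def)
  qed
  have bV: "\<bar>V t x\<bar> \<le> M" for t x by (simp add: V_def bv)
  define Q where "Q = x\<^sup>2 + t + 1"
  have Q: "Q > 0" using \<open>t \<ge> 0\<close> by (simp add: Q_def add_nonneg_pos)
  define \<eta> where "\<eta> = d / Q"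
  have \<eta>: "\<eta> > 0" using d Q by (simp add: \<eta>_def)
  \<comment> \<open>For \<open>\<bar>y\<bar> > R\<close> the penalty is at least
    \<open>2 * M\<close>, so that the initial inequality is trivial there; closeness of
    \<open>W\<close> to \<open>v\<close> thus matters on a compact set only.\<close>
  define R where "R = max (2 * M / \<eta>) 1 + \<bar>x\<bar>"
  have R: "R \<ge> 1" "\<bar>x\<bar> \<le> R" "2 * M / \<eta> \<le> R" by (auto simp: R_def)
  have R3: "2 * M \<le> \<eta> * R" using R(3) \<eta> by (simp add: field_simps)
  define D where "D = {0..t + 1} \<times> {- R - 2..R + 2}"
  have "uniformly_continuous_on D (\<lambda>(t, x). V t x)"
    unfolding D_def by (intro compact_uniformly_continuous continuous_on_subset[OF cV] compact_Times) auto
  then obtain e where e: "e > 0" "\<And>p q. p \<in> D \<Longrightarrow> q \<in> D \<Longrightarrow> dist p q < e \<Longrightarrow>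
      \<bar>(case p of (t, x) \<Rightarrow> V t x) - (case q of (t, x) \<Rightarrow> V t x)\<bar> < d"
    using d unfolding uniformly_continuous_on_def dist_real_def by metis
  \<comment> \<open>\<open>W\<close> at a point involves times up to \<open>\<delta>\<close> and
    positions up to \<open>2 * \<delta>\<close> away, which is within distance \<open>e\<close> and,
    for \<open>\<delta> \<le> 1\<close>, within the enlarged box \<open>D\<close>.\<close>
  define \<delta> where "\<delta> = min 1 (e / 4)"
  have \<delta>: "\<delta> > 0" "\<delta> \<le> 1" "4 * \<delta> \<le> e" using e by (auto simp: \<delta>_def)
  define W where "W = steklov \<delta> V"
  have cW: "continuous_on UNIV (\<lambda>(t, x). W t x)" unfolding W_def by (rule continuous_on_steklov[OF cV])
  have near: "\<bar>W s y - V s y\<bar> \<le> d" if "0 \<le> s" "s \<le> t" "\<bar>y\<bar> \<le> R" for s y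
    unfolding W_def
  proof (rule steklov_close[OF cV \<delta>(1)])
    fix s' y' assume a: "\<bar>s' - s\<bar> \<le> \<delta>" "\<bar>y' - y\<bar> \<le> 2 * \<delta>"
    show "\<bar>V s' y' - V s y\<bar> \<le> d"
    proof -
      have m: "(max 0 s', y') \<in> D" "(s, y) \<in> D" using that a \<delta>(2) \<open>t \<ge> 0\<close> by (auto simp: D_def abs_le_iff max_def)
      have "dist (max 0 s', y') (s, y) \<le> \<bar>max 0 s' - s\<bar> + \<bar>y' - y\<bar>"
        using norm_Pair_le[of "max 0 s' - s" "y' - y"] by (simp add: dist_norm)
      also have "\<dots> < e" using a that \<delta> by (auto simp: abs_le_iff max_def)
      finally show ?thesis using e(2)[OF m] by (simp add: V_def)
    qed
  qed
  have bW: "\<bar>W t x\<bar> \<le> M" for t x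
    using steklov_close[OF cV \<delta>(1), of t x 0 M] bV by (simp add: W_def)
  obtain a c where tf: "test_function W a c"
    using test_function_steklov[OF cV \<delta>(1)] W_def by blast
  have av: "gauss_avg \<kappa> s (W t) x \<le> W (t + s) x"
    if \<kappa>: "0 \<le> \<kappa>" "\<kappa> \<le> 1" "\<And>c. \<kappa>\<^sup>2 * c / 2 \<le> Gfun \<sigma>\<^sub>0 c" and ts: "t \<ge> 0" "s \<ge> 0" for \<kappa> t s x
  proof -
    have 0: "gauss_avg \<kappa> s (V t) x \<le> V (t + s) x" if "t \<ge> 0" "s \<ge> 0" for t s x
      using supersolution_ge_gauss_avg[OF super \<kappa> cv bv that, where x = x] that by (simp add: V_def[abs_def])
    have b1: "\<bar>seg_avg d e f t x\<bar> \<le> M" if "continuous_on UNIV (\<lambda>(t, x). f t x)" "\<And>t x. \<bar>f t x\<bar> \<le> M"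
      for d e f t x using seg_avg_bounded[of f t d x e 0 M] that by simp
    note c1 = continuous_on_seg_avg[OF cV, of \<delta> 0]
    note c2 = continuous_on_seg_avg[OF c1, of 0 \<delta>]
    have 1: "gauss_avg \<kappa> s (seg_avg \<delta> 0 V t) x \<le> seg_avg \<delta> 0 V (t + s) x" if "t \<ge> 0" "s \<ge> 0" for t s x
      using \<delta> that by (intro gauss_avg_seg_avg_le[OF cV bV 0]) auto
    have 2: "gauss_avg \<kappa> s (seg_avg 0 \<delta> (seg_avg \<delta> 0 V) t) x \<le> seg_avg 0 \<delta> (seg_avg \<delta> 0 V) (t + s) x"
      if "t \<ge> 0" "s \<ge> 0" for t s x
      using that by (intro gauss_avg_seg_avg_le[OF c1 b1[OF cV bV] 1]) auto
    show ?thesis unfolding W_def steklov_def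
      using ts by (intro gauss_avg_seg_avg_le[OF c2 b1[OF c1 b1[OF cV bV]] 2]) auto
  qed
  have G: "Gfun \<sigma>\<^sub>0 (c t x) \<le> a t x" if "t > 0" for t x
  proof -
    have "\<kappa>\<^sup>2 * c t x / 2 \<le> a t x" if \<kappa>: "0 \<le> \<kappa>" "\<kappa> \<le> 1" "\<And>c. \<kappa>\<^sup>2 * c / 2 \<le> Gfun \<sigma>\<^sub>0 c" for \<kappa>
      using av[OF \<kappa>] \<open>t > 0\<close> continuous_on_slice[of UNIV W] cW bW
      by (intro gauss_avg_le_imp_supersolution[OF tf]) auto
    \<comment> \<open>The two admissible values \<open>\<kappa> = 1\<close> and
      \<open>\<kappa> = \<sigma>\<^sub>0\<close> give the two slopes whose maximum is
      \<open>G\<close>.\<close>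
    from this[of 1] this[of \<sigma>\<^sub>0] show ?thesis using \<sigma> by (simp add: Gfun_eq_max)
  qed
  define \<Psi> where "\<Psi> = (\<lambda>t x. W t x + (d + \<eta> * (t - 0) + \<eta> * (x - 0)\<^sup>2))"
  have "w t x \<le> \<Psi> t x"
  proof (rule smooth_comparison[where w = w and H = "Gfun \<sigma>\<^sub>0" and M = M and K = M and \<tau> = 0 and \<Psi> = \<Psi>
        and a = "\<lambda>t x. a t x + \<eta>" and c = "\<lambda>t x. c t x + 2 * \<eta>"])
    show "a t x \<le> Gfun \<sigma>\<^sub>0 (c t x)" if "test_function \<psi> a c" "0 < t"
      "\<forall>\<^sub>F (s, y) in nhds (t, x). w s y - \<psi> s y \<le> w t x - \<psi> t x" for \<psi> a c t x
      using sub that unfolding viscosity_subsolution_def by fastforce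
    show "Gfun \<sigma>\<^sub>0 (c + 2 * e) \<le> Gfun \<sigma>\<^sub>0 c + e" if "e \<ge> 0" for c e using Gfun_shift[OF \<sigma> that] .
    show "w t x \<le> M" if "t \<ge> 0" for t x using bw[OF that, of x] by linarith
    show "test_function \<Psi> (\<lambda>t x. a t x + \<eta>) (\<lambda>t x. c t x + 2 * \<eta>)"
      unfolding \<Psi>_def by (rule test_function_add[OF tf test_function_const_quadratic])
    show "continuous_on ({0..} \<times> UNIV) (\<lambda>(t, x). \<Psi> t x)"
      unfolding \<Psi>_def using continuous_on_subset[OF cW] by (auto simp: case_prod_unfold intro!: continuous_intros)
    show "- M \<le> \<Psi> t x" if "0 \<le> t" for t x
    proof -
      have "0 \<le> \<eta> * (t - 0)" "0 \<le> \<eta> * (x - 0)\<^sup>2" using \<eta> that by auto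
      then show ?thesis using bW[of t x] d by (simp add: \<Psi>_def abs_le_iff)
    qed
    show "Gfun \<sigma>\<^sub>0 (c t x + 2 * \<eta>) \<le> a t x + \<eta>" if "0 < t" for t x
      using Gfun_shift[OF \<sigma>, of \<eta> "c t x"] G[OF that, of x] \<eta> by simp
    show "w 0 y \<le> \<Psi> 0 y" for y
    proof (cases "\<bar>y\<bar> \<le> R")
      case True
      have "0 \<le> \<eta> * y\<^sup>2" using \<eta> by simp
      then show ?thesis using near[of 0 y] True init[of y] \<open>t \<ge> 0\<close> by (simp add: \<Psi>_def V_def abs_le_iff)
    next
      case False
      then have "R * 1 \<le> \<bar>y\<bar> * \<bar>y\<bar>" using R by (intro mult_mono) auto
      then have "\<eta> * R \<le> \<eta> * y\<^sup>2" using \<eta> by (simp add: power2_eq_square)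
      then show ?thesis using bw[of 0 y] bW[of 0 y] R3 d by (simp add: \<Psi>_def abs_le_iff)
    qed
  qed (use cw \<open>t \<ge> 0\<close> in auto)
  moreover have "\<eta> * t + \<eta> * x\<^sup>2 \<le> d"
  proof -
    have "\<eta> * Q = d" using Q by (simp add: \<eta>_def)
    then show ?thesis using \<eta> by (simp add: Q_def distrib_left)
  qed
  moreover have "W t x \<le> v t x + d" using near[of t x] \<open>t \<ge> 0\<close> R by (simp add: V_def abs_le_iff)
  ultimately have "w t x \<le> v t x + 3 * d" by (simp add: \<Psi>_def)
  moreover have "4 * d = w t x - v t x" by (simp add: d_def)
  ultimately show False using d by linarith
qed

lemma G_heat_solution_unique:
  assumes \<sigma>: "0 \<le> \<sigma>\<^sub>0" "\<sigma>\<^sub>0 \<le> 1"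
    and u: "G_heat_solution \<sigma>\<^sub>0 \<phi> u" and v: "G_heat_solution \<sigma>\<^sub>0 \<phi> v" and "t \<ge> 0"
  shows "u t x = v t x"
proof -
  obtain M1 where M1: "\<forall>t\<ge>0. \<forall>x. \<bar>u t x\<bar> \<le> M1" using u unfolding G_heat_solution_def by blast
  obtain M2 where M2: "\<forall>t\<ge>0. \<forall>x. \<bar>v t x\<bar> \<le> M2" using v unfolding G_heat_solution_def by blast
  have b: "\<bar>u t x\<bar> \<le> max M1 M2" "\<bar>v t x\<bar> \<le> max M1 M2" if "t \<ge> 0" for t x
    using M1 M2 that by (auto simp: le_max_iff_disj)
  show ?thesis
    using comparison[OF \<sigma>, of u v "max M1 M2" t x] comparison[OF \<sigma>, of v u "max M1 M2" t x] b u v \<open>t \<ge> 0\<close>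
    unfolding G_heat_solution_def by (intro antisym) simp_all
qed

lemma PG_eq:
  assumes \<sigma>: "0 \<le> \<sigma>\<^sub>0" "\<sigma>\<^sub>0 \<le> 1"
    and u: "G_heat_solution \<sigma>\<^sub>0 \<phi> u" and "t \<ge> 0"
  shows "PG \<sigma>\<^sub>0 t \<phi> x = u t x"
  unfolding PG_def
proof (rule the_equality)
  show "r = u t x" if "\<exists>u. G_heat_solution \<sigma>\<^sub>0 \<phi> u \<and> r = u t x" for r
    using that G_heat_solution_unique[OF \<sigma> _ u \<open>t \<ge> 0\<close>] by blast
qed (use u in blast)

section \<open>Existence by a monotone scheme\<close>

text \<open>\<open>True\<close> yields the scheme for \<open>G\<close>, \<open>False\<close> its
  mirror image under \<open>\<phi>\<close> to \<open>- \<phi>\<close>, which is the scheme for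
  \<open>c\<close> to \<open>- G (- c)\<close>. Both are carried along, because the lower limit of
  one is minus the upper limit of the other.\<close>

definition ext :: "bool \<Rightarrow> real \<Rightarrow> real \<Rightarrow> real" where "ext b x y = (if b then max x y else min x y)"

definition sym_avg :: "(real \<Rightarrow> real) \<Rightarrow> real \<Rightarrow> real \<Rightarrow> real" where
  "sym_avg f x k = (f (x + k) + f (x - k)) / 2"

text \<open>The step lengths have variances \<open>h\<close> and
  \<open>\<sigma>\<^sup>2 * h\<close>, so that for smooth \<open>f\<close> one step with
  \<open>b\<close> true adds \<open>h * G f''\<close> up to lower order.\<close>

definition scheme :: "bool \<Rightarrow> real \<Rightarrow> real \<Rightarrow> (real \<Rightarrow> real) \<Rightarrow> real \<Rightarrow> real" where
  "scheme b \<sigma> h f = (\<lambda>x. ext b (sym_avg f x (sqrt h)) (sym_avg f x (\<sigma> * sqrt h)))"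

text \<open>The mesh is \<open>1 / Suc n\<close> and the number of steps is rounded down, so the
  approximation is piecewise constant in time.\<close>

definition scheme_sol :: "bool \<Rightarrow> real \<Rightarrow> (real \<Rightarrow> real) \<Rightarrow> nat \<Rightarrow> real \<Rightarrow> real \<Rightarrow> real" where
  "scheme_sol b \<sigma> \<phi> n t x = (scheme b \<sigma> (1 / real (Suc n)) ^^ nat \<lfloor>t * real (Suc n)\<rfloor>) \<phi> x"

lemma ext_mono: "x \<le> x' + m \<Longrightarrow> y \<le> y' + m \<Longrightarrow> ext b x y \<le> ext b x' y' + m"
  by (auto simp: ext_def)

lemma sym_avg_mono: "f (x + k) \<le> g (x + k) + m \<Longrightarrow> f (x - k) \<le> g (x - k) + m \<Longrightarrow> sym_avg f x k \<le> sym_avg g x k + m"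
  by (simp add: sym_avg_def field_simps)

lemma sym_avg_uminus: "sym_avg (\<lambda>x. - f x) x k = - sym_avg f x k"
  by (simp add: sym_avg_def field_simps)

lemma sym_avg_scale: "sym_avg (\<lambda>x. c * f x) x k = c * sym_avg f x k"
  by (simp add: sym_avg_def field_simps)

lemma sym_avg_affine: "sym_avg (\<lambda>x. p + q * x) x k = p + q * x"
  by (simp add: sym_avg_def field_simps)

lemma sym_avg_shift: "sym_avg (\<lambda>x. f (x + z)) x k = sym_avg f (x + z) k"
proof -
  have "x - k + z = x + z - k" "x + k + z = x + z + k" by simp_all
  then show ?thesis by (simp only: sym_avg_def)
qed

lemma ext_uminus: "ext b (- x) (- y) = - ext (\<not> b) x y"
  by (auto simp: ext_def max_def min_def)

lemma ext_same [simp]: "ext b x x = x"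
  by (simp add: ext_def)

lemma ext_scale: "c \<ge> 0 \<Longrightarrow> ext b (c * x) (c * y) = c * ext b x y"
  using mult_left_mono[of x y c] mult_left_mono[of y x c] by (auto simp: ext_def max_def min_def)

lemma scheme_uminus: "scheme b \<sigma> h (\<lambda>x. - f x) = (\<lambda>x. - scheme (\<not> b) \<sigma> h f x)"
  by (simp add: scheme_def sym_avg_uminus ext_uminus)

lemma scheme_funpow_uminus: "(scheme b \<sigma> h ^^ k) (\<lambda>x. - f x) = (\<lambda>x. - (scheme (\<not> b) \<sigma> h ^^ k) f x)"
  by (induction k) (auto simp: scheme_uminus)

lemma scheme_sol_uminus: "scheme_sol b \<sigma> (\<lambda>x. - \<phi> x) n t x = - scheme_sol (\<not> b) \<sigma> \<phi> n t x"
  by (simp add: scheme_sol_def scheme_funpow_uminus)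

lemma scheme_funpow_affine: "(scheme b \<sigma> h ^^ k) (\<lambda>x. p + q * x) = (\<lambda>x. p + q * x)"
  by (induction k) (auto simp: scheme_def sym_avg_affine)

lemma scheme_funpow_const [simp]: "(scheme b \<sigma> h ^^ k) (\<lambda>x. p) = (\<lambda>x. p)"
  using scheme_funpow_affine[of k b \<sigma> h p 0] by simp

lemma scheme_shift: "scheme b \<sigma> h (\<lambda>x. f (x + z)) = (\<lambda>x. scheme b \<sigma> h f (x + z))"
  by (simp add: scheme_def sym_avg_shift)

lemma scheme_scale: "c \<ge> 0 \<Longrightarrow> scheme b \<sigma> h (\<lambda>x. c * f x) = (\<lambda>x. c * scheme b \<sigma> h f x)"
  by (simp add: scheme_def sym_avg_scale ext_scale)

lemma scheme_funpow_shift: "(scheme b \<sigma> h ^^ k) (\<lambda>x. f (x + z)) = (\<lambda>x. (scheme b \<sigma> h ^^ k) f (x + z))"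
  by (induction k) (auto simp: scheme_shift)

lemma scheme_funpow_scale:
  "c \<ge> 0 \<Longrightarrow> (scheme b \<sigma> h ^^ k) (\<lambda>x. c * f x) = (\<lambda>x. c * (scheme b \<sigma> h ^^ k) f x)"
  by (induction k) (auto simp: scheme_scale)

context
  fixes \<sigma> :: real
  assumes \<sigma>: "0 \<le> \<sigma>" "\<sigma> \<le> 1"
begin

text \<open>A step reaches no further than \<open>sqrt h\<close>, so an inequality near
  \<open>x\<close> suffices. This allows the scheme to be tested within a small box.\<close>

lemma scheme_mono_local:
  assumes "\<And>y. \<bar>y - x\<bar> \<le> sqrt h \<Longrightarrow> f y \<le> g y + m" "h \<ge> 0"
  shows "scheme b \<sigma> h f x \<le> scheme b \<sigma> h g x + m"
proof -
  have "0 \<le> \<sigma> * sqrt h" "\<sigma> * sqrt h \<le> sqrt h" 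
    using mult_right_mono[OF \<sigma>(2), of "sqrt h"] \<sigma>(1) assms(2) by simp_all
  then show ?thesis unfolding scheme_def
    using assms(1)[of "x + sqrt h"] assms(1)[of "x - sqrt h"] assms(1)[of "x + \<sigma> * sqrt h"] assms(1)[of "x - \<sigma> * sqrt h"]
    by (intro ext_mono sym_avg_mono) (use assms(2) in auto)
qed

lemma half_sum_le:
  fixes a b c d p x y z :: real
  shows "x + y \<le> 2 * z \<Longrightarrow> a \<le> c + p + x \<Longrightarrow> b \<le> d + p + y \<Longrightarrow> (a + b) / 2 \<le> (c + d) / 2 + (p + z)"
  by (simp add: field_simps)

text \<open>One step raises the mean of \<open>(y - z)\<^sup>2\<close> by its variance, which is at
  most \<open>h\<close>. With \<open>q = 0\<close> this gives the sup norm and Lipschitz bounds;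
  with \<open>q > 0\<close> it localises: a discrepancy far from \<open>z\<close> has little effect
  near \<open>z\<close> after time \<open>k * h\<close>.\<close>

lemma scheme_stable:
  assumes "\<And>y. f y \<le> g y + p + q * (y - z)\<^sup>2" "q \<ge> 0" "h \<ge> 0"
  shows "(scheme b \<sigma> h ^^ k) f y \<le> (scheme b \<sigma> h ^^ k) g y + p + q * ((y - z)\<^sup>2 + real k * h)"
proof (induction k arbitrary: y)
  case (Suc k)
  let ?f = "(scheme b \<sigma> h ^^ k) f" and ?g = "(scheme b \<sigma> h ^^ k) g"
  have 1: "sym_avg ?f y (s * sqrt h) \<le> sym_avg ?g y (s * sqrt h) + (p + q * ((y - z)\<^sup>2 + real (Suc k) * h))"
    if s: "0 \<le> s" "s \<le> 1" for s
  proof -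
    have e: "(y + s * sqrt h - z)\<^sup>2 + (y - s * sqrt h - z)\<^sup>2 = 2 * (y - z)\<^sup>2 + 2 * (s\<^sup>2 * (sqrt h)\<^sup>2)"
      by (simp add: power2_eq_square algebra_simps)
    have "s\<^sup>2 * h \<le> 1 * h" using s assms(3) by (intro mult_right_mono) (auto simp: power_le_one)
    then have "(y + s * sqrt h - z)\<^sup>2 + (y - s * sqrt h - z)\<^sup>2 + 2 * (real k * h) \<le> 2 * ((y - z)\<^sup>2 + real (Suc k) * h)"
      unfolding e using assms(3) by (simp add: algebra_simps)
    from mult_left_mono[OF this \<open>q \<ge> 0\<close>]
    have "q * ((y + s * sqrt h - z)\<^sup>2 + real k * h) + q * ((y - s * sqrt h - z)\<^sup>2 + real k * h)
        \<le> 2 * (q * ((y - z)\<^sup>2 + real (Suc k) * h))" by (simp add: algebra_simps)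
    then show ?thesis unfolding sym_avg_def
      by (rule half_sum_le[OF _ Suc[of "y + s * sqrt h"] Suc[of "y - s * sqrt h"]])
  qed
  have "scheme b \<sigma> h ?f y \<le> scheme b \<sigma> h ?g y + (p + q * ((y - z)\<^sup>2 + real (Suc k) * h))"
    using 1[of 1] 1[of \<sigma>] \<sigma> ext_mono[of "sym_avg ?f y (sqrt h)" "sym_avg ?g y (sqrt h)" _
      "sym_avg ?f y (\<sigma> * sqrt h)" "sym_avg ?g y (\<sigma> * sqrt h)" b] by (simp add: scheme_def)
  then show ?case by (simp add: add.assoc)
qed (use assms in simp)

text \<open>The scheme commutes with translations, so \<open>f\<close> is compared with its
  translate by \<open>x - y\<close>.\<close>

lemma scheme_funpow_lipschitz:
  assumes "\<And>x y. \<bar>f x - f y\<bar> \<le> L * \<bar>x - y\<bar>" "h \<ge> 0"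
  shows "\<bar>(scheme b \<sigma> h ^^ k) f x - (scheme b \<sigma> h ^^ k) f y\<bar> \<le> L * \<bar>x - y\<bar>"
proof -
  have "(scheme b \<sigma> h ^^ k) f x \<le> (scheme b \<sigma> h ^^ k) f y + L * \<bar>x - y\<bar>" for x y
  proof -
    have "(scheme b \<sigma> h ^^ k) (\<lambda>z. f (z + (x - y))) y \<le> (scheme b \<sigma> h ^^ k) f y + L * \<bar>x - y\<bar> + 0 * ((y - 0)\<^sup>2 + real k * h)"
    proof (rule scheme_stable)
      show "f (z + (x - y)) \<le> f z + L * \<bar>x - y\<bar> + 0 * (z - 0)\<^sup>2" for z
        using assms(1)[of "z + (x - y)" z] by (auto simp: abs_le_iff)
    qed (use assms in auto)
    then show ?thesis by (simp add: scheme_funpow_shift)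
  qed
  from this[of x y] this[of y x] show ?thesis by (simp add: abs_le_iff abs_minus_commute)
qed

lemma scheme_funpow_bounded:
  assumes "\<And>x. \<bar>f x\<bar> \<le> M" "h \<ge> 0"
  shows "\<bar>(scheme b \<sigma> h ^^ k) f x\<bar> \<le> M"
proof -
  have "(scheme b \<sigma> h ^^ k) f x \<le> (scheme b \<sigma> h ^^ k) (\<lambda>_. M) x + 0 + 0 * ((x - 0)\<^sup>2 + real k * h)"
    using assms by (intro scheme_stable) (auto simp: abs_le_iff)
  moreover have "(scheme b \<sigma> h ^^ k) (\<lambda>_. - M) x \<le> (scheme b \<sigma> h ^^ k) f x + 0 + 0 * ((x - 0)\<^sup>2 + real k * h)"
    using assms by (intro scheme_stable) (auto simp: abs_le_iff minus_le_iff)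
  ultimately show ?thesis by (simp add: abs_le_iff)
qed

text \<open>From \<open>\<bar>y - x\<bar> \<le> e / 2 + (y - x)\<^sup>2 / (2 * e)\<close>, where
  \<open>e = sqrt (k * h)\<close>, the standard deviation of the wider walk, balances the two terms.
  The lower bound follows by passing to \<open>- f\<close>.\<close>

lemma scheme_funpow_time:
  assumes L: "\<And>x y. \<bar>f x - f y\<bar> \<le> L * \<bar>x - y\<bar>" and "h > 0"
  shows "\<bar>(scheme b \<sigma> h ^^ k) f x - f x\<bar> \<le> L * sqrt (real k * h)"
proof (cases "k = 0")
  case False
  define e where "e = sqrt (real k * h)"
  have e: "e > 0" "e\<^sup>2 = real k * h" using False \<open>h > 0\<close> by (auto simp: e_def)
  have L0: "L \<ge> 0" using L[of 0 1] by simp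
  have up: "(scheme b \<sigma> h ^^ k) f x \<le> f x + L * e"
    if L: "\<And>x y. \<bar>f x - f y\<bar> \<le> L * \<bar>x - y\<bar>" for f b
  proof -
    have "(scheme b \<sigma> h ^^ k) f x \<le> (scheme b \<sigma> h ^^ k) (\<lambda>_. f x) x + L * e / 2 + L / (2 * e) * ((x - x)\<^sup>2 + real k * h)"
    proof (rule scheme_stable)
      fix y
      have "0 \<le> (\<bar>y - x\<bar> - e)\<^sup>2" by simp
      then have "2 * e * \<bar>y - x\<bar> \<le> e\<^sup>2 + (y - x)\<^sup>2" by (simp add: power2_diff algebra_simps)
      then have "\<bar>y - x\<bar> \<le> e / 2 + (y - x)\<^sup>2 / (2 * e)" using e(1) by (simp add: field_simps power2_eq_square)
      from mult_left_mono[OF this L0] show "f y \<le> f x + L * e / 2 + L / (2 * e) * (y - x)\<^sup>2"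
        using L[of y x] by (simp add: algebra_simps abs_le_iff)
    qed (use L0 e \<open>h > 0\<close> in auto)
    also have "\<dots> = f x + L * e" using e(1) unfolding e(2)[symmetric] by (simp add: field_simps power2_eq_square)
    finally show ?thesis .
  qed
  have "(scheme (\<not> b) \<sigma> h ^^ k) (\<lambda>x. - f x) x \<le> - f x + L * e"
    using L by (intro up) (simp add: abs_minus_commute)
  then show ?thesis using up[of f b] L by (simp add: scheme_funpow_uminus e_def abs_le_iff)
qed simp

lemma scheme_sol_bounded:
  "(\<And>x. \<bar>\<phi> x\<bar> \<le> M) \<Longrightarrow> \<bar>scheme_sol b \<sigma> \<phi> n t x\<bar> \<le> M"
  unfolding scheme_sol_def by (intro scheme_funpow_bounded) auto

lemma scheme_sol_lipschitz:
  "(\<And>x y. \<bar>\<phi> x - \<phi> y\<bar> \<le> L * \<bar>x - y\<bar>) \<Longrightarrow> \<bar>scheme_sol b \<sigma> \<phi> n t x - scheme_sol b \<sigma> \<phi> n t y\<bar> \<le> L * \<bar>x - y\<bar>"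
  unfolding scheme_sol_def by (intro scheme_funpow_lipschitz) auto

text \<open>The modulus is that of a diffusion, Lipschitz in space and of order 1/2 in time;
  rounding the times to the mesh costs the additional \<open>1 / Suc n\<close>.\<close>

lemma scheme_sol_equicontinuous:
  assumes L: "\<And>x y. \<bar>\<phi> x - \<phi> y\<bar> \<le> L * \<bar>x - y\<bar>" and "t \<ge> 0" "s \<ge> 0"
  shows "\<bar>scheme_sol b \<sigma> \<phi> n t x - scheme_sol b \<sigma> \<phi> n s y\<bar> \<le> L * \<bar>x - y\<bar> + L * sqrt (\<bar>t - s\<bar> + 1 / real (Suc n))"
proof -
  let ?h = "1 / real (Suc n)"
  have L0: "L \<ge> 0" using L[of 0 1] by simp
  have time: "\<bar>scheme_sol b \<sigma> \<phi> n t x - scheme_sol b \<sigma> \<phi> n s x\<bar> \<le> L * sqrt (\<bar>t - s\<bar> + ?h)" if "s \<le> t" "s \<ge> 0" for t s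
  proof -
    define k l where "k = nat \<lfloor>s * real (Suc n)\<rfloor>" and "l = nat \<lfloor>t * real (Suc n)\<rfloor>"
    have kl: "k \<le> l" unfolding k_def l_def using that by (intro nat_mono floor_mono mult_right_mono) auto
    have "real l \<le> t * real (Suc n)" "s * real (Suc n) \<le> real k + 1"
      using that unfolding k_def l_def by (auto intro: of_nat_floor)
    then have "real (l - k) \<le> (t - s) * real (Suc n) + 1"
      using kl by (simp add: of_nat_diff algebra_simps)
    then have "real (l - k) * ?h \<le> ((t - s) * real (Suc n) + 1) * ?h" by (intro mult_right_mono) auto
    then have d: "real (l - k) * ?h \<le> \<bar>t - s\<bar> + ?h"
      using that by (simp add: add_divide_distrib)
    have "\<bar>(scheme b \<sigma> ?h ^^ (l - k)) ((scheme b \<sigma> ?h ^^ k) \<phi>) x - (scheme b \<sigma> ?h ^^ k) \<phi> x\<bar> \<le> L * sqrt (real (l - k) * ?h)"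
      by (intro scheme_funpow_time scheme_funpow_lipschitz L) auto
    also have "\<dots> \<le> L * sqrt (\<bar>t - s\<bar> + ?h)" using d L0 by (intro mult_left_mono) auto
    finally have "\<bar>(scheme b \<sigma> ?h ^^ l) \<phi> x - (scheme b \<sigma> ?h ^^ k) \<phi> x\<bar> \<le> L * sqrt (\<bar>t - s\<bar> + ?h)"
      using kl funpow_add[of "l - k" k "scheme b \<sigma> ?h"] by (simp add: fun_eq_iff)
    then show ?thesis by (simp add: scheme_sol_def k_def l_def)
  qed
  have "\<bar>scheme_sol b \<sigma> \<phi> n t x - scheme_sol b \<sigma> \<phi> n s x\<bar> \<le> L * sqrt (\<bar>t - s\<bar> + ?h)"
    using time[of s t] time[of t s] assms(2,3) by (cases "s \<le> t") (auto simp: abs_minus_commute)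
  moreover have "\<bar>scheme_sol b \<sigma> \<phi> n s x - scheme_sol b \<sigma> \<phi> n s y\<bar> \<le> L * \<bar>x - y\<bar>"
    by (rule scheme_sol_lipschitz[OF L])
  ultimately show ?thesis by linarith
qed

lemma scheme_sol_step:
  assumes "t \<ge> 1 / real (Suc n)"
  shows "scheme_sol b \<sigma> \<phi> n t x = scheme b \<sigma> (1 / real (Suc n)) (scheme_sol b \<sigma> \<phi> n (t - 1 / real (Suc n))) x"
proof -
  have "(t - 1 / real (Suc n)) * real (Suc n) = t * real (Suc n) - 1" by (simp add: field_simps)
  moreover have "t * real (Suc n) \<ge> 1" using assms by (simp add: field_simps)
  ultimately have "nat \<lfloor>t * real (Suc n)\<rfloor> = Suc (nat \<lfloor>(t - 1 / real (Suc n)) * real (Suc n)\<rfloor>)"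
    by (simp only:) linarith
  then show ?thesis by (simp add: scheme_sol_def[abs_def])
qed

lemma scheme_sol_0 [simp]: "scheme_sol b \<sigma> \<phi> n 0 x = \<phi> x"
  by (simp add: scheme_sol_def)

end

section \<open>Upper limits of the scheme\<close>

lemma frequently_eventually_ex:
  assumes "frequently P F" "eventually Q F"
  obtains x where "P x" "Q x"
proof -
  have "\<not> eventually (\<lambda>x. \<not> P x) F" using assms(1) by (simp add: frequently_def)
  moreover have "eventually (\<lambda>x. \<not> P x) F" if "\<not> (\<exists>x. P x \<and> Q x)"
    using assms(2) by (rule eventually_mono) (use that in blast)
  ultimately show ?thesis using that by blast
qed

text \<open>The limes superior within the reals, meaningful for bounded sequences.\<close>

definition lsup :: "(nat \<Rightarrow> real) \<Rightarrow> real" where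
  "lsup f = Inf {a. \<forall>\<^sub>F n in sequentially. f n \<le> a}"

lemma lsup_bounds:
  assumes M: "\<And>n. \<bar>f n\<bar> \<le> M" and "e > 0"
  shows "\<forall>\<^sub>F n in sequentially. f n \<le> lsup f + e" and "\<exists>\<^sub>F n in sequentially. f n > lsup f - e"
proof -
  let ?A = "{a. \<forall>\<^sub>F n in sequentially. f n \<le> a}"
  have ne: "M \<in> ?A" using M by (auto simp: abs_le_iff)
  have bd: "bdd_below ?A"
  proof (rule bdd_belowI[where m = "- M"])
    fix a assume "a \<in> ?A"
    then obtain n where "f n \<le> a" using eventually_happens[of "\<lambda>n. f n \<le> a" sequentially] by auto
    then show "- M \<le> a" using M[of n] by linarith
  qed
  obtain a where a: "a \<in> ?A" "a < Inf ?A + e"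
    using cInf_lessD[of ?A "Inf ?A + e"] ne \<open>e > 0\<close> by auto
  then show "\<forall>\<^sub>F n in sequentially. f n \<le> lsup f + e"
    by (auto simp: lsup_def elim: eventually_mono)
  show "\<exists>\<^sub>F n in sequentially. f n > lsup f - e"
  proof (rule ccontr)
    assume "\<not> ?thesis"
    then have "Inf ?A - e \<in> ?A" by (auto simp: lsup_def frequently_def not_less)
    then have "Inf ?A \<le> Inf ?A - e" by (rule cInf_lower[OF _ bd])
    then show False using \<open>e > 0\<close> by simp
  qed
qed

lemma lsup_leI:
  assumes M: "\<And>n. \<bar>f n\<bar> \<le> M" and "\<And>e. e > 0 \<Longrightarrow> \<forall>\<^sub>F n in sequentially. f n \<le> a + e"
  shows "lsup f \<le> a"
proof (rule field_le_epsilon)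
  fix e :: real assume "e > 0"
  then obtain n where "f n > lsup f - e / 2" "f n \<le> a + e / 2"
    using frequently_eventually_ex[OF lsup_bounds(2)[of f, OF M, of "e / 2"] assms(2)[of "e / 2"]] by auto
  then show "lsup f \<le> a + e" by simp
qed

text \<open>Symmetry cancels the first order terms, and only an upper bound for the second
  derivative near \<open>x\<close> is involved.\<close>

lemma sym_avg_le_taylor:
  assumes "\<And>z. (f has_real_derivative f' z) (at z)" "\<And>z. (f' has_real_derivative f'' z) (at z)"
    and "k \<ge> 0" "\<And>z. \<bar>z - x\<bar> \<le> k \<Longrightarrow> f'' z \<le> C"
  shows "sym_avg f x k \<le> f x + k\<^sup>2 * C / 2"
proof -
  have "f y \<le> f x + f' x * (y - x) + C / 2 * (y - x)\<^sup>2" if y: "\<bar>y - x\<bar> = k" for y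
  proof -
    obtain z where z: "\<bar>z - x\<bar> \<le> \<bar>y - x\<bar>" "f y = f x + f' x * (y - x) + f'' z / 2 * (y - x)\<^sup>2"
      using second_order_taylor[OF assms(1,2)] by blast
    have "f'' z / 2 * (y - x)\<^sup>2 \<le> C / 2 * (y - x)\<^sup>2" using assms(4)[of z] z(1) y by (intro mult_right_mono) auto
    then show ?thesis using z(2) by simp
  qed
  from this[of "x + k"] this[of "x - k"] show ?thesis
    using assms(3) by (simp add: sym_avg_def field_simps)
qed

lemma tendsto_inverse_Suc: "((\<lambda>n. 1 / real (Suc n)) \<longlongrightarrow> 0) sequentially"
  by (rule LIMSEQ_Suc) (rule lim_1_over_n)

context
  fixes \<sigma> :: real
  assumes \<sigma>: "0 \<le> \<sigma>" "\<sigma> \<le> 1"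
begin

text \<open>At this point nothing is known about convergence, but an upper limit of bounded values
  always exists; equicontinuity of the schemes makes it a continuous function.\<close>

definition upper_limit :: "bool \<Rightarrow> (real \<Rightarrow> real) \<Rightarrow> real \<Rightarrow> real \<Rightarrow> real" where
  "upper_limit b \<phi> t x = lsup (\<lambda>n. scheme_sol b \<sigma> \<phi> n t x)"

lemma upper_limit_bounded:
  assumes "\<And>x. \<bar>\<phi> x\<bar> \<le> M" shows "\<bar>upper_limit b \<phi> t x\<bar> \<le> M"
proof -
  have B: "\<bar>scheme_sol b \<sigma> \<phi> n t x\<bar> \<le> M" for n by (rule scheme_sol_bounded[OF \<sigma> assms])
  have "upper_limit b \<phi> t x \<le> M"
    unfolding upper_limit_def
  proof (rule lsup_leI[OF B])
    show "\<forall>\<^sub>F n in sequentially. scheme_sol b \<sigma> \<phi> n t x \<le> M + e" if "e > 0" for e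
    proof (rule always_eventually, rule allI)
      fix n show "scheme_sol b \<sigma> \<phi> n t x \<le> M + e" using B[of n] that by linarith
    qed
  qed
  moreover have "- M \<le> upper_limit b \<phi> t x"
  proof (rule field_le_epsilon)
    fix e :: real assume "e > 0"
    obtain n where "scheme_sol b \<sigma> \<phi> n t x \<le> upper_limit b \<phi> t x + e"
      using eventually_happens[OF lsup_bounds(1)[of "\<lambda>n. scheme_sol b \<sigma> \<phi> n t x", OF B \<open>e > 0\<close>]]
      unfolding upper_limit_def by auto
    then show "- M \<le> upper_limit b \<phi> t x + e" using B[of n] by linarith
  qed
  ultimately show ?thesis by (simp add: abs_le_iff)
qed

context
  fixes \<phi> :: "real \<Rightarrow> real" and L M :: real
  assumes L: "\<And>x y. \<bar>\<phi> x - \<phi> y\<bar> \<le> L * \<bar>x - y\<bar>" and M: "\<And>x. \<bar>\<phi> x\<bar> \<le> M"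
begin

lemma B: "\<bar>scheme_sol b \<sigma> \<phi> n t x\<bar> \<le> M"
  by (rule scheme_sol_bounded[OF \<sigma> M])

lemma L_nonneg: "L \<ge> 0" using L[of 0 1] by simp

lemma upper_limit_0: "upper_limit b \<phi> 0 x = \<phi> x"
proof -
  have e: "\<phi> x \<le> lsup (\<lambda>n. \<phi> x) + e" "lsup (\<lambda>n. \<phi> x) \<le> \<phi> x + e" if "e > 0" for e
    using lsup_bounds[of "\<lambda>_. \<phi> x" "\<bar>\<phi> x\<bar>" e] that by simp_all
  have "lsup (\<lambda>n. \<phi> x) = \<phi> x"
    by (rule antisym; rule field_le_epsilon) (rule e(2), assumption, rule e(1), assumption)
  then show ?thesis by (simp add: upper_limit_def scheme_sol_0[OF \<sigma>])
qed

lemma upper_limit_equicontinuous: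
  assumes "t \<ge> 0" "s \<ge> 0"
  shows "\<bar>upper_limit b \<phi> t x - upper_limit b \<phi> s y\<bar> \<le> L * \<bar>x - y\<bar> + L * sqrt \<bar>t - s\<bar>"
proof -
  have "upper_limit b \<phi> t x \<le> upper_limit b \<phi> s y + (L * \<bar>x - y\<bar> + L * sqrt \<bar>t - s\<bar>)"
    if ts: "t \<ge> 0" "s \<ge> 0" for t s x y
    unfolding upper_limit_def[of _ _ t x]
  proof (rule lsup_leI[OF B])
    fix e :: real assume e: "e > 0"
    have "((\<lambda>n. L * sqrt (\<bar>t - s\<bar> + 1 / real (Suc n))) \<longlongrightarrow> L * sqrt (\<bar>t - s\<bar> + 0)) sequentially"
      by (intro tendsto_intros tendsto_inverse_Suc)
    then have "\<forall>\<^sub>F n in sequentially. L * sqrt (\<bar>t - s\<bar> + 1 / real (Suc n)) < L * sqrt \<bar>t - s\<bar> + e / 2"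
      using e by (intro order_tendstoD(2)) auto
    moreover have "\<forall>\<^sub>F n in sequentially. scheme_sol b \<sigma> \<phi> n s y \<le> upper_limit b \<phi> s y + e / 2"
      unfolding upper_limit_def using e by (intro lsup_bounds(1)[OF B]) auto
    ultimately show "\<forall>\<^sub>F n in sequentially. scheme_sol b \<sigma> \<phi> n t x
        \<le> upper_limit b \<phi> s y + (L * \<bar>x - y\<bar> + L * sqrt \<bar>t - s\<bar>) + e"
    proof eventually_elim
      case (elim n)
      then show ?case using scheme_sol_equicontinuous[OF \<sigma> L ts, of b n x y] by linarith
    qed
  qed
  from this[of t s x y] this[of s t y x] assms show ?thesis
    by (simp add: abs_le_iff abs_minus_commute)
qed

lemma continuous_on_upper_limit: "continuous_on ({0..} \<times> UNIV) (\<lambda>(t, x). upper_limit b \<phi> t x)"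
proof -
  have "((\<lambda>(t, x). upper_limit b \<phi> t x) \<longlongrightarrow> upper_limit b \<phi> s y) (at (s, y) within {0..} \<times> UNIV)"
    if s: "s \<ge> 0" for s y
  proof (rule Lim_null_comparison[THEN Lim_null[THEN iffD2]])
    show "\<forall>\<^sub>F p in at (s, y) within {0..} \<times> UNIV. norm ((case p of (t, x) \<Rightarrow> upper_limit b \<phi> t x) - upper_limit b \<phi> s y)
        \<le> L * \<bar>snd p - y\<bar> + L * sqrt \<bar>fst p - s\<bar>"
      unfolding eventually_at_filter
      using upper_limit_equicontinuous s by (auto intro!: always_eventually)
    have "((\<lambda>p. L * \<bar>snd p - y\<bar> + L * sqrt \<bar>fst p - s\<bar>) \<longlongrightarrow> L * \<bar>snd (s, y) - y\<bar> + L * sqrt \<bar>fst (s, y) - s\<bar>)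
       (at (s, y) within {0..} \<times> UNIV)"
      by (intro tendsto_intros)
    then show "((\<lambda>p. L * \<bar>snd p - y\<bar> + L * sqrt \<bar>fst p - s\<bar>) \<longlongrightarrow> 0) (at (s, y) within {0..} \<times> UNIV)"
      by simp
  qed
  then show ?thesis by (auto simp: continuous_on_def)
qed

text \<open>Both sides have a common modulus of continuity up to the mesh width, so the pointwise
  bound on a finite net spreads over the compact set.\<close>

lemma scheme_sol_le_upper_limit:
  assumes K: "compact K" "K \<subseteq> {0..} \<times> UNIV" and "e > 0"
  shows "\<forall>\<^sub>F n in sequentially. \<forall>(t, x)\<in>K. scheme_sol b \<sigma> \<phi> n t x \<le> upper_limit b \<phi> t x + e"
proof -
  \<comment> \<open>The \<open>2 * r\<close> bounds a time distance \<open>r\<close> plus a mesh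
    width below \<open>r\<close>.\<close>
  have "((\<lambda>r. L * r + L * sqrt (2 * r)) \<longlongrightarrow> L * 0 + L * sqrt (2 * 0)) (at_right 0)"
    by (intro tendsto_intros)
  then have "\<forall>\<^sub>F r in at_right 0. L * r + L * sqrt (2 * r) < e / 3"
    using \<open>e > 0\<close> by (intro order_tendstoD(2)) auto
  then obtain r0 where r0: "r0 > 0" "\<And>r. r > 0 \<Longrightarrow> r < r0 \<Longrightarrow> L * r + L * sqrt (2 * r) < e / 3"
    by (auto simp: eventually_at_right_field)
  define r where "r = r0 / 2"
  have "r > 0" "r < r0" using r0(1) by (auto simp: r_def)
  then have r: "r > 0" "L * r + L * sqrt (2 * r) < e / 3" using r0(2) by blast+
  have "K \<subseteq> (\<Union>p\<in>K. ball p r)" using r by auto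
  then obtain F where F: "F \<subseteq> K" "finite F" "K \<subseteq> (\<Union>p\<in>F. ball p r)"
    using compactE_image[OF K(1), of K "\<lambda>p. ball p r"] by auto
  have "\<forall>\<^sub>F n in sequentially. \<forall>(t, x)\<in>F. scheme_sol b \<sigma> \<phi> n t x \<le> upper_limit b \<phi> t x + e / 3"
    unfolding case_prod_unfold upper_limit_def
    using \<open>e > 0\<close> by (intro eventually_ball_finite F(2) ballI lsup_bounds(1)[OF B]) auto
  moreover have "\<forall>\<^sub>F n in sequentially. 1 / real (Suc n) < r"
    using r by (intro order_tendstoD(2)[OF tendsto_inverse_Suc])
  ultimately show ?thesis
  proof eventually_elim
    case (elim n)
    show ?case
    proof (clarify)
      fix t x assume tx: "(t, x) \<in> K"
      then obtain s y where sy: "(s, y) \<in> F" "dist (s, y) (t, x) < r" using F(3) by auto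
      have pos: "t \<ge> 0" "s \<ge> 0" using K(2) tx sy(1) F(1) by auto
      have d: "\<bar>t - s\<bar> \<le> r" "\<bar>x - y\<bar> \<le> r"
        using sy(2) dist_fst_le[of "(s, y)" "(t, x)"] dist_snd_le[of "(s, y)" "(t, x)"] by (auto simp: dist_real_def)
      have m1: "L * \<bar>x - y\<bar> + L * sqrt (\<bar>t - s\<bar> + 1 / real (Suc n)) \<le> L * r + L * sqrt (2 * r)"
        using d elim(2) L_nonneg by (intro add_mono mult_left_mono) auto
      have m2: "L * \<bar>x - y\<bar> + L * sqrt \<bar>t - s\<bar> \<le> L * r + L * sqrt (2 * r)"
        using d r L_nonneg by (intro add_mono mult_left_mono) auto
      have "scheme_sol b \<sigma> \<phi> n s y \<le> upper_limit b \<phi> s y + e / 3" using elim(1) sy(1) by auto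
      then show "scheme_sol b \<sigma> \<phi> n t x \<le> upper_limit b \<phi> t x + e"
        using scheme_sol_equicontinuous[OF \<sigma> L pos, of b n x y] upper_limit_equicontinuous[OF pos, of b x y] m1 m2 r(2)
        unfolding abs_le_iff by linarith
    qed
  qed
qed

text \<open>At an almost maximal point of \<open>scheme_sol - \<psi>\<close> in a small box, which by strictness lies
  in the interior, one step of the scheme would raise \<open>scheme_sol - \<psi>\<close> above its supremum.\<close>

lemma upper_limit_subsolution:
  assumes tf: "test_function \<psi> a c" and "t0 > 0"
    and max: "\<forall>\<^sub>F (s, y) in nhds (t0, x0). upper_limit b \<phi> s y - \<psi> s y \<le> upper_limit b \<phi> t0 x0 - \<psi> t0 x0"
  shows "a t0 x0 \<le> ext b (c t0 x0 / 2) (\<sigma>\<^sup>2 * c t0 x0 / 2)"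
proof (rule ccontr)
  assume neg: "\<not> ?thesis"
  let ?u = "upper_limit b \<phi>"
  define H where "H = (\<lambda>c. ext b (c / 2) (\<sigma>\<^sup>2 * c / 2))"
  have s1: "\<sigma>\<^sup>2 \<le> 1" using \<sigma> by (simp add: power_le_one)
  have H: "H (c + 2 * e) \<le> H c + e" if "e \<ge> 0" for c e
    unfolding H_def using mult_right_mono[OF s1 that] that by (intro ext_mono) (auto simp: algebra_simps)
  \<comment> \<open>The violation is split into four parts: one pays for making the maximum strict,
    one each for the variation of \<open>a'\<close> and of \<open>c'\<close> over the box, and the
    last one is the gain per unit of time.\<close>
  define \<theta> where "\<theta> = (a t0 x0 - H (c t0 x0)) / 4"
  have \<theta>: "\<theta> > 0" using neg by (simp add: \<theta>_def H_def)
  define \<psi>' where "\<psi>' = (\<lambda>t x. \<psi> t x + (0 + 0 * (t - t0) + \<theta> * (t - t0)\<^sup>2 + \<theta> * (x - x0)\<^sup>2))"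
  define a' where "a' = (\<lambda>t x. a t x + (0 + 2 * \<theta> * (t - t0)))"
  define c' where "c' = (\<lambda>t x. c t x + 2 * \<theta>)"
  have "test_function \<psi>' a' c'"
    unfolding \<psi>'_def a'_def c'_def by (rule test_function_add[OF tf test_function_quadratic])
  then obtain b' where b': "\<And>t x. t > 0 \<Longrightarrow> ((\<lambda>s. \<psi>' s x) has_real_derivative a' t x) (at t)"
     "\<And>t x. t > 0 \<Longrightarrow> (\<psi>' t has_real_derivative b' t x) (at x)"
     "\<And>t x. t > 0 \<Longrightarrow> (b' t has_real_derivative c' t x) (at x)"
     "continuous_on ({0<..} \<times> UNIV) (\<lambda>(t, x). a' t x)" "continuous_on ({0<..} \<times> UNIV) (\<lambda>(t, x). b' t x)"
     "continuous_on ({0<..} \<times> UNIV) (\<lambda>(t, x). c' t x)"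
    unfolding test_function_def by blast
  have gap: "a' t0 x0 - H (c' t0 x0) \<ge> 3 * \<theta>"
    using H[of \<theta> "c t0 x0"] \<theta> by (simp add: a'_def c'_def \<theta>_def field_simps)
  have op: "open ({0::real<..} \<times> (UNIV :: real set))" by (intro open_Times) auto
  have nb: "\<forall>\<^sub>F p in nhds (t0, x0). \<bar>(case p of (t, x) \<Rightarrow> f t x) - f t0 x0\<bar> < \<theta>"
    if "continuous_on ({0<..} \<times> UNIV) (\<lambda>(t, x). f t x)" for f :: "real \<Rightarrow> real \<Rightarrow> real"
  proof -
    have "isCont (\<lambda>(t, x). f t x) (t0, x0)"
      using that op \<open>t0 > 0\<close> by (simp add: continuous_on_eq_continuous_at)
    then have "((\<lambda>(t, x). f t x) \<longlongrightarrow> f t0 x0) (nhds (t0, x0))"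
      using tendsto_at_iff_tendsto_nhds[of "\<lambda>(t, x). f t x" "(t0, x0)"] by (simp add: isCont_def)
    from tendstoD[OF this \<theta>] show ?thesis by (simp add: dist_real_def)
  qed
  have "\<forall>\<^sub>F p in nhds (t0, x0). (case p of (s, y) \<Rightarrow> ?u s y - \<psi> s y \<le> ?u t0 x0 - \<psi> t0 x0) \<and>
      \<bar>(case p of (t, x) \<Rightarrow> a' t x) - a' t0 x0\<bar> < \<theta> \<and> \<bar>(case p of (t, x) \<Rightarrow> c' t x) - c' t0 x0\<bar> < \<theta> \<and> p \<in> {0<..} \<times> UNIV"
    using max nb[OF b'(4)] nb[OF b'(6)] eventually_nhds_in_open[OF op, of "(t0, x0)"] \<open>t0 > 0\<close>
    by (auto simp: eventually_conj_iff)
  then obtain r0 where r0: "r0 > 0" and r0': "\<And>p. dist p (t0, x0) < r0 \<Longrightarrow> (case p of (s, y) \<Rightarrow> ?u s y - \<psi> s y \<le> ?u t0 x0 - \<psi> t0 x0) \<and>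
      \<bar>(case p of (t, x) \<Rightarrow> a' t x) - a' t0 x0\<bar> < \<theta> \<and> \<bar>(case p of (t, x) \<Rightarrow> c' t x) - c' t0 x0\<bar> < \<theta> \<and> p \<in> {0<..} \<times> UNIV"
    unfolding eventually_nhds_metric by blast
  define r where "r = r0 / 3"
  have r: "r > 0" using r0 by (simp add: r_def)
  define D where "D = {t0 - r..t0 + r} \<times> {x0 - r..x0 + r}"
  have D: "?u s y - \<psi> s y \<le> ?u t0 x0 - \<psi> t0 x0" "a' t0 x0 - \<theta> \<le> a' s y" "c' s y \<le> c' t0 x0 + 2 * \<theta>" "s > 0"
    if "(s, y) \<in> D" for s y
  proof -
    have "dist (s, y) (t0, x0) \<le> \<bar>s - t0\<bar> + \<bar>y - x0\<bar>"
      using norm_Pair_le[of "s - t0" "y - x0"] by (simp add: dist_norm)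
    also have "\<dots> < r0" using that r by (auto simp: D_def r_def abs_le_iff abs_if)
    finally show "?u s y - \<psi> s y \<le> ?u t0 x0 - \<psi> t0 x0" "a' t0 x0 - \<theta> \<le> a' s y" "c' s y \<le> c' t0 x0 + 2 * \<theta>" "s > 0"
      using r0'[of "(s, y)"] \<theta> by (auto simp: abs_less_iff)
  qed
  have cD: "compact D" by (auto simp: D_def intro: compact_Times)
  have D0: "D \<subseteq> {0..} \<times> UNIV" using D(4) by force
  \<comment> \<open>\<open>\<rho>\<close> is the separation that the added quadratic terms enforce
    outside the inner half of the box; deviations of \<open>\<rho> / 4\<close> of the scheme from
    its limit do not destroy it.\<close>
  define \<rho> where "\<rho> = \<theta> * (r / 2)\<^sup>2"
  have \<rho>: "\<rho> > 0" using \<theta> r by (simp add: \<rho>_def)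
  have outer: "?u s y - \<psi>' s y \<le> ?u t0 x0 - \<psi>' t0 x0 - \<rho>" if "(s, y) \<in> D" "\<bar>s - t0\<bar> > r / 2 \<or> \<bar>y - x0\<bar> > r / 2" for s y
  proof -
    have "(r / 2)\<^sup>2 \<le> (s - t0)\<^sup>2 + (y - x0)\<^sup>2"
    proof -
      have "(r / 2)\<^sup>2 \<le> (s - t0)\<^sup>2 \<or> (r / 2)\<^sup>2 \<le> (y - x0)\<^sup>2"
        using that(2) r by (auto simp flip: abs_le_square_iff)
      then show ?thesis using zero_le_power2[of "s - t0"] zero_le_power2[of "y - x0"] by linarith
    qed
    from mult_left_mono[OF this less_imp_le[OF \<theta>]] show ?thesis
      using D(1)[OF that(1)] by (simp add: \<psi>'_def \<rho>_def algebra_simps)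
  qed
  have ev: "\<forall>\<^sub>F n in sequentially. (\<forall>(t, x)\<in>D. scheme_sol b \<sigma> \<phi> n t x \<le> ?u t x + \<rho> / 4) \<and> 1 / real (Suc n) < min (r / 2) ((r / 2)\<^sup>2)"
  proof (rule eventually_conj)
    show "\<forall>\<^sub>F n in sequentially. \<forall>(t, x)\<in>D. scheme_sol b \<sigma> \<phi> n t x \<le> ?u t x + \<rho> / 4"
      using \<rho> by (intro scheme_sol_le_upper_limit[OF cD D0]) simp
    show "\<forall>\<^sub>F n in sequentially. 1 / real (Suc n) < min (r / 2) ((r / 2)\<^sup>2)"
      using r by (intro order_tendstoD(2)[OF tendsto_inverse_Suc]) simp
  qed
  have fr: "\<exists>\<^sub>F n in sequentially. scheme_sol b \<sigma> \<phi> n t0 x0 > ?u t0 x0 - \<rho> / 4"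
    unfolding upper_limit_def using \<rho> by (intro lsup_bounds(2)[OF B]) auto
  \<comment> \<open>The upper bound holds eventually on the whole box, closeness at the centre only
    for infinitely many \<open>n\<close>; one common \<open>n\<close> is enough.\<close>
  obtain n where n0: "scheme_sol b \<sigma> \<phi> n t0 x0 > ?u t0 x0 - \<rho> / 4"
    and n1: "(\<forall>(t, x)\<in>D. scheme_sol b \<sigma> \<phi> n t x \<le> ?u t x + \<rho> / 4) \<and> 1 / real (Suc n) < min (r / 2) ((r / 2)\<^sup>2)"
    by (rule frequently_eventually_ex[OF fr ev])
  have n: "scheme_sol b \<sigma> \<phi> n t0 x0 > ?u t0 x0 - \<rho> / 4"
     "\<And>t x. (t, x) \<in> D \<Longrightarrow> scheme_sol b \<sigma> \<phi> n t x \<le> ?u t x + \<rho> / 4" "1 / real (Suc n) < min (r / 2) ((r / 2)\<^sup>2)"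
    using n0 conjunct1[OF n1] conjunct2[OF n1] by blast+
  define h where "h = 1 / real (Suc n)"
  have h: "h > 0" "h < r / 2" "sqrt h \<le> r / 2" "h = 1 / real (Suc n)"
  proof -
    show "h > 0" "h < r / 2" using n(3) by (auto simp: h_def)
    have "h \<le> (r / 2)\<^sup>2" using n(3) by (auto simp: h_def)
    then have "sqrt h \<le> sqrt ((r / 2)\<^sup>2)" by (rule real_sqrt_le_mono)
    then show "sqrt h \<le> r / 2" using r by simp
  qed (simp add: h_def)
  let ?U = "scheme_sol b \<sigma> \<phi> n"
  define f where "f = (\<lambda>(t, x). ?U t x - \<psi>' t x)"
  have bdd: "bdd_above (f ` D)"
  proof (rule bdd_aboveI2)
    fix p assume "p \<in> D"
    moreover obtain t x where p: "p = (t, x)" by (cases p)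
    ultimately have "?u t x - \<psi> t x \<le> ?u t0 x0 - \<psi> t0 x0" using D(1) by simp
    moreover have "\<psi> t x \<le> \<psi>' t x" using \<theta> by (simp add: \<psi>'_def)
    ultimately show "f p \<le> 3 * M - \<psi> t0 x0"
      using B[of b n t x] upper_limit_bounded[of \<phi> M, OF M, of b t x] upper_limit_bounded[of \<phi> M, OF M, of b t0 x0]
      unfolding f_def p abs_le_iff prod.case by linarith
  qed
  define m where "m = Sup (f ` D)"
  have m: "f p \<le> m" if "p \<in> D" for p unfolding m_def using that bdd by (intro cSup_upper) auto
  have p0: "(t0, x0) \<in> D" using r by (simp add: D_def)
  then have neD: "D \<noteq> {}" by blast
  \<comment> \<open>The supremum need not be attained, as the scheme jumps in time. A point within
    \<open>\<rho> / 4\<close> of it lies in the inner half of the box;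
    \<open>\<theta> * h / 2\<close> is less than the amount \<open>\<theta> * h\<close> by which one
    step of the scheme will show the value to be below \<open>m\<close>.\<close>
  have "m - min (\<rho> / 4) (\<theta> * h / 2) < Sup (f ` D)" using \<rho> \<theta> h by (simp add: m_def)
  then obtain p where p: "p \<in> D" "f p > m - min (\<rho> / 4) (\<theta> * h / 2)"
    using less_cSup_iff[of "f ` D"] bdd neD by blast
  obtain t x where tx: "p = (t, x)" by (cases p)
  have mlow: "m > ?u t0 x0 - \<psi>' t0 x0 - \<rho> / 4" using m[OF p0] n(1) by (simp add: f_def)
  have inner: "\<bar>t - t0\<bar> \<le> r / 2 \<and> \<bar>x - x0\<bar> \<le> r / 2"
  proof (rule ccontr)
    assume "\<not> ?thesis"
    then have "?u t x - \<psi>' t x \<le> ?u t0 x0 - \<psi>' t0 x0 - \<rho>" using p(1) by (intro outer) (auto simp: tx)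
    moreover have "?U t x \<le> ?u t x + \<rho> / 4" using n(2) p(1) by (simp add: tx)
    ultimately show False using p(2) mlow \<rho> by (simp add: f_def tx)
  qed
  have inD: "(s, y) \<in> D" if "t - h \<le> s" "s \<le> t" "\<bar>y - x\<bar> \<le> sqrt h" for s y
  proof -
    have "t - t0 \<le> r / 2" "t0 - t \<le> r / 2" "x - x0 \<le> r / 2" "x0 - x \<le> r / 2" "y - x \<le> sqrt h" "x - y \<le> sqrt h"
      using inner that(3) by (simp_all only: abs_le_iff) linarith+
    then show ?thesis using that(1,2) h(1-3) r unfolding D_def by auto
  qed
  have t: "t \<ge> h" "t - h > 0"
    using D(4)[OF inD[of "t - h" x]] h by auto
  define C where "C = c' t0 x0 + 2 * \<theta>"
  have "?U t x = scheme b \<sigma> h (?U (t - h)) x" unfolding h(4) by (rule scheme_sol_step[OF \<sigma>]) (use t h(4) in simp)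
  also have "\<dots> \<le> scheme b \<sigma> h (\<psi>' (t - h)) x + m"
  proof (rule scheme_mono_local[OF \<sigma>])
    fix y assume "\<bar>y - x\<bar> \<le> sqrt h"
    then have "(t - h, y) \<in> D" using h by (intro inD) auto
    from m[OF this] show "?U (t - h) y \<le> \<psi>' (t - h) y + m" by (simp add: f_def)
  qed (use h in simp)
  finally have s1: "?U t x \<le> scheme b \<sigma> h (\<psi>' (t - h)) x + m" .
  have s2: "scheme b \<sigma> h (\<psi>' (t - h)) x \<le> H C * h + \<psi>' (t - h) x"
  proof -
    have 1: "sym_avg (\<psi>' (t - h)) x k \<le> \<psi>' (t - h) x + k\<^sup>2 * C / 2" if k: "0 \<le> k" "k \<le> sqrt h" for k
    proof (rule sym_avg_le_taylor)
      show "(\<psi>' (t - h) has_real_derivative b' (t - h) z) (at z)" for z by (rule b'(2)[OF t(2)])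
      show "(b' (t - h) has_real_derivative c' (t - h) z) (at z)" for z by (rule b'(3)[OF t(2)])
      show "c' (t - h) z \<le> C" if z: "\<bar>z - x\<bar> \<le> k" for z
      proof -
        have "t - h \<le> t" using h(1) by simp
        from inD[OF order_refl this order_trans[OF z k(2)]] show ?thesis unfolding C_def by (rule D(3))
      qed
    qed (rule k(1))
    have k1: "0 \<le> sqrt h" "(sqrt h)\<^sup>2 = h" using h(1) by simp_all
    have k2: "\<sigma> * sqrt h \<le> sqrt h" "0 \<le> \<sigma> * sqrt h"
      using mult_right_mono[OF \<sigma>(2) k1(1)] mult_nonneg_nonneg[OF \<sigma>(1) k1(1)] by simp_all
    have k3: "(\<sigma> * sqrt h)\<^sup>2 = h * \<sigma>\<^sup>2" unfolding power_mult_distrib k1(2) by (rule mult.commute)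
    have A1: "sym_avg (\<psi>' (t - h)) x (sqrt h) \<le> \<psi>' (t - h) x + (sqrt h)\<^sup>2 * C / 2"
      by (rule 1[OF k1(1) order_refl])
    have A2: "sym_avg (\<psi>' (t - h)) x (\<sigma> * sqrt h) \<le> \<psi>' (t - h) x + (\<sigma> * sqrt h)\<^sup>2 * C / 2"
      by (rule 1[OF k2(2,1)])
    have e1: "\<psi>' (t - h) x + (sqrt h)\<^sup>2 * C / 2 = h * (C / 2) + \<psi>' (t - h) x"
      unfolding k1(2) times_divide_eq_right by (rule add.commute)
    have e2: "\<psi>' (t - h) x + (\<sigma> * sqrt h)\<^sup>2 * C / 2 = h * (\<sigma>\<^sup>2 * C / 2) + \<psi>' (t - h) x"
      unfolding k3 times_divide_eq_right mult.assoc by (rule add.commute)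
    note A1[unfolded e1] moreover note A2[unfolded e2]
    ultimately have "scheme b \<sigma> h (\<psi>' (t - h)) x \<le> ext b (h * (C / 2)) (h * (\<sigma>\<^sup>2 * C / 2)) + \<psi>' (t - h) x"
      unfolding scheme_def by (rule ext_mono)
    moreover have "ext b (h * (C / 2)) (h * (\<sigma>\<^sup>2 * C / 2)) = H C * h"
      using h(1) ext_scale[of h b "C / 2" "\<sigma>\<^sup>2 * C / 2"] by (simp add: H_def)
    ultimately show ?thesis by simp
  qed
  have s3: "\<psi>' (t - h) x \<le> \<psi>' t x - (a' t0 x0 - \<theta>) * h"
  proof -
    obtain s where s: "t - h < s" "s < t" "\<psi>' t x - \<psi>' (t - h) x = (t - (t - h)) * a' s x"
      using MVT2[of "t - h" t "\<lambda>s. \<psi>' s x" "\<lambda>s. a' s x"] b'(1) t h by auto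
    have "a' t0 x0 - \<theta> \<le> a' s x" using s h by (intro D(2) inD) auto
    from mult_right_mono[OF this, of h] show ?thesis using s(3) h by (simp add: mult.commute)
  qed
  have "H C * h - (a' t0 x0 - \<theta>) * h \<le> (- \<theta>) * h"
  proof -
    have "H C \<le> H (c' t0 x0) + \<theta>" unfolding C_def using \<theta> by (intro H) auto
    then show ?thesis unfolding left_diff_distrib[symmetric] using gap h(1) by (intro mult_right_mono) auto
  qed
  then have "f p \<le> m - \<theta> * h" using s1 s2 s3 unfolding f_def tx prod.case by linarith
  moreover have "0 < \<theta> * h" using \<theta> h by simp
  ultimately show False using p(2) by linarith
qed

end

end

section \<open>Solutions as limits of the scheme, and the semigroup\<close>

definition blip :: "(real \<Rightarrow> real) \<Rightarrow> bool" where
  "blip \<phi> \<longleftrightarrow> (\<exists>M. \<forall>x. \<bar>\<phi> x\<bar> \<le> M) \<and> (\<exists>L. \<forall>x y. \<bar>\<phi> x - \<phi> y\<bar> \<le> L * \<bar>x - y\<bar>)"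

lemma blipE:
  assumes "blip \<phi>"
  obtains L M where "\<And>x y. \<bar>\<phi> x - \<phi> y\<bar> \<le> L * \<bar>x - y\<bar>" "\<And>x. \<bar>\<phi> x\<bar> \<le> M"
  using assms unfolding blip_def by blast

lemma blipI:
  "(\<And>x y. \<bar>\<phi> x - \<phi> y\<bar> \<le> L * \<bar>x - y\<bar>) \<Longrightarrow> (\<And>x. \<bar>\<phi> x\<bar> \<le> M) \<Longrightarrow> blip \<phi>"
  unfolding blip_def by blast

lemma blip_const: "blip (\<lambda>_. c)"
  by (rule blipI[where L = 0 and M = "\<bar>c\<bar>"]) auto

lemma blip_scale: assumes "blip f" shows "blip (\<lambda>y. c * f y)"
proof -
  obtain L M where LM: "\<And>x y. \<bar>f x - f y\<bar> \<le> L * \<bar>x - y\<bar>" "\<And>x. \<bar>f x\<bar> \<le> M" using blipE[OF assms(1)] by metis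
  show ?thesis
  proof (rule blipI)
    show "\<bar>c * f x - c * f y\<bar> \<le> (\<bar>c\<bar> * L) * \<bar>x - y\<bar>" for x y
      using mult_left_mono[OF LM(1)[of x y], of "\<bar>c\<bar>"] by (simp add: abs_mult[symmetric] right_diff_distrib mult.assoc)
    show "\<bar>c * f x\<bar> \<le> \<bar>c\<bar> * M" for x using mult_left_mono[OF LM(2)[of x], of "\<bar>c\<bar>"] by (simp add: abs_mult)
  qed
qed

lemma blip_add: assumes "blip f" "blip g" shows "blip (\<lambda>y. f y + g y)"
proof -
  obtain L M where LM: "\<And>x y. \<bar>f x - f y\<bar> \<le> L * \<bar>x - y\<bar>" "\<And>x. \<bar>f x\<bar> \<le> M" using blipE[OF assms(1)] by metis
  obtain L' M' where LM': "\<And>x y. \<bar>g x - g y\<bar> \<le> L' * \<bar>x - y\<bar>" "\<And>x. \<bar>g x\<bar> \<le> M'" using blipE[OF assms(2)] by metis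
  show ?thesis
  proof (rule blipI)
    show "\<bar>f x + g x - (f y + g y)\<bar> \<le> (L + L') * \<bar>x - y\<bar>" for x y
      using LM(1)[of x y] LM'(1)[of x y] unfolding distrib_right by linarith
    show "\<bar>f x + g x\<bar> \<le> M + M'" for x using LM(2)[of x] LM'(2)[of x] by linarith
  qed
qed

text \<open>The inequality between lower and upper limit, with the lower limit written as minus the
  upper limit of \<open>- f\<close>.\<close>

lemma lsup_uminus_sum_nonneg:
  assumes "\<And>n. \<bar>f n\<bar> \<le> M" shows "0 \<le> lsup f + lsup (\<lambda>n. - f n)"
proof (rule field_le_epsilon)
  fix e :: real assume "e > 0"
  then have "\<forall>\<^sub>F n in sequentially. f n \<le> lsup f + e / 2" "\<forall>\<^sub>F n in sequentially. - f n \<le> lsup (\<lambda>n. - f n) + e / 2"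
    using lsup_bounds(1)[of f M "e / 2"] lsup_bounds(1)[of "\<lambda>n. - f n" M "e / 2"] assms by simp_all
  then have "\<forall>\<^sub>F n in sequentially. 0 \<le> lsup f + lsup (\<lambda>n. - f n) + e"
    by eventually_elim linarith
  then show "0 \<le> lsup f + lsup (\<lambda>n. - f n) + e" by simp
qed

context
  fixes \<sigma> :: real
  assumes \<sigma>: "0 \<le> \<sigma>" "\<sigma> \<le> 1"
begin

context
  fixes \<phi> :: "real \<Rightarrow> real" and L M :: real
  assumes L: "\<And>x y. \<bar>\<phi> x - \<phi> y\<bar> \<le> L * \<bar>x - y\<bar>" and M: "\<And>x. \<bar>\<phi> x\<bar> \<le> M"
begin

lemma Lm: "\<bar>- \<phi> x - - \<phi> y\<bar> \<le> L * \<bar>x - y\<bar>" and Mm: "\<bar>- \<phi> x\<bar> \<le> M"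
  using L[of x y] M[of x] by (simp_all add: abs_minus_commute)

text \<open>\<open>?u\<close> is the upper limit of the scheme and \<open>?v\<close>, written
  through the mirrored scheme, its lower limit. The first is a subsolution, the second a
  supersolution with the same initial value; comparison gives \<open>?u \<le> ?v\<close>, the
  converse is immediate, and so both are the solution.\<close>

lemma G_heat_solution_upper_limit:
  "G_heat_solution \<sigma> \<phi> (upper_limit \<sigma> True \<phi>)"
  and upper_limit_uminus: "t \<ge> 0 \<Longrightarrow> upper_limit \<sigma> False (\<lambda>x. - \<phi> x) t x = - upper_limit \<sigma> True \<phi> t x"
proof -
  let ?u = "upper_limit \<sigma> True \<phi>" and ?v = "\<lambda>t x. - upper_limit \<sigma> False (\<lambda>x. - \<phi> x) t x"
  have G: "ext True (c / 2) (\<sigma>\<^sup>2 * c / 2) = Gfun \<sigma> c" "ext False (c / 2) (\<sigma>\<^sup>2 * c / 2) = - Gfun \<sigma> (- c)" for c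
    by (auto simp: ext_def Gfun_eq_max[OF \<sigma>] min_def max_def)
  have bu: "\<bar>?u t x\<bar> \<le> M" and bv: "\<bar>?v t x\<bar> \<le> M" for t x
    using upper_limit_bounded[OF \<sigma>, of \<phi> M, OF M] upper_limit_bounded[OF \<sigma>, of "\<lambda>x. - \<phi> x" M, OF Mm] by simp_all
  have cu: "continuous_on ({0..} \<times> UNIV) (\<lambda>(t, x). ?u t x)"
    by (rule continuous_on_upper_limit[OF \<sigma> L M])
  have cv: "continuous_on ({0..} \<times> UNIV) (\<lambda>(t, x). ?v t x)"
    using continuous_on_minus[OF continuous_on_upper_limit[OF \<sigma> Lm Mm, of False]] by (simp add: case_prod_unfold)
  have sub: "viscosity_subsolution \<sigma> ?u"
    unfolding viscosity_subsolution_def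
  proof (intro allI impI)
    fix \<psi> a c t x assume t: "test_function \<psi> a c" "0 < (t::real)"
      "\<forall>\<^sub>F (s, y) in nhds (t, x). ?u s y - \<psi> s y \<le> ?u t x - \<psi> t x"
    have "a t x \<le> ext True (c t x / 2) (\<sigma>\<^sup>2 * c t x / 2)"
      by (rule upper_limit_subsolution[OF \<sigma> L M t])
    then show "a t x - Gfun \<sigma> (c t x) \<le> 0" by (simp add: G)
  qed
  have super: "viscosity_supersolution \<sigma> ?v"
    unfolding viscosity_supersolution_def
  proof (intro allI impI)
    fix \<psi> a c t x assume t: "test_function \<psi> a c" "0 < (t::real)"
      and ev: "\<forall>\<^sub>F (s, y) in nhds (t, x). ?v s y - \<psi> s y \<ge> ?v t x - \<psi> t x"
    have ev': "\<forall>\<^sub>F (s, y) in nhds (t, x). upper_limit \<sigma> False (\<lambda>x. - \<phi> x) s y - - \<psi> s y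
       \<le> upper_limit \<sigma> False (\<lambda>x. - \<phi> x) t x - - \<psi> t x"
      using ev by (rule eventually_mono) (auto simp: case_prod_unfold)
    have "- a t x \<le> ext False (- c t x / 2) (\<sigma>\<^sup>2 * - c t x / 2)"
      by (rule upper_limit_subsolution[OF \<sigma> Lm Mm test_function_uminus[OF t(1)] t(2) ev'])
    then show "a t x - Gfun \<sigma> (c t x) \<ge> 0" using G(2)[of "- c t x"] by simp
  qed
  have le: "?u t x \<le> ?v t x" if "t \<ge> 0" for t x
  proof (rule comparison[OF \<sigma> sub super cu cv bu bv _ that])
    show "?u 0 x \<le> ?v 0 x" for x
      using upper_limit_0[OF \<sigma> L M, of True] upper_limit_0[OF \<sigma> Lm Mm, of False] by simp
  qed
  have ge: "?v t x \<le> ?u t x" for t x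
    using lsup_uminus_sum_nonneg[of "\<lambda>n. scheme_sol True \<sigma> \<phi> n t x" M] scheme_sol_bounded[OF \<sigma>, of \<phi> M, OF M]
    by (simp add: upper_limit_def[OF \<sigma>] scheme_sol_uminus)
  have eq: "?v t x = ?u t x" if "t \<ge> 0" for t x using le[OF that] ge by (intro antisym)
  show "upper_limit \<sigma> False (\<lambda>x. - \<phi> x) t x = - upper_limit \<sigma> True \<phi> t x" if "t \<ge> 0"
    using eq[OF that, of x] by simp
  have "viscosity_supersolution \<sigma> ?u"
    unfolding viscosity_supersolution_def
  proof (intro allI impI)
    fix \<psi> a c t x assume t: "test_function \<psi> a c" "0 < (t::real)"
      and ev: "\<forall>\<^sub>F (s, y) in nhds (t, x). ?u s y - \<psi> s y \<ge> ?u t x - \<psi> t x"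
    \<comment> \<open>The two functions are known to agree at nonnegative times, so the
      neighbourhood is restricted to positive ones.\<close>
    have "open ({0::real<..} \<times> (UNIV :: real set))" by (intro open_Times) auto
    then have "\<forall>\<^sub>F q in nhds (t, x). q \<in> {0<..} \<times> UNIV"
      using t(2) by (intro eventually_nhds_in_open) auto
    with ev have "\<forall>\<^sub>F (s, y) in nhds (t, x). ?v s y - \<psi> s y \<ge> ?v t x - \<psi> t x"
    proof eventually_elim
      case (elim q)
      then show ?case using eq[of "fst q" "snd q"] eq[of t x] t(2) by (cases q) simp
    qed
    then show "a t x - Gfun \<sigma> (c t x) \<ge> 0"
      using super t unfolding viscosity_supersolution_def by blast
  qed
  then show "G_heat_solution \<sigma> \<phi> ?u"
    unfolding G_heat_solution_def using cu bu sub upper_limit_0[OF \<sigma> L M] by blast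
qed

lemma PG_eq_upper_limit: "t \<ge> 0 \<Longrightarrow> PG \<sigma> t \<phi> x = upper_limit \<sigma> True \<phi> t x"
  by (rule PG_eq[OF \<sigma> G_heat_solution_upper_limit])

text \<open>Upper bounds for the scheme and for its mirror image amount to a two-sided bound, now
  that both upper limits belong to the same function.\<close>

lemma scheme_sol_tendsto_PG_uniformly:
  assumes K: "compact K" "K \<subseteq> {0..} \<times> UNIV" and "e > 0"
  shows "\<forall>\<^sub>F n in sequentially. \<forall>(t, x)\<in>K. \<bar>scheme_sol True \<sigma> \<phi> n t x - PG \<sigma> t \<phi> x\<bar> \<le> e"
  using scheme_sol_le_upper_limit[OF \<sigma> L M K \<open>e > 0\<close>, of True] scheme_sol_le_upper_limit[OF \<sigma> Lm Mm K \<open>e > 0\<close>, of False]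
proof eventually_elim
  case (elim n)
  show ?case
  proof (intro ballI, clarify)
    fix t x assume tx: "(t, x) \<in> K"
    then have "t \<ge> 0" using K(2) by auto
    then show "\<bar>scheme_sol True \<sigma> \<phi> n t x - PG \<sigma> t \<phi> x\<bar> \<le> e"
      using bspec[OF elim(1) tx] bspec[OF elim(2) tx]
      by (simp add: PG_eq_upper_limit upper_limit_uminus scheme_sol_uminus abs_le_iff)
  qed
qed

lemma PG_lipschitz: "t \<ge> 0 \<Longrightarrow> \<bar>PG \<sigma> t \<phi> x - PG \<sigma> t \<phi> y\<bar> \<le> L * \<bar>x - y\<bar>"
  using upper_limit_equicontinuous[OF \<sigma> L M, of t t True x y] by (simp add: PG_eq_upper_limit)

lemma PG_bounded: "t \<ge> 0 \<Longrightarrow> \<bar>PG \<sigma> t \<phi> x\<bar> \<le> M"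
  using upper_limit_bounded[OF \<sigma>, of \<phi> M True t x, OF M] by (simp add: PG_eq_upper_limit)

lemma PG_0: "PG \<sigma> 0 \<phi> x = \<phi> x"
  using upper_limit_0[OF \<sigma> L M, of True] by (simp add: PG_eq_upper_limit)

end

lemma scheme_sol_tendsto_PG:
  assumes "blip \<phi>" "t \<ge> 0"
  shows "(\<lambda>n. scheme_sol True \<sigma> \<phi> n t x) \<longlonglongrightarrow> PG \<sigma> t \<phi> x"
proof (rule tendstoI)
  fix e :: real assume "e > 0"
  obtain L M where LM: "\<And>x y. \<bar>\<phi> x - \<phi> y\<bar> \<le> L * \<bar>x - y\<bar>" "\<And>x. \<bar>\<phi> x\<bar> \<le> M" using blipE[OF assms(1)] by metis
  have "\<forall>\<^sub>F n in sequentially. \<forall>(t, x)\<in>{(t, x)}. \<bar>scheme_sol True \<sigma> \<phi> n t x - PG \<sigma> t \<phi> x\<bar> \<le> e / 2"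
    using assms(2) \<open>e > 0\<close> by (intro scheme_sol_tendsto_PG_uniformly[OF LM]) auto
  then show "\<forall>\<^sub>F n in sequentially. dist (scheme_sol True \<sigma> \<phi> n t x) (PG \<sigma> t \<phi> x) < e"
    using \<open>e > 0\<close> by (auto elim!: eventually_mono simp: dist_real_def)
qed

lemma blip_PG: "blip \<phi> \<Longrightarrow> t \<ge> 0 \<Longrightarrow> blip (PG \<sigma> t \<phi>)"
proof -
  assume "blip \<phi>" "t \<ge> 0"
  obtain L M where LM: "\<And>x y. \<bar>\<phi> x - \<phi> y\<bar> \<le> L * \<bar>x - y\<bar>" "\<And>x. \<bar>\<phi> x\<bar> \<le> M" using blipE[OF \<open>blip \<phi>\<close>] by metis
  show ?thesis by (rule blipI[OF PG_lipschitz[OF LM \<open>t \<ge> 0\<close>] PG_bounded[OF LM \<open>t \<ge> 0\<close>]])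
qed

lemma steps_le: "t \<ge> 0 \<Longrightarrow> real (nat \<lfloor>t * real (Suc n)\<rfloor>) * (1 / real (Suc n)) \<le> t"
proof -
  assume "t \<ge> 0"
  then have "real (nat \<lfloor>t * real (Suc n)\<rfloor>) \<le> t * real (Suc n)" by (intro of_nat_floor) simp
  then show ?thesis by (simp add: pos_divide_le_eq)
qed

lemma scheme_sol_stable:
  assumes "\<And>y. f y \<le> g y + p + q * (y - z)\<^sup>2" "q \<ge> 0" "t \<ge> 0"
  shows "scheme_sol True \<sigma> f n t y \<le> scheme_sol True \<sigma> g n t y + p + q * ((y - z)\<^sup>2 + t)"
proof -
  let ?k = "nat \<lfloor>t * real (Suc n)\<rfloor>" and ?h = "1 / real (Suc n)"
  have "scheme_sol True \<sigma> f n t y \<le> scheme_sol True \<sigma> g n t y + p + q * ((y - z)\<^sup>2 + real ?k * ?h)"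
    unfolding scheme_sol_def by (rule scheme_stable[OF \<sigma> assms(1,2)]) simp
  moreover have "q * ((y - z)\<^sup>2 + real ?k * ?h) \<le> q * ((y - z)\<^sup>2 + t)"
    using steps_le[OF assms(3), of n] assms(2) by (intro mult_left_mono) auto
  ultimately show ?thesis by linarith
qed

lemma PG_stable:
  assumes "blip f" "blip g" "\<And>y. f y \<le> g y + p + q * (y - z)\<^sup>2" "q \<ge> 0" "t \<ge> 0"
  shows "PG \<sigma> t f y \<le> PG \<sigma> t g y + p + q * ((y - z)\<^sup>2 + t)"
proof (rule LIMSEQ_le)
  show "(\<lambda>n. scheme_sol True \<sigma> f n t y) \<longlonglongrightarrow> PG \<sigma> t f y" by (rule scheme_sol_tendsto_PG[OF assms(1,5)])
  show "(\<lambda>n. scheme_sol True \<sigma> g n t y + p + q * ((y - z)\<^sup>2 + t)) \<longlonglongrightarrow> PG \<sigma> t g y + p + q * ((y - z)\<^sup>2 + t)"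
    by (intro tendsto_intros scheme_sol_tendsto_PG[OF assms(2,5)])
qed (use scheme_sol_stable[OF assms(3-5)] in blast)

lemma PG_mono_add:
  assumes "blip f" "blip g" "\<And>y. f y \<le> g y + p" "t \<ge> 0"
  shows "PG \<sigma> t f y \<le> PG \<sigma> t g y + p"
  using PG_stable[OF assms(1,2), of p 0 0 t y] assms(3,4) by simp

lemma PG_mono:
  "blip f \<Longrightarrow> blip g \<Longrightarrow> (\<And>y. f y \<le> g y) \<Longrightarrow> t \<ge> 0 \<Longrightarrow> PG \<sigma> t f y \<le> PG \<sigma> t g y"
  using PG_mono_add[of f g 0 t y] by simp

lemma PG_const: "t \<ge> 0 \<Longrightarrow> PG \<sigma> t (\<lambda>_. c) x = c"
  by (rule LIMSEQ_unique[OF scheme_sol_tendsto_PG[OF blip_const]]) (auto simp: scheme_sol_def)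

lemma PG_shift:
  assumes "blip f" "t \<ge> 0" shows "PG \<sigma> t (\<lambda>y. f (y + z)) x = PG \<sigma> t f (x + z)"
proof (rule LIMSEQ_unique)
  obtain L M where "\<And>x y. \<bar>f x - f y\<bar> \<le> L * \<bar>x - y\<bar>" "\<And>x. \<bar>f x\<bar> \<le> M" using blipE[OF assms(1)] by metis
  then have "blip (\<lambda>y. f (y + z))" by (intro blipI[where L = L and M = M]) (metis add_diff_cancel_right, blast)
  then show "(\<lambda>n. scheme_sol True \<sigma> (\<lambda>y. f (y + z)) n t x) \<longlonglongrightarrow> PG \<sigma> t (\<lambda>y. f (y + z)) x"
    using assms(2) by (rule scheme_sol_tendsto_PG)
  show "(\<lambda>n. scheme_sol True \<sigma> (\<lambda>y. f (y + z)) n t x) \<longlonglongrightarrow> PG \<sigma> t f (x + z)"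
    using scheme_sol_tendsto_PG[OF assms, of "x + z"] by (simp add: scheme_sol_def scheme_funpow_shift)
qed

lemma PG_scale:
  assumes "blip f" "t \<ge> 0" "c \<ge> 0" shows "PG \<sigma> t (\<lambda>y. c * f y) x = c * PG \<sigma> t f x"
proof (rule LIMSEQ_unique)
  show "(\<lambda>n. scheme_sol True \<sigma> (\<lambda>y. c * f y) n t x) \<longlonglongrightarrow> PG \<sigma> t (\<lambda>y. c * f y) x"
    by (intro scheme_sol_tendsto_PG blip_scale assms)
  show "(\<lambda>n. scheme_sol True \<sigma> (\<lambda>y. c * f y) n t x) \<longlonglongrightarrow> c * PG \<sigma> t f x"
    using tendsto_mult[OF tendsto_const scheme_sol_tendsto_PG[OF assms(1,2), of x], of c]
    by (simp add: scheme_sol_def scheme_funpow_scale[OF assms(3)])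
qed

text \<open>A maximum of linear maps is subadditive, and monotonicity passes this on to the
  iterates. This concerns the scheme \<open>True\<close> alone.\<close>

lemma scheme_funpow_subadd:
  "(scheme True \<sigma> h ^^ k) (\<lambda>y. f y + g y) x \<le> (scheme True \<sigma> h ^^ k) f x + (scheme True \<sigma> h ^^ k) g x" if "h \<ge> 0"
proof (induction k arbitrary: x)
  case (Suc k)
  let ?F = "(scheme True \<sigma> h ^^ k) f" and ?G = "(scheme True \<sigma> h ^^ k) g"
  have "scheme True \<sigma> h ((scheme True \<sigma> h ^^ k) (\<lambda>y. f y + g y)) x \<le> scheme True \<sigma> h (\<lambda>y. ?F y + ?G y) x + 0"
    using Suc that by (intro scheme_mono_local[OF \<sigma>]) auto
  also have "\<dots> \<le> scheme True \<sigma> h ?F x + scheme True \<sigma> h ?G x"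
  proof -
    have "sym_avg (\<lambda>y. ?F y + ?G y) x m = sym_avg ?F x m + sym_avg ?G x m" for m
      by (simp add: sym_avg_def add_divide_distrib)
    then show ?thesis by (auto simp: scheme_def ext_def intro: add_mono)
  qed
  finally show ?case by simp
qed simp

lemma PG_subadd:
  assumes "blip f" "blip g" "t \<ge> 0" shows "PG \<sigma> t (\<lambda>y. f y + g y) x \<le> PG \<sigma> t f x + PG \<sigma> t g x"
proof (rule LIMSEQ_le)
  show "(\<lambda>n. scheme_sol True \<sigma> (\<lambda>y. f y + g y) n t x) \<longlonglongrightarrow> PG \<sigma> t (\<lambda>y. f y + g y) x"
    by (intro scheme_sol_tendsto_PG blip_add assms)
  show "(\<lambda>n. scheme_sol True \<sigma> f n t x + scheme_sol True \<sigma> g n t x) \<longlonglongrightarrow> PG \<sigma> t f x + PG \<sigma> t g x"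
    by (intro tendsto_add scheme_sol_tendsto_PG assms)
  show "\<exists>N. \<forall>n\<ge>N. scheme_sol True \<sigma> (\<lambda>y. f y + g y) n t x \<le> scheme_sol True \<sigma> f n t x + scheme_sol True \<sigma> g n t x"
    unfolding scheme_sol_def by (intro exI allI impI scheme_funpow_subadd) simp
qed

text \<open>The scheme fixes affine functions, because its steps are symmetric, so a linear part
  contributes nothing at 0. Applied to both signs of a truncation this bounds its mean.\<close>

lemma PG_affine_quadratic_bound:
  assumes "blip f" "\<And>y. f y \<le> p + r * y + q * y\<^sup>2" "q \<ge> 0" "t \<ge> 0"
  shows "PG \<sigma> t f 0 \<le> p + q * t"
proof (rule LIMSEQ_le_const2[OF scheme_sol_tendsto_PG[OF assms(1,4)]])
  have "scheme_sol True \<sigma> f n t 0 \<le> scheme_sol True \<sigma> (\<lambda>y. p + r * y) n t 0 + 0 + q * ((0 - 0)\<^sup>2 + t)" for n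
    using assms by (intro scheme_sol_stable) auto
  then show "\<exists>N. \<forall>n\<ge>N. scheme_sol True \<sigma> f n t 0 \<le> p + q * t"
    by (auto simp: scheme_sol_def scheme_funpow_affine)
qed

text \<open>\<open>y ^ 4 + 6 * t * y\<^sup>2 + 3 * t\<^sup>2\<close> is the fourth moment of a
  normal variable with mean \<open>y\<close> and variance \<open>t\<close>; the scheme, whose steps
  have variance at most \<open>h\<close>, stays below it.\<close>

lemma scheme_funpow_quartic:
  assumes "\<And>y. f y \<le> q * y ^ 4" "q \<ge> 0" "h \<ge> 0"
  shows "(scheme True \<sigma> h ^^ k) f y \<le> q * (y ^ 4 + 6 * (real k * h) * y\<^sup>2 + 3 * (real k * h)\<^sup>2)"
proof (induction k arbitrary: y)
  case (Suc k)
  let ?P = "\<lambda>k y. q * (y ^ 4 + 6 * (real k * h) * y\<^sup>2 + 3 * (real k * h)\<^sup>2)"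
  have s: "sym_avg (?P k) y (s * sqrt h) \<le> ?P (Suc k) y" if s: "0 \<le> s" "s \<le> 1" for s
  proof -
    have half: "u / 2 = v" if "u = 2 * v" for u v :: real using that by simp
    define a where "a = s\<^sup>2 * h"
    have a: "0 \<le> a" "a \<le> h" using s assms(3) mult_right_mono[of "s\<^sup>2" 1 h] by (auto simp: a_def power_le_one)
    have "(y + s * sqrt h)\<^sup>2 + (y - s * sqrt h)\<^sup>2 = 2 * (y\<^sup>2 + a)"
      using assms(3) by (simp add: a_def power2_eq_square algebra_simps)
    then have e2: "((y + s * sqrt h)\<^sup>2 + (y - s * sqrt h)\<^sup>2) / 2 = y\<^sup>2 + a" by (rule half)
    have "(y + s * sqrt h) ^ 4 + (y - s * sqrt h) ^ 4 = 2 * (y ^ 4 + 6 * a * y\<^sup>2 + a\<^sup>2)"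
    proof -
      have "a = (s * sqrt h)\<^sup>2" using assms(3) by (simp add: a_def power_mult_distrib)
      then show ?thesis by (simp add: power2_eq_square power4_eq_xxxx algebra_simps)
    qed
    then have e4: "((y + s * sqrt h) ^ 4 + (y - s * sqrt h) ^ 4) / 2 = y ^ 4 + 6 * a * y\<^sup>2 + a\<^sup>2" by (rule half)
    have "sym_avg (?P k) y (s * sqrt h)
      = q * (((y + s * sqrt h) ^ 4 + (y - s * sqrt h) ^ 4) / 2 + 6 * (real k * h) * (((y + s * sqrt h)\<^sup>2 + (y - s * sqrt h)\<^sup>2) / 2) + 3 * (real k * h)\<^sup>2)"
      by (simp add: sym_avg_def field_simps)
    also have "\<dots> = q * (y ^ 4 + 6 * a * y\<^sup>2 + a\<^sup>2 + 6 * (real k * h) * (y\<^sup>2 + a) + 3 * (real k * h)\<^sup>2)"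
      unfolding e2 e4 ..
    also have "\<dots> \<le> ?P (Suc k) y"
    proof (rule mult_left_mono[OF _ assms(2)])
      have "a * y\<^sup>2 \<le> h * y\<^sup>2" using a by (intro mult_right_mono) auto
      moreover have "a\<^sup>2 \<le> 3 * h\<^sup>2" using power_mono[OF a(2,1), of 2] zero_le_power2[of h] by linarith
      moreover have "real k * h * a \<le> real k * h * h" using a assms(3) by (intro mult_left_mono) auto
      moreover have "(real (Suc k) * h)\<^sup>2 = (real k * h)\<^sup>2 + 2 * (real k * h * h) + h\<^sup>2" by (simp add: power2_eq_square algebra_simps)
      moreover have "6 * (real (Suc k) * h) * y\<^sup>2 = 6 * (real k * h) * y\<^sup>2 + 6 * (h * y\<^sup>2)" by (simp add: algebra_simps)
      ultimately show "y ^ 4 + 6 * a * y\<^sup>2 + a\<^sup>2 + 6 * (real k * h) * (y\<^sup>2 + a) + 3 * (real k * h)\<^sup>2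
         \<le> y ^ 4 + 6 * (real (Suc k) * h) * y\<^sup>2 + 3 * (real (Suc k) * h)\<^sup>2"
        by (simp add: distrib_left mult.assoc)
    qed
    finally show ?thesis .
  qed
  have "scheme True \<sigma> h ((scheme True \<sigma> h ^^ k) f) y \<le> scheme True \<sigma> h (?P k) y + 0"
    using Suc assms(3) by (intro scheme_mono_local[OF \<sigma>]) auto
  also have "\<dots> \<le> ?P (Suc k) y" using s[of 1] s[of \<sigma>] \<sigma> by (simp add: scheme_def ext_def)
  finally show ?case by simp
qed (use assms in simp)

lemma PG_quartic_bound:
  assumes "blip f" "\<And>y. f y \<le> q * y ^ 4" "q \<ge> 0" "t \<ge> 0"
  shows "PG \<sigma> t f 0 \<le> 3 * q * t\<^sup>2"
proof (rule LIMSEQ_le_const2[OF scheme_sol_tendsto_PG[OF assms(1,4)]])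
  have "scheme_sol True \<sigma> f n t 0 \<le> 3 * q * t\<^sup>2" for n
  proof -
    let ?k = "nat \<lfloor>t * real (Suc n)\<rfloor>" and ?h = "1 / real (Suc n)"
    have "scheme_sol True \<sigma> f n t 0 \<le> q * (3 * (real ?k * ?h)\<^sup>2)"
      unfolding scheme_sol_def using scheme_funpow_quartic[OF assms(2,3), of ?h ?k 0] by simp
    also have "\<dots> \<le> q * (3 * t\<^sup>2)"
      using steps_le[OF assms(4), of n] assms(3) by (intro mult_left_mono power_mono) auto
    finally show ?thesis by simp
  qed
  then show "\<exists>N. \<forall>n\<ge>N. scheme_sol True \<sigma> f n t 0 \<le> 3 * q * t\<^sup>2" by blast
qed

text \<open>The scheme has the semigroup property up to at most one step of rounding. Passing to the
  limit in the inner function uses its locally uniform convergence; outside a ball the bound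
  \<open>2 * M\<close> is absorbed into a quadratic term, which \<open>scheme_sol_stable\<close>
  controls.\<close>

lemma PG_semigroup:
  assumes "blip \<phi>" "t \<ge> 0" "s \<ge> 0"
  shows "PG \<sigma> (t + s) \<phi> x = PG \<sigma> s (PG \<sigma> t \<phi>) x"
proof -
  obtain L M where LM: "\<And>x y. \<bar>\<phi> x - \<phi> y\<bar> \<le> L * \<bar>x - y\<bar>" "\<And>x. \<bar>\<phi> x\<bar> \<le> M" using blipE[OF assms(1)] by metis
  let ?S = "scheme_sol True \<sigma>" and ?P = "PG \<sigma> t \<phi>"
  have M0: "M \<ge> 0" using LM(2)[of 0] by simp
  have L0: "L \<ge> 0" using LM(1)[of 0 1] by simp
  have b1: "blip ?P" by (rule blip_PG[OF assms(1,2)])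
  have time: "\<bar>?S \<phi> n (t + s) x - ?S (?S \<phi> n t) n s x\<bar> \<le> L * sqrt (1 / real (Suc n))" for n
  proof -
    let ?h = "1 / real (Suc n)" and ?i = "nat \<lfloor>t * real (Suc n)\<rfloor>" and ?j = "nat \<lfloor>s * real (Suc n)\<rfloor>" and ?k = "nat \<lfloor>(t + s) * real (Suc n)\<rfloor>"
    have n: "0 \<le> t * real (Suc n)" "0 \<le> s * real (Suc n)" using assms by auto
    have "(t + s) * real (Suc n) = t * real (Suc n) + s * real (Suc n)" by (rule distrib_right)
    \<comment> \<open>The integer part is additive up to one.\<close>
    then have "?k = ?j + ?i \<or> ?k = Suc (?j + ?i)" using n by linarith
    moreover have S: "?S (?S \<phi> n t) n s x = (scheme True \<sigma> ?h ^^ (?j + ?i)) \<phi> x"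
      by (simp add: scheme_sol_def[abs_def] funpow_add)
    moreover have "\<bar>(scheme True \<sigma> ?h ^^ Suc (?j + ?i)) \<phi> x - (scheme True \<sigma> ?h ^^ (?j + ?i)) \<phi> x\<bar> \<le> L * sqrt (1 / real (Suc n))"
    proof -
      have "\<bar>(scheme True \<sigma> ?h ^^ 1) ((scheme True \<sigma> ?h ^^ (?j + ?i)) \<phi>) x - (scheme True \<sigma> ?h ^^ (?j + ?i)) \<phi> x\<bar> \<le> L * sqrt (real 1 * ?h)"
        by (rule scheme_funpow_time[OF \<sigma> scheme_funpow_lipschitz[OF \<sigma> LM(1)]]) simp_all
      then show ?thesis by simp
    qed
    ultimately show ?thesis using L0 unfolding scheme_sol_def[of _ _ \<phi> n "t + s"] by (elim disjE) simp_all
  qed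
  have le: "\<bar>PG \<sigma> (t + s) \<phi> x - PG \<sigma> s ?P x\<bar> \<le> e + 2 * M / R\<^sup>2 * s" if "e > 0" "R > 0" for e R
  proof -
    have "\<forall>\<^sub>F n in sequentially. \<forall>(t, x)\<in>{t} \<times> {x - R..x + R}. \<bar>?S \<phi> n t x - PG \<sigma> t \<phi> x\<bar> \<le> e"
      using assms \<open>e > 0\<close> by (intro scheme_sol_tendsto_PG_uniformly[OF LM] compact_Times) auto
    then have "\<forall>\<^sub>F n in sequentially. \<bar>?S \<phi> n (t + s) x - ?S ?P n s x\<bar> \<le> e + 2 * M / R\<^sup>2 * s + L * sqrt (1 / real (Suc n))"
    proof eventually_elim
      case (elim n)
      have near: "\<bar>?S \<phi> n t y - ?P y\<bar> \<le> e + 2 * M / R\<^sup>2 * (y - x)\<^sup>2" for y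
      proof (cases "\<bar>y - x\<bar> \<le> R")
        case True
        then have "\<bar>?S \<phi> n t y - ?P y\<bar> \<le> e" using elim by (auto simp: abs_le_iff)
        moreover have "0 \<le> 2 * M / R\<^sup>2 * (y - x)\<^sup>2" using M0 by simp
        ultimately show ?thesis by linarith
      next
        case False
        then have "R\<^sup>2 \<le> (y - x)\<^sup>2" using \<open>R > 0\<close> by (simp flip: abs_le_square_iff)
        then have "2 * M * 1 \<le> 2 * M * ((y - x)\<^sup>2 / R\<^sup>2)" using \<open>R > 0\<close> M0 by (intro mult_left_mono) auto
        then show ?thesis
          using scheme_sol_bounded[OF \<sigma>, of \<phi> M True n t y, OF LM(2)] PG_bounded[OF LM assms(2), of y] \<open>e > 0\<close>
          by (simp add: abs_le_iff)
      qed
      have "?S (?S \<phi> n t) n s x \<le> ?S ?P n s x + e + 2 * M / R\<^sup>2 * ((x - x)\<^sup>2 + s)"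
        using near M0 assms by (intro scheme_sol_stable) (auto simp: abs_le_iff algebra_simps)
      moreover have "?S ?P n s x \<le> ?S (?S \<phi> n t) n s x + e + 2 * M / R\<^sup>2 * ((x - x)\<^sup>2 + s)"
        using near M0 assms by (intro scheme_sol_stable) (auto simp: abs_le_iff algebra_simps)
      ultimately show ?case using time[of n] by (simp add: abs_le_iff)
    qed
    moreover have "(\<lambda>n. \<bar>?S \<phi> n (t + s) x - ?S ?P n s x\<bar>) \<longlonglongrightarrow> \<bar>PG \<sigma> (t + s) \<phi> x - PG \<sigma> s ?P x\<bar>"
      using assms b1 by (intro tendsto_intros scheme_sol_tendsto_PG) auto
    moreover have "(\<lambda>n. e + 2 * M / R\<^sup>2 * s + L * sqrt (1 / real (Suc n))) \<longlonglongrightarrow> e + 2 * M / R\<^sup>2 * s + L * sqrt 0"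
      by (intro tendsto_intros tendsto_inverse_Suc)
    ultimately show ?thesis using tendsto_le[of sequentially] by force
  qed
  have "\<bar>PG \<sigma> (t + s) \<phi> x - PG \<sigma> s ?P x\<bar> \<le> 0"
  proof (rule field_le_epsilon)
    fix e :: real assume "e > 0"
    \<comment> \<open>\<open>R\<close> is large enough that the quadratic tail
      \<open>2 * M * s / R\<^sup>2\<close> is at most \<open>e / 2\<close>; the added ones keep it
      positive.\<close>
    define R where "R = sqrt (4 * (M + 1) * (s + 1) / e)"
    have R: "R > 0" "R\<^sup>2 = 4 * (M + 1) * (s + 1) / e" using \<open>e > 0\<close> M0 assms(3) by (auto simp: R_def)
    have "e / 2 * R\<^sup>2 = 2 * ((M + 1) * (s + 1))" unfolding R(2) using \<open>e > 0\<close> by simp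
    moreover have "2 * (M * s) \<le> 2 * ((M + 1) * (s + 1))" using M0 assms(3) by (simp add: algebra_simps)
    ultimately have "2 * (M * s) \<le> e / 2 * R\<^sup>2" by simp
    then have "2 * M / R\<^sup>2 * s \<le> e / 2" using R(1) by (simp add: divide_le_eq mult.assoc)
    then show "\<bar>PG \<sigma> (t + s) \<phi> x - PG \<sigma> s ?P x\<bar> \<le> 0 + e"
      using le[of "e / 2" R] R(1) \<open>e > 0\<close> by linarith
  qed
  then show ?thesis by simp
qed

end

section \<open>Cylinder functionals and the expectation\<close>

text \<open>\<open>F\<close> acts on all functions of time, not only on continuous paths, so that
  the recursion may change a single value of its argument. The Lipschitz bound also expresses that
  \<open>F\<close> depends on the values on \<open>A\<close> only.\<close>

definition cyl :: "real set \<Rightarrow> ((real \<Rightarrow> real) \<Rightarrow> real) \<Rightarrow> bool" where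
  "cyl A F \<longleftrightarrow> finite A \<and> (\<exists>M. \<forall>w. \<bar>F w\<bar> \<le> M) \<and>
     (\<exists>C\<ge>0. \<forall>w w'. \<bar>F w - F w'\<bar> \<le> C * (\<Sum>a\<in>A. \<bar>w a - w' a\<bar>))"

lemma cylI:
  "finite A \<Longrightarrow> (\<And>w. \<bar>F w\<bar> \<le> M) \<Longrightarrow> C \<ge> 0 \<Longrightarrow> (\<And>w w'. \<bar>F w - F w'\<bar> \<le> C * (\<Sum>a\<in>A. \<bar>w a - w' a\<bar>)) \<Longrightarrow> cyl A F"
  unfolding cyl_def by blast

lemma cylE:
  assumes "cyl A F"
  obtains M C where "finite A" "\<And>w. \<bar>F w\<bar> \<le> M" "C \<ge> 0" "\<And>w w'. \<bar>F w - F w'\<bar> \<le> C * (\<Sum>a\<in>A. \<bar>w a - w' a\<bar>)"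
  using assms unfolding cyl_def by blast

lemma cyl_finite: "cyl A F \<Longrightarrow> finite A" by (simp add: cyl_def)

lemma cyl_cong:
  assumes "cyl A F" "\<And>a. a \<in> A \<Longrightarrow> w a = w' a" shows "F w = F w'"
proof -
  obtain M C where "\<bar>F w - F w'\<bar> \<le> C * (\<Sum>a\<in>A. \<bar>w a - w' a\<bar>)" using cylE[OF assms(1)] by metis
  also have "\<dots> = 0" using assms(2) by simp
  finally show ?thesis by simp
qed

lemma cyl_mono:
  assumes "cyl A F" "A \<subseteq> D" "finite D" shows "cyl D F"
proof -
  obtain M C where F: "\<And>w. \<bar>F w\<bar> \<le> M" "C \<ge> 0" "\<And>w w'. \<bar>F w - F w'\<bar> \<le> C * (\<Sum>a\<in>A. \<bar>w a - w' a\<bar>)"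
    using cylE[OF assms(1)] by metis
  show ?thesis
  proof (rule cylI[OF assms(3) F(1,2)])
    fix w w' :: "real \<Rightarrow> real"
    have "(\<Sum>a\<in>A. \<bar>w a - w' a\<bar>) \<le> (\<Sum>a\<in>D. \<bar>w a - w' a\<bar>)" using assms by (intro sum_mono2) auto
    from mult_left_mono[OF this F(2)] show "\<bar>F w - F w'\<bar> \<le> C * (\<Sum>a\<in>D. \<bar>w a - w' a\<bar>)" using F(3)[of w w'] by linarith
  qed
qed

text \<open>\<open>F\<close> and \<open>G\<close> have bounded range, so it is enough that
  \<open>k\<close> is Lipschitz on bounded sets; this covers multiplication together with the
  lattice operations.\<close>

lemma cyl_comp2:
  assumes F: "cyl A F" "cyl A G"
    and k: "\<And>M. \<exists>K\<ge>0. \<forall>x x' y y'. \<bar>x\<bar> \<le> M \<longrightarrow> \<bar>x'\<bar> \<le> M \<longrightarrow> \<bar>y\<bar> \<le> M \<longrightarrow> \<bar>y'\<bar> \<le> M \<longrightarrow>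
        \<bar>k x y - k x' y'\<bar> \<le> K * (\<bar>x - x'\<bar> + \<bar>y - y'\<bar>)"
  shows "cyl A (\<lambda>w. k (F w) (G w))"
proof -
  obtain M1 C1 where F1: "\<And>w. \<bar>F w\<bar> \<le> M1" "C1 \<ge> 0" "\<And>w w'. \<bar>F w - F w'\<bar> \<le> C1 * (\<Sum>a\<in>A. \<bar>w a - w' a\<bar>)"
    using cylE[OF F(1)] by metis
  obtain M2 C2 where F2: "\<And>w. \<bar>G w\<bar> \<le> M2" "C2 \<ge> 0" "\<And>w w'. \<bar>G w - G w'\<bar> \<le> C2 * (\<Sum>a\<in>A. \<bar>w a - w' a\<bar>)"
    using cylE[OF F(2)] by metis
  define M where "M = max M1 M2"
  have M: "\<bar>F w\<bar> \<le> M" "\<bar>G w\<bar> \<le> M" for w using F1(1)[of w] F2(1)[of w] by (auto simp: M_def)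
  have M0: "0 \<le> M" using M(1)[of undefined] by linarith
  obtain K where K: "K \<ge> 0" "\<And>x x' y y'. \<bar>x\<bar> \<le> M \<Longrightarrow> \<bar>x'\<bar> \<le> M \<Longrightarrow> \<bar>y\<bar> \<le> M \<Longrightarrow> \<bar>y'\<bar> \<le> M \<Longrightarrow>
        \<bar>k x y - k x' y'\<bar> \<le> K * (\<bar>x - x'\<bar> + \<bar>y - y'\<bar>)" using k[of M] by metis
  show ?thesis
  proof (rule cylI)
    show "\<bar>k (F w) (G w)\<bar> \<le> \<bar>k 0 0\<bar> + K * (M + M)" for w
    proof -
      have "\<bar>F w - 0\<bar> + \<bar>G w - 0\<bar> \<le> M + M" using add_mono[OF M(1)[of w] M(2)[of w]] by simp
      from mult_left_mono[OF this K(1)] have "K * (\<bar>F w - 0\<bar> + \<bar>G w - 0\<bar>) \<le> K * (M + M)" .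
      moreover have "\<bar>k (F w) (G w) - k 0 0\<bar> \<le> K * (\<bar>F w - 0\<bar> + \<bar>G w - 0\<bar>)"
        using M0 by (intro K(2) M) simp_all
      ultimately show ?thesis by linarith
    qed
    show "\<bar>k (F w) (G w) - k (F w') (G w')\<bar> \<le> (K * (C1 + C2)) * (\<Sum>a\<in>A. \<bar>w a - w' a\<bar>)" for w w'
    proof -
      have "K * (\<bar>F w - F w'\<bar> + \<bar>G w - G w'\<bar>) \<le> K * ((C1 + C2) * (\<Sum>a\<in>A. \<bar>w a - w' a\<bar>))"
        using add_mono[OF F1(3)[of w w'] F2(3)[of w w']] K(1) by (intro mult_left_mono) (simp_all add: distrib_right)
      then show ?thesis using K(2)[OF M(1)[of w] M(1)[of w'] M(2)[of w] M(2)[of w']] by (simp add: mult.assoc)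
    qed
  qed (use cyl_finite[OF F(1)] K(1) F1(2) F2(2) in auto)
qed

lemma cyl_nonexpansive2:
  assumes "\<And>x x' y y'. \<bar>k x y - k x' y'\<bar> \<le> \<bar>x - x'\<bar> + \<bar>y - y'\<bar>" "cyl A F" "cyl A G"
  shows "cyl A (\<lambda>w. k (F w) (G w))"
proof (rule cyl_comp2[OF assms(2,3)])
  fix M :: real
  show "\<exists>K\<ge>0. \<forall>x x' y y'. \<bar>x\<bar> \<le> M \<longrightarrow> \<bar>x'\<bar> \<le> M \<longrightarrow> \<bar>y\<bar> \<le> M \<longrightarrow> \<bar>y'\<bar> \<le> M \<longrightarrow>
        \<bar>k x y - k x' y'\<bar> \<le> K * (\<bar>x - x'\<bar> + \<bar>y - y'\<bar>)"
    by (rule exI[of _ 1]) (simp add: assms(1))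
qed

lemma cyl_add: "cyl A F \<Longrightarrow> cyl A G \<Longrightarrow> cyl A (\<lambda>w. F w + G w)"
  by (rule cyl_nonexpansive2[where k = "(+)"]) (linarith | assumption)+

lemma cyl_max: "cyl A F \<Longrightarrow> cyl A G \<Longrightarrow> cyl A (\<lambda>w. max (F w) (G w))"
  by (rule cyl_nonexpansive2[where k = max]) (linarith | assumption)+

lemma cyl_min: "cyl A F \<Longrightarrow> cyl A G \<Longrightarrow> cyl A (\<lambda>w. min (F w) (G w))"
  by (rule cyl_nonexpansive2[where k = min]) (linarith | assumption)+

lemma cyl_mult:
  assumes "cyl A F" "cyl A G" shows "cyl A (\<lambda>w. F w * G w)"
proof (rule cyl_comp2[OF assms, where k = "(*)"])
  fix M :: real
  have "\<bar>x * y - x' * y'\<bar> \<le> max M 0 * (\<bar>x - x'\<bar> + \<bar>y - y'\<bar>)"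
    if "\<bar>x\<bar> \<le> M" "\<bar>x'\<bar> \<le> M" "\<bar>y\<bar> \<le> M" "\<bar>y'\<bar> \<le> M" for x x' y y'
  proof -
    have "\<bar>x * y - x' * y'\<bar> = \<bar>(x - x') * y + x' * (y - y')\<bar>" by (simp add: algebra_simps)
    also have "\<dots> \<le> \<bar>x - x'\<bar> * \<bar>y\<bar> + \<bar>x'\<bar> * \<bar>y - y'\<bar>" by (metis abs_mult abs_triangle_ineq)
    also have "\<dots> \<le> \<bar>x - x'\<bar> * max M 0 + max M 0 * \<bar>y - y'\<bar>" using that by (intro add_mono mult_mono) auto
    finally show ?thesis by (simp add: algebra_simps)
  qed
  then show "\<exists>K\<ge>0. \<forall>x x' y y'. \<bar>x\<bar> \<le> M \<longrightarrow> \<bar>x'\<bar> \<le> M \<longrightarrow> \<bar>y\<bar> \<le> M \<longrightarrow> \<bar>y'\<bar> \<le> M \<longrightarrow>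
        \<bar>x * y - x' * y'\<bar> \<le> K * (\<bar>x - x'\<bar> + \<bar>y - y'\<bar>)"
    by (intro exI[of _ "max M 0"]) simp
qed

lemma cyl_const: "finite A \<Longrightarrow> cyl A (\<lambda>_. c)"
  by (rule cylI[where M = "\<bar>c\<bar>" and C = 0]) auto

lemma cyl_uminus: "cyl A F \<Longrightarrow> cyl A (\<lambda>w. - F w)"
  using cyl_mult[OF cyl_const, of A F "-1"] cyl_finite[of A F] by simp

text \<open>Cylinder variables with a set of times instead of a list: the sets of two variables are
  simply united, which makes the class closed under pointwise sums, products, maxima and
  minima.\<close>

definition rvs :: "real set \<Rightarrow> (cpath \<Rightarrow> real) set" where
  "rvs I = {X. \<exists>A F. cyl A F \<and> A \<subseteq> I \<and> X = (\<lambda>\<omega>. F (Rep_cpath \<omega>))}"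

lemma rvs_mono: "I \<subseteq> J \<Longrightarrow> rvs I \<subseteq> rvs J"
  unfolding rvs_def by blast

lemma rvs_lift2:
  assumes "\<And>A F G. cyl A F \<Longrightarrow> cyl A G \<Longrightarrow> cyl A (\<lambda>w. k (F w) (G w))" and X: "X \<in> rvs I" "Y \<in> rvs I"
  shows "(\<lambda>\<omega>. k (X \<omega>) (Y \<omega>)) \<in> rvs I"
proof -
  obtain A F where A: "cyl A F" "A \<subseteq> I" "X = (\<lambda>\<omega>. F (Rep_cpath \<omega>))" using X(1) by (auto simp: rvs_def)
  obtain D G where D: "cyl D G" "D \<subseteq> I" "Y = (\<lambda>\<omega>. G (Rep_cpath \<omega>))" using X(2) by (auto simp: rvs_def)
  have fin: "finite (A \<union> D)" using A(1) D(1) by (simp add: cyl_finite)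
  have "cyl (A \<union> D) (\<lambda>w. k (F w) (G w))"
    by (rule assms(1)[OF cyl_mono[OF A(1) Un_upper1 fin] cyl_mono[OF D(1) Un_upper2 fin]])
  then show ?thesis unfolding rvs_def using A(2,3) D(2,3) by blast
qed

lemma rvs_add: "X \<in> rvs I \<Longrightarrow> Y \<in> rvs I \<Longrightarrow> (\<lambda>\<omega>. X \<omega> + Y \<omega>) \<in> rvs I"
  by (rule rvs_lift2[OF cyl_add])

lemma rvs_max: "X \<in> rvs I \<Longrightarrow> Y \<in> rvs I \<Longrightarrow> (\<lambda>\<omega>. max (X \<omega>) (Y \<omega>)) \<in> rvs I"
  by (rule rvs_lift2[OF cyl_max])

lemma rvs_min: "X \<in> rvs I \<Longrightarrow> Y \<in> rvs I \<Longrightarrow> (\<lambda>\<omega>. min (X \<omega>) (Y \<omega>)) \<in> rvs I"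
  by (rule rvs_lift2[OF cyl_min])

lemma rvs_mult: "X \<in> rvs I \<Longrightarrow> Y \<in> rvs I \<Longrightarrow> (\<lambda>\<omega>. X \<omega> * Y \<omega>) \<in> rvs I"
  by (rule rvs_lift2[OF cyl_mult])

lemma rvs_const: "(\<lambda>\<omega>. c) \<in> rvs I"
proof -
  have "cyl {} (\<lambda>_. c)" by (rule cyl_const) simp
  then show ?thesis unfolding rvs_def by blast
qed

lemma rvs_scale: "X \<in> rvs I \<Longrightarrow> (\<lambda>\<omega>. c * X \<omega>) \<in> rvs I"
  by (rule rvs_mult[OF rvs_const])

lemma rvs_uminus: "X \<in> rvs I \<Longrightarrow> (\<lambda>\<omega>. - X \<omega>) \<in> rvs I"
  using rvs_scale[of X I "-1"] by simp

lemma rvs_diff: "X \<in> rvs I \<Longrightarrow> Y \<in> rvs I \<Longrightarrow> (\<lambda>\<omega>. X \<omega> - Y \<omega>) \<in> rvs I"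
  using rvs_add[OF _ rvs_uminus] by simp

lemma rvs_abs: "X \<in> rvs I \<Longrightarrow> (\<lambda>\<omega>. \<bar>X \<omega>\<bar>) \<in> rvs I"
proof -
  assume "X \<in> rvs I"
  from rvs_max[OF this rvs_uminus[OF this]] have "(\<lambda>\<omega>. max (X \<omega>) (- X \<omega>)) \<in> rvs I" .
  moreover have "max x (- x) = \<bar>x\<bar>" for x :: real by (simp add: max_def abs_if)
  ultimately show ?thesis by simp
qed

lemma rvs_power2: "X \<in> rvs I \<Longrightarrow> (\<lambda>\<omega>. (X \<omega>)\<^sup>2) \<in> rvs I"
  using rvs_mult[of X I X] by (simp add: power2_eq_square)

lemma rvs_bounded:
  assumes "X \<in> rvs I" obtains M where "\<And>\<omega>. \<bar>X \<omega>\<bar> \<le> M" "M \<ge> 0"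
proof -
  obtain A F where A: "cyl A F" "X = (\<lambda>\<omega>. F (Rep_cpath \<omega>))" using assms by (auto simp: rvs_def)
  obtain M where "\<And>w. \<bar>F w\<bar> \<le> M" using cylE[OF A(1)] by metis
  then show ?thesis using that[of "\<bar>M\<bar>"] A(2) by (metis abs_ge_zero abs_le_D1 abs_of_nonneg order_trans)
qed

lemma cyl_increment:
  assumes "blip h" shows "cyl {s, t} (\<lambda>w. h (w t - w s))"
proof -
  obtain L M where LM: "\<And>x y. \<bar>h x - h y\<bar> \<le> L * \<bar>x - y\<bar>" "\<And>x. \<bar>h x\<bar> \<le> M" using blipE[OF assms] by metis
  have L0: "L \<ge> 0" using LM(1)[of 0 1] by simp
  show ?thesis
  proof (rule cylI[OF _ LM(2)])
    fix w w' :: "real \<Rightarrow> real"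
    have "\<bar>(w t - w s) - (w' t - w' s)\<bar> \<le> (\<Sum>a\<in>{s, t}. \<bar>w a - w' a\<bar>)" by (cases "s = t") auto
    from mult_left_mono[OF this L0] show "\<bar>h (w t - w s) - h (w' t - w' s)\<bar> \<le> L * (\<Sum>a\<in>{s, t}. \<bar>w a - w' a\<bar>)"
      using LM(1)[of "w t - w s" "w' t - w' s"] by linarith
  qed (use L0 in auto)
qed

lemma rvs_increment:
  assumes "blip h" "s \<in> I" "t \<in> I" shows "(\<lambda>\<omega>. h (B t \<omega> - B s \<omega>)) \<in> rvs I"
  unfolding rvs_def B_def using cyl_increment[OF assms(1), of s t] assms(2,3) by blast

section \<open>Cylinder variables as functions of values and increments\<close>

lemma lipI:
  "(\<And>x. length x = m \<Longrightarrow> \<bar>\<phi> x\<bar> \<le> M) \<Longrightarrow> (\<And>x y. length x = m \<Longrightarrow> length y = m \<Longrightarrow>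
     \<bar>\<phi> x - \<phi> y\<bar> \<le> C * L2_set (\<lambda>i. x ! i - y ! i) {..<m}) \<Longrightarrow> \<phi> \<in> lip m"
  unfolding lip_def by blast

lemma abs_le_L2_set: "finite A \<Longrightarrow> i \<in> A \<Longrightarrow> \<bar>f i\<bar> \<le> L2_set f A"
  using member_le_L2_set[of A i "\<lambda>i. \<bar>f i\<bar>"] by (simp add: L2_set_def)

lemma sum_abs_le_L2:
  fixes f :: "nat \<Rightarrow> real" shows "(\<Sum>i<m. \<bar>f i\<bar>) \<le> real m * L2_set f {..<m}"
  using sum_bounded_above[of "{..<m}" "\<lambda>i. \<bar>f i\<bar>" "L2_set f {..<m}"] abs_le_L2_set[of "{..<m}" _ f] by simp

lemma lip_comp_cyl:
  assumes \<phi>: "\<phi> \<in> lip m" and v: "\<And>w. length (v w) = m" and A: "finite A"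
    and l: "\<And>w w' i. i < m \<Longrightarrow> \<bar>v w ! i - v w' ! i\<bar> \<le> K * (\<Sum>a\<in>A. \<bar>w a - w' a\<bar>)" and K: "K \<ge> 0"
  shows "cyl A (\<lambda>w. \<phi> (v w))"
proof -
  obtain M where M: "\<And>x. length x = m \<Longrightarrow> \<bar>\<phi> x\<bar> \<le> M" using \<phi> unfolding lip_def by blast
  obtain C where C: "\<And>x y. length x = m \<Longrightarrow> length y = m \<Longrightarrow> \<bar>\<phi> x - \<phi> y\<bar> \<le> C * L2_set (\<lambda>i. x ! i - y ! i) {..<m}"
    using \<phi> unfolding lip_def by blast
  show ?thesis
  proof (rule cylI[OF A])
    show "\<bar>\<phi> (v w)\<bar> \<le> M" for w by (rule M[OF v])
    show "\<bar>\<phi> (v w) - \<phi> (v w')\<bar> \<le> (\<bar>C\<bar> * (real m * K)) * (\<Sum>a\<in>A. \<bar>w a - w' a\<bar>)" for w w'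
    proof -
      have "L2_set (\<lambda>i. v w ! i - v w' ! i) {..<m} \<le> (\<Sum>i<m. \<bar>v w ! i - v w' ! i\<bar>)" by (rule L2_set_le_sum_abs)
      also have "\<dots> \<le> (\<Sum>i<m. K * (\<Sum>a\<in>A. \<bar>w a - w' a\<bar>))" by (intro sum_mono l) auto
      also have "\<dots> = real m * (K * (\<Sum>a\<in>A. \<bar>w a - w' a\<bar>))" by simp
      finally have 1: "L2_set (\<lambda>i. v w ! i - v w' ! i) {..<m} \<le> real m * (K * (\<Sum>a\<in>A. \<bar>w a - w' a\<bar>))" .
      have "\<bar>\<phi> (v w) - \<phi> (v w')\<bar> \<le> C * L2_set (\<lambda>i. v w ! i - v w' ! i) {..<m}" by (intro C v)
      also have "\<dots> \<le> \<bar>C\<bar> * L2_set (\<lambda>i. v w ! i - v w' ! i) {..<m}" by (intro mult_right_mono) (auto simp: L2_set_nonneg)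
      also have "\<dots> \<le> \<bar>C\<bar> * (real m * (K * (\<Sum>a\<in>A. \<bar>w a - w' a\<bar>)))" by (intro mult_left_mono 1) auto
      finally show ?thesis by (simp add: mult.assoc)
    qed
  qed (use K in auto)
qed

lemma abs_diff_le_sum:
  fixes w w' :: "'a \<Rightarrow> real"
  assumes "finite A" "a \<in> A" shows "\<bar>w a - w' a\<bar> \<le> (\<Sum>a\<in>A. \<bar>w a - w' a\<bar>)"
  using member_le_sum[OF assms(2), of "\<lambda>a. \<bar>w a - w' a\<bar>"] assms(1) by simp

text \<open>The inverse of taking increments: a path that jumps by \<open>xs ! k\<close> at time
  \<open>ts ! k\<close>, so its values at these times are the partial sums. It is not continuous,
  but cylinder functionals accept every function.\<close>

definition step_path :: "real list \<Rightarrow> real list \<Rightarrow> real \<Rightarrow> real" where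
  "step_path ts xs s = (\<Sum>k<length ts. if ts ! k \<le> s then xs ! k else 0)"

lemma cyl_step_path_lip:
  assumes "cyl A F" shows "(\<lambda>xs. F (step_path ts xs)) \<in> lip (length ts)"
proof -
  obtain M C where F: "finite A" "\<And>w. \<bar>F w\<bar> \<le> M" "C \<ge> 0" "\<And>w w'. \<bar>F w - F w'\<bar> \<le> C * (\<Sum>a\<in>A. \<bar>w a - w' a\<bar>)"
    using cylE[OF assms] by metis
  let ?m = "length ts"
  have "\<bar>F (step_path ts x) - F (step_path ts y)\<bar> \<le> C * (real (card A) * real ?m) * L2_set (\<lambda>i. x ! i - y ! i) {..<?m}" for x y
  proof -
    have "\<bar>step_path ts x a - step_path ts y a\<bar> \<le> real ?m * L2_set (\<lambda>i. x ! i - y ! i) {..<?m}" for a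
    proof -
      have "\<bar>step_path ts x a - step_path ts y a\<bar> = \<bar>\<Sum>k<?m. if ts ! k \<le> a then x ! k - y ! k else 0\<bar>"
        unfolding step_path_def sum_subtractf[symmetric] by (rule arg_cong[where f = abs], rule sum.cong) auto
      also have "\<dots> \<le> (\<Sum>k<?m. \<bar>if ts ! k \<le> a then x ! k - y ! k else 0\<bar>)" by (rule sum_abs)
      also have "\<dots> \<le> (\<Sum>k<?m. \<bar>x ! k - y ! k\<bar>)" by (rule sum_mono) auto
      also have "\<dots> \<le> real ?m * L2_set (\<lambda>i. x ! i - y ! i) {..<?m}" by (rule sum_abs_le_L2)
      finally show ?thesis .
    qed
    then have "(\<Sum>a\<in>A. \<bar>step_path ts x a - step_path ts y a\<bar>) \<le> (\<Sum>a\<in>A. real ?m * L2_set (\<lambda>i. x ! i - y ! i) {..<?m})"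
      by (intro sum_mono)
    also have "\<dots> = real (card A) * real ?m * L2_set (\<lambda>i. x ! i - y ! i) {..<?m}" by simp
    finally have "C * (\<Sum>a\<in>A. \<bar>step_path ts x a - step_path ts y a\<bar>)
        \<le> C * (real (card A) * real ?m * L2_set (\<lambda>i. x ! i - y ! i) {..<?m})" by (rule mult_left_mono[OF _ F(3)])
    then show ?thesis using F(4)[of "step_path ts x" "step_path ts y"] by (simp add: mult.assoc)
  qed
  then show ?thesis by (intro lipI[where M = M and C = "C * (real (card A) * real ?m)"] F(2))
qed

lemma step_path_increments:
  assumes ts: "sorted_wrt (<) ts" and w0: "w 0 = 0" and s: "s \<in> set ts"
  shows "step_path ts (map (\<lambda>i. w ((0 # ts) ! Suc i) - w ((0 # ts) ! i)) [0..<length ts]) s = w s"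
proof -
  obtain j where j: "j < length ts" "s = ts ! j" using s by (auto simp: in_set_conv_nth)
  let ?d = "\<lambda>i. w ((0 # ts) ! Suc i) - w ((0 # ts) ! i)"
  have "step_path ts (map ?d [0..<length ts]) s = (\<Sum>k<length ts. if k \<le> j then ?d k else 0)"
    unfolding step_path_def
  proof (rule sum.cong[OF refl])
    fix k assume "k \<in> {..<length ts}"
    then have k: "k < length ts" by simp
    have "ts ! k \<le> s \<longleftrightarrow> k \<le> j"
      using sorted_wrt_nth_less[OF ts, of k j] sorted_wrt_nth_less[OF ts, of j k] j k
      by (cases k j rule: linorder_cases) auto
    then show "(if ts ! k \<le> s then map ?d [0..<length ts] ! k else 0) = (if k \<le> j then ?d k else 0)" using k by simp
  qed
  also have "\<dots> = (\<Sum>k<Suc j. ?d k)" using j by (intro sum.mono_neutral_cong_right) auto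
  also have "\<dots> = w ((0 # ts) ! Suc j) - w ((0 # ts) ! 0)" by (rule sum_lessThan_telescope)
  finally show ?thesis using j w0 by simp
qed

lemma Rep_cpath_nonpos: "s \<le> 0 \<Longrightarrow> Rep_cpath \<omega> s = 0"
  using Rep_cpath[of \<omega>] by (cases "s = 0") auto

text \<open>A functional is written as a function of finitely many values by evaluating it on the
  step path through them; conversely, composing with \<open>map\<close> gives a functional. Adding
  time 0, where paths vanish, keeps the list nonempty.\<close>

lemma Lip_eq_rvs:
  assumes "T \<ge> 0" shows "Lip T = rvs {0..T}"
proof (intro equalityI subsetI)
  fix X assume "X \<in> Lip T"
  then obtain m ts \<phi> where X: "length ts = m" "set ts \<subseteq> {0..T}" "\<phi> \<in> lip m" "X = (\<lambda>\<omega>. \<phi> (map (\<lambda>t. B t \<omega>) ts))"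
    unfolding Lip_def by blast
  have "cyl (set ts) (\<lambda>w. \<phi> (map w ts))"
  proof (rule lip_comp_cyl[OF X(3), where K = 1])
    show "\<bar>map w ts ! i - map w' ts ! i\<bar> \<le> 1 * (\<Sum>a\<in>set ts. \<bar>w a - w' a\<bar>)" if "i < m" for w w' :: "real \<Rightarrow> real" and i
      using abs_diff_le_sum[of "set ts" "ts ! i" w w'] that X(1) by simp
  qed (use X(1) in auto)
  then show "X \<in> rvs {0..T}" unfolding rvs_def using X(2,4) by (auto simp: B_def)
next
  fix X assume "X \<in> rvs {0..T}"
  then obtain A F where A: "cyl A F" "A \<subseteq> {0..T}" "X = (\<lambda>\<omega>. F (Rep_cpath \<omega>))" by (auto simp: rvs_def)
  have fA: "finite (insert 0 A)" using cyl_finite[OF A(1)] by simp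
  define ts where "ts = sorted_list_of_set (insert 0 A)"
  have ts: "set ts = insert 0 A" "sorted_wrt (<) ts"
    unfolding ts_def by (rule set_sorted_list_of_set[OF fA], rule strict_sorted_list_of_set)
  \<comment> \<open>Differences of consecutive entries, which \<open>step_path\<close> sums up
    again.\<close>
  define g where "g = (\<lambda>xs :: real list. map (\<lambda>i. (0 # xs) ! Suc i - (0 # xs) ! i) [0..<length ts])"
  define \<phi> where "\<phi> = (\<lambda>xs. F (step_path ts (g xs)))"
  have "\<phi> \<in> lip (length ts)"
  proof -
    obtain M where M: "\<And>x. \<bar>F (step_path ts x)\<bar> \<le> M" using cylE[OF A(1)] by metis
    obtain C where C: "\<And>x y. length x = length ts \<Longrightarrow> length y = length ts \<Longrightarrow>
       \<bar>F (step_path ts x) - F (step_path ts y)\<bar> \<le> C * L2_set (\<lambda>i. x ! i - y ! i) {..<length ts}"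
      using cyl_step_path_lip[OF A(1), of ts] unfolding lip_def by blast
    have "\<bar>\<phi> x - \<phi> y\<bar> \<le> (\<bar>C\<bar> * (real (length ts) * 2)) * L2_set (\<lambda>i. x ! i - y ! i) {..<length ts}"
      if xy: "length x = length ts" "length y = length ts" for x y
    proof -
      let ?L = "L2_set (\<lambda>i. x ! i - y ! i) {..<length ts}"
      have i: "\<bar>(0 # x) ! i - (0 # y) ! i\<bar> \<le> ?L" if "i \<le> length ts" for i
      proof (cases i)
        case (Suc i')
        then show ?thesis using abs_le_L2_set[of "{..<length ts}" i' "\<lambda>i. x ! i - y ! i"] that by simp
      qed (simp add: L2_set_nonneg)
      have "L2_set (\<lambda>i. g x ! i - g y ! i) {..<length ts} \<le> (\<Sum>i<length ts. \<bar>g x ! i - g y ! i\<bar>)" by (rule L2_set_le_sum_abs)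
      also have "\<dots> \<le> (\<Sum>i<length ts. 2 * ?L)"
      proof (rule sum_mono)
        fix k assume "k \<in> {..<length ts}"
        then show "\<bar>g x ! k - g y ! k\<bar> \<le> 2 * ?L" using i[of k] i[of "Suc k"] by (simp add: g_def)
      qed
      finally have "L2_set (\<lambda>i. g x ! i - g y ! i) {..<length ts} \<le> real (length ts) * 2 * ?L" by simp
      from mult_left_mono[OF this abs_ge_zero[of C]]
      have "\<bar>C\<bar> * L2_set (\<lambda>i. g x ! i - g y ! i) {..<length ts} \<le> (\<bar>C\<bar> * (real (length ts) * 2)) * ?L" by (simp add: mult.assoc)
      moreover have "C * L2_set (\<lambda>i. g x ! i - g y ! i) {..<length ts} \<le> \<bar>C\<bar> * L2_set (\<lambda>i. g x ! i - g y ! i) {..<length ts}"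
        by (intro mult_right_mono) (auto simp: L2_set_nonneg)
      moreover have "\<bar>\<phi> x - \<phi> y\<bar> \<le> C * L2_set (\<lambda>i. g x ! i - g y ! i) {..<length ts}"
        unfolding \<phi>_def by (rule C) (auto simp: g_def)
      ultimately show ?thesis by linarith
    qed
    then show ?thesis by (rule lipI[of _ _ M, rotated]) (simp_all add: \<phi>_def M)
  qed
  moreover have "X = (\<lambda>\<omega>. \<phi> (map (\<lambda>t. B t \<omega>) ts))"
  proof
    fix \<omega>
    let ?w = "Rep_cpath \<omega>"
    have "g (map (\<lambda>t. B t \<omega>) ts) = map (\<lambda>i. ?w ((0 # ts) ! Suc i) - ?w ((0 # ts) ! i)) [0..<length ts]"
      unfolding g_def
    proof (rule map_cong[OF refl])
      fix i assume "i \<in> set [0..<length ts]"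
      then have "i < length ts" by simp
      then show "(0 # map (\<lambda>t. B t \<omega>) ts) ! Suc i - (0 # map (\<lambda>t. B t \<omega>) ts) ! i = ?w ((0 # ts) ! Suc i) - ?w ((0 # ts) ! i)"
        by (cases i) (simp_all add: B_def Rep_cpath_nonpos)
    qed
    then have "\<phi> (map (\<lambda>t. B t \<omega>) ts) = F ?w"
      unfolding \<phi>_def using step_path_increments[OF ts(2), of ?w] ts(1)
      by (intro cyl_cong[OF A(1)]) (auto simp: Rep_cpath_nonpos)
    then show "X \<omega> = \<phi> (map (\<lambda>t. B t \<omega>) ts)" by (simp add: A(3))
  qed
  moreover have "length ts \<ge> 1" using ts(1) by (cases ts) auto
  moreover have "set ts \<subseteq> {0..T}" using ts(1) A(2) assms by auto
  ultimately show "X \<in> Lip T" unfolding Lip_def by blast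
qed

lemma Lip_all_eq_rvs: "Lip_all = rvs {0..}"
proof (intro equalityI subsetI)
  fix X assume "X \<in> Lip_all"
  then obtain n where "X \<in> Lip (real n)" by (auto simp: Lip_all_def)
  then have "X \<in> rvs {0..real n}" by (simp add: Lip_eq_rvs)
  moreover have "rvs {0..real n} \<subseteq> rvs {0..}" by (rule rvs_mono) auto
  ultimately show "X \<in> rvs {0..}" by blast
next
  fix X assume "X \<in> rvs {0..}"
  then obtain A F where A: "cyl A F" "A \<subseteq> {0..}" "X = (\<lambda>\<omega>. F (Rep_cpath \<omega>))" by (auto simp: rvs_def)
  obtain n where n: "real n \<ge> Max (insert 1 A)" using real_arch_simple by blast
  have "finite (insert 1 A)" using cyl_finite[OF A(1)] by simp
  then have b: "a \<le> real n" if "a \<in> insert 1 A" for a using n Max_ge[of "insert 1 A" a] that by linarith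
  then have "A \<subseteq> {0..real n}" "n \<ge> 1" using A(2) b[of 1] by auto
  then have "X \<in> Lip (real n)" using A(1,3) by (subst Lip_eq_rvs) (auto simp: rvs_def)
  then show "X \<in> Lip_all" unfolding Lip_all_def using \<open>n \<ge> 1\<close> by auto
qed

text \<open>The backward recursion with a path instead of a list of increments as argument: the
  value at \<open>t\<close> is set to the one at the preceding time \<open>p\<close> plus the
  variable integrated by \<open>PG\<close>. Inserting a further time is then a local change.\<close>

primrec Ev :: "real \<Rightarrow> real list \<Rightarrow> real \<Rightarrow> ((real \<Rightarrow> real) \<Rightarrow> real) \<Rightarrow> (real \<Rightarrow> real) \<Rightarrow> real" where
  "Ev \<sigma> [] p F w = F w"
| "Ev \<sigma> (t # ts) p F w = PG \<sigma> (t - p) (\<lambda>y. Ev \<sigma> ts t F (w(t := w p + y))) 0"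

text \<open>Paths vanish at times up to 0, so only positive times are integrated and the recursion
  starts from the zero path at time 0.\<close>

definition expF :: "real \<Rightarrow> real set \<Rightarrow> ((real \<Rightarrow> real) \<Rightarrow> real) \<Rightarrow> real" where
  "expF \<sigma> A F = Ev \<sigma> (sorted_list_of_set (A \<inter> {0<..})) 0 F (\<lambda>_. 0)"

text \<open>Lagrange interpolation; the extra factor \<open>t / a\<close> makes the polynomial
  vanish at 0. Hence what is known of a cylinder functional on continuous paths holds for every
  function that vanishes up to time 0.\<close>

lemma cpath_interpolation:
  assumes "finite A" "\<And>s. s \<le> 0 \<Longrightarrow> w s = 0"
  obtains \<omega> where "\<And>s. s \<in> A \<Longrightarrow> Rep_cpath \<omega> s = w s"
proof -
  define P where "P = A \<inter> {0<..}"
  have P: "finite P" using assms(1) by (simp add: P_def)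
  define f where "f = (\<lambda>t. if t \<le> 0 then 0 else \<Sum>a\<in>P. w a * (\<Prod>b\<in>P - {a}. (t - b) / (a - b)) * (t / a))"
  have "continuous_on {0..} f"
  proof (rule continuous_on_eq)
    show "continuous_on {0..} (\<lambda>t. \<Sum>a\<in>P. w a * (\<Prod>b\<in>P - {a}. (t - b) / (a - b)) * (t / a))"
      by (auto intro!: continuous_intros simp: P_def)
    show "(\<Sum>a\<in>P. w a * (\<Prod>b\<in>P - {a}. (t - b) / (a - b)) * (t / a)) = f t" if "t \<in> {0..}" for t
      using that by (auto simp: f_def)
  qed
  then have "f \<in> {w. continuous_on {0..} w \<and> w 0 = 0 \<and> (\<forall>t<0. w t = 0)}" by (auto simp: f_def)
  then have R: "Rep_cpath (Abs_cpath f) = f" by (rule Abs_cpath_inverse)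
  have "f s = w s" if "s \<in> A" for s
  proof (cases "s \<le> 0")
    case False
    then have s: "s \<in> P" using that by (simp add: P_def)
    have "f s = (\<Sum>a\<in>P. if a = s then w s else 0)"
      unfolding f_def using False
    proof (simp, intro sum.cong refl)
      fix a assume a: "a \<in> P"
      show "w a * (\<Prod>b\<in>P - {a}. (s - b) / (a - b)) * s / a = (if a = s then w s else 0)"
      proof (cases "a = s")
        case True
        have "(\<Prod>b\<in>P - {a}. (s - b) / (a - b)) = (\<Prod>b\<in>P - {a}. 1)" using True by (intro prod.cong) auto
        then show ?thesis using True False by simp
      next
        case F: False
        then have "s \<in> P - {a}" using s by blast
        then have "(\<Prod>b\<in>P - {a}. (s - b) / (a - b)) = 0" using P by (intro prod_zero) auto
        then show ?thesis using F by simp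
      qed
    qed
    also have "\<dots> = w s" using s P by simp
    finally show ?thesis .
  qed (use assms(2) in \<open>simp add: f_def\<close>)
  then show ?thesis using that[of "Abs_cpath f"] R by simp
qed

context
  fixes \<sigma> :: real
  assumes \<sigma>: "0 \<le> \<sigma>" "\<sigma> \<le> 1"
begin

text \<open>Each step doubles the Lipschitz constant: the value at \<open>p\<close> now enters
  twice, by itself and through the new value at \<open>t\<close>.\<close>

lemma Ev_regular:
  assumes F: "\<And>w. \<bar>F w\<bar> \<le> M" "\<And>w w'. \<bar>F w - F w'\<bar> \<le> C * (\<Sum>a\<in>D. \<bar>w a - w' a\<bar>)" "C \<ge> 0" "finite D"
  shows "sorted_wrt (<) (p # ts) \<Longrightarrow> set (p # ts) \<subseteq> D \<Longrightarrow>
    \<bar>Ev \<sigma> ts p F w\<bar> \<le> M \<and> \<bar>Ev \<sigma> ts p F w - Ev \<sigma> ts p F w'\<bar> \<le> C * 2 ^ length ts * (\<Sum>a\<in>D. \<bar>w a - w' a\<bar>)"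
proof (induction ts arbitrary: p w w')
  case (Cons t ts)
  have t: "p < t" "sorted_wrt (<) (t # ts)" "set (t # ts) \<subseteq> D" "p \<in> D" "t \<in> D" using Cons.prems by auto
  let ?K = "C * 2 ^ length ts" and ?g = "\<lambda>w y. Ev \<sigma> ts t F (w(t := w p + y))"
  note IH = Cons.IH[OF t(2,3)]
  have K0: "?K \<ge> 0" using F(3) by simp
  have bd: "\<bar>?g w y\<bar> \<le> M" for w y using IH by blast
  have lip: "\<bar>?g w x - ?g w y\<bar> \<le> ?K * \<bar>x - y\<bar>" for w x y
  proof -
    have "(\<Sum>a\<in>D. \<bar>(w(t := w p + x)) a - (w(t := w p + y)) a\<bar>) = (\<Sum>a\<in>D. if a = t then \<bar>x - y\<bar> else 0)"
      by (rule sum.cong) auto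
    also have "\<dots> = \<bar>x - y\<bar>" using F(4) t(5) by simp
    finally have e: "(\<Sum>a\<in>D. \<bar>(w(t := w p + x)) a - (w(t := w p + y)) a\<bar>) = \<bar>x - y\<bar>" .
    show ?thesis using conjunct2[OF IH, of "w(t := w p + x)" "w(t := w p + y)"] unfolding e .
  qed
  have bl: "blip (?g w)" for w by (rule blipI[OF lip bd])
  have near: "\<bar>?g w y - ?g w' y\<bar> \<le> C * 2 ^ length (t # ts) * (\<Sum>a\<in>D. \<bar>w a - w' a\<bar>)" for w w' y
  proof -
    have "(\<Sum>a\<in>D. \<bar>(w(t := w p + y)) a - (w'(t := w' p + y)) a\<bar>)
       \<le> (\<Sum>a\<in>D. \<bar>w a - w' a\<bar> + (if a = t then \<bar>w p - w' p\<bar> else 0))"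
      by (rule sum_mono) auto
    also have "\<dots> = (\<Sum>a\<in>D. \<bar>w a - w' a\<bar>) + \<bar>w p - w' p\<bar>" using F(4) t(5) by (simp add: sum.distrib)
    also have "\<dots> \<le> 2 * (\<Sum>a\<in>D. \<bar>w a - w' a\<bar>)" using abs_diff_le_sum[OF F(4) t(4), of w w'] by simp
    finally have "?K * (\<Sum>a\<in>D. \<bar>(w(t := w p + y)) a - (w'(t := w' p + y)) a\<bar>) \<le> ?K * (2 * (\<Sum>a\<in>D. \<bar>w a - w' a\<bar>))"
      using K0 by (rule mult_left_mono)
    moreover have "?K * (2 * (\<Sum>a\<in>D. \<bar>w a - w' a\<bar>)) = C * 2 ^ length (t # ts) * (\<Sum>a\<in>D. \<bar>w a - w' a\<bar>)" by simp
    ultimately show ?thesis using conjunct2[OF IH, of "w(t := w p + y)" "w'(t := w' p + y)"] by linarith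
  qed
  have tp: "t - p \<ge> 0" using t(1) by simp
  have le: "PG \<sigma> (t - p) (?g w) 0 \<le> PG \<sigma> (t - p) (?g w') 0 + C * 2 ^ length (t # ts) * (\<Sum>a\<in>D. \<bar>w a - w' a\<bar>)" for w w'
  proof (rule PG_mono_add[OF \<sigma> bl bl _ tp])
    show "?g w y \<le> ?g w' y + C * 2 ^ length (t # ts) * (\<Sum>a\<in>D. \<bar>w a - w' a\<bar>)" for y
      using near[where w = w and w' = w' and y = y] unfolding abs_le_iff by linarith
  qed
  have sym: "(\<Sum>a\<in>D. \<bar>w' a - w a\<bar>) = (\<Sum>a\<in>D. \<bar>w a - w' a\<bar>)" by (intro sum.cong refl abs_minus_commute)
  have "\<bar>PG \<sigma> (t - p) (?g w) 0\<bar> \<le> M" by (rule PG_bounded[OF \<sigma> lip bd tp])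
  moreover have "\<bar>PG \<sigma> (t - p) (?g w) 0 - PG \<sigma> (t - p) (?g w') 0\<bar> \<le> C * 2 ^ length (t # ts) * (\<Sum>a\<in>D. \<bar>w a - w' a\<bar>)"
    using le[of w w'] le[of w' w] unfolding sym abs_le_iff by linarith
  ultimately show ?case by simp
qed (use F in simp)

lemma cyl_Ev:
  assumes F: "cyl A F" and s: "sorted_wrt (<) (p # ts)"
  shows "cyl (A \<union> set (p # ts)) (Ev \<sigma> ts p F)"
proof -
  let ?D = "A \<union> set (p # ts)"
  have fD: "finite ?D" using cyl_finite[OF F] by simp
  obtain M C where FD: "\<And>w. \<bar>F w\<bar> \<le> M" "C \<ge> 0" "\<And>w w'. \<bar>F w - F w'\<bar> \<le> C * (\<Sum>a\<in>?D. \<bar>w a - w' a\<bar>)"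
    using cylE[OF cyl_mono[OF F Un_upper1 fD]] by metis
  note R = Ev_regular[OF FD(1,3,2) fD s Un_upper2]
  show ?thesis by (rule cylI[OF fD conjunct1[OF R] _ conjunct2[OF R]]) (use FD(2) in simp)
qed

lemma blip_cyl_update:
  assumes "cyl A F" shows "blip (\<lambda>y. F (w(t := x + y)))"
proof -
  have fD: "finite (insert t A)" using cyl_finite[OF assms] by simp
  obtain M C where F: "\<And>w. \<bar>F w\<bar> \<le> M" "C \<ge> 0" "\<And>w w'. \<bar>F w - F w'\<bar> \<le> C * (\<Sum>a\<in>insert t A. \<bar>w a - w' a\<bar>)"
    using cylE[OF cyl_mono[OF assms subset_insertI fD]] by metis
  have e: "(\<Sum>a\<in>insert t A. \<bar>(w(t := x + y)) a - (w(t := x + y')) a\<bar>) = \<bar>y - y'\<bar>" for y y'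
  proof -
    have "(\<Sum>a\<in>insert t A. \<bar>(w(t := x + y)) a - (w(t := x + y')) a\<bar>) = (\<Sum>a\<in>insert t A. if a = t then \<bar>y - y'\<bar> else 0)"
      by (rule sum.cong) auto
    then show ?thesis using fD by simp
  qed
  have "\<bar>F (w(t := x + y)) - F (w(t := x + y'))\<bar> \<le> C * \<bar>y - y'\<bar>" for y y'
    using F(3)[of "w(t := x + y)" "w(t := x + y')"] unfolding e .
  then show ?thesis by (rule blipI[OF _ F(1)])
qed

lemma blip_Ev:
  assumes F: "cyl A F" and s: "sorted_wrt (<) (t # ts)"
  shows "blip (\<lambda>y. Ev \<sigma> ts t F (w(t := x + y)))"
  by (rule blip_cyl_update[OF cyl_Ev[OF F s]])

text \<open>At a time on which \<open>F\<close> does not depend, the recursion divides an interval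
  into two steps that one step covers as well; this is the semigroup property or, after the last
  time, the preservation of constants.\<close>

lemma Ev_insort:
  assumes F: "cyl A F" and s: "s \<notin> A"
  shows "sorted_wrt (<) (p # ts) \<Longrightarrow> s \<notin> set ts \<Longrightarrow> p < s \<Longrightarrow> Ev \<sigma> (insort s ts) p F w = Ev \<sigma> ts p F w"
proof (induction ts arbitrary: p w)
  case Nil
  have "F (w(s := w p + y)) = F w" for y using s by (intro cyl_cong[OF F]) auto
  then show ?case using PG_const[OF \<sigma>, of "s - p"] Nil by simp
next
  case (Cons t ts)
  have t: "p < t" "sorted_wrt (<) (t # ts)" "s \<noteq> t" "s \<notin> set ts" using Cons.prems by auto
  show ?case
  proof (cases "s \<le> t")
    case True
    then have st: "s < t" using t by simp
    define g where "g = (\<lambda>y. Ev \<sigma> ts t F (w(t := w p + y)))"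
    have bg: "blip g" unfolding g_def by (rule blip_Ev[OF F t(2)])
    \<comment> \<open>\<open>F\<close> ignores the value at \<open>s\<close>, so what remains is a
      function of the sum of the two increments.\<close>
    have "Ev \<sigma> ts t F ((w(s := w p + y1))(t := (w(s := w p + y1)) s + y2)) = g (y2 + y1)" for y1 y2
      unfolding g_def by (rule cyl_cong[OF cyl_Ev[OF F t(2)]]) (use s t(3,4) in auto)
    then have "Ev \<sigma> (insort s (t # ts)) p F w = PG \<sigma> (s - p) (\<lambda>y1. PG \<sigma> (t - s) (\<lambda>y2. g (y2 + y1)) 0) 0"
      using True by simp
    also have "\<dots> = PG \<sigma> (s - p) (PG \<sigma> (t - s) g) 0"
      using PG_shift[OF \<sigma> bg, of "t - s"] st by simp
    also have "\<dots> = PG \<sigma> ((t - s) + (s - p)) g 0"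
      using PG_semigroup[OF \<sigma> bg, of "t - s" "s - p"] st Cons.prems by simp
    finally show ?thesis by (simp add: g_def)
  next
    case False
    then show ?thesis using Cons.IH[OF t(2) t(4)] by simp
  qed
qed

text \<open>The hypothesis compares only functions that vanish up to time 0, because these are the
  ones reached by interpolation; updates at positive times stay within them.\<close>

lemma Ev_mono:
  assumes F: "cyl A F" "cyl A' F'"
  shows "sorted_wrt (<) (p # ts) \<Longrightarrow> 0 \<le> p \<Longrightarrow> (\<And>w. (\<And>s. s \<le> 0 \<Longrightarrow> w s = 0) \<Longrightarrow> F w \<le> F' w) \<Longrightarrow>
    (\<And>s. s \<le> 0 \<Longrightarrow> w s = 0) \<Longrightarrow> Ev \<sigma> ts p F w \<le> Ev \<sigma> ts p F' w"
proof (induction ts arbitrary: p w)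
  case (Cons t ts)
  have t: "p < t" "sorted_wrt (<) (t # ts)" using Cons.prems by auto
  have "Ev \<sigma> ts t F (w(t := w p + y)) \<le> Ev \<sigma> ts t F' (w(t := w p + y))" for y
    using t Cons.prems(2) by (intro Cons.IH[OF t(2) _ Cons.prems(3)]) (auto simp: Cons.prems(4))
  then show ?case using t by (simp add: PG_mono[OF \<sigma> blip_Ev[OF F(1) t(2)] blip_Ev[OF F(2) t(2)]])
qed simp

lemma Ev_subadd:
  assumes F: "cyl A F" "cyl A F'"
  shows "sorted_wrt (<) (p # ts) \<Longrightarrow> Ev \<sigma> ts p (\<lambda>w. F w + F' w) w \<le> Ev \<sigma> ts p F w + Ev \<sigma> ts p F' w"
proof (induction ts arbitrary: p w)
  case (Cons t ts)
  have t: "p < t" "sorted_wrt (<) (t # ts)" using Cons.prems by auto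
  note FF = cyl_add[OF F]
  note b = blip_Ev[OF F(1) t(2), of w "w p"] blip_Ev[OF F(2) t(2), of w "w p"]
  have tp: "t - p \<ge> 0" using t(1) by simp
  have "PG \<sigma> (t - p) (\<lambda>y. Ev \<sigma> ts t (\<lambda>w. F w + F' w) (w(t := w p + y))) 0
    \<le> PG \<sigma> (t - p) (\<lambda>y. Ev \<sigma> ts t F (w(t := w p + y)) + Ev \<sigma> ts t F' (w(t := w p + y))) 0"
    by (rule PG_mono[OF \<sigma> blip_Ev[OF FF t(2)] blip_add[OF b] _ tp]) (rule Cons.IH[OF t(2)])
  also have "\<dots> \<le> PG \<sigma> (t - p) (\<lambda>y. Ev \<sigma> ts t F (w(t := w p + y))) 0 + PG \<sigma> (t - p) (\<lambda>y. Ev \<sigma> ts t F' (w(t := w p + y))) 0"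
    by (rule PG_subadd[OF \<sigma> b tp])
  finally show ?case by simp
qed simp

lemma Ev_scale:
  assumes F: "cyl A F" and "c \<ge> 0"
  shows "sorted_wrt (<) (p # ts) \<Longrightarrow> Ev \<sigma> ts p (\<lambda>w. c * F w) w = c * Ev \<sigma> ts p F w"
proof (induction ts arbitrary: p w)
  case (Cons t ts)
  have t: "p < t" "sorted_wrt (<) (t # ts)" using Cons.prems by auto
  have tp: "t - p \<ge> 0" using t(1) by simp
  show ?case by (simp only: Ev.simps Cons.IH[OF t(2)] PG_scale[OF \<sigma> blip_Ev[OF F t(2)] tp \<open>c \<ge> 0\<close>])
qed simp

text \<open>The integration over the last time is the innermost one. Splitting it off is what
  conditioning on the time before amounts to.\<close>

lemma Ev_append: "Ev \<sigma> (ts @ [t]) p F w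
    = Ev \<sigma> ts p (\<lambda>w. PG \<sigma> (t - last (p # ts)) (\<lambda>y. F (w(t := w (last (p # ts)) + y))) 0) w"
  by (induction ts arbitrary: p w) auto

lemma sorted_positive: "finite A \<Longrightarrow> sorted_wrt (<) (0 # sorted_list_of_set (A \<inter> {0<..}))" for A :: "real set"
proof -
  assume "finite A"
  then have "finite (A \<inter> {0<..})" by simp
  from set_sorted_list_of_set[OF this] strict_sorted_list_of_set[of "A \<inter> {0<..}"] show ?thesis by auto
qed

text \<open>Times are added one by one with \<open>Ev_insort\<close>; two functionals can then be
  compared over a common set of times.\<close>

lemma expF_superset:
  assumes F: "cyl A F" and D: "finite D" shows "expF \<sigma> (A \<union> D) F = expF \<sigma> A F"
  using D
proof (induction D rule: finite_induct)
  case (insert s D)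
  show ?case
  proof (cases "s \<in> A \<union> D \<or> s \<le> 0")
    case True
    then have "(A \<union> insert s D) \<inter> {0<..} = (A \<union> D) \<inter> {0<..}" by auto
    then show ?thesis using insert.IH by (simp add: expF_def)
  next
    case False
    have fin: "finite (A \<union> D)" using cyl_finite[OF F] insert by simp
    have "(A \<union> insert s D) \<inter> {0<..} = insert s ((A \<union> D) \<inter> {0<..})" using False by auto
    then have "sorted_list_of_set ((A \<union> insert s D) \<inter> {0<..}) = insort s (sorted_list_of_set ((A \<union> D) \<inter> {0<..}))"
      using fin False by (simp add: sorted_list_of_set_insert)
    then show ?thesis
      using Ev_insort[OF F _ sorted_positive[OF fin], of s] False fin insert.IH by (simp add: expF_def)
  qed
qed simp

text \<open>Continuous paths suffice by interpolation. Applied in both directions this shows that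
  \<open>expF\<close> depends on the random variable alone, not on the functional or time set that
  represents it.\<close>

lemma expF_mono_cpath:
  assumes F: "cyl A F" "cyl A' F'" and le: "\<And>\<omega>. F (Rep_cpath \<omega>) \<le> F' (Rep_cpath \<omega>)"
  shows "expF \<sigma> A F \<le> expF \<sigma> A' F'"
proof -
  have fin: "finite (A \<union> A')" using F by (simp add: cyl_finite)
  have "F w \<le> F' w" if w: "\<And>s. s \<le> 0 \<Longrightarrow> w s = 0" for w
  proof -
    obtain \<omega> where "\<And>s. s \<in> A \<union> A' \<Longrightarrow> Rep_cpath \<omega> s = w s" by (rule cpath_interpolation[OF fin, of w]) (use w in auto)
    then have "F w = F (Rep_cpath \<omega>)" "F' w = F' (Rep_cpath \<omega>)" by (auto intro!: cyl_cong[OF F(1)] cyl_cong[OF F(2)])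
    then show ?thesis using le by simp
  qed
  then have "expF \<sigma> (A \<union> A') F \<le> expF \<sigma> (A \<union> A') F'"
    unfolding expF_def by (intro Ev_mono[OF F sorted_positive[OF fin]]) auto
  moreover have "expF \<sigma> (A \<union> A') F = expF \<sigma> A F" using cyl_finite[OF F(2)] by (rule expF_superset[OF F(1)])
  moreover have "expF \<sigma> (A \<union> A') F' = expF \<sigma> A' F'"
    using expF_superset[OF F(2) cyl_finite[OF F(1)]] by (simp add: Un_commute)
  ultimately show ?thesis by simp
qed

text \<open>The base point \<open>-1\<close> in place of \<open>0\<close> keeps the first increment free when \<open>hd ts = 0\<close>;
  continuous paths vanish at both times.\<close>

lemma backward_eq_expF:
  assumes ts: "ts \<noteq> []" "sorted_wrt (<) ts" "hd ts \<ge> 0" and \<phi>: "\<phi> \<in> lip (length ts)"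
  defines "F \<equiv> (\<lambda>w. \<phi> (map (\<lambda>i. w ((-1 # ts) ! Suc i) - w ((-1 # ts) ! i)) [0..<length ts]))"
  shows "cyl (set (-1 # ts)) F" and "backward \<sigma> ts \<phi> (length ts) [] = expF \<sigma> (set (-1 # ts)) F"
proof -
  define inc where "inc = (\<lambda>w :: real \<Rightarrow> real. map (\<lambda>i. w ((-1 # ts) ! Suc i) - w ((-1 # ts) ! i)) [0..<length ts])"
  have F: "F = (\<lambda>w. \<phi> (inc w))" by (simp add: F_def inc_def)
  show cF: "cyl (set (-1 # ts)) F"
    unfolding F
  proof (rule lip_comp_cyl[OF \<phi>, where K = 2])
    fix w w' :: "real \<Rightarrow> real" and i assume i: "i < length ts"
    have m: "(-1 # ts) ! Suc i \<in> set (-1 # ts)" "(-1 # ts) ! i \<in> set (-1 # ts)"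
      by (rule nth_mem, use i in simp)+
    have "\<bar>inc w ! i - inc w' ! i\<bar> \<le> \<bar>w ((-1 # ts) ! Suc i) - w' ((-1 # ts) ! Suc i)\<bar> + \<bar>w ((-1 # ts) ! i) - w' ((-1 # ts) ! i)\<bar>"
      using i by (simp add: inc_def)
    then show "\<bar>inc w ! i - inc w' ! i\<bar> \<le> 2 * (\<Sum>a\<in>set (-1 # ts). \<bar>w a - w' a\<bar>)"
      using abs_diff_le_sum[OF _ m(1), of w w'] abs_diff_le_sum[OF _ m(2), of w w'] by simp
  qed (auto simp: inc_def)
  let ?m = "length ts"
  have incn: "inc v ! l = v ((-1 # ts) ! Suc l) - v ((-1 # ts) ! l)" if "l < ?m" for v l
    using that by (simp add: inc_def del: nth_Cons_Suc)
  have less: "ts ! i < ts ! k" if "i < k" "k < ?m" for i k using sorted_wrt_nth_less[OF ts(2) that] .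
  have pos: "0 \<le> ts ! i" if "i < ?m" for i
    using ts(1,3) less[of 0 i] that by (cases i) (auto simp: hd_conv_nth)
  \<comment> \<open>After \<open>k\<close> steps the last \<open>k\<close> increments are integrated
    out and the first \<open>?m - k\<close> remain as arguments; \<open>Ev\<close> sees them through
    the path \<open>w\<close>.\<close>
  have claim: "backward \<sigma> ts \<phi> k (take (?m - k) (inc w)) = Ev \<sigma> (drop (?m - k) ts) (ts ! (?m - k - 1)) F w" if "k < ?m" for k w
    using that
  proof (induction k arbitrary: w)
    case 0
    have "length (inc w) = ?m" by (simp add: inc_def)
    then show ?case by (simp add: F)
  next
    case (Suc k)
    define i where "i = ?m - Suc k - 1"
    have i: "?m - Suc k = Suc i" "?m - k = Suc (Suc i)" "Suc i < ?m" "?m - k - 1 = Suc i" using Suc.prems by (auto simp: i_def)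
    have dr: "drop (Suc i) ts = ts ! Suc i # drop (Suc (Suc i)) ts" using i(3) by (simp add: Cons_nth_drop_Suc)
    have "backward \<sigma> ts \<phi> k (take (Suc i) (inc w) @ [y])
        = Ev \<sigma> (drop (Suc (Suc i)) ts) (ts ! Suc i) F (w(ts ! Suc i := w (ts ! i) + y))" for y
    proof -
      define W where "W = w(ts ! Suc i := w (ts ! i) + y)"
      have old: "W ((-1 # ts) ! l) = w ((-1 # ts) ! l)" if "l \<le> Suc i" for l
      proof (cases l)
        case 0
        then show ?thesis using pos[of "Suc i"] i(3) by (simp add: W_def)
      next
        case (Suc l')
        then show ?thesis using less[of l' "Suc i"] that i(3) by (simp add: W_def)
      qed
      have "take (Suc (Suc i)) (inc W) = take (Suc i) (inc w) @ [y]"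
      proof (rule nth_equalityI)
        fix l assume "l < length (take (Suc (Suc i)) (inc W))"
        then have l: "l < Suc (Suc i)" by simp
        show "take (Suc (Suc i)) (inc W) ! l = (take (Suc i) (inc w) @ [y]) ! l"
        proof (cases "l < Suc i")
          case True
          then have "l < ?m" "l \<le> Suc i" "Suc l \<le> Suc i" using i(3) by simp_all
          then have "inc W ! l = inc w ! l" by (simp only: incn old)
          then show ?thesis using True i(3) by (simp add: nth_append inc_def)
        next
          case False
          then have "l = Suc i" using l by simp
          moreover have "inc W ! Suc i = y" using incn[OF i(3), of W] less[of i "Suc i"] i(3) by (simp add: W_def)
          ultimately show ?thesis using i(3) by (simp add: nth_append inc_def)
        qed
      qed (use i(3) in \<open>simp add: inc_def\<close>)
      then show ?thesis using Suc.IH[of W] Suc.prems i by (simp add: W_def[symmetric])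
    qed
    then show ?case using i dr by simp
  qed
  define t where "t = ts ! 0"
  have m: "?m > 0" using ts(1) by simp
  have tts: "ts = t # tl ts" using ts(1) by (cases ts) (auto simp: t_def)
  have srt: "sorted_wrt (<) (t # tl ts)" using ts(2) tts by simp
  have t0: "t \<ge> 0" using pos[OF m] by (simp add: t_def)
  have g: "backward \<sigma> ts \<phi> (?m - 1) [y] = Ev \<sigma> (tl ts) t F ((\<lambda>_. 0)(t := 0 + y))" for y
  proof -
    let ?w = "(\<lambda>_. 0)(t := 0 + y)"
    have "take 1 (inc ?w) = [y]" using m t0 by (cases "?m") (auto simp: inc_def t_def[symmetric] upt_conv_Cons simp del: upt_Suc)
    then show ?thesis using claim[of "?m - 1" ?w] m by (simp add: t_def drop_Suc)
  qed
  have "backward \<sigma> ts \<phi> ?m [] = backward \<sigma> ts \<phi> (Suc (?m - 1)) []" using m by simp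
  also have "\<dots> = PG \<sigma> (t - 0) (\<lambda>y. Ev \<sigma> (tl ts) t F ((\<lambda>_. 0)(t := 0 + y))) 0"
    using m by (simp only: backward.simps g append_Nil) (simp add: t_def)
  also have "\<dots> = expF \<sigma> (set (-1 # ts)) F"
  \<comment> \<open>A first time equal to 0 occurs in \<open>backward\<close> but not in
    \<open>expF\<close>; it contributes \<open>PG\<close> over time 0, the identity.\<close>
  proof (cases "t = 0")
    case True
    have "set (-1 # ts) \<inter> {0<..} = set (tl ts)"
      using srt True by (subst tts) auto
    moreover have "sorted_list_of_set (set (tl ts)) = tl ts"
      using srt by (simp add: strict_sorted_iff sorted_list_of_set.idem_if_sorted_distinct)
    moreover have "PG \<sigma> 0 (\<lambda>y. Ev \<sigma> (tl ts) t F ((\<lambda>_. 0)(t := 0 + y))) 0 = Ev \<sigma> (tl ts) t F ((\<lambda>_. 0)(t := 0 + 0))"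
    proof -
      obtain L M where LM: "\<And>x y. \<bar>Ev \<sigma> (tl ts) t F ((\<lambda>_. 0)(t := 0 + x)) - Ev \<sigma> (tl ts) t F ((\<lambda>_. 0)(t := 0 + y))\<bar> \<le> L * \<bar>x - y\<bar>"
        "\<And>x. \<bar>Ev \<sigma> (tl ts) t F ((\<lambda>_. 0)(t := 0 + x))\<bar> \<le> M"
        using blipE[OF blip_Ev[OF cF srt, of "\<lambda>_. 0" 0]] by metis
      show ?thesis by (rule PG_0[OF \<sigma> LM])
    qed
    ultimately show ?thesis using True by (simp add: expF_def fun_upd_idem)
  next
    case False
    then have "set (-1 # ts) \<inter> {0<..} = set ts" using srt t0 by (subst tts, subst (2) tts) auto
    moreover have "sorted_list_of_set (set ts) = ts"
      using ts(2) by (simp add: strict_sorted_iff sorted_list_of_set.idem_if_sorted_distinct)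
    moreover have "Ev \<sigma> ts 0 F (\<lambda>_. 0) = PG \<sigma> (t - 0) (\<lambda>y. Ev \<sigma> (tl ts) t F ((\<lambda>_. 0)(t := 0 + y))) 0"
      by (subst tts) simp
    ultimately show ?thesis by (simp add: expF_def)
  qed
  finally show "backward \<sigma> ts \<phi> ?m [] = expF \<sigma> (set (-1 # ts)) F" .
qed

text \<open>Every representation by increments has the value of \<open>expF\<close>, by
  \<open>expF_mono_cpath\<close> in both directions, so the description has a unique value. The step
  path at the times of \<open>A\<close> together with 0 provides one representation.\<close>

lemma gexp_eq_expF:
  assumes F: "cyl A F" "A \<subseteq> {0..}"
  shows "gexp \<sigma> (\<lambda>\<omega>. F (Rep_cpath \<omega>)) = expF \<sigma> A F"
  unfolding gexp_def
proof (rule the_equality)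
  have rep: "backward \<sigma> ts \<phi> (length ts) [] = expF \<sigma> A F"
    if ts: "ts \<noteq> []" "sorted_wrt (<) ts" "hd ts \<ge> 0" "\<phi> \<in> lip (length ts)"
      and X: "(\<lambda>\<omega>. F (Rep_cpath \<omega>)) = (\<lambda>\<omega>. \<phi> (increments ts \<omega>))" for ts \<phi>
  proof -
    let ?F = "\<lambda>w. \<phi> (map (\<lambda>i. w ((-1 # ts) ! Suc i) - w ((-1 # ts) ! i)) [0..<length ts])"
    note b = backward_eq_expF[OF ts]
    have "?F (Rep_cpath \<omega>) = F (Rep_cpath \<omega>)" for \<omega>
    proof -
      have "map (\<lambda>i. Rep_cpath \<omega> ((-1 # ts) ! Suc i) - Rep_cpath \<omega> ((-1 # ts) ! i)) [0..<length ts] = increments ts \<omega>"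
        unfolding increments_def
      proof (rule map_cong[OF refl])
        fix i
        show "Rep_cpath \<omega> ((-1 # ts) ! Suc i) - Rep_cpath \<omega> ((-1 # ts) ! i) = B ((0 # ts) ! Suc i) \<omega> - B ((0 # ts) ! i) \<omega>"
          by (cases i) (simp_all add: B_def Rep_cpath_nonpos)
      qed
      then show ?thesis using fun_cong[OF X, of \<omega>] by simp
    qed
    then have "expF \<sigma> (set (-1 # ts)) ?F = expF \<sigma> A F"
      by (intro antisym expF_mono_cpath[OF b(1) F(1)] expF_mono_cpath[OF F(1) b(1)]) simp_all
    then show ?thesis using b(2) by simp
  qed
  have fin: "finite (insert 0 A)" using cyl_finite[OF F(1)] by simp
  define ts where "ts = sorted_list_of_set (insert 0 A)"
  have ts: "set ts = insert 0 A" "sorted_wrt (<) ts"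
    unfolding ts_def by (rule set_sorted_list_of_set[OF fin], rule strict_sorted_list_of_set)
  have ne: "ts \<noteq> []" using ts(1) by auto
  have hd: "hd ts \<ge> 0" using hd_in_set[OF ne] ts(1) F(2) by auto
  have X: "(\<lambda>\<omega>. F (Rep_cpath \<omega>)) = (\<lambda>\<omega>. F (step_path ts (increments ts \<omega>)))"
  proof
    fix \<omega>
    have "step_path ts (increments ts \<omega>) s = Rep_cpath \<omega> s" if "s \<in> A" for s
      using step_path_increments[OF ts(2), of "Rep_cpath \<omega>" s] that ts(1) by (simp add: increments_def B_def Rep_cpath_nonpos)
    then show "F (Rep_cpath \<omega>) = F (step_path ts (increments ts \<omega>))" by (intro cyl_cong[OF F(1)]) simp
  qed
  show "\<exists>ts \<phi>. ts \<noteq> [] \<and> sorted_wrt (<) ts \<and> 0 \<le> hd ts \<and> \<phi> \<in> lip (length ts) \<and>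
     (\<lambda>\<omega>. F (Rep_cpath \<omega>)) = (\<lambda>\<omega>. \<phi> (increments ts \<omega>)) \<and> expF \<sigma> A F = backward \<sigma> ts \<phi> (length ts) []"
    using rep[OF ne ts(2) hd cyl_step_path_lip[OF F(1)] X] ne ts(2) hd cyl_step_path_lip[OF F(1), of ts] X
    by (intro exI[of _ ts] exI[of _ "\<lambda>xs. F (step_path ts xs)"]) simp
  show "r = expF \<sigma> A F" if "\<exists>ts \<phi>. ts \<noteq> [] \<and> sorted_wrt (<) ts \<and> 0 \<le> hd ts \<and> \<phi> \<in> lip (length ts) \<and>
     (\<lambda>\<omega>. F (Rep_cpath \<omega>)) = (\<lambda>\<omega>. \<phi> (increments ts \<omega>)) \<and> r = backward \<sigma> ts \<phi> (length ts) []" for r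
    using that rep by blast
qed

lemma gexp_mono:
  assumes "X \<in> rvs {0..}" "Y \<in> rvs {0..}" "\<And>\<omega>. X \<omega> \<le> Y \<omega>" shows "gexp \<sigma> X \<le> gexp \<sigma> Y"
proof -
  obtain A F where A: "cyl A F" "A \<subseteq> {0..}" "X = (\<lambda>\<omega>. F (Rep_cpath \<omega>))" using assms(1) by (auto simp: rvs_def)
  obtain D G where D: "cyl D G" "D \<subseteq> {0..}" "Y = (\<lambda>\<omega>. G (Rep_cpath \<omega>))" using assms(2) by (auto simp: rvs_def)
  show ?thesis using expF_mono_cpath[OF A(1) D(1)] assms(3) unfolding A(3) D(3)
    by (simp add: gexp_eq_expF[OF A(1,2)] gexp_eq_expF[OF D(1,2)])
qed

lemma gexp_add_le:
  assumes "X \<in> rvs {0..}" "Y \<in> rvs {0..}" shows "gexp \<sigma> (\<lambda>\<omega>. X \<omega> + Y \<omega>) \<le> gexp \<sigma> X + gexp \<sigma> Y"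
proof -
  obtain A F where A: "cyl A F" "A \<subseteq> {0..}" "X = (\<lambda>\<omega>. F (Rep_cpath \<omega>))" using assms(1) by (auto simp: rvs_def)
  obtain D G where D: "cyl D G" "D \<subseteq> {0..}" "Y = (\<lambda>\<omega>. G (Rep_cpath \<omega>))" using assms(2) by (auto simp: rvs_def)
  have fin: "finite (A \<union> D)" using A(1) D(1) by (simp add: cyl_finite)
  have sub: "A \<union> D \<subseteq> {0..}" using A(2) D(2) by blast
  note F = cyl_mono[OF A(1) Un_upper1 fin] and G = cyl_mono[OF D(1) Un_upper2 fin]
  note FG = cyl_add[OF F G]
  have "expF \<sigma> (A \<union> D) (\<lambda>w. F w + G w) \<le> expF \<sigma> (A \<union> D) F + expF \<sigma> (A \<union> D) G"
    unfolding expF_def by (rule Ev_subadd[OF F G sorted_positive[OF fin]])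
  then show ?thesis unfolding A(3) D(3)
    by (simp add: gexp_eq_expF[OF FG sub] gexp_eq_expF[OF F sub] gexp_eq_expF[OF G sub])
qed

lemma gexp_scale:
  assumes "X \<in> rvs {0..}" "c \<ge> 0" shows "gexp \<sigma> (\<lambda>\<omega>. c * X \<omega>) = c * gexp \<sigma> X"
proof -
  obtain A F where A: "cyl A F" "A \<subseteq> {0..}" "X = (\<lambda>\<omega>. F (Rep_cpath \<omega>))" using assms(1) by (auto simp: rvs_def)
  note fin = cyl_finite[OF A(1)]
  note cF = cyl_mult[OF cyl_const[OF fin, of c] A(1)]
  show ?thesis unfolding A(3) gexp_eq_expF[OF cF A(2)] gexp_eq_expF[OF A(1,2)] expF_def
    by (rule Ev_scale[OF A(1) assms(2) sorted_positive[OF fin]])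
qed

lemma gexp_const: "gexp \<sigma> (\<lambda>_. c) = c"
proof -
  have c: "cyl {} (\<lambda>_. c)" by (rule cyl_const) simp
  show ?thesis using gexp_eq_expF[OF c] by (simp add: expF_def)
qed

text \<open>Independence of \<open>B t - B s\<close> from the past: \<open>t\<close> is the last
  time, so its increment is integrated first, with \<open>X\<close> frozen. Only nonnegative
  constants may be taken out of \<open>PG\<close>, whence the two parts of \<open>X\<close> with
  \<open>g\<close> and \<open>- g\<close>.\<close>

lemma gexp_increment:
  assumes X: "X \<in> rvs {0..s}" and g: "blip g" and s: "0 \<le> s" "s < t"
  shows "gexp \<sigma> (\<lambda>\<omega>. X \<omega> * g (B t \<omega> - B s \<omega>))
    = gexp \<sigma> (\<lambda>\<omega>. max (X \<omega>) 0 * PG \<sigma> (t - s) g 0 + max (- X \<omega>) 0 * PG \<sigma> (t - s) (\<lambda>y. - g y) 0)"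
proof -
  let ?c = "PG \<sigma> (t - s) g 0" and ?c' = "PG \<sigma> (t - s) (\<lambda>y. - g y) 0"
  obtain A F where A: "cyl A F" "A \<subseteq> {0..s}" "X = (\<lambda>\<omega>. F (Rep_cpath \<omega>))" using X by (auto simp: rvs_def)
  have fin: "finite A" using A(1) by (rule cyl_finite)
  define D where "D = insert t (insert s A)"
  have finD: "finite D" "D \<subseteq> {0..}" using fin A(2) s by (auto simp: D_def)
  have cI: "cyl {s, t} (\<lambda>w. g (w t - w s))" by (rule cyl_increment[OF g])
  define G where "G = (\<lambda>w. F w * g (w t - w s))"
  have cG: "cyl D G" unfolding G_def
    by (rule cyl_mult[OF cyl_mono[OF A(1) _ finD(1)] cyl_mono[OF cI _ finD(1)]]) (auto simp: D_def)
  define H where "H = (\<lambda>w. max (F w) 0 * ?c + max (- F w) 0 * ?c')"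
  have cH: "cyl (insert s A) H"
  proof -
    have fs: "finite (insert s A)" using fin by simp
    note cF = cyl_mono[OF A(1) subset_insertI fs]
    show ?thesis unfolding H_def
      by (rule cyl_add[OF cyl_mult[OF cyl_max[OF cF cyl_const] cyl_const]
            cyl_mult[OF cyl_max[OF cyl_uminus[OF cF] cyl_const] cyl_const]]) (rule fs)+
  qed
  define ts where "ts = sorted_list_of_set (insert s A \<inter> {0<..})"
  have fts: "finite (insert s A \<inter> {0<..})" using fin by simp
  have sts: "set ts = insert s A \<inter> {0<..}" "sorted_wrt (<) ts"
    unfolding ts_def by (rule set_sorted_list_of_set[OF fts], rule strict_sorted_list_of_set)
  have le_last: "x \<le> last xs" if "sorted xs" "x \<in> set xs" for x and xs :: "real list"
    using that by (induction xs) auto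
  \<comment> \<open>\<open>s\<close> has been added to the times of \<open>A\<close>, so the
    recursion over \<open>t\<close> starts at \<open>s\<close>; for \<open>s = 0\<close> the base
    point takes this role.\<close>
  have lst: "last (0 # ts) = s"
  proof (cases "s = 0")
    case True
    then have "set ts = {}" using A(2) by (auto simp: sts)
    then show ?thesis using True by simp
  next
    case False
    then have s': "s \<in> set ts" using s by (simp add: sts)
    then have ne: "ts \<noteq> []" by auto
    have "last ts \<le> s" using last_in_set[OF ne] A(2) by (auto simp: sts)
    moreover have "s \<le> last ts" by (rule le_last[OF _ s']) (use sts(2) in \<open>simp add: strict_sorted_iff\<close>)
    ultimately show ?thesis using ne by simp
  qed
  have tsD: "sorted_list_of_set (D \<inter> {0<..}) = ts @ [t]"
  proof (rule sorted_distinct_set_unique)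
    have e: "D \<inter> {0<..} = insert t (insert s A \<inter> {0<..})" using s by (auto simp: D_def)
    have "finite (D \<inter> {0<..})" using finD(1) by simp
    from set_sorted_list_of_set[OF this] show "set (sorted_list_of_set (D \<inter> {0<..})) = set (ts @ [t])"
      unfolding e by (simp only: set_append sts(1)) auto
    have "\<forall>a\<in>set ts. a < t" using A(2) s by (auto simp: sts)
    then show "sorted (ts @ [t])" "distinct (ts @ [t])"
      using sts(2) by (auto simp: strict_sorted_iff sorted_append less_imp_le)
  qed simp_all
  have inner: "PG \<sigma> (t - s) (\<lambda>y. G (w(t := w s + y))) 0 = H w" for w
  proof -
    have "t \<notin> A" using A(2) s by auto
    then have "F (w(t := w s + y)) = F w" for y by (intro cyl_cong[OF A(1)]) auto
    then have e: "(\<lambda>y. G (w(t := w s + y))) = (\<lambda>y. F w * g y)" using s by (auto simp: G_def)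
    show ?thesis
    proof (cases "F w \<ge> 0")
      case True
      then show ?thesis unfolding e using PG_scale[OF \<sigma> g _ True, of "t - s" 0] s by (simp add: H_def)
    next
      case False
      have "(\<lambda>y. F w * g y) = (\<lambda>y. (- F w) * (- g y))" by simp
      moreover have "blip (\<lambda>y. - g y)" using blip_scale[OF g, of "-1"] by simp
      ultimately show ?thesis unfolding e using PG_scale[OF \<sigma>, of "\<lambda>y. - g y" "t - s" "- F w" 0] s False by (simp add: H_def)
    qed
  qed
  have "expF \<sigma> D G = expF \<sigma> (insert s A) H"
    unfolding expF_def tsD ts_def[symmetric] Ev_append lst inner ..
  moreover have "gexp \<sigma> (\<lambda>\<omega>. X \<omega> * g (B t \<omega> - B s \<omega>)) = expF \<sigma> D G"
    using gexp_eq_expF[OF cG finD(2)] by (simp add: G_def A(3) B_def)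
  moreover have "insert s A \<subseteq> {0..}" using A(2) s by auto
  then have "gexp \<sigma> (\<lambda>\<omega>. max (X \<omega>) 0 * ?c + max (- X \<omega>) 0 * ?c') = expF \<sigma> (insert s A) H"
    using gexp_eq_expF[OF cH] by (simp add: H_def A(3))
  ultimately show ?thesis by simp
qed

end

text \<open>A Lipschitz map sends sequences converging in the completion to Cauchy sequences, and
  the filter in \<open>cont_ext\<close> is nontrivial because the sequence enters every
  neighbourhood of its limit. Operations defined by \<open>cont_ext\<close> are henceforth computed
  along sequences.\<close>

lemma cont_ext_lim:
  fixes j :: "'v \<Rightarrow> 'l::metric_space" and F :: "'v \<Rightarrow> 'b::complete_space"
  assumes lip: "\<And>x y. x \<in> V \<Longrightarrow> y \<in> V \<Longrightarrow> dist (F x) (F y) \<le> K * dist (j x) (j y)" and "K \<ge> 0"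
    and x: "\<And>n. x n \<in> V" "(\<lambda>n. j (x n)) \<longlonglongrightarrow> X"
  shows "(\<lambda>n. F (x n)) \<longlonglongrightarrow> cont_ext j V F X"
proof -
  \<comment> \<open>\<open>K + 1\<close> takes the place of \<open>K\<close> in the denominators
    below, since \<open>K\<close> may be 0.\<close>
  have K: "K + 1 > 0" using \<open>K \<ge> 0\<close> by simp
  have small: "K * (e / (K + 1)) \<le> e" if "e > 0" for e
  proof -
    have "K * e \<le> (K + 1) * e" using that by (intro mult_right_mono) auto
    then show ?thesis using K by (simp add: divide_le_eq mult.commute)
  qed
  have "Cauchy (\<lambda>n. F (x n))"
  proof (rule metric_CauchyI)
    fix e :: real assume e: "e > 0"
    have "Cauchy (\<lambda>n. j (x n))" using x(2) by (intro convergent_Cauchy) (auto simp: convergent_def)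
    moreover have "0 < e / 2 / (K + 1)" using e K by simp
    ultimately obtain M where M: "\<And>m n. m \<ge> M \<Longrightarrow> n \<ge> M \<Longrightarrow> dist (j (x m)) (j (x n)) < e / 2 / (K + 1)"
      using metric_CauchyD[of "\<lambda>n. j (x n)"] by blast
    have "dist (F (x m)) (F (x n)) < e" if "m \<ge> M" "n \<ge> M" for m n
    proof -
      have "K * dist (j (x m)) (j (x n)) \<le> K * (e / 2 / (K + 1))"
        using M[OF that] \<open>K \<ge> 0\<close> by (intro mult_left_mono) auto
      then show ?thesis using lip[OF x(1) x(1), of m n] small[of "e / 2"] e by linarith
    qed
    then show "\<exists>M. \<forall>m\<ge>M. \<forall>n\<ge>M. dist (F (x m)) (F (x n)) < e" by blast
  qed
  from Cauchy_convergent[OF this] obtain L where L: "(\<lambda>n. F (x n)) \<longlonglongrightarrow> L" unfolding convergent_def by blast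
  have ev: "eventually P (j going_to nhds X within V) \<longleftrightarrow> (\<exists>d>0. \<forall>v\<in>V. dist (j v) X < d \<longrightarrow> P v)" for P
  proof
    assume "eventually P (j going_to nhds X within V)"
    then obtain Q where Q: "eventually Q (nhds X)" "\<And>v. Q (j v) \<Longrightarrow> v \<in> V \<Longrightarrow> P v"
      unfolding going_to_within_def eventually_inf_principal eventually_filtercomap by auto
    then obtain d where "d > 0" "\<And>y. dist y X < d \<Longrightarrow> Q y" unfolding eventually_nhds_metric by auto
    then show "\<exists>d>0. \<forall>v\<in>V. dist (j v) X < d \<longrightarrow> P v" using Q(2) by auto
  next
    assume "\<exists>d>0. \<forall>v\<in>V. dist (j v) X < d \<longrightarrow> P v"
    then obtain d where d: "d > 0" "\<And>v. v \<in> V \<Longrightarrow> dist (j v) X < d \<Longrightarrow> P v" by auto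
    have "eventually (\<lambda>y. dist y X < d) (nhds X)" unfolding eventually_nhds_metric using d(1) by auto
    then show "eventually P (j going_to nhds X within V)"
      unfolding going_to_within_def eventually_inf_principal eventually_filtercomap using d(2)
      by (intro exI[of _ "\<lambda>y. dist y X < d"]) auto
  qed
  have "j going_to nhds X within V \<noteq> bot"
  proof
    assume "j going_to nhds X within V = bot"
    then have "eventually (\<lambda>_. False) (j going_to nhds X within V)" by simp
    then obtain d where d: "d > 0" "\<And>v. v \<in> V \<Longrightarrow> \<not> dist (j v) X < d" unfolding ev by blast
    then show False using metric_LIMSEQ_D[OF x(2) d(1)] x(1) by blast
  qed
  moreover have "(F \<longlongrightarrow> L) (j going_to nhds X within V)"
  proof (rule tendstoI, unfold ev)
    fix e :: real assume e: "e > 0"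
    define d where "d = e / 3 / (K + 1)"
    have d: "d > 0" using e K by (simp add: d_def)
    show "\<exists>d>0. \<forall>v\<in>V. dist (j v) X < d \<longrightarrow> dist (F v) L < e"
    proof (intro exI[of _ d] conjI ballI impI d)
      fix v assume v: "v \<in> V" "dist (j v) X < d"
      have "\<forall>\<^sub>F n in sequentially. dist (j (x n)) X < d \<and> dist (F (x n)) L < e / 3"
        using tendstoD[OF x(2) d] tendstoD[OF L, of "e / 3"] e by (simp add: eventually_conj)
      then obtain n where n: "dist (j (x n)) X < d" "dist (F (x n)) L < e / 3"
        using eventually_happens trivial_limit_sequentially by blast
      have "dist (j v) (j (x n)) \<le> 2 * d" using dist_triangle2[of "j v" "j (x n)" X] v(2) n(1) by simp
      then have "K * dist (j v) (j (x n)) \<le> K * (2 * d)" using \<open>K \<ge> 0\<close> by (intro mult_left_mono) auto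
      moreover have "K * (2 * d) \<le> 2 * (e / 3)" using small[of "e / 3"] e by (simp add: d_def)
      ultimately have "dist (F v) (F (x n)) \<le> 2 * (e / 3)" using lip[OF v(1) x(1), of n] by linarith
      then show "dist (F v) L < e" using dist_triangle[of "F v" L "F (x n)"] n(2) by linarith
    qed
  qed
  ultimately have "cont_ext j V F X = L" unfolding cont_ext_def by (rule tendsto_Lim)
  then show ?thesis using L by simp
qed

lemma cont_ext_lim2:
  fixes j :: "'v \<Rightarrow> 'l::metric_space" and F :: "'v \<Rightarrow> 'v \<Rightarrow> 'b::complete_space"
  assumes lip: "\<And>x y x' y'. x \<in> V \<Longrightarrow> y \<in> V \<Longrightarrow> x' \<in> V \<Longrightarrow> y' \<in> V \<Longrightarrow>
      dist (F x y) (F x' y') \<le> K * (dist (j x) (j x') + dist (j y) (j y'))" and "K \<ge> 0"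
    and x: "\<And>n. x n \<in> V" "(\<lambda>n. j (x n)) \<longlonglongrightarrow> X" and y: "\<And>n. y n \<in> V" "(\<lambda>n. j (y n)) \<longlonglongrightarrow> Y"
  shows "(\<lambda>n. F (x n) (y n)) \<longlonglongrightarrow> cont_ext (\<lambda>(x, y). (j x, j y)) (V \<times> V) (\<lambda>(x, y). F x y) (X, Y)"
proof -
  have "(\<lambda>n. (\<lambda>(x, y). F x y) (x n, y n)) \<longlonglongrightarrow> cont_ext (\<lambda>(x, y). (j x, j y)) (V \<times> V) (\<lambda>(x, y). F x y) (X, Y)"
  \<comment> \<open>Each coordinate distance is at most the distance of the pairs, whence the factor
    2.\<close>
  proof (rule cont_ext_lim[where K = "2 * K"])
    fix p q assume pq: "p \<in> V \<times> V" "q \<in> V \<times> V"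
    obtain a b c d where ab: "p = (a, b)" "q = (c, d)" by (cases p, cases q)
    have "dist (j a) (j c) + dist (j b) (j d) \<le> 2 * dist (j a, j b) (j c, j d)"
      using dist_fst_le[of "(j a, j b)" "(j c, j d)"] dist_snd_le[of "(j a, j b)" "(j c, j d)"] by simp
    from mult_left_mono[OF this \<open>K \<ge> 0\<close>]
    show "dist ((\<lambda>(x, y). F x y) p) ((\<lambda>(x, y). F x y) q) \<le> 2 * K * dist ((\<lambda>(x, y). (j x, j y)) p) ((\<lambda>(x, y). (j x, j y)) q)"
      using lip[of a b c d] pq by (simp add: ab)
  qed (use x y \<open>K \<ge> 0\<close> in \<open>auto intro!: tendsto_Pair\<close>)
  then show ?thesis by simp
qed

definition trunc :: "nat \<Rightarrow> real \<Rightarrow> real" where "trunc N x = max (min x (real N)) (- real N)"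

lemma abs_trunc_le: "\<bar>trunc N x\<bar> \<le> real N" and abs_trunc_le_abs: "\<bar>trunc N x\<bar> \<le> \<bar>x\<bar>"
  and trunc_nonexpansive: "\<bar>trunc N x - trunc N y\<bar> \<le> \<bar>x - y\<bar>"
  and trunc_id: "\<bar>x\<bar> \<le> real N \<Longrightarrow> trunc N x = x"
  unfolding trunc_def by (auto simp: max_def min_def)

text \<open>\<open>trunc N\<close> is the nearest point projection onto \<open>[-N, N]\<close>, to
  which \<open>y\<close> belongs.\<close>

lemma trunc_error: "\<bar>y\<bar> \<le> real N \<Longrightarrow> \<bar>x - trunc N x\<bar> \<le> \<bar>x - y\<bar>"
  unfolding trunc_def by (auto simp: max_def min_def)

text \<open>The two truncations do not differ in sign, so their difference is at most their sum in
  modulus. Convergence of truncated squares in \<open>E[|X|]\<close> thereby controls second moments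
  of differences.\<close>

lemma trunc_square_diff:
  assumes "N \<le> M" shows "(trunc M x - trunc N x)\<^sup>2 \<le> \<bar>(trunc M x)\<^sup>2 - (trunc N x)\<^sup>2\<bar>"
proof -
  have "\<bar>trunc M x - trunc N x\<bar> \<le> \<bar>trunc M x + trunc N x\<bar>"
    using assms unfolding trunc_def by (auto simp: max_def min_def)
  then have "\<bar>trunc M x - trunc N x\<bar> * \<bar>trunc M x - trunc N x\<bar> \<le> \<bar>trunc M x + trunc N x\<bar> * \<bar>trunc M x - trunc N x\<bar>"
    by (intro mult_right_mono) auto
  also have "\<dots> = \<bar>(trunc M x)\<^sup>2 - (trunc N x)\<^sup>2\<bar>" by (simp add: abs_mult[symmetric] power2_eq_square algebra_simps)
  finally show ?thesis by (simp add: power2_eq_square)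
qed

lemma closure_image_sequence:
  fixes f :: "'a \<Rightarrow> 'b::metric_space"
  assumes "X \<in> closure (f ` V)"
  obtains x where "\<And>n. x n \<in> V" "(\<lambda>n. f (x n)) \<longlonglongrightarrow> X"
proof -
  obtain y where y: "\<forall>n. y n \<in> f ` V" "y \<longlonglongrightarrow> X" using assms unfolding closure_sequential by blast
  have "\<exists>u. u \<in> V \<and> y n = f u" for n using y(1) by auto
  then obtain x where x: "\<And>n. x n \<in> V" "\<And>n. y n = f (x n)" by metis
  have "y = (\<lambda>n. f (x n))" using x(2) by auto
  then show ?thesis using that[of x] x(1) y(2) by simp
qed

section \<open>Operations on the completion and their limits\<close>

locale G_expectation =
  fixes \<sigma>\<^sub>0 :: real and j :: "(cpath \<Rightarrow> real) \<Rightarrow> 'l::banach"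
  assumes \<sigma>: "0 \<le> \<sigma>\<^sub>0" "\<sigma>\<^sub>0 \<le> 1" and LG1: "is_LG1 \<sigma>\<^sub>0 j"
begin

abbreviation E where "E \<equiv> gexp \<sigma>\<^sub>0"
abbreviation RV where "RV \<equiv> rvs {0..}"

lemmas E_mono = gexp_mono[OF \<sigma>] and E_add_le = gexp_add_le[OF \<sigma>] and E_scale = gexp_scale[OF \<sigma>]
  and E_const = gexp_const[OF \<sigma>]

lemma j_linear: "X \<in> RV \<Longrightarrow> Y \<in> RV \<Longrightarrow> j (\<lambda>\<omega>. a * X \<omega> + b * Y \<omega>) = a *\<^sub>R j X + b *\<^sub>R j Y"
  and norm_j: "X \<in> RV \<Longrightarrow> norm (j X) = E (\<lambda>\<omega>. \<bar>X \<omega>\<bar>)"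
  and closure_j: "closure (j ` RV) = UNIV"
  using LG1 unfolding is_LG1_def is_completion_def Lip_all_eq_rvs by auto

lemma j_diff: "X \<in> RV \<Longrightarrow> Y \<in> RV \<Longrightarrow> j (\<lambda>\<omega>. X \<omega> - Y \<omega>) = j X - j Y"
  using j_linear[of X Y 1 "-1"] by simp

lemma j_add: "X \<in> RV \<Longrightarrow> Y \<in> RV \<Longrightarrow> j (\<lambda>\<omega>. X \<omega> + Y \<omega>) = j X + j Y"
  using j_linear[of X Y 1 1] by simp

lemma dist_j: "X \<in> RV \<Longrightarrow> Y \<in> RV \<Longrightarrow> dist (j X) (j Y) = E (\<lambda>\<omega>. \<bar>X \<omega> - Y \<omega>\<bar>)"
  by (simp add: dist_norm j_diff[symmetric] norm_j rvs_diff)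

lemma E_nonneg: "X \<in> RV \<Longrightarrow> (\<And>\<omega>. 0 \<le> X \<omega>) \<Longrightarrow> 0 \<le> E X"
  using E_mono[OF rvs_const, of X 0] by (simp add: E_const)

lemma E_diff_le:
  assumes "X \<in> RV" "Y \<in> RV" shows "\<bar>E X - E Y\<bar> \<le> E (\<lambda>\<omega>. \<bar>X \<omega> - Y \<omega>\<bar>)"
proof -
  have "E X \<le> E Y + E (\<lambda>\<omega>. \<bar>X \<omega> - Y \<omega>\<bar>)" if "X \<in> RV" "Y \<in> RV" for X Y
  proof -
    have "E X \<le> E (\<lambda>\<omega>. Y \<omega> + \<bar>X \<omega> - Y \<omega>\<bar>)"
      by (intro E_mono rvs_add rvs_abs rvs_diff that) linarith
    also have "\<dots> \<le> E Y + E (\<lambda>\<omega>. \<bar>X \<omega> - Y \<omega>\<bar>)" by (intro E_add_le rvs_abs rvs_diff that)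
    finally show ?thesis .
  qed
  from this[OF assms] this[OF assms(2,1)] show ?thesis by (simp add: abs_le_iff abs_minus_commute)
qed

text \<open>A pointwise Lipschitz estimate becomes one in the norm by monotonicity and sublinearity;
  in this form it feeds the limit rules.\<close>

lemma dist_j_le:
  assumes "X \<in> RV" "Y \<in> RV" "U \<in> RV" "W \<in> RV" "X' \<in> RV" "Y' \<in> RV" "K \<ge> 0"
    and "\<And>\<omega>. \<bar>U \<omega> - W \<omega>\<bar> \<le> K * (\<bar>X \<omega> - X' \<omega>\<bar> + \<bar>Y \<omega> - Y' \<omega>\<bar>)"
  shows "dist (j U) (j W) \<le> K * (dist (j X) (j X') + dist (j Y) (j Y'))"
proof -
  note r = rvs_abs[OF rvs_diff[OF assms(1,5)]] rvs_abs[OF rvs_diff[OF assms(2,6)]]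
  have "dist (j U) (j W) \<le> E (\<lambda>\<omega>. K * (\<bar>X \<omega> - X' \<omega>\<bar> + \<bar>Y \<omega> - Y' \<omega>\<bar>))"
    unfolding dist_j[OF assms(3,4)] by (intro E_mono rvs_abs rvs_diff rvs_scale rvs_add assms)
  also have "\<dots> = K * E (\<lambda>\<omega>. \<bar>X \<omega> - X' \<omega>\<bar> + \<bar>Y \<omega> - Y' \<omega>\<bar>)" by (rule E_scale[OF rvs_add[OF r] assms(7)])
  also have "\<dots> \<le> K * (E (\<lambda>\<omega>. \<bar>X \<omega> - X' \<omega>\<bar>) + E (\<lambda>\<omega>. \<bar>Y \<omega> - Y' \<omega>\<bar>))"
    by (intro mult_left_mono E_add_le r assms)
  finally show ?thesis by (simp add: dist_j assms)
qed

lemma LE_lim: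
  assumes "\<And>n. x n \<in> RV" "(\<lambda>n. j (x n)) \<longlonglongrightarrow> X" shows "(\<lambda>n. E (x n)) \<longlonglongrightarrow> LE \<sigma>\<^sub>0 j X"
  unfolding LE_def Lip_all_eq_rvs
  by (rule cont_ext_lim[where K = 1]) (use assms E_diff_le in \<open>auto simp: dist_j dist_real_def\<close>)

lemma Lsup_lim:
  assumes x: "\<And>n. x n \<in> RV" "(\<lambda>n. j (x n)) \<longlonglongrightarrow> X" and y: "\<And>n. y n \<in> RV" "(\<lambda>n. j (y n)) \<longlonglongrightarrow> Y"
  shows "(\<lambda>n. j (\<lambda>\<omega>. max (x n \<omega>) (y n \<omega>))) \<longlonglongrightarrow> Lsup j X Y"
  unfolding Lsup_def Lip_all_eq_rvs
proof (rule cont_ext_lim2[where F = "\<lambda>x y. j (\<lambda>\<omega>. max (x \<omega>) (y \<omega>))" and K = 1 and x = x and y = y, OF _ _ x y])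
  fix x y x' y' :: "cpath \<Rightarrow> real" assume r: "x \<in> RV" "y \<in> RV" "x' \<in> RV" "y' \<in> RV"
  show "dist (j (\<lambda>\<omega>. max (x \<omega>) (y \<omega>))) (j (\<lambda>\<omega>. max (x' \<omega>) (y' \<omega>))) \<le> 1 * (dist (j x) (j x') + dist (j y) (j y'))"
    by (intro dist_j_le rvs_max r) (auto simp: max_def)
qed simp

lemma Linf_lim:
  assumes x: "\<And>n. x n \<in> RV" "(\<lambda>n. j (x n)) \<longlonglongrightarrow> X" and y: "\<And>n. y n \<in> RV" "(\<lambda>n. j (y n)) \<longlonglongrightarrow> Y"
  shows "(\<lambda>n. j (\<lambda>\<omega>. min (x n \<omega>) (y n \<omega>))) \<longlonglongrightarrow> Linf j X Y"
  unfolding Linf_def Lip_all_eq_rvs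
proof (rule cont_ext_lim2[where F = "\<lambda>x y. j (\<lambda>\<omega>. min (x \<omega>) (y \<omega>))" and K = 1 and x = x and y = y, OF _ _ x y])
  fix x y x' y' :: "cpath \<Rightarrow> real" assume r: "x \<in> RV" "y \<in> RV" "x' \<in> RV" "y' \<in> RV"
  show "dist (j (\<lambda>\<omega>. min (x \<omega>) (y \<omega>))) (j (\<lambda>\<omega>. min (x' \<omega>) (y' \<omega>))) \<le> 1 * (dist (j x) (j x') + dist (j y) (j y'))"
    by (intro dist_j_le rvs_min r) (auto simp: min_def)
qed simp

lemma rvs_trunc: "X \<in> rvs I \<Longrightarrow> (\<lambda>\<omega>. trunc N (X \<omega>)) \<in> rvs I"
  unfolding trunc_def by (intro rvs_max rvs_min rvs_const)

lemma Ltrunc_lim: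
  assumes x: "\<And>n. x n \<in> RV" "(\<lambda>n. j (x n)) \<longlonglongrightarrow> X"
  shows "(\<lambda>n. j (\<lambda>\<omega>. trunc N (x n \<omega>))) \<longlonglongrightarrow> Ltrunc j N X"
  unfolding trunc_def Ltrunc_def
  by (intro Lsup_lim Linf_lim x rvs_min rvs_const tendsto_const)

lemma Lip_bdd_trunc: "X \<in> RV \<Longrightarrow> (\<lambda>\<omega>. trunc N (X \<omega>)) \<in> Lip_bdd N"
  by (simp add: Lip_bdd_def Lip_all_eq_rvs rvs_trunc abs_trunc_le)

lemma bdd_mult_lim:
  assumes x: "\<And>n. x n \<in> Lip_bdd N" "(\<lambda>n. j (x n)) \<longlonglongrightarrow> X" and y: "\<And>n. y n \<in> Lip_bdd N" "(\<lambda>n. j (y n)) \<longlonglongrightarrow> Y"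
  shows "(\<lambda>n. j (\<lambda>\<omega>. x n \<omega> * y n \<omega>)) \<longlonglongrightarrow> bdd_mult j N X Y"
  unfolding bdd_mult_def
proof (rule cont_ext_lim2[where F = "\<lambda>x y. j (\<lambda>\<omega>. x \<omega> * y \<omega>)" and K = "real N" and x = x and y = y, OF _ _ x y])
  fix x y x' y' :: "cpath \<Rightarrow> real" assume r: "x \<in> Lip_bdd N" "y \<in> Lip_bdd N" "x' \<in> Lip_bdd N" "y' \<in> Lip_bdd N"
  have RV: "x \<in> RV" "y \<in> RV" "x' \<in> RV" "y' \<in> RV" and b: "\<And>\<omega>. \<bar>y \<omega>\<bar> \<le> real N" "\<And>\<omega>. \<bar>x' \<omega>\<bar> \<le> real N"
    using r by (auto simp: Lip_bdd_def Lip_all_eq_rvs)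
  have "\<bar>x \<omega> * y \<omega> - x' \<omega> * y' \<omega>\<bar> \<le> real N * (\<bar>x \<omega> - x' \<omega>\<bar> + \<bar>y \<omega> - y' \<omega>\<bar>)" for \<omega>
  proof -
    have "\<bar>x \<omega> * y \<omega> - x' \<omega> * y' \<omega>\<bar> = \<bar>(x \<omega> - x' \<omega>) * y \<omega> + x' \<omega> * (y \<omega> - y' \<omega>)\<bar>" by (simp add: algebra_simps)
    also have "\<dots> \<le> \<bar>x \<omega> - x' \<omega>\<bar> * \<bar>y \<omega>\<bar> + \<bar>x' \<omega>\<bar> * \<bar>y \<omega> - y' \<omega>\<bar>" by (metis abs_mult abs_triangle_ineq)
    also have "\<dots> \<le> \<bar>x \<omega> - x' \<omega>\<bar> * real N + real N * \<bar>y \<omega> - y' \<omega>\<bar>" by (intro add_mono mult_mono b) auto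
    finally show ?thesis by (simp add: algebra_simps)
  qed
  then show "dist (j (\<lambda>\<omega>. x \<omega> * y \<omega>)) (j (\<lambda>\<omega>. x' \<omega> * y' \<omega>)) \<le> real N * (dist (j x) (j x') + dist (j y) (j y'))"
    by (intro dist_j_le rvs_mult RV) auto
qed simp

lemma abs_powr_2: "\<bar>x :: real\<bar> powr 2 = x\<^sup>2"
  by (cases "x = 0") (simp_all add: powr_numeral)

lemma bdd_pow_lim:
  assumes x: "\<And>n. x n \<in> Lip_bdd N" "(\<lambda>n. j (x n)) \<longlonglongrightarrow> X"
  shows "(\<lambda>n. j (\<lambda>\<omega>. (x n \<omega>)\<^sup>2)) \<longlonglongrightarrow> bdd_pow j 2 N X"
  unfolding bdd_pow_def abs_powr_2
proof (rule cont_ext_lim[where F = "\<lambda>x. j (\<lambda>\<omega>. (x \<omega>)\<^sup>2)" and K = "2 * real N" and x = x, OF _ _ x])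
  fix x x' :: "cpath \<Rightarrow> real" assume r: "x \<in> Lip_bdd N" "x' \<in> Lip_bdd N"
  have RV: "x \<in> RV" "x' \<in> RV" and b: "\<And>\<omega>. \<bar>x \<omega>\<bar> \<le> real N" "\<And>\<omega>. \<bar>x' \<omega>\<bar> \<le> real N"
    using r by (auto simp: Lip_bdd_def Lip_all_eq_rvs)
  have "\<bar>(x \<omega>)\<^sup>2 - (x' \<omega>)\<^sup>2\<bar> \<le> real N * (\<bar>x \<omega> - x' \<omega>\<bar> + \<bar>x \<omega> - x' \<omega>\<bar>)" for \<omega>
  proof -
    have "\<bar>(x \<omega>)\<^sup>2 - (x' \<omega>)\<^sup>2\<bar> = \<bar>x \<omega> + x' \<omega>\<bar> * \<bar>x \<omega> - x' \<omega>\<bar>" by (simp add: abs_mult[symmetric] power2_eq_square algebra_simps)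
    also have "\<dots> \<le> (2 * real N) * \<bar>x \<omega> - x' \<omega>\<bar>" using b[of \<omega>] by (intro mult_right_mono) linarith+
    finally show ?thesis by simp
  qed
  then have "dist (j (\<lambda>\<omega>. (x \<omega>)\<^sup>2)) (j (\<lambda>\<omega>. (x' \<omega>)\<^sup>2)) \<le> real N * (dist (j x) (j x') + dist (j x) (j x'))"
    by (intro dist_j_le rvs_power2 RV) auto
  then show "dist (j (\<lambda>\<omega>. (x \<omega>)\<^sup>2)) (j (\<lambda>\<omega>. (x' \<omega>)\<^sup>2)) \<le> 2 * real N * dist (j x) (j x')" by simp
qed simp

section \<open>Square integrable elements\<close>

definition n2 :: "(cpath \<Rightarrow> real) \<Rightarrow> real" where "n2 x = sqrt (E (\<lambda>\<omega>. (x \<omega>)\<^sup>2))"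

lemma E_square_nonneg: "x \<in> RV \<Longrightarrow> 0 \<le> E (\<lambda>\<omega>. (x \<omega>)\<^sup>2)"
  by (intro E_nonneg rvs_power2) auto

lemma n2_nonneg: "x \<in> RV \<Longrightarrow> 0 \<le> n2 x" and n2_square: "x \<in> RV \<Longrightarrow> (n2 x)\<^sup>2 = E (\<lambda>\<omega>. (x \<omega>)\<^sup>2)"
  using E_square_nonneg[of x] by (simp_all add: n2_def)

lemma n2_mono: "x \<in> RV \<Longrightarrow> y \<in> RV \<Longrightarrow> (\<And>\<omega>. \<bar>x \<omega>\<bar> \<le> \<bar>y \<omega>\<bar>) \<Longrightarrow> n2 x \<le> n2 y"
  unfolding n2_def by (intro real_sqrt_le_mono E_mono rvs_power2) (auto simp: abs_le_square_iff)

lemma n2_scale: assumes "x \<in> RV" shows "n2 (\<lambda>\<omega>. c * x \<omega>) = \<bar>c\<bar> * n2 x"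
proof -
  have "E (\<lambda>\<omega>. (c * x \<omega>)\<^sup>2) = c\<^sup>2 * E (\<lambda>\<omega>. (x \<omega>)\<^sup>2)"
    using E_scale[OF rvs_power2[OF assms], of "c\<^sup>2"] by (simp add: power_mult_distrib)
  then show ?thesis by (simp add: n2_def real_sqrt_mult)
qed

lemma n2_commute: "n2 (\<lambda>\<omega>. x \<omega> - y \<omega>) = n2 (\<lambda>\<omega>. y \<omega> - x \<omega>)"
  by (simp add: n2_def power2_commute)

text \<open>\<open>2 * r * \<bar>x * y\<bar> \<le> r\<^sup>2 * x\<^sup>2 + y\<^sup>2\<close> for
  every \<open>r > 0\<close>, with expectations taken by sublinearity. The optimal \<open>r\<close>
  is \<open>n2 y / n2 x\<close>; adding a small \<open>d\<close> to both avoids a division by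
  zero.\<close>

lemma Cauchy_Schwarz:
  assumes x: "x \<in> RV" and y: "y \<in> RV" shows "E (\<lambda>\<omega>. \<bar>x \<omega> * y \<omega>\<bar>) \<le> n2 x * n2 y"
proof (rule field_le_epsilon)
  have amgm: "E (\<lambda>\<omega>. \<bar>x \<omega> * y \<omega>\<bar>) \<le> (r * (n2 x)\<^sup>2 + (n2 y)\<^sup>2 / r) / 2" if r: "r > 0" for r
  proof -
    have p: "\<bar>x \<omega> * y \<omega>\<bar> \<le> r / 2 * (x \<omega>)\<^sup>2 + 1 / (2 * r) * (y \<omega>)\<^sup>2" for \<omega>
    proof -
      have "0 \<le> (r * \<bar>x \<omega>\<bar> - \<bar>y \<omega>\<bar>)\<^sup>2" by simp
      then have "2 * r * \<bar>x \<omega> * y \<omega>\<bar> \<le> r * r * (x \<omega>)\<^sup>2 + (y \<omega>)\<^sup>2"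
        by (simp add: power2_diff power_mult_distrib abs_mult power2_eq_square[of r])
      then show ?thesis using r by (simp add: field_simps)
    qed
    note sx = rvs_scale[OF rvs_power2[OF x], of "r / 2"] and sy = rvs_scale[OF rvs_power2[OF y], of "1 / (2 * r)"]
    have "E (\<lambda>\<omega>. \<bar>x \<omega> * y \<omega>\<bar>) \<le> E (\<lambda>\<omega>. r / 2 * (x \<omega>)\<^sup>2 + 1 / (2 * r) * (y \<omega>)\<^sup>2)"
      by (intro E_mono rvs_abs rvs_mult x y rvs_add[OF sx sy] p)
    also have "\<dots> \<le> E (\<lambda>\<omega>. r / 2 * (x \<omega>)\<^sup>2) + E (\<lambda>\<omega>. 1 / (2 * r) * (y \<omega>)\<^sup>2)" by (rule E_add_le[OF sx sy])
    also have "\<dots> = r / 2 * (n2 x)\<^sup>2 + 1 / (2 * r) * (n2 y)\<^sup>2"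
      using r E_scale[OF rvs_power2[OF x], of "r / 2"] E_scale[OF rvs_power2[OF y], of "1 / (2 * r)"]
      by (simp only: n2_square[OF x] n2_square[OF y]) simp
    finally show ?thesis using r by (simp add: field_simps)
  qed
  fix e :: real assume e: "e > 0"
  define a b where "a = n2 x" and "b = n2 y"
  have ab: "a \<ge> 0" "b \<ge> 0" using n2_nonneg x y by (auto simp: a_def b_def)
  define d where "d = min 1 (e / (a + b + 1))"
  have d: "d > 0" "d * (a + b + 1) \<le> e" "d \<le> 1"
  proof -
    show "d > 0" "d \<le> 1" using e ab by (auto simp: d_def)
    have "d \<le> e / (a + b + 1)" by (simp add: d_def)
    then show "d * (a + b + 1) \<le> e" using ab by (simp add: pos_le_divide_eq)
  qed
  define r where "r = (b + d) / (a + d)"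
  have r: "r > 0" using ab d by (simp add: r_def)
  have "r * a\<^sup>2 \<le> (b + d) * (a + d)"
  proof -
    have "r * a\<^sup>2 \<le> r * (a + d)\<^sup>2" using ab d r by (intro mult_left_mono power_mono) auto
    also have "\<dots> = (b + d) * (a + d)" using ab d by (simp add: r_def power2_eq_square)
    finally show ?thesis .
  qed
  moreover have "b\<^sup>2 / r \<le> (b + d) * (a + d)"
  proof -
    have "b\<^sup>2 / r \<le> (b + d)\<^sup>2 / r" using ab d r by (intro divide_right_mono power_mono) auto
    also have "\<dots> = (b + d) * (a + d)" using ab d by (simp add: r_def power2_eq_square)
    finally show ?thesis .
  qed
  ultimately have "E (\<lambda>\<omega>. \<bar>x \<omega> * y \<omega>\<bar>) \<le> (b + d) * (a + d)" using amgm[OF r] by (simp add: a_def b_def)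
  also have "\<dots> = a * b + d * (a + b + d)" by (simp add: algebra_simps)
  also have "\<dots> \<le> a * b + d * (a + b + 1)" using d ab by (intro add_left_mono mult_left_mono) auto
  finally show "E (\<lambda>\<omega>. \<bar>x \<omega> * y \<omega>\<bar>) \<le> n2 x * n2 y + e" using d(2) by (simp add: a_def b_def)
qed

lemma n2_triangle:
  assumes x: "x \<in> RV" and y: "y \<in> RV" shows "n2 (\<lambda>\<omega>. x \<omega> + y \<omega>) \<le> n2 x + n2 y"
proof -
  note xy = rvs_abs[OF rvs_mult[OF x y]] and s = rvs_power2[OF x] rvs_power2[OF y]
  note xy2 = rvs_scale[OF xy, of 2]
  have "E (\<lambda>\<omega>. (x \<omega> + y \<omega>)\<^sup>2) \<le> E (\<lambda>\<omega>. ((x \<omega>)\<^sup>2 + (y \<omega>)\<^sup>2) + 2 * \<bar>x \<omega> * y \<omega>\<bar>)"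
  proof (intro E_mono rvs_power2 rvs_add x y xy2)
    show "(x \<omega> + y \<omega>)\<^sup>2 \<le> ((x \<omega>)\<^sup>2 + (y \<omega>)\<^sup>2) + 2 * \<bar>x \<omega> * y \<omega>\<bar>" for \<omega>
      unfolding power2_sum using abs_ge_self[of "x \<omega> * y \<omega>"] by (simp add: mult.assoc)
  qed
  also have "\<dots> \<le> E (\<lambda>\<omega>. (x \<omega>)\<^sup>2 + (y \<omega>)\<^sup>2) + E (\<lambda>\<omega>. 2 * \<bar>x \<omega> * y \<omega>\<bar>)" by (rule E_add_le[OF rvs_add[OF s] xy2])
  also have "\<dots> \<le> (E (\<lambda>\<omega>. (x \<omega>)\<^sup>2) + E (\<lambda>\<omega>. (y \<omega>)\<^sup>2)) + 2 * E (\<lambda>\<omega>. \<bar>x \<omega> * y \<omega>\<bar>)"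
    using E_add_le[OF s] by (simp add: E_scale[OF xy])
  also have "\<dots> \<le> (n2 x)\<^sup>2 + (n2 y)\<^sup>2 + 2 * (n2 x * n2 y)"
    using Cauchy_Schwarz[OF x y] by (simp add: n2_square x y)
  also have "\<dots> = (n2 x + n2 y)\<^sup>2" by (simp add: power2_sum)
  finally show ?thesis unfolding n2_def[of "\<lambda>\<omega>. x \<omega> + y \<omega>"] using n2_nonneg[OF x] n2_nonneg[OF y] by (intro real_le_lsqrt) auto
qed

lemma n2_triangle_diff:
  assumes "x \<in> RV" "y \<in> RV" "z \<in> RV"
  shows "n2 (\<lambda>\<omega>. x \<omega> - z \<omega>) \<le> n2 (\<lambda>\<omega>. x \<omega> - y \<omega>) + n2 (\<lambda>\<omega>. y \<omega> - z \<omega>)"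
  using n2_triangle[OF rvs_diff[OF assms(1,2)] rvs_diff[OF assms(2,3)]] by simp

lemma E_abs_le_n2: assumes "x \<in> RV" shows "E (\<lambda>\<omega>. \<bar>x \<omega>\<bar>) \<le> n2 x"
  using Cauchy_Schwarz[OF assms rvs_const[of 1]] by (simp add: n2_def E_const)

lemma norm_j_le_n2: "x \<in> RV \<Longrightarrow> norm (j x) \<le> n2 x"
  by (simp add: norm_j E_abs_le_n2)

lemma dist_j_mult:
  assumes r: "x \<in> RV" "y \<in> RV" "x' \<in> RV" "y' \<in> RV"
  shows "dist (j (\<lambda>\<omega>. x \<omega> * y \<omega>)) (j (\<lambda>\<omega>. x' \<omega> * y' \<omega>))
    \<le> n2 (\<lambda>\<omega>. x \<omega> - x' \<omega>) * n2 y + n2 x' * n2 (\<lambda>\<omega>. y \<omega> - y' \<omega>)"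
proof -
  note d = rvs_diff[OF r(1,3)] rvs_diff[OF r(2,4)]
  note m = rvs_abs[OF rvs_mult[OF d(1) r(2)]] rvs_abs[OF rvs_mult[OF r(3) d(2)]]
  have "dist (j (\<lambda>\<omega>. x \<omega> * y \<omega>)) (j (\<lambda>\<omega>. x' \<omega> * y' \<omega>))
      \<le> E (\<lambda>\<omega>. \<bar>(x \<omega> - x' \<omega>) * y \<omega>\<bar> + \<bar>x' \<omega> * (y \<omega> - y' \<omega>)\<bar>)"
    unfolding dist_j[OF rvs_mult[OF r(1,2)] rvs_mult[OF r(3,4)]]
  proof (intro E_mono rvs_abs rvs_diff rvs_mult r rvs_add[OF m])
    fix \<omega>
    have "x \<omega> * y \<omega> - x' \<omega> * y' \<omega> = (x \<omega> - x' \<omega>) * y \<omega> + x' \<omega> * (y \<omega> - y' \<omega>)" by (simp add: algebra_simps)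
    then show "\<bar>x \<omega> * y \<omega> - x' \<omega> * y' \<omega>\<bar> \<le> \<bar>(x \<omega> - x' \<omega>) * y \<omega>\<bar> + \<bar>x' \<omega> * (y \<omega> - y' \<omega>)\<bar>"
      by (simp only: abs_triangle_ineq)
  qed
  also have "\<dots> \<le> E (\<lambda>\<omega>. \<bar>(x \<omega> - x' \<omega>) * y \<omega>\<bar>) + E (\<lambda>\<omega>. \<bar>x' \<omega> * (y \<omega> - y' \<omega>)\<bar>)" by (rule E_add_le[OF m])
  also have "\<dots> \<le> n2 (\<lambda>\<omega>. x \<omega> - x' \<omega>) * n2 y + n2 x' * n2 (\<lambda>\<omega>. y \<omega> - y' \<omega>)"
    by (intro add_mono Cauchy_Schwarz d r)
  finally show ?thesis .
qed

text \<open>A sequence of cylinder variables up to time \<open>T\<close> that represents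
  \<open>X\<close> and is Cauchy for second moments. For \<open>T \<ge> 0\<close> such sequences
  exist exactly for the elements of \<open>LGp j 2 T\<close>; along them products and squares are
  computed termwise, without truncations.\<close>

definition L2app :: "real \<Rightarrow> (nat \<Rightarrow> cpath \<Rightarrow> real) \<Rightarrow> 'l \<Rightarrow> bool" where
  "L2app T x X \<longleftrightarrow> (\<forall>n. x n \<in> rvs {0..T}) \<and> (\<forall>e>0. \<exists>N. \<forall>m\<ge>N. \<forall>n\<ge>N. n2 (\<lambda>\<omega>. x m \<omega> - x n \<omega>) < e) \<and>
     (\<lambda>n. j (x n)) \<longlonglongrightarrow> X"

lemma rvs_RV: "X \<in> rvs {0..T} \<Longrightarrow> X \<in> RV"
  using rvs_mono[of "{0..T}" "{0..}"] by auto

lemma L2appD: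
  assumes "L2app T x X"
  shows "x n \<in> rvs {0..T}" "x n \<in> RV" "e > 0 \<Longrightarrow> \<exists>N. \<forall>m\<ge>N. \<forall>n\<ge>N. n2 (\<lambda>\<omega>. x m \<omega> - x n \<omega>) < e" "(\<lambda>n. j (x n)) \<longlonglongrightarrow> X"
  using assms rvs_RV unfolding L2app_def by blast+

lemma L2app_CauchyE:
  assumes "L2app T x X" "e > 0"
  obtains N where "\<And>m n. m \<ge> N \<Longrightarrow> n \<ge> N \<Longrightarrow> n2 (\<lambda>\<omega>. x m \<omega> - x n \<omega>) < e"
proof -
  obtain N where "\<forall>m\<ge>N. \<forall>n\<ge>N. n2 (\<lambda>\<omega>. x m \<omega> - x n \<omega>) < e" using L2appD(3)[OF assms] ..
  then show ?thesis using that[of N] by simp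
qed

lemma L2app_mono: "L2app S x X \<Longrightarrow> S \<le> T \<Longrightarrow> L2app T x X"
  using rvs_mono[of "{0..S}" "{0..T}"] unfolding L2app_def by auto

lemma L2app_const: "x \<in> rvs {0..T} \<Longrightarrow> L2app T (\<lambda>_. x) (j x)"
  unfolding L2app_def by (auto simp: n2_def E_const)

lemma L2app_bounded:
  assumes "L2app T x X" obtains C where "\<And>n. n2 (x n) \<le> C" "C \<ge> 0"
proof -
  note D = L2appD[OF assms]
  obtain N where N: "\<And>m n. m \<ge> N \<Longrightarrow> n \<ge> N \<Longrightarrow> n2 (\<lambda>\<omega>. x m \<omega> - x n \<omega>) < 1"
    using L2app_CauchyE[OF assms zero_less_one] by metis
  define C where "C = (\<Sum>i\<le>N. n2 (x i)) + 1"
  have le: "n2 (x i) \<le> (\<Sum>i\<le>N. n2 (x i))" if "i \<le> N" for i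
    using that by (intro member_le_sum) (auto simp: n2_nonneg D(2))
  have "n2 (x n) \<le> C" for n
  proof (cases "n \<le> N")
    case False
    then have "n2 (x n) \<le> n2 (\<lambda>\<omega>. x n \<omega> - x N \<omega>) + n2 (x N)"
      using n2_triangle[OF rvs_diff[OF D(2) D(2)] D(2), of n N N] by simp
    then show ?thesis using N[of n N] le[of N] False by (simp add: C_def)
  qed (use le[of n] in \<open>simp add: C_def\<close>)
  moreover have "C \<ge> 0" unfolding C_def by (intro add_nonneg_nonneg sum_nonneg n2_nonneg D(2)) simp
  ultimately show ?thesis using that by blast
qed

text \<open>The error is uniform in \<open>n\<close>: up to some \<open>m\<close> the variables are
  bounded, and for later \<open>n\<close> truncation moves \<open>x n\<close> no further than to the
  bounded variable \<open>x m\<close>.\<close>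

lemma L2app_trunc:
  assumes "L2app T x X" "e > 0"
  obtains N0 where "\<And>N n. N \<ge> N0 \<Longrightarrow> n2 (\<lambda>\<omega>. x n \<omega> - trunc N (x n \<omega>)) \<le> e"
proof -
  note D = L2appD[OF assms(1)]
  obtain m where m: "\<And>k n. k \<ge> m \<Longrightarrow> n \<ge> m \<Longrightarrow> n2 (\<lambda>\<omega>. x k \<omega> - x n \<omega>) < e"
    using L2app_CauchyE[OF assms] by metis
  have "\<exists>B. \<forall>\<omega>. \<bar>x i \<omega>\<bar> \<le> B" for i using rvs_bounded[OF D(2)[of i]] by metis
  then obtain B where B: "\<And>i \<omega>. \<bar>x i \<omega>\<bar> \<le> B i" by metis
  obtain N0 :: nat where N0: "(\<Sum>i\<le>m. \<bar>B i\<bar>) \<le> real N0" using real_arch_simple by blast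
  have bd: "\<bar>x i \<omega>\<bar> \<le> real N" if "i \<le> m" "N \<ge> N0" for i N \<omega>
  proof -
    have "\<bar>B i\<bar> \<le> (\<Sum>i\<le>m. \<bar>B i\<bar>)" using that by (intro member_le_sum) auto
    then show ?thesis using B[of i \<omega>] N0 that(2) by linarith
  qed
  have "n2 (\<lambda>\<omega>. x n \<omega> - trunc N (x n \<omega>)) \<le> e" if N: "N \<ge> N0" for N n
  proof (cases "n \<le> m")
    case True
    then have "n2 (\<lambda>\<omega>. x n \<omega> - trunc N (x n \<omega>)) = 0" using bd[OF True N] by (simp add: trunc_id n2_def E_const)
    then show ?thesis using assms(2) by simp
  next
    case False
    have "n2 (\<lambda>\<omega>. x n \<omega> - trunc N (x n \<omega>)) \<le> n2 (\<lambda>\<omega>. x n \<omega> - x m \<omega>)"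
      by (intro n2_mono rvs_diff rvs_trunc D(2) trunc_error bd N) auto
    then show ?thesis using m[of n m] False by simp
  qed
  then show ?thesis using that by blast
qed

text \<open>Two limits are exchanged, along the sequences and in the truncation level; the
  truncation error is uniform along the sequences, which justifies it.\<close>

lemma L2app_Lmult:
  assumes x: "L2app S x X" and y: "L2app T y Y"
  shows "(\<lambda>n. j (\<lambda>\<omega>. x n \<omega> * y n \<omega>)) \<longlonglongrightarrow> Lmult j X Y"
    and "(\<lambda>N. bdd_mult j N (Ltrunc j N X) (Ltrunc j N Y)) \<longlonglongrightarrow> Lmult j X Y"
proof -
  note Dx = L2appD[OF x] and Dy = L2appD[OF y]
  obtain Cx where Cx: "\<And>n. n2 (x n) \<le> Cx" "Cx \<ge> 0" using L2app_bounded[OF x] by metis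
  obtain Cy where Cy: "\<And>n. n2 (y n) \<le> Cy" "Cy \<ge> 0" using L2app_bounded[OF y] by metis
  define C where "C = Cx + Cy + 1"
  have C: "C > 0" using Cx(2) Cy(2) by (simp add: C_def)
  \<comment> \<open>Errors of at most \<open>d\<close> in either factor change a product by at most
    \<open>d * C\<close>.\<close>
  have comb: "a * n2 (y n) + b * c \<le> d * C" if "0 \<le> a" "a \<le> d" "0 \<le> b" "b \<le> Cx" "0 \<le> c" "c \<le> d" for a b c d n
  proof -
    have "a * n2 (y n) \<le> d * Cy" using that Cy n2_nonneg[OF Dy(2)] by (intro mult_mono) auto
    moreover have "b * c \<le> Cx * d" using that Cx by (intro mult_mono) auto
    moreover have "0 \<le> d" using that by simp
    ultimately show ?thesis by (simp add: C_def algebra_simps)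
  qed
  have "Cauchy (\<lambda>n. j (\<lambda>\<omega>. x n \<omega> * y n \<omega>))"
  proof (rule metric_CauchyI)
    fix e :: real assume e: "e > 0"
    define d where "d = e / (2 * C)"
    have d: "d > 0" "d * C < e" using e C by (auto simp: d_def)
    obtain N1 where N1: "\<And>m n. m \<ge> N1 \<Longrightarrow> n \<ge> N1 \<Longrightarrow> n2 (\<lambda>\<omega>. x m \<omega> - x n \<omega>) < d" using L2app_CauchyE[OF x d(1)] by metis
    obtain N2 where N2: "\<And>m n. m \<ge> N2 \<Longrightarrow> n \<ge> N2 \<Longrightarrow> n2 (\<lambda>\<omega>. y m \<omega> - y n \<omega>) < d" using L2app_CauchyE[OF y d(1)] by metis
    have "dist (j (\<lambda>\<omega>. x m \<omega> * y m \<omega>)) (j (\<lambda>\<omega>. x n \<omega> * y n \<omega>)) < e" if "m \<ge> max N1 N2" "n \<ge> max N1 N2" for m n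
    proof -
      have "dist (j (\<lambda>\<omega>. x m \<omega> * y m \<omega>)) (j (\<lambda>\<omega>. x n \<omega> * y n \<omega>))
        \<le> n2 (\<lambda>\<omega>. x m \<omega> - x n \<omega>) * n2 (y m) + n2 (x n) * n2 (\<lambda>\<omega>. y m \<omega> - y n \<omega>)"
        by (intro dist_j_mult Dx(2) Dy(2))
      also have "\<dots> \<le> d * C"
        using N1[of m n] N2[of m n] that Cx(1) by (intro comb n2_nonneg rvs_diff Dx(2) Dy(2)) auto
      finally show ?thesis using d(2) by simp
    qed
    then show "\<exists>M. \<forall>m\<ge>M. \<forall>n\<ge>M. dist (j (\<lambda>\<omega>. x m \<omega> * y m \<omega>)) (j (\<lambda>\<omega>. x n \<omega> * y n \<omega>)) < e" by blast
  qed
  from Cauchy_convergent[OF this] obtain P where P: "(\<lambda>n. j (\<lambda>\<omega>. x n \<omega> * y n \<omega>)) \<longlonglongrightarrow> P"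
    unfolding convergent_def by blast
  have lim: "(\<lambda>N. bdd_mult j N (Ltrunc j N X) (Ltrunc j N Y)) \<longlonglongrightarrow> P"
  proof (rule metric_LIMSEQ_I)
    fix e :: real assume e: "e > 0"
    define d where "d = e / (2 * C)"
    have d: "d > 0" "d * C < e" using e C by (auto simp: d_def)
    obtain N1 where N1: "\<And>N n. N \<ge> N1 \<Longrightarrow> n2 (\<lambda>\<omega>. x n \<omega> - trunc N (x n \<omega>)) \<le> d" using L2app_trunc[OF x d(1)] by metis
    obtain N2 where N2: "\<And>N n. N \<ge> N2 \<Longrightarrow> n2 (\<lambda>\<omega>. y n \<omega> - trunc N (y n \<omega>)) \<le> d" using L2app_trunc[OF y d(1)] by metis
    have "dist (bdd_mult j N (Ltrunc j N X) (Ltrunc j N Y)) P < e" if N: "N \<ge> max N1 N2" for N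
    proof -
      let ?tx = "\<lambda>n \<omega>. trunc N (x n \<omega>)" and ?ty = "\<lambda>n \<omega>. trunc N (y n \<omega>)"
      have "(\<lambda>n. j (\<lambda>\<omega>. ?tx n \<omega> * ?ty n \<omega>)) \<longlonglongrightarrow> bdd_mult j N (Ltrunc j N X) (Ltrunc j N Y)"
        by (intro bdd_mult_lim Lip_bdd_trunc Ltrunc_lim Dx(2,4) Dy(2,4))
      from tendsto_dist[OF P this]
      have l: "(\<lambda>n. dist (j (\<lambda>\<omega>. x n \<omega> * y n \<omega>)) (j (\<lambda>\<omega>. ?tx n \<omega> * ?ty n \<omega>))) \<longlonglongrightarrow> dist P (bdd_mult j N (Ltrunc j N X) (Ltrunc j N Y))" .
      have "dist (j (\<lambda>\<omega>. x n \<omega> * y n \<omega>)) (j (\<lambda>\<omega>. ?tx n \<omega> * ?ty n \<omega>)) \<le> d * C" for n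
      proof -
        have "n2 (?tx n) \<le> n2 (x n)" by (intro n2_mono rvs_trunc Dx(2) abs_trunc_le_abs)
        then have t: "n2 (?tx n) \<le> Cx" using Cx(1)[of n] by linarith
        have "dist (j (\<lambda>\<omega>. x n \<omega> * y n \<omega>)) (j (\<lambda>\<omega>. ?tx n \<omega> * ?ty n \<omega>))
          \<le> n2 (\<lambda>\<omega>. x n \<omega> - ?tx n \<omega>) * n2 (y n) + n2 (?tx n) * n2 (\<lambda>\<omega>. y n \<omega> - ?ty n \<omega>)"
          by (intro dist_j_mult rvs_trunc Dx(2) Dy(2))
        also have "\<dots> \<le> d * C"
          using N1[of N n] N2[of N n] N t by (intro comb n2_nonneg rvs_diff rvs_trunc Dx(2) Dy(2)) auto
        finally show ?thesis .
      qed
      then have "dist P (bdd_mult j N (Ltrunc j N X) (Ltrunc j N Y)) \<le> d * C"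
        by (intro LIMSEQ_le_const2[OF l]) blast
      then show ?thesis using d(2) by (simp add: dist_commute)
    qed
    then show "\<exists>M. \<forall>N\<ge>M. dist (bdd_mult j N (Ltrunc j N X) (Ltrunc j N Y)) P < e" by blast
  qed
  then have "Lmult j X Y = P" unfolding Lmult_def by (rule limI)
  then show "(\<lambda>n. j (\<lambda>\<omega>. x n \<omega> * y n \<omega>)) \<longlonglongrightarrow> Lmult j X Y" "(\<lambda>N. bdd_mult j N (Ltrunc j N X) (Ltrunc j N Y)) \<longlonglongrightarrow> Lmult j X Y"
    using P lim by simp_all
qed

lemma bdd_pow_eq_bdd_mult: "bdd_pow j 2 N (Ltrunc j N X) = bdd_mult j N (Ltrunc j N X) (Ltrunc j N X)"
proof -
  have X: "X \<in> closure (j ` RV)" by (simp add: closure_j)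
  obtain x where x: "\<And>n. x n \<in> RV" "(\<lambda>n. j (x n)) \<longlonglongrightarrow> X"
    using closure_image_sequence[OF X] by metis
  note t = Lip_bdd_trunc[OF x(1)] Ltrunc_lim[OF x]
  have "(\<lambda>n. j (\<lambda>\<omega>. (trunc N (x n \<omega>))\<^sup>2)) \<longlonglongrightarrow> bdd_pow j 2 N (Ltrunc j N X)" by (rule bdd_pow_lim[OF t])
  moreover have "(\<lambda>n. j (\<lambda>\<omega>. (trunc N (x n \<omega>))\<^sup>2)) \<longlonglongrightarrow> bdd_mult j N (Ltrunc j N X) (Ltrunc j N X)"
    unfolding power2_eq_square by (rule bdd_mult_lim[OF t t])
  ultimately show ?thesis by (rule LIMSEQ_unique)
qed

lemma L2app_Lpow:
  assumes x: "L2app T x X"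
  shows "(\<lambda>n. j (\<lambda>\<omega>. (x n \<omega>)\<^sup>2)) \<longlonglongrightarrow> Lpow j 2 X"
    and "(\<lambda>N. bdd_pow j 2 N (Ltrunc j N X)) \<longlonglongrightarrow> Lpow j 2 X"
proof -
  have "Lpow j 2 X = Lmult j X X" by (simp add: Lpow_def Lmult_def bdd_pow_eq_bdd_mult)
  then show "(\<lambda>n. j (\<lambda>\<omega>. (x n \<omega>)\<^sup>2)) \<longlonglongrightarrow> Lpow j 2 X" "(\<lambda>N. bdd_pow j 2 N (Ltrunc j N X)) \<longlonglongrightarrow> Lpow j 2 X"
    using L2app_Lmult[OF x x] by (simp_all add: power2_eq_square bdd_pow_eq_bdd_mult)
qed

lemma L2app_imp_LGp:
  assumes x: "L2app T x X" and "T \<ge> 0" shows "X \<in> LGp j 2 T"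
proof -
  note D = L2appD[OF x]
  have "X \<in> LG1 j T" unfolding LG1_def closure_sequential
    using D(1,4) \<open>T \<ge> 0\<close> by (intro exI[of _ "\<lambda>n. j (x n)"]) (auto simp: Lip_eq_rvs)
  moreover have "Lpow j 2 X \<in> LG1 j T" unfolding LG1_def closure_sequential
    using L2app_Lpow(1)[OF x] rvs_power2[OF D(1)] \<open>T \<ge> 0\<close>
    by (intro exI[of _ "\<lambda>n. j (\<lambda>\<omega>. (x n \<omega>)\<^sup>2)"]) (auto simp: Lip_eq_rvs)
  ultimately show ?thesis using L2app_Lpow(2)[OF x] unfolding LGp_def by (auto simp: convergent_def)
qed

text \<open>Cylinder variables close to \<open>X\<close> in \<open>E[|X|]\<close> are truncated at
  level \<open>N\<close>. By \<open>trunc_square_diff\<close> the assumed convergence of truncated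
  squares makes truncations of different levels close in second moment, and what is lost in
  replacing \<open>X\<close> by the cylinder variable tends to 0.\<close>

lemma LGp_imp_L2app:
  assumes X: "X \<in> LGp j 2 T" and "T \<ge> 0" obtains x where "L2app T x X"
proof -
  have cl: "X \<in> closure (j ` rvs {0..T})" using X \<open>T \<ge> 0\<close> by (simp add: LGp_def LG1_def Lip_eq_rvs)
  obtain z where z: "\<And>n. z n \<in> rvs {0..T}" and zX: "(\<lambda>n. j (z n)) \<longlonglongrightarrow> X"
    using closure_image_sequence[OF cl] by metis
  have zR: "z n \<in> RV" for n using z by (rule rvs_RV)
  define Y where "Y = (\<lambda>N. bdd_pow j 2 N (Ltrunc j N X))"
  have CY: "Cauchy Y" using X unfolding Y_def LGp_def by (simp add: convergent_Cauchy)
  \<comment> \<open>For values bounded by \<open>N\<close> the second moment of a difference is at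
    most \<open>2 * N\<close> times its first moment; the rate \<open>1 / (Suc N)\<^sup>2\<close>
    compensates this factor.\<close>
  have "\<exists>k. dist (j (z k)) X < 1 / (real (Suc N))\<^sup>2" for N
    using metric_LIMSEQ_D[OF zX, of "1 / (real (Suc N))\<^sup>2"] by (auto simp del: of_nat_Suc)
  then obtain k where k: "\<And>N. dist (j (z (k N))) X < 1 / (real (Suc N))\<^sup>2" by metis
  define x where "x = (\<lambda>N \<omega>. trunc N (z (k N) \<omega>))"
  have xT: "x N \<in> rvs {0..T}" for N unfolding x_def by (intro rvs_trunc z)
  have xR: "x N \<in> RV" for N using xT by (rule rvs_RV)
  let ?t = "\<lambda>N i \<omega>. trunc N (z i \<omega>)"
  have tR: "?t N i \<in> RV" for N i by (intro rvs_trunc zR)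
  have tX: "(\<lambda>i. j (?t N i)) \<longlonglongrightarrow> Ltrunc j N X" for N by (rule Ltrunc_lim[OF zR zX])
  have near: "n2 (\<lambda>\<omega>. x N \<omega> - ?t N i \<omega>) \<le> sqrt (2 * real N * dist (j (z (k N))) (j (z i)))" for N i
  proof -
    have "E (\<lambda>\<omega>. (x N \<omega> - ?t N i \<omega>)\<^sup>2) \<le> E (\<lambda>\<omega>. 2 * real N * \<bar>z (k N) \<omega> - z i \<omega>\<bar>)"
    proof (intro E_mono rvs_power2 rvs_diff xR tR rvs_scale rvs_abs zR)
      fix \<omega>
      have "\<bar>x N \<omega> - ?t N i \<omega>\<bar> \<le> 2 * real N" using abs_trunc_le[of N "z (k N) \<omega>"] abs_trunc_le[of N "z i \<omega>"] by (simp add: x_def)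
      moreover have "\<bar>x N \<omega> - ?t N i \<omega>\<bar> \<le> \<bar>z (k N) \<omega> - z i \<omega>\<bar>" by (simp add: x_def trunc_nonexpansive)
      ultimately have "\<bar>x N \<omega> - ?t N i \<omega>\<bar> * \<bar>x N \<omega> - ?t N i \<omega>\<bar> \<le> 2 * real N * \<bar>z (k N) \<omega> - z i \<omega>\<bar>"
        by (intro mult_mono) auto
      then show "(x N \<omega> - ?t N i \<omega>)\<^sup>2 \<le> 2 * real N * \<bar>z (k N) \<omega> - z i \<omega>\<bar>" by (simp add: power2_eq_square)
    qed
    also have "\<dots> = 2 * real N * dist (j (z (k N))) (j (z i))"
      by (simp add: E_scale[OF rvs_abs[OF rvs_diff[OF zR zR]]] dist_j[OF zR zR])
    finally show ?thesis by (simp add: n2_def)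
  qed
  have mid: "n2 (\<lambda>\<omega>. ?t M i \<omega> - ?t N i \<omega>) \<le> sqrt (dist (j (\<lambda>\<omega>. (?t M i \<omega>)\<^sup>2)) (j (\<lambda>\<omega>. (?t N i \<omega>)\<^sup>2)))" if "N \<le> M" for N M i
    unfolding n2_def dist_j[OF rvs_power2[OF tR] rvs_power2[OF tR]]
    by (intro real_sqrt_le_mono E_mono rvs_power2 rvs_abs rvs_diff tR trunc_square_diff that)
  \<comment> \<open>The index \<open>i\<close> approximates \<open>X\<close> for both levels at once
    and is then sent to infinity.\<close>
  have close: "n2 (\<lambda>\<omega>. x M \<omega> - x N \<omega>) \<le> sqrt (2 / real (Suc M)) + sqrt (dist (Y M) (Y N)) + sqrt (2 / real (Suc N))"
    if "N \<le> M" for N M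
  proof -
    have Yl: "(\<lambda>i. j (\<lambda>\<omega>. (?t N i \<omega>)\<^sup>2)) \<longlonglongrightarrow> Y N" for N
      unfolding Y_def by (rule bdd_pow_lim[OF Lip_bdd_trunc[OF zR] tX])
    have "n2 (\<lambda>\<omega>. x M \<omega> - x N \<omega>) \<le> sqrt (2 * real M * dist (j (z (k M))) (j (z i)))
       + sqrt (dist (j (\<lambda>\<omega>. (?t M i \<omega>)\<^sup>2)) (j (\<lambda>\<omega>. (?t N i \<omega>)\<^sup>2))) + sqrt (2 * real N * dist (j (z (k N))) (j (z i)))" for i
      using n2_triangle_diff[where x = "x M" and y = "?t M i" and z = "x N", OF xR tR xR]
        n2_triangle_diff[where x = "?t M i" and y = "?t N i" and z = "x N", OF tR tR xR]
        near[of M i] near[of N i] mid[OF that, of i] n2_commute[of "x N" "?t N i"] by linarith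
    moreover have "(\<lambda>i. sqrt (2 * real M * dist (j (z (k M))) (j (z i)))
       + sqrt (dist (j (\<lambda>\<omega>. (?t M i \<omega>)\<^sup>2)) (j (\<lambda>\<omega>. (?t N i \<omega>)\<^sup>2))) + sqrt (2 * real N * dist (j (z (k N))) (j (z i))))
       \<longlonglongrightarrow> sqrt (2 * real M * dist (j (z (k M))) X) + sqrt (dist (Y M) (Y N)) + sqrt (2 * real N * dist (j (z (k N))) X)"
      by (intro tendsto_intros zX Yl)
    ultimately have 1: "n2 (\<lambda>\<omega>. x M \<omega> - x N \<omega>)
       \<le> sqrt (2 * real M * dist (j (z (k M))) X) + sqrt (dist (Y M) (Y N)) + sqrt (2 * real N * dist (j (z (k N))) X)"
      by (intro LIMSEQ_le_const) blast+
    have "2 * real N * dist (j (z (k N))) X \<le> 2 / real (Suc N)" for N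
    proof -
      have "2 * real N * dist (j (z (k N))) X \<le> 2 * real (Suc N) * (1 / (real (Suc N))\<^sup>2)"
        by (rule mult_mono[OF _ less_imp_le[OF k]]) simp_all
      moreover have "2 * a * (1 / a\<^sup>2) = 2 / a" if "a > 0" for a :: real using that by (simp add: power2_eq_square)
      from this[of "real (Suc N)"] have "2 * real (Suc N) * (1 / (real (Suc N))\<^sup>2) = 2 / real (Suc N)" by (simp only: of_nat_0_less_iff zero_less_Suc)
      ultimately show ?thesis by linarith
    qed
    from real_sqrt_le_mono[OF this[of M]] real_sqrt_le_mono[OF this[of N]] show ?thesis using 1 by linarith
  qed
  have "L2app T x X"
    unfolding L2app_def
  proof (intro conjI allI impI xT)
    fix e :: real assume e: "e > 0"
    have "(\<lambda>n. sqrt (2 * (1 / real (Suc n)))) \<longlonglongrightarrow> sqrt (2 * 0)"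
      by (intro tendsto_intros tendsto_inverse_Suc)
    then have "\<forall>\<^sub>F n in sequentially. sqrt (2 * (1 / real (Suc n))) < e / 3" using e by (intro order_tendstoD(2)) auto
    then obtain N1 where N1: "\<And>n. n \<ge> N1 \<Longrightarrow> sqrt (2 / real (Suc n)) < e / 3" by (auto simp: eventually_sequentially)
    have "(e / 3)\<^sup>2 > 0" using e by simp
    then obtain N2 where N2: "\<And>m n. m \<ge> N2 \<Longrightarrow> n \<ge> N2 \<Longrightarrow> dist (Y m) (Y n) < (e / 3)\<^sup>2" using metric_CauchyD[OF CY] by blast
    have c: "n2 (\<lambda>\<omega>. x M \<omega> - x N \<omega>) < e" if "N \<le> M" "N \<ge> max N1 N2" for N M
    proof -
      have "sqrt (dist (Y M) (Y N)) < e / 3" using N2[of M N] that e by (intro real_less_lsqrt) auto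
      then show ?thesis using close[OF that(1)] N1[of M] N1[of N] that by simp
    qed
    show "\<exists>N. \<forall>m\<ge>N. \<forall>n\<ge>N. n2 (\<lambda>\<omega>. x m \<omega> - x n \<omega>) < e"
    proof (intro exI allI impI)
      fix m n assume "max N1 N2 \<le> m" "max N1 N2 \<le> n"
      then show "n2 (\<lambda>\<omega>. x m \<omega> - x n \<omega>) < e"
        using c[of n m] c[of m n] n2_commute[of "x m" "x n"] by (cases "n \<le> m") auto
    qed
  next
    show "(\<lambda>n. j (x n)) \<longlonglongrightarrow> X"
    proof (rule metric_LIMSEQ_I)
      fix e :: real assume e: "e > 0"
      obtain m where m: "dist (j (z m)) X < e / 4" using metric_LIMSEQ_D[OF zX, of "e / 4"] e by auto
      obtain B where B: "\<And>\<omega>. \<bar>z m \<omega>\<bar> \<le> B" using rvs_bounded[OF zR[of m]] by metis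
      \<comment> \<open>Once \<open>N\<close> exceeds the bound of \<open>z m\<close>, truncating
        \<open>z (k N)\<close> moves it no further than to \<open>z m\<close>.\<close>
      obtain N0 :: nat where N0: "B \<le> real N0" using real_arch_simple by blast
      have "\<forall>\<^sub>F n in sequentially. 1 / real (Suc n) < e / 4" using e by (intro order_tendstoD(2)[OF tendsto_inverse_Suc]) auto
      then obtain N1 where N1: "\<And>n. n \<ge> N1 \<Longrightarrow> 1 / real (Suc n) < e / 4" by (auto simp: eventually_sequentially)
      have "dist (j (x N)) X < e" if N: "N \<ge> max N0 N1" for N
      proof -
        have "dist (j (z (k N))) (j (x N)) \<le> dist (j (z (k N))) (j (z m))"
          unfolding dist_j[OF zR xR] dist_j[OF zR zR]
        proof (intro E_mono rvs_abs rvs_diff zR xR)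
          show "\<bar>z (k N) \<omega> - x N \<omega>\<bar> \<le> \<bar>z (k N) \<omega> - z m \<omega>\<bar>" for \<omega>
            unfolding x_def by (rule trunc_error) (use B[of \<omega>] N0 N in auto)
        qed
        moreover have "dist (j (z (k N))) X < e / 4"
        proof -
          have "real (Suc N) \<le> (real (Suc N))\<^sup>2" by (rule self_le_power) simp_all
          then have "1 / (real (Suc N))\<^sup>2 \<le> 1 / real (Suc N)" by (intro divide_left_mono) simp_all
          moreover have "1 / real (Suc N) < e / 4" using N1[of N] N by simp
          ultimately show ?thesis using k[of N] by linarith
        qed
        ultimately show ?thesis
          using m dist_triangle[of "j (x N)" X "j (z (k N))"] dist_triangle2[of "j (z (k N))" "j (z m)" X]
            dist_commute[of "j (x N)" "j (z (k N))"] e by linarith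
      qed
      then show "\<exists>M. \<forall>n\<ge>M. dist (j (x n)) X < e" by blast
    qed
  qed
  then show ?thesis by (rule that)
qed

lemma L2app_lincomb:
  assumes x: "L2app T x X" and y: "L2app T y Y"
  shows "L2app T (\<lambda>n \<omega>. a * x n \<omega> + b * y n \<omega>) (a *\<^sub>R X + b *\<^sub>R Y)"
  unfolding L2app_def
proof (intro conjI allI impI)
  note Dx = L2appD[OF x] and Dy = L2appD[OF y]
  show "(\<lambda>\<omega>. a * x n \<omega> + b * y n \<omega>) \<in> rvs {0..T}" for n by (intro rvs_add rvs_scale Dx Dy)
  show "(\<lambda>n. j (\<lambda>\<omega>. a * x n \<omega> + b * y n \<omega>)) \<longlonglongrightarrow> a *\<^sub>R X + b *\<^sub>R Y"
    unfolding j_linear[OF Dx(2) Dy(2)] by (intro tendsto_intros Dx Dy)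
  fix e :: real assume e: "e > 0"
  define d where "d = e / (\<bar>a\<bar> + \<bar>b\<bar> + 1)"
  have d: "d > 0" "(\<bar>a\<bar> + \<bar>b\<bar>) * d < e"
  proof -
    show "d > 0" using e by (simp add: d_def add_nonneg_pos)
    moreover have "(\<bar>a\<bar> + \<bar>b\<bar> + 1) * d = e" by (simp add: d_def add_nonneg_eq_0_iff)
    ultimately show "(\<bar>a\<bar> + \<bar>b\<bar>) * d < e" by (simp add: distrib_right)
  qed
  obtain N1 where N1: "\<And>m n. m \<ge> N1 \<Longrightarrow> n \<ge> N1 \<Longrightarrow> n2 (\<lambda>\<omega>. x m \<omega> - x n \<omega>) < d" using L2app_CauchyE[OF x d(1)] by metis
  obtain N2 where N2: "\<And>m n. m \<ge> N2 \<Longrightarrow> n \<ge> N2 \<Longrightarrow> n2 (\<lambda>\<omega>. y m \<omega> - y n \<omega>) < d" using L2app_CauchyE[OF y d(1)] by metis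
  have "n2 (\<lambda>\<omega>. a * x m \<omega> + b * y m \<omega> - (a * x n \<omega> + b * y n \<omega>)) < e" if mn: "m \<ge> max N1 N2" "n \<ge> max N1 N2" for m n
  proof -
    note dx = rvs_diff[OF Dx(2) Dx(2), of m n] and dy = rvs_diff[OF Dy(2) Dy(2), of m n]
    have eq: "(\<lambda>\<omega>. a * x m \<omega> + b * y m \<omega> - (a * x n \<omega> + b * y n \<omega>)) = (\<lambda>\<omega>. a * (x m \<omega> - x n \<omega>) + b * (y m \<omega> - y n \<omega>))"
      by (simp add: algebra_simps)
    have "n2 (\<lambda>\<omega>. a * x m \<omega> + b * y m \<omega> - (a * x n \<omega> + b * y n \<omega>)) \<le> \<bar>a\<bar> * n2 (\<lambda>\<omega>. x m \<omega> - x n \<omega>) + \<bar>b\<bar> * n2 (\<lambda>\<omega>. y m \<omega> - y n \<omega>)"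
      unfolding eq n2_scale[OF dx, symmetric] n2_scale[OF dy, symmetric] by (intro n2_triangle rvs_scale dx dy)
    also have "\<dots> \<le> \<bar>a\<bar> * d + \<bar>b\<bar> * d"
      using N1[of m n] N2[of m n] mn by (intro add_mono mult_left_mono) auto
    finally show ?thesis using d(2) by (simp add: distrib_right)
  qed
  then show "\<exists>N. \<forall>m\<ge>N. \<forall>n\<ge>N. n2 (\<lambda>\<omega>. a * x m \<omega> + b * y m \<omega> - (a * x n \<omega> + b * y n \<omega>)) < e" by blast
qed

lemma L2app_add: "L2app T x X \<Longrightarrow> L2app T y Y \<Longrightarrow> L2app T (\<lambda>n \<omega>. x n \<omega> + y n \<omega>) (X + Y)"
  using L2app_lincomb[of T x X y Y 1 1] by simp

lemma L2app_0: "L2app T (\<lambda>_ _. 0) 0"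
proof -
  have "j (\<lambda>_. 0) = 0" using j_linear[OF rvs_const rvs_const, of 0 0 0 0] by simp
  then show ?thesis using L2app_const[OF rvs_const[of 0]] by simp
qed

lemma LE_Lpow_lim: "L2app T x X \<Longrightarrow> (\<lambda>n. E (\<lambda>\<omega>. (x n \<omega>)\<^sup>2)) \<longlonglongrightarrow> LE \<sigma>\<^sub>0 j (Lpow j 2 X)"
  by (intro LE_lim rvs_power2 L2appD(2) L2app_Lpow(1))

lemma LGp_norm_lim:
  assumes x: "L2app T x X" shows "(\<lambda>n. n2 (x n)) \<longlonglongrightarrow> LGp_norm \<sigma>\<^sub>0 j 2 X"
    and "LE \<sigma>\<^sub>0 j (Lpow j 2 X) \<ge> 0" "LGp_norm \<sigma>\<^sub>0 j 2 X = sqrt (LE \<sigma>\<^sub>0 j (Lpow j 2 X))"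
proof -
  show "LE \<sigma>\<^sub>0 j (Lpow j 2 X) \<ge> 0"
    using E_square_nonneg[OF L2appD(2)[OF x]] by (intro LIMSEQ_le_const[OF LE_Lpow_lim[OF x]]) blast
  then show "LGp_norm \<sigma>\<^sub>0 j 2 X = sqrt (LE \<sigma>\<^sub>0 j (Lpow j 2 X))"
    by (simp add: LGp_norm_def powr_half_sqrt)
  then show "(\<lambda>n. n2 (x n)) \<longlonglongrightarrow> LGp_norm \<sigma>\<^sub>0 j 2 X"
    unfolding n2_def by (simp add: tendsto_real_sqrt[OF LE_Lpow_lim[OF x]])
qed

lemma LGp_lincomb:
  assumes "X \<in> LGp j 2 T" "Y \<in> LGp j 2 T" "T \<ge> 0"
  shows "a *\<^sub>R X + b *\<^sub>R Y \<in> LGp j 2 T"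
proof -
  obtain x where x: "L2app T x X" using LGp_imp_L2app[OF assms(1,3)] by metis
  obtain y where y: "L2app T y Y" using LGp_imp_L2app[OF assms(2,3)] by metis
  show ?thesis by (rule L2app_imp_LGp[OF L2app_lincomb[OF x y] assms(3)])
qed

lemma LGp_mono: "X \<in> LGp j 2 S \<Longrightarrow> 0 \<le> S \<Longrightarrow> S \<le> T \<Longrightarrow> X \<in> LGp j 2 T"
  using LGp_imp_L2app[of X S] L2app_mono L2app_imp_LGp by (meson order_trans)

lemma LGp_norm_triangle:
  assumes "X \<in> LGp j 2 T" "Y \<in> LGp j 2 T" "T \<ge> 0"
  shows "LGp_norm \<sigma>\<^sub>0 j 2 (X + Y) \<le> LGp_norm \<sigma>\<^sub>0 j 2 X + LGp_norm \<sigma>\<^sub>0 j 2 Y"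
proof -
  obtain x where x: "L2app T x X" using LGp_imp_L2app[OF assms(1,3)] by metis
  obtain y where y: "L2app T y Y" using LGp_imp_L2app[OF assms(2,3)] by metis
  show ?thesis
  proof (rule LIMSEQ_le)
    show "(\<lambda>n. n2 (\<lambda>\<omega>. x n \<omega> + y n \<omega>)) \<longlonglongrightarrow> LGp_norm \<sigma>\<^sub>0 j 2 (X + Y)" by (rule LGp_norm_lim(1)[OF L2app_add[OF x y]])
    show "(\<lambda>n. n2 (x n) + n2 (y n)) \<longlonglongrightarrow> LGp_norm \<sigma>\<^sub>0 j 2 X + LGp_norm \<sigma>\<^sub>0 j 2 Y"
      by (intro tendsto_add LGp_norm_lim(1)[OF x] LGp_norm_lim(1)[OF y])
    show "\<exists>N. \<forall>n\<ge>N. n2 (\<lambda>\<omega>. x n \<omega> + y n \<omega>) \<le> n2 (x n) + n2 (y n)"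
      using n2_triangle[OF L2appD(2)[OF x] L2appD(2)[OF y]] by blast
  qed
qed

lemma norm_le_LGp_norm:
  assumes "X \<in> LGp j 2 T" "T \<ge> 0" shows "norm X \<le> LGp_norm \<sigma>\<^sub>0 j 2 X"
proof -
  obtain x where x: "L2app T x X" using LGp_imp_L2app[OF assms] by metis
  show ?thesis using norm_j_le_n2[OF L2appD(2)[OF x]]
    by (intro LIMSEQ_le[OF tendsto_norm[OF L2appD(4)[OF x]] LGp_norm_lim(1)[OF x]]) blast
qed

lemma LGp_norm_commute: "X \<in> LGp j 2 T \<Longrightarrow> Y \<in> LGp j 2 T \<Longrightarrow> T \<ge> 0 \<Longrightarrow> LGp_norm \<sigma>\<^sub>0 j 2 (X - Y) = LGp_norm \<sigma>\<^sub>0 j 2 (Y - X)"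
proof -
  assume a: "X \<in> LGp j 2 T" "Y \<in> LGp j 2 T" "T \<ge> 0"
  obtain x where x: "L2app T x X" using LGp_imp_L2app[OF a(1,3)] by metis
  obtain y where y: "L2app T y Y" using LGp_imp_L2app[OF a(2,3)] by metis
  have 1: "L2app T (\<lambda>n \<omega>. x n \<omega> - y n \<omega>) (X - Y)" using L2app_lincomb[OF x y, of 1 "-1"] by simp
  have 2: "L2app T (\<lambda>n \<omega>. y n \<omega> - x n \<omega>) (Y - X)" using L2app_lincomb[OF y x, of 1 "-1"] by simp
  show ?thesis using LGp_norm_lim(1)[OF 1] LGp_norm_lim(1)[OF 2]
    unfolding n2_commute[of "y _" "x _"] by (rule LIMSEQ_unique)
qed

lemma LGp_diff: "X \<in> LGp j 2 T \<Longrightarrow> Y \<in> LGp j 2 T \<Longrightarrow> T \<ge> 0 \<Longrightarrow> X - Y \<in> LGp j 2 T"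
  using LGp_lincomb[of X T Y 1 "-1"] by simp

lemma LGp_approx:
  assumes "X \<in> LGp j 2 T" "T \<ge> 0" "e > 0"
  shows "\<exists>x. x \<in> rvs {0..T} \<and> LGp_norm \<sigma>\<^sub>0 j 2 (X - j x) \<le> e"
proof -
  obtain x where x: "L2app T x X" using LGp_imp_L2app[OF assms(1,2)] by metis
  obtain N where N: "\<And>m n. m \<ge> N \<Longrightarrow> n \<ge> N \<Longrightarrow> n2 (\<lambda>\<omega>. x m \<omega> - x n \<omega>) < e" using L2app_CauchyE[OF x assms(3)] by metis
  have "L2app T (\<lambda>n \<omega>. x n \<omega> - x N \<omega>) (X - j (x N))"
    using L2app_lincomb[OF x L2app_const[OF L2appD(1)[OF x]], of 1 "-1" N] by simp
  then have "LGp_norm \<sigma>\<^sub>0 j 2 (X - j (x N)) \<le> e"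
    by (rule LIMSEQ_le_const2[OF LGp_norm_lim(1)]) (use N in \<open>auto intro!: exI[of _ N] less_imp_le\<close>)
  then show ?thesis using L2appD(1)[OF x] by blast
qed

text \<open>The second moment norm is not the norm of \<open>'l\<close>, so its completeness
  requires an argument: cylinder variables within \<open>1 / Suc n\<close> of \<open>Z n\<close> are
  Cauchy for \<open>n2\<close> and represent \<open>X\<close>.\<close>

lemma LGp_complete:
  assumes Z: "\<And>n. Z n \<in> LGp j 2 T" and "T \<ge> 0" and lim: "Z \<longlonglongrightarrow> X"
    and C: "\<And>e. e > 0 \<Longrightarrow> \<exists>N. \<forall>m\<ge>N. \<forall>n\<ge>N. LGp_norm \<sigma>\<^sub>0 j 2 (Z m - Z n) < e"
  shows "X \<in> LGp j 2 T" and "(\<lambda>n. LGp_norm \<sigma>\<^sub>0 j 2 (X - Z n)) \<longlonglongrightarrow> 0"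
proof -
  let ?p = "LGp_norm \<sigma>\<^sub>0 j 2"
  have "\<exists>x. x \<in> rvs {0..T} \<and> ?p (Z n - j x) \<le> 1 / real (Suc n)" for n
    by (rule LGp_approx[OF Z \<open>T \<ge> 0\<close>]) simp
  then obtain x where x: "\<And>n. x n \<in> rvs {0..T}" "\<And>n. ?p (Z n - j (x n)) \<le> 1 / real (Suc n)" by metis
  note xR = rvs_RV[OF x(1)]
  have jx: "j (x n) \<in> LGp j 2 T" for n by (rule L2app_imp_LGp[OF L2app_const[OF x(1)] \<open>T \<ge> 0\<close>])
  have small: "\<exists>N. \<forall>n\<ge>N. 1 / real (Suc n) < e" if "e > 0" for e
    using order_tendstoD(2)[OF tendsto_inverse_Suc that] by (auto simp: eventually_sequentially)
  have n2p: "n2 (\<lambda>\<omega>. x m \<omega> - x n \<omega>) = ?p (j (x m) - j (x n))" for m n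
    using LIMSEQ_unique[OF LGp_norm_lim(1)[OF L2app_const[OF rvs_diff[OF x(1) x(1)]]] tendsto_const, of m n]
    by (simp add: j_diff[OF xR xR])
  have L: "L2app T x X"
    unfolding L2app_def
  proof (intro conjI allI impI x(1))
    fix e :: real assume e: "e > 0"
    obtain N1 where N1: "\<forall>n\<ge>N1. 1 / real (Suc n) < e / 3" using small[of "e / 3"] e by auto
    obtain N2 where N2: "\<forall>m\<ge>N2. \<forall>n\<ge>N2. ?p (Z m - Z n) < e / 3" using C[of "e / 3"] e by auto
    show "\<exists>N. \<forall>m\<ge>N. \<forall>n\<ge>N. n2 (\<lambda>\<omega>. x m \<omega> - x n \<omega>) < e"
    proof (intro exI allI impI)
      fix m n assume mn: "max N1 N2 \<le> m" "max N1 N2 \<le> n"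
      have "j (x m) - j (x n) = (j (x m) - Z m) + ((Z m - Z n) + (Z n - j (x n)))" by simp
      then have "?p (j (x m) - j (x n)) \<le> ?p (j (x m) - Z m) + ?p ((Z m - Z n) + (Z n - j (x n)))"
        using LGp_norm_triangle[of "j (x m) - Z m" T "(Z m - Z n) + (Z n - j (x n))"] LGp_lincomb[of _ T _ 1 1]
        by (simp add: LGp_diff Z jx \<open>T \<ge> 0\<close>)
      also have "?p ((Z m - Z n) + (Z n - j (x n))) \<le> ?p (Z m - Z n) + ?p (Z n - j (x n))"
        by (intro LGp_norm_triangle[of _ T] LGp_diff Z jx \<open>T \<ge> 0\<close>)
      finally have "?p (j (x m) - j (x n)) \<le> ?p (Z m - j (x m)) + (?p (Z m - Z n) + ?p (Z n - j (x n)))"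
        using LGp_norm_commute[OF jx Z \<open>T \<ge> 0\<close>, of m m] by simp
      moreover have "?p (Z m - j (x m)) < e / 3" using x(2)[of m] spec[OF N1, of m] mn by simp
      moreover have "?p (Z n - j (x n)) < e / 3" using x(2)[of n] spec[OF N1, of n] mn by simp
      moreover have "?p (Z m - Z n) < e / 3" using N2 mn by simp
      ultimately show "n2 (\<lambda>\<omega>. x m \<omega> - x n \<omega>) < e" unfolding n2p by linarith
    qed
  next
    have "(\<lambda>n. Z n - j (x n)) \<longlonglongrightarrow> 0"
    proof (rule Lim_null_comparison[OF always_eventually tendsto_inverse_Suc], rule allI)
      show "norm (Z n - j (x n)) \<le> 1 / real (Suc n)" for n
        using norm_le_LGp_norm[OF LGp_diff[OF Z jx \<open>T \<ge> 0\<close>] \<open>T \<ge> 0\<close>, of n n] x(2)[of n] by linarith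
    qed
    from tendsto_diff[OF lim this] show "(\<lambda>n. j (x n)) \<longlonglongrightarrow> X" by simp
  qed
  then show X: "X \<in> LGp j 2 T" using \<open>T \<ge> 0\<close> by (rule L2app_imp_LGp)
  show "(\<lambda>n. ?p (X - Z n)) \<longlonglongrightarrow> 0"
  proof (rule LIMSEQ_I)
    fix e :: real assume e: "e > 0"
    obtain N1 where N1: "\<forall>n\<ge>N1. 1 / real (Suc n) < e / 2" using small[of "e / 2"] e by auto
    have "e / 3 > 0" using e by simp
    then obtain N where N: "\<And>m n. m \<ge> N \<Longrightarrow> n \<ge> N \<Longrightarrow> n2 (\<lambda>\<omega>. x m \<omega> - x n \<omega>) < e / 3" using L2app_CauchyE[OF L] by metis
    have "norm (?p (X - Z n) - 0) < e" if n: "n \<ge> max N1 N" for n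
    proof -
      have "L2app T (\<lambda>k \<omega>. x k \<omega> - x n \<omega>) (X - j (x n))"
        using L2app_lincomb[OF L L2app_const[OF x(1)], of 1 "-1" n] by simp
      then have 1: "?p (X - j (x n)) \<le> e / 3"
        by (rule LIMSEQ_le_const2[OF LGp_norm_lim(1)]) (use N n in \<open>auto intro!: exI[of _ N] less_imp_le\<close>)
      have "?p (X - Z n) \<le> ?p (X - j (x n)) + ?p (j (x n) - Z n)"
        using LGp_norm_triangle[OF LGp_diff[OF X jx \<open>T \<ge> 0\<close>] LGp_diff[OF jx Z \<open>T \<ge> 0\<close>] \<open>T \<ge> 0\<close>, of n n n] by simp
      moreover have "?p (j (x n) - Z n) < e / 2"
        using LGp_norm_commute[OF jx Z \<open>T \<ge> 0\<close>, of n n] x(2)[of n] spec[OF N1, of n] n by simp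
      moreover have "0 \<le> ?p (X - Z n)"
        using norm_le_LGp_norm[OF LGp_diff[OF X Z \<open>T \<ge> 0\<close>] \<open>T \<ge> 0\<close>, of n] norm_ge_zero[of "X - Z n"] by linarith
      ultimately show ?thesis using 1 e by simp
    qed
    then show "\<exists>no. \<forall>n\<ge>no. norm (?p (X - Z n) - 0) < e" by blast
  qed
qed

lemma LE_add_le:
  assumes x: "L2app T x X" and y: "L2app T y Y" shows "LE \<sigma>\<^sub>0 j (X + Y) \<le> LE \<sigma>\<^sub>0 j X + LE \<sigma>\<^sub>0 j Y"
proof (rule LIMSEQ_le)
  note D = L2appD[OF x] and D' = L2appD[OF y] and S = L2appD[OF L2app_add[OF x y]]
  show "(\<lambda>n. E (\<lambda>\<omega>. x n \<omega> + y n \<omega>)) \<longlonglongrightarrow> LE \<sigma>\<^sub>0 j (X + Y)" by (rule LE_lim[OF S(2,4)])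
  show "(\<lambda>n. E (x n) + E (y n)) \<longlonglongrightarrow> LE \<sigma>\<^sub>0 j X + LE \<sigma>\<^sub>0 j Y" by (intro tendsto_add LE_lim D D')
  show "\<exists>N. \<forall>n\<ge>N. E (\<lambda>\<omega>. x n \<omega> + y n \<omega>) \<le> E (x n) + E (y n)" using E_add_le[OF D(2) D'(2)] by blast
qed

section \<open>Increments of the canonical process\<close>

lemma blip_trunc: "blip (trunc N)"
  by (rule blipI[where L = 1 and M = "real N"]) (simp_all add: trunc_nonexpansive abs_trunc_le)

lemma blip_square: assumes "blip f" shows "blip (\<lambda>y. (f y)\<^sup>2)"
proof -
  obtain L M where LM: "\<And>x y. \<bar>f x - f y\<bar> \<le> L * \<bar>x - y\<bar>" "\<And>x. \<bar>f x\<bar> \<le> M" using blipE[OF assms(1)] by metis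
  show ?thesis
  proof (rule blipI)
    show "\<bar>(f x)\<^sup>2\<bar> \<le> M\<^sup>2" for x using power_mono[OF LM(2)[of x], of 2] by simp
    show "\<bar>(f x)\<^sup>2 - (f y)\<^sup>2\<bar> \<le> (2 * M * L) * \<bar>x - y\<bar>" for x y
    proof -
      have "\<bar>(f x)\<^sup>2 - (f y)\<^sup>2\<bar> = \<bar>f x + f y\<bar> * \<bar>f x - f y\<bar>" by (simp add: abs_mult[symmetric] power2_eq_square algebra_simps)
      also have "\<dots> \<le> (2 * M) * (L * \<bar>x - y\<bar>)"
        using LM(2)[of x] LM(2)[of y] LM(1)[of x y] by (intro mult_mono) linarith+
      finally show ?thesis by (simp add: mult.assoc)
    qed
  qed
qed

lemma blip_uminus: "blip f \<Longrightarrow> blip (\<lambda>y. - f y)"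
  using blip_scale[of f "-1"] by simp

text \<open>Truncation changes \<open>y\<close> only if \<open>\<bar>y\<bar> > N\<close>, and then
  \<open>\<bar>y\<bar> \<le> y\<^sup>2 / N\<close>. Both signs are thus bounded by an affine plus a
  quadratic function, the case treated in \<open>PG_affine_quadratic_bound\<close>.\<close>

lemma trunc_le_quadratic:
  assumes "N > 0" shows "trunc N y \<le> 0 + 1 * y + 1 / real N * y\<^sup>2" "- trunc N y \<le> 0 + (- 1) * y + 1 / real N * y\<^sup>2"
proof -
  have N: "real N > 0" using assms by simp
  have q: "\<bar>y\<bar> \<le> y\<^sup>2 / real N" if "\<bar>y\<bar> \<ge> real N"
  proof -
    have "real N * \<bar>y\<bar> \<le> \<bar>y\<bar> * \<bar>y\<bar>" using that by (intro mult_right_mono) auto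
    then show ?thesis using N by (simp add: pos_le_divide_eq power2_eq_square mult.commute)
  qed
  have "0 \<le> y\<^sup>2 / real N" using N by simp
  then have "\<bar>y - trunc N y\<bar> \<le> y\<^sup>2 / real N"
    using q N by (cases "\<bar>y\<bar> \<ge> real N") (auto simp: trunc_def max_def min_def)
  then show "trunc N y \<le> 0 + 1 * y + 1 / real N * y\<^sup>2" "- trunc N y \<le> 0 + (- 1) * y + 1 / real N * y\<^sup>2"
    by (auto simp: abs_le_iff)
qed

lemma PG_trunc:
  assumes "N > 0" "t \<ge> 0"
  shows "PG \<sigma>\<^sub>0 t (trunc N) 0 \<le> t / real N" "PG \<sigma>\<^sub>0 t (\<lambda>y. - trunc N y) 0 \<le> t / real N"
  using PG_affine_quadratic_bound[OF \<sigma> blip_trunc trunc_le_quadratic(1)[OF assms(1)] _ assms(2)]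
    PG_affine_quadratic_bound[OF \<sigma> blip_uminus[OF blip_trunc] trunc_le_quadratic(2)[OF assms(1)] _ assms(2)] by simp_all

lemma PG_trunc_square: "t \<ge> 0 \<Longrightarrow> PG \<sigma>\<^sub>0 t (\<lambda>y. (trunc N y)\<^sup>2) 0 \<le> t"
proof -
  assume t: "t \<ge> 0"
  have "(trunc N y)\<^sup>2 \<le> 0 + 0 * y + 1 * y\<^sup>2" for y using abs_trunc_le_abs[of N y] by (simp add: abs_le_square_iff)
  from PG_affine_quadratic_bound[OF \<sigma> blip_square[OF blip_trunc] this _ t] show ?thesis by simp
qed

lemma blip_trunc_diff: "blip (\<lambda>y. trunc M y - trunc N y)"
  using blip_add[OF blip_trunc blip_uminus[OF blip_trunc]] by simp

text \<open>The difference vanishes for \<open>\<bar>y\<bar> \<le> N\<close> and is at most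
  \<open>\<bar>y\<bar>\<close> elsewhere, so its square is at most \<open>y ^ 4 / N\<^sup>2\<close>.
  The fourth moment is what gives decay in \<open>N\<close>.\<close>

lemma PG_trunc_diff_square:
  assumes "N > 0" "N \<le> M" "t \<ge> 0"
  shows "PG \<sigma>\<^sub>0 t (\<lambda>y. (trunc M y - trunc N y)\<^sup>2) 0 \<le> 3 * t\<^sup>2 / (real N)\<^sup>2"
proof -
  have N: "real N > 0" using assms by simp
  have "(trunc M y - trunc N y)\<^sup>2 \<le> 1 / (real N)\<^sup>2 * y ^ 4" for y
  proof (cases "\<bar>y\<bar> \<le> real N")
    case True
    then have "trunc M y = trunc N y" using assms by (simp add: trunc_id)
    then show ?thesis by simp
  next
    case False
    have "\<bar>trunc M y - trunc N y\<bar> \<le> \<bar>y\<bar>" using assms by (auto simp: trunc_def max_def min_def)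
    then have "(trunc M y - trunc N y)\<^sup>2 \<le> y\<^sup>2" by (simp add: abs_le_square_iff)
    moreover have "(real N)\<^sup>2 * y\<^sup>2 \<le> y\<^sup>2 * y\<^sup>2"
    proof (rule mult_right_mono)
      show "(real N)\<^sup>2 \<le> y\<^sup>2" using False by (simp flip: abs_le_square_iff)
    qed simp
    then have "y\<^sup>2 \<le> 1 / (real N)\<^sup>2 * y ^ 4" using N by (simp add: pos_le_divide_eq power4_eq_xxxx power2_eq_square mult_ac)
    ultimately show ?thesis by linarith
  qed
  from PG_quartic_bound[OF \<sigma> blip_square[OF blip_trunc_diff] this _ assms(3)] show ?thesis by simp
qed

text \<open>The level \<open>Suc n\<close> is positive, as the bounds of order \<open>1 / N\<close>
  demand.\<close>

definition incr :: "real \<Rightarrow> real \<Rightarrow> nat \<Rightarrow> cpath \<Rightarrow> real" where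
  "incr s t n \<omega> = trunc (Suc n) (B t \<omega> - B s \<omega>)"

lemma rvs_incr: "s \<in> I \<Longrightarrow> t \<in> I \<Longrightarrow> incr s t n \<in> rvs I"
  unfolding incr_def[abs_def] by (rule rvs_increment[OF blip_trunc])

lemma E_increment_le:
  assumes X: "X \<in> rvs {0..s}" "\<And>\<omega>. 0 \<le> X \<omega>" and g: "blip g" and s: "0 \<le> s" "s < t"
    and c: "PG \<sigma>\<^sub>0 (t - s) g 0 \<le> c" "c \<ge> 0"
  shows "E (\<lambda>\<omega>. X \<omega> * g (B t \<omega> - B s \<omega>)) \<le> c * E X"
proof -
  have "E (\<lambda>\<omega>. X \<omega> * g (B t \<omega> - B s \<omega>)) = E (\<lambda>\<omega>. X \<omega> * PG \<sigma>\<^sub>0 (t - s) g 0)"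
    unfolding gexp_increment[OF \<sigma> X(1) g s] using X(2) by simp
  also have "\<dots> \<le> E (\<lambda>\<omega>. c * X \<omega>)"
  proof (rule E_mono[OF rvs_mult[OF rvs_RV[OF X(1)] rvs_const] rvs_scale[OF rvs_RV[OF X(1)]]])
    show "X \<omega> * PG \<sigma>\<^sub>0 (t - s) g 0 \<le> c * X \<omega>" for \<omega> using mult_left_mono[OF c(1) X(2)] by (simp add: mult.commute)
  qed
  also have "\<dots> = c * E X" by (rule E_scale[OF rvs_RV[OF X(1)] c(2)])
  finally show ?thesis .
qed

lemma n2_mult_increment:
  assumes X: "X \<in> rvs {0..s}" and g: "blip g" and s: "0 \<le> s" "s < t"
    and c: "PG \<sigma>\<^sub>0 (t - s) (\<lambda>y. (g y)\<^sup>2) 0 \<le> c" "c \<ge> 0"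
  shows "n2 (\<lambda>\<omega>. X \<omega> * g (B t \<omega> - B s \<omega>)) \<le> sqrt c * n2 X"
  unfolding n2_def real_sqrt_mult[symmetric] power_mult_distrib
  by (intro real_sqrt_le_mono E_increment_le rvs_power2 X blip_square g s c) simp

text \<open>The mean of a truncated increment is not shown to be zero, but both of its signs have
  mean at most \<open>(t - s) / Suc n\<close>; multiplied with the two parts of \<open>X\<close>
  this gives \<open>\<bar>X\<bar>\<close>.\<close>

lemma E_mult_incr_le:
  assumes X: "X \<in> rvs {0..s}" and s: "0 \<le> s" "s < t"
  shows "E (\<lambda>\<omega>. X \<omega> * incr s t n \<omega>) \<le> (t - s) / real (Suc n) * E (\<lambda>\<omega>. \<bar>X \<omega>\<bar>)"
proof -
  let ?c = "(t - s) / real (Suc n)" and ?g = "trunc (Suc n)"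
  have ts: "t - s \<ge> 0" using s by simp
  note p = PG_trunc[OF zero_less_Suc ts, of n]
  note XR = rvs_RV[OF X]
  have "E (\<lambda>\<omega>. X \<omega> * incr s t n \<omega>)
     = E (\<lambda>\<omega>. max (X \<omega>) 0 * PG \<sigma>\<^sub>0 (t - s) ?g 0 + max (- X \<omega>) 0 * PG \<sigma>\<^sub>0 (t - s) (\<lambda>y. - ?g y) 0)"
    unfolding incr_def by (rule gexp_increment[OF \<sigma> X blip_trunc s])
  also have "\<dots> \<le> E (\<lambda>\<omega>. ?c * \<bar>X \<omega>\<bar>)"
  proof (rule E_mono)
    show "(\<lambda>\<omega>. max (X \<omega>) 0 * PG \<sigma>\<^sub>0 (t - s) ?g 0 + max (- X \<omega>) 0 * PG \<sigma>\<^sub>0 (t - s) (\<lambda>y. - ?g y) 0) \<in> RV"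
      by (intro rvs_add rvs_mult rvs_max rvs_uminus rvs_const XR)
    show "max (X \<omega>) 0 * PG \<sigma>\<^sub>0 (t - s) ?g 0 + max (- X \<omega>) 0 * PG \<sigma>\<^sub>0 (t - s) (\<lambda>y. - ?g y) 0 \<le> ?c * \<bar>X \<omega>\<bar>" for \<omega>
    proof -
      have "max (X \<omega>) 0 * PG \<sigma>\<^sub>0 (t - s) ?g 0 \<le> max (X \<omega>) 0 * ?c" by (intro mult_left_mono p) simp
      moreover have "max (- X \<omega>) 0 * PG \<sigma>\<^sub>0 (t - s) (\<lambda>y. - ?g y) 0 \<le> max (- X \<omega>) 0 * ?c" by (intro mult_left_mono p) simp
      moreover have "\<bar>X \<omega>\<bar> = max (X \<omega>) 0 + max (- X \<omega>) 0" by (simp add: max_def abs_if)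
      then have "?c * \<bar>X \<omega>\<bar> = max (X \<omega>) 0 * ?c + max (- X \<omega>) 0 * ?c" by (simp only: distrib_left mult.commute)
      ultimately show ?thesis by linarith
    qed
  qed (intro rvs_scale rvs_abs XR)
  also have "\<dots> = ?c * E (\<lambda>\<omega>. \<bar>X \<omega>\<bar>)" using ts by (intro E_scale rvs_abs XR) simp
  finally show ?thesis .
qed

text \<open>The \<open>sqrt 3\<close> stems from the fourth moment in
  \<open>PG_trunc_diff_square\<close>.\<close>

lemma incr_Cauchy:
  assumes X: "X \<in> rvs {0..s}" and s: "0 \<le> s" "s < t" and "n \<le> m"
  shows "n2 (\<lambda>\<omega>. X \<omega> * (incr s t m \<omega> - incr s t n \<omega>)) \<le> sqrt 3 * (t - s) / real (Suc n) * n2 X"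
proof -
  have "n2 (\<lambda>\<omega>. X \<omega> * (incr s t m \<omega> - incr s t n \<omega>)) \<le> sqrt (3 * (t - s)\<^sup>2 / (real (Suc n))\<^sup>2) * n2 X"
    unfolding incr_def using s \<open>n \<le> m\<close>
    by (intro n2_mult_increment[OF X blip_trunc_diff s] PG_trunc_diff_square) auto
  also have "sqrt (3 * (t - s)\<^sup>2 / (real (Suc n))\<^sup>2) = sqrt 3 * (t - s) / real (Suc n)"
    using s by (simp add: real_sqrt_mult real_sqrt_divide del: of_nat_Suc)
  finally show ?thesis .
qed

text \<open>Truncation is not additive. The defect vanishes if both arguments are at most
  \<open>N / 2\<close> in modulus; otherwise it is at most \<open>3 * N\<close>, while one truncated
  square is at least \<open>N\<^sup>2 / 4\<close>, which explains the 12.\<close>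

lemma trunc_diff_error:
  assumes "N > 0"
  shows "\<bar>trunc N (x - y) - (trunc N x - trunc N y)\<bar> \<le> 12 / real N * ((trunc N x)\<^sup>2 + (trunc N y)\<^sup>2)"
proof (cases "\<bar>x\<bar> \<le> real N / 2 \<and> \<bar>y\<bar> \<le> real N / 2")
  case True
  then have "\<bar>x - y\<bar> \<le> real N" "\<bar>x\<bar> \<le> real N" "\<bar>y\<bar> \<le> real N" by linarith+
  then have "trunc N (x - y) - (trunc N x - trunc N y) = 0" by (simp add: trunc_id)
  moreover have "0 \<le> 12 / real N * ((trunc N x)\<^sup>2 + (trunc N y)\<^sup>2)" by simp
  ultimately show ?thesis by (metis abs_zero)
next
  case False
  have N: "real N > 0" using assms by simp
  have t: "(real N / 2)\<^sup>2 \<le> (trunc N z)\<^sup>2" if "\<not> \<bar>z\<bar> \<le> real N / 2" for z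
  proof -
    have "real N / 2 \<le> \<bar>trunc N z\<bar>" using that N by (auto simp: trunc_def max_def min_def)
    then show ?thesis using N by (simp flip: abs_le_square_iff)
  qed
  have "(real N / 2)\<^sup>2 \<le> (trunc N x)\<^sup>2 + (trunc N y)\<^sup>2"
    using False t[of x] t[of y] zero_le_power2[of "trunc N x"] zero_le_power2[of "trunc N y"] by linarith
  then have "12 / real N * (real N / 2)\<^sup>2 \<le> 12 / real N * ((trunc N x)\<^sup>2 + (trunc N y)\<^sup>2)"
    by (intro mult_left_mono) auto
  moreover have "12 / real N * (real N / 2)\<^sup>2 = 3 * real N" using N by (simp add: power2_eq_square)
  ultimately show ?thesis
    using abs_trunc_le[of N "x - y"] abs_trunc_le[of N x] abs_trunc_le[of N y] by linarith
qed

lemma B_0: "B 0 \<omega> = 0"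
  by (simp add: B_def Rep_cpath_nonpos)

lemma L2app_incr_ex:
  assumes s: "0 \<le> s" "s < t" obtains Y where "L2app t (incr s t) Y"
proof -
  have r: "incr s t n \<in> rvs {0..t}" for n using s by (intro rvs_incr) auto
  have one: "n2 (\<lambda>_. 1) = 1" by (simp add: n2_def E_const)
  have c: "n2 (\<lambda>\<omega>. incr s t m \<omega> - incr s t n \<omega>) \<le> sqrt 3 * (t - s) * (1 / real (Suc n))" if "n \<le> m" for m n
    using incr_Cauchy[OF rvs_const[of 1] s that] by (simp add: one)
  have C: "\<exists>N. \<forall>m\<ge>N. \<forall>n\<ge>N. n2 (\<lambda>\<omega>. incr s t m \<omega> - incr s t n \<omega>) < e" if e: "e > 0" for e
  proof -
    have "(\<lambda>n. sqrt 3 * (t - s) * (1 / real (Suc n))) \<longlonglongrightarrow> sqrt 3 * (t - s) * 0"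
      by (intro tendsto_intros tendsto_inverse_Suc)
    then have "\<forall>\<^sub>F n in sequentially. sqrt 3 * (t - s) * (1 / real (Suc n)) < e" using e by (intro order_tendstoD(2)) auto
    then obtain N where N: "\<forall>n\<ge>N. sqrt 3 * (t - s) * (1 / real (Suc n)) < e" unfolding eventually_sequentially by blast
    show ?thesis
    proof (intro exI allI impI)
      fix m n assume mn: "N \<le> m" "N \<le> n"
      show "n2 (\<lambda>\<omega>. incr s t m \<omega> - incr s t n \<omega>) < e"
      proof (cases "n \<le> m")
        case True
        then show ?thesis using c[OF True] N mn by fastforce
      next
        case False
        then have "m \<le> n" by simp
        then have "n2 (\<lambda>\<omega>. incr s t n \<omega> - incr s t m \<omega>) < e" using c[of m n] N mn by fastforce
        then show ?thesis unfolding n2_commute[of "incr s t m"] .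
      qed
    qed
  qed
  have "Cauchy (\<lambda>n. j (incr s t n))"
  proof (rule metric_CauchyI)
    fix e :: real assume "e > 0"
    then obtain N where N: "\<forall>m\<ge>N. \<forall>n\<ge>N. n2 (\<lambda>\<omega>. incr s t m \<omega> - incr s t n \<omega>) < e" using C by metis
    have "dist (j (incr s t m)) (j (incr s t n)) < e" if "m \<ge> N" "n \<ge> N" for m n
    proof -
      note R = rvs_RV[OF r]
      have "dist (j (incr s t m)) (j (incr s t n)) \<le> n2 (\<lambda>\<omega>. incr s t m \<omega> - incr s t n \<omega>)"
        unfolding dist_j[OF R R] by (rule E_abs_le_n2[OF rvs_diff[OF R R]])
      then show ?thesis using N that by fastforce
    qed
    then show "\<exists>M. \<forall>m\<ge>M. \<forall>n\<ge>M. dist (j (incr s t m)) (j (incr s t n)) < e" by blast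
  qed
  from Cauchy_convergent[OF this] obtain Y where "(\<lambda>n. j (incr s t n)) \<longlonglongrightarrow> Y" unfolding convergent_def by blast
  then have "L2app t (incr s t) Y" unfolding L2app_def using r C by blast
  then show ?thesis by (rule that)
qed

lemma LB_lim:
  assumes "t \<ge> 0" shows "(\<lambda>n. j (incr 0 t n)) \<longlonglongrightarrow> LB j t"
proof -
  have "\<exists>Y. (\<lambda>n. j (incr 0 t n)) \<longlonglongrightarrow> Y"
  proof (cases "t = 0")
    case True
    then have "(\<lambda>n. j (incr 0 t n)) = (\<lambda>_. j (\<lambda>_. 0))" by (simp add: incr_def[abs_def] B_0 trunc_id)
    then have "(\<lambda>n. j (incr 0 t n)) \<longlonglongrightarrow> j (\<lambda>_. 0)" by simp
    then show ?thesis by blast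
  next
    case False
    then obtain Y where "L2app t (incr 0 t) Y" using L2app_incr_ex[of 0 t] assms by (metis order_less_le order_refl)
    then show ?thesis using L2appD(4) by blast
  qed
  then obtain Y where Y: "(\<lambda>n. j (incr 0 t n)) \<longlonglongrightarrow> Y" ..
  \<comment> \<open>\<open>incr\<close> with index \<open>n\<close> truncates at
    \<open>n + 1\<close>, the sequence defining \<open>LB\<close> at its own index.\<close>
  have "(\<lambda>N::nat. j (\<lambda>\<omega>. max (min (B t \<omega>) (real N)) (- real N))) \<longlonglongrightarrow> Y"
    by (rule LIMSEQ_imp_Suc) (use Y in \<open>simp add: incr_def[abs_def] trunc_def B_0\<close>)
  then have "LB j t = Y" unfolding LB_def by (rule limI)
  then show ?thesis using Y by simp
qed

text \<open>\<open>LB j t\<close> and \<open>LB j s\<close> are obtained by truncating at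
  \<open>t\<close> and at \<open>s\<close> separately, whereas independence concerns the truncated
  difference. The expected defect is at most \<open>12 * (t + s) / Suc n\<close> by
  \<open>trunc_diff_error\<close> and the second moments, so the limits coincide.\<close>

lemma L2app_incr:
  assumes s: "0 \<le> s" "s < t" shows "L2app t (incr s t) (LB j t - LB j s)"
proof -
  obtain Y where Y: "L2app t (incr s t) Y" using L2app_incr_ex[OF s] by metis
  have t0: "0 < t" "0 \<le> t" using s by auto
  have r: "incr s t n \<in> RV" "incr 0 t n \<in> RV" "incr 0 s n \<in> RV" for n using s by (intro rvs_incr; simp)+
  have sq: "E (\<lambda>\<omega>. (incr 0 u n \<omega>)\<^sup>2) \<le> u" if "u \<ge> 0" for u n
  proof (cases "u = 0")
    case True
    then show ?thesis by (simp add: incr_def B_0 trunc_id E_const)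
  next
    case False
    then have u: "0 < u" using that by simp
    have "E (\<lambda>\<omega>. 1 * (incr 0 u n \<omega>)\<^sup>2) \<le> u * E (\<lambda>_. 1)"
      unfolding incr_def by (rule E_increment_le[OF rvs_const _ blip_square[OF blip_trunc]])
        (use u PG_trunc_square in auto)
    then show ?thesis by (simp add: E_const)
  qed
  have "(\<lambda>n. j (incr s t n) - (j (incr 0 t n) - j (incr 0 s n))) \<longlonglongrightarrow> 0"
  proof (rule Lim_null_comparison[OF always_eventually], rule allI)
    fix n
    let ?q = "\<lambda>\<omega>. 12 / real (Suc n) * ((incr 0 t n \<omega>)\<^sup>2 + (incr 0 s n \<omega>)\<^sup>2)"
    note d = rvs_diff[OF r(2,3)] and p = rvs_add[OF rvs_power2[OF r(2)] rvs_power2[OF r(3)]]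
    have "norm (j (incr s t n) - (j (incr 0 t n) - j (incr 0 s n))) = E (\<lambda>\<omega>. \<bar>incr s t n \<omega> - (incr 0 t n \<omega> - incr 0 s n \<omega>)\<bar>)"
      using dist_j[OF r(1) d] by (simp add: dist_norm j_diff[OF r(2,3)])
    also have "\<dots> \<le> E ?q"
    proof (intro E_mono rvs_abs rvs_diff[OF r(1) d] rvs_scale p)
      show "\<bar>incr s t n \<omega> - (incr 0 t n \<omega> - incr 0 s n \<omega>)\<bar> \<le> ?q \<omega>" for \<omega>
        using trunc_diff_error[OF zero_less_Suc, of n "B t \<omega>" "B s \<omega>"] by (simp add: incr_def B_0)
    qed
    also have "\<dots> = 12 / real (Suc n) * E (\<lambda>\<omega>. (incr 0 t n \<omega>)\<^sup>2 + (incr 0 s n \<omega>)\<^sup>2)" by (rule E_scale[OF p]) simp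
    also have "\<dots> \<le> 12 / real (Suc n) * (t + s)"
    proof (rule mult_left_mono)
      show "E (\<lambda>\<omega>. (incr 0 t n \<omega>)\<^sup>2 + (incr 0 s n \<omega>)\<^sup>2) \<le> t + s"
        using E_add_le[OF rvs_power2[OF r(2)] rvs_power2[OF r(3)], of n n] sq[OF t0(2), of n] sq[OF s(1), of n] by linarith
    qed simp
    also have "\<dots> = 12 * (t + s) * (1 / real (Suc n))" by simp
    finally show "norm (j (incr s t n) - (j (incr 0 t n) - j (incr 0 s n))) \<le> 12 * (t + s) * (1 / real (Suc n))" .
  next
    have "(\<lambda>n. 12 * (t + s) * (1 / real (Suc n))) \<longlonglongrightarrow> 12 * (t + s) * 0"
      by (intro tendsto_intros tendsto_inverse_Suc)
    then show "(\<lambda>n. 12 * (t + s) * (1 / real (Suc n))) \<longlonglongrightarrow> 0" by simp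
  qed
  from tendsto_add[OF this tendsto_diff[OF LB_lim[OF t0(2)] LB_lim[OF s(1)]]]
  have "(\<lambda>n. j (incr s t n)) \<longlonglongrightarrow> LB j t - LB j s" by simp
  then have "Y = LB j t - LB j s" using L2appD(4)[OF Y] LIMSEQ_unique by blast
  then show ?thesis using Y by simp
qed

text \<open>A product of square integrable elements need not be square integrable. Here the
  increment is independent of \<open>X\<close>, so multiplying by it costs only the factor
  \<open>sqrt (t - s)\<close> in \<open>n2\<close>, and the product sequence is Cauchy.\<close>

lemma L2app_Lmult_incr:
  assumes x: "L2app s x X" and s: "0 \<le> s" "s < t"
  shows "L2app t (\<lambda>n \<omega>. x n \<omega> * incr s t n \<omega>) (Lmult j X (LB j t - LB j s))"
  unfolding L2app_def
proof (intro conjI allI impI)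
  note D = L2appD[OF x]
  have st: "s \<le> t" using s by simp
  have xt: "x n \<in> rvs {0..t}" for n by (rule L2appD(1)[OF L2app_mono[OF x st]])
  have ir: "incr s t n \<in> rvs {0..t}" for n using s by (intro rvs_incr) auto
  note iR = rvs_RV[OF ir]
  show "(\<lambda>\<omega>. x n \<omega> * incr s t n \<omega>) \<in> rvs {0..t}" for n by (rule rvs_mult[OF xt ir])
  show "(\<lambda>n. j (\<lambda>\<omega>. x n \<omega> * incr s t n \<omega>)) \<longlonglongrightarrow> Lmult j X (LB j t - LB j s)"
    by (rule L2app_Lmult(1)[OF x L2app_incr[OF s]])
  fix e :: real assume e: "e > 0"
  obtain C where C: "\<And>n. n2 (x n) \<le> C" "C \<ge> 0" using L2app_bounded[OF x] by metis
  define r where "r = sqrt (t - s)"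
  have q: "r \<ge> 0" using s by (simp add: r_def)
  then have q1: "r + 1 \<noteq> 0" by linarith
  define d where "d = e / 2 / (r + 1)"
  have d: "d > 0" using e q by (simp add: d_def)
  have "(r + 1) * d = e / 2" unfolding d_def using q1 by (metis nonzero_mult_div_cancel_left times_divide_eq_right)
  then have "r * d + d = e / 2" by (metis distrib_right mult_1)
  then have d2: "r * d \<le> e / 2" using d by linarith
  obtain N1 where N1: "\<And>m n. m \<ge> N1 \<Longrightarrow> n \<ge> N1 \<Longrightarrow> n2 (\<lambda>\<omega>. x m \<omega> - x n \<omega>) < d" using L2app_CauchyE[OF x d] by metis
  have "(\<lambda>n. sqrt 3 * (t - s) * C * (1 / real (Suc n))) \<longlonglongrightarrow> sqrt 3 * (t - s) * C * 0"
    by (intro tendsto_intros tendsto_inverse_Suc)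
  then have "\<forall>\<^sub>F n in sequentially. sqrt 3 * (t - s) * C * (1 / real (Suc n)) < e / 2" using e by (intro order_tendstoD(2)) auto
  then obtain N2 where N2: "\<forall>n\<ge>N2. sqrt 3 * (t - s) * C * (1 / real (Suc n)) < e / 2" unfolding eventually_sequentially by blast
  have main: "n2 (\<lambda>\<omega>. x m \<omega> * incr s t m \<omega> - x n \<omega> * incr s t n \<omega>) < e" if mn: "n \<le> m" "n \<ge> max N1 N2" for m n
  proof -
    note dx = rvs_diff[OF D(1) D(1), of m n] and dxR = rvs_diff[OF D(2) D(2), of m n]
    have eq: "(\<lambda>\<omega>. x m \<omega> * incr s t m \<omega> - x n \<omega> * incr s t n \<omega>)
        = (\<lambda>\<omega>. (x m \<omega> - x n \<omega>) * incr s t m \<omega> + x n \<omega> * (incr s t m \<omega> - incr s t n \<omega>))"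
      by (simp add: algebra_simps)
    have "n2 (\<lambda>\<omega>. x m \<omega> * incr s t m \<omega> - x n \<omega> * incr s t n \<omega>)
       \<le> n2 (\<lambda>\<omega>. (x m \<omega> - x n \<omega>) * incr s t m \<omega>) + n2 (\<lambda>\<omega>. x n \<omega> * (incr s t m \<omega> - incr s t n \<omega>))"
      unfolding eq by (intro n2_triangle rvs_mult dxR iR D(2) rvs_diff)
    moreover have "n2 (\<lambda>\<omega>. (x m \<omega> - x n \<omega>) * incr s t m \<omega>) \<le> r * n2 (\<lambda>\<omega>. x m \<omega> - x n \<omega>)"
      unfolding incr_def r_def using s by (intro n2_mult_increment[OF dx blip_trunc s] PG_trunc_square) auto
    moreover have "r * n2 (\<lambda>\<omega>. x m \<omega> - x n \<omega>) \<le> r * d"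
      using N1[of m n] mn q by (intro mult_left_mono) auto
    moreover have "n2 (\<lambda>\<omega>. x n \<omega> * (incr s t m \<omega> - incr s t n \<omega>)) \<le> sqrt 3 * (t - s) / real (Suc n) * n2 (x n)"
      by (rule incr_Cauchy[OF D(1) s mn(1)])
    moreover have "sqrt 3 * (t - s) / real (Suc n) * n2 (x n) \<le> sqrt 3 * (t - s) / real (Suc n) * C"
      using C(1) s by (intro mult_left_mono) auto
    moreover have "sqrt 3 * (t - s) / real (Suc n) * C = sqrt 3 * (t - s) * C * (1 / real (Suc n))" by simp
    moreover have "sqrt 3 * (t - s) * C * (1 / real (Suc n)) < e / 2" using spec[OF N2, of n] mn by simp
    ultimately show ?thesis using d2 by linarith
  qed
  show "\<exists>N. \<forall>m\<ge>N. \<forall>n\<ge>N. n2 (\<lambda>\<omega>. x m \<omega> * incr s t m \<omega> - x n \<omega> * incr s t n \<omega>) < e"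
  proof (intro exI allI impI)
    fix m n assume mn: "max N1 N2 \<le> m" "max N1 N2 \<le> n"
    show "n2 (\<lambda>\<omega>. x m \<omega> * incr s t m \<omega> - x n \<omega> * incr s t n \<omega>) < e"
    proof (cases "n \<le> m")
      case True
      then show ?thesis using main mn by blast
    next
      case False
      then have "n2 (\<lambda>\<omega>. x n \<omega> * incr s t n \<omega> - x m \<omega> * incr s t m \<omega>) < e" using main[of m n] mn by simp
      then show ?thesis unfolding n2_commute[of "\<lambda>\<omega>. x m \<omega> * incr s t m \<omega>"] .
    qed
  qed
qed

lemma L1_bounded:
  assumes x: "L2app s x X" obtains C where "\<And>n. E (\<lambda>\<omega>. \<bar>x n \<omega>\<bar>) \<le> C" "C \<ge> 0"
  using L2app_bounded[OF x] E_abs_le_n2[OF L2appD(2)[OF x]] by (metis order_trans)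

text \<open>With first moments bounded by \<open>C\<close>, the truncation bias
  \<open>(t - s) * C / Suc n\<close> tends to 0.\<close>

lemma E_mult_incr_tendsto:
  assumes C: "\<And>n. y n \<in> rvs {0..s}" "\<And>n. E (\<lambda>\<omega>. \<bar>y n \<omega>\<bar>) \<le> C" and s: "0 \<le> s" "s < t"
    and l: "(\<lambda>n. E (\<lambda>\<omega>. y n \<omega> * incr s t n \<omega>)) \<longlonglongrightarrow> l"
  shows "l \<le> 0"
proof (rule LIMSEQ_le[OF l])
  have "(\<lambda>n. (t - s) * C * (1 / real (Suc n))) \<longlonglongrightarrow> (t - s) * C * 0" by (intro tendsto_intros tendsto_inverse_Suc)
  then show "(\<lambda>n. (t - s) * C * (1 / real (Suc n))) \<longlonglongrightarrow> 0" by simp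
  have "E (\<lambda>\<omega>. y n \<omega> * incr s t n \<omega>) \<le> (t - s) * C * (1 / real (Suc n))" for n
  proof -
    have "E (\<lambda>\<omega>. y n \<omega> * incr s t n \<omega>) \<le> (t - s) / real (Suc n) * E (\<lambda>\<omega>. \<bar>y n \<omega>\<bar>)"
      by (rule E_mult_incr_le[OF C(1) s])
    also have "\<dots> \<le> (t - s) / real (Suc n) * C" using s C(2) by (intro mult_left_mono) auto
    finally show ?thesis by simp
  qed
  then show "\<exists>N. \<forall>n\<ge>N. E (\<lambda>\<omega>. y n \<omega> * incr s t n \<omega>) \<le> (t - s) * C * (1 / real (Suc n))" by blast
qed

lemma LE_0: "LE \<sigma>\<^sub>0 j 0 = 0"
proof -
  have "(\<lambda>n. E (\<lambda>_. 0)) \<longlonglongrightarrow> LE \<sigma>\<^sub>0 j 0" using LE_lim[OF L2appD(2) L2appD(4), OF L2app_0 L2app_0] .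
  then show ?thesis by (simp add: E_const LIMSEQ_const_iff)
qed

lemma L2app_uminus: "L2app T x X \<Longrightarrow> L2app T (\<lambda>n \<omega>. - x n \<omega>) (- X)"
  using L2app_lincomb[of T x X x X "-1" 0] by simp

text \<open>In the limit both the product and its negative have expectation at most 0; as they add
  up to 0, subadditivity forces both expectations to be 0.\<close>

lemma LE_Lmult_incr:
  assumes x: "L2app s x X" and s: "0 \<le> s" "s < t"
  shows "LE \<sigma>\<^sub>0 j (Lmult j X (LB j t - LB j s)) = 0" (is "LE _ _ ?W = 0") and "LE \<sigma>\<^sub>0 j (- Lmult j X (LB j t - LB j s)) = 0"
proof -
  note A = L2app_Lmult_incr[OF x s] and nA = L2app_Lmult_incr[OF L2app_uminus[OF x] s]
  have nA: "L2app t (\<lambda>n \<omega>. - x n \<omega> * incr s t n \<omega>) (- ?W)" using L2app_uminus[OF A] by simp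
  obtain C where C: "\<And>n. E (\<lambda>\<omega>. \<bar>x n \<omega>\<bar>) \<le> C" using L1_bounded[OF x] by metis
  have "LE \<sigma>\<^sub>0 j ?W \<le> 0"
    by (rule E_mult_incr_tendsto[OF L2appD(1)[OF x] C s LE_lim[OF L2appD(2)[OF A] L2appD(4)[OF A]]])
  moreover have "LE \<sigma>\<^sub>0 j (- ?W) \<le> 0"
  proof (rule E_mult_incr_tendsto[OF L2appD(1)[OF L2app_uminus[OF x]] _ s LE_lim[OF L2appD(2)[OF nA] L2appD(4)[OF nA]]])
    show "E (\<lambda>\<omega>. \<bar>- x n \<omega>\<bar>) \<le> C" for n using C[of n] by simp
  qed
  moreover have "0 \<le> LE \<sigma>\<^sub>0 j ?W + LE \<sigma>\<^sub>0 j (- ?W)" using LE_add_le[OF A nA] by (simp add: LE_0)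
  ultimately show "LE \<sigma>\<^sub>0 j ?W = 0" "LE \<sigma>\<^sub>0 j (- ?W) = 0" by linarith+
qed

text \<open>Mean zero of the product gives one inequality; the other one uses that its negative has
  mean zero as well, since the expectation is only sublinear.\<close>

lemma LE_add_Lmult_incr:
  assumes z: "L2app s z Z" and x: "L2app s x X" and s: "0 \<le> s" "s < t"
  shows "LE \<sigma>\<^sub>0 j (Z + Lmult j X (LB j t - LB j s)) = LE \<sigma>\<^sub>0 j Z" (is "LE _ _ (Z + ?W) = _")
proof (rule antisym)
  note A = L2app_Lmult_incr[OF x s] and zt = L2app_mono[OF z less_imp_le[OF s(2)]]
  show "LE \<sigma>\<^sub>0 j (Z + ?W) \<le> LE \<sigma>\<^sub>0 j Z" using LE_add_le[OF zt A] LE_Lmult_incr(1)[OF x s] by linarith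
  show "LE \<sigma>\<^sub>0 j Z \<le> LE \<sigma>\<^sub>0 j (Z + ?W)"
    using LE_add_le[OF L2app_add[OF zt A] L2app_uminus[OF A]] LE_Lmult_incr(2)[OF x s] by simp
qed

text \<open>The square is expanded for cylinder variables. In the mixed term the factor
  \<open>2 * z * x\<close> belongs to the past, so its expectation is at most of order
  \<open>1 / Suc n\<close> by \<open>E_mult_incr_le\<close>, uniformly because Cauchy-Schwarz bounds
  \<open>E[|z * x|]\<close> by \<open>Cz * Cx\<close>.\<close>

lemma LE_Lpow_add_Lmult_incr:
  assumes z: "L2app s z Z" and x: "L2app s x X" and s: "0 \<le> s" "s < t"
  shows "LE \<sigma>\<^sub>0 j (Lpow j 2 (Z + Lmult j X (LB j t - LB j s)))
    \<le> LE \<sigma>\<^sub>0 j (Lpow j 2 Z) + (t - s) * LE \<sigma>\<^sub>0 j (Lpow j 2 X)"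
proof -
  note A = L2app_Lmult_incr[OF x s] and zt = L2app_mono[OF z less_imp_le[OF s(2)]]
  note Dz = L2appD[OF z] and Dx = L2appD[OF x]
  obtain Cz where Cz: "\<And>n. n2 (z n) \<le> Cz" "Cz \<ge> 0" using L2app_bounded[OF z] by metis
  obtain Cx where Cx: "\<And>n. n2 (x n) \<le> Cx" "Cx \<ge> 0" using L2app_bounded[OF x] by metis
  let ?r = "\<lambda>n. (t - s) * (2 * Cz * Cx) * (1 / real (Suc n))"
  have bound: "E (\<lambda>\<omega>. (z n \<omega> + x n \<omega> * incr s t n \<omega>)\<^sup>2) \<le> E (\<lambda>\<omega>. (z n \<omega>)\<^sup>2) + (t - s) * E (\<lambda>\<omega>. (x n \<omega>)\<^sup>2) + ?r n" for n
  proof -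
    have iR: "incr s t n \<in> RV" using s by (intro rvs_incr) auto
    let ?u = "\<lambda>\<omega>. 2 * z n \<omega> * x n \<omega> * incr s t n \<omega>" and ?v = "\<lambda>\<omega>. (x n \<omega>)\<^sup>2 * (incr s t n \<omega>)\<^sup>2"
    have u: "?u \<in> RV" by (intro rvs_mult rvs_scale Dz Dx iR)
    have v: "?v \<in> RV" by (intro rvs_mult rvs_power2 Dx iR)
    have eq: "(\<lambda>\<omega>. (z n \<omega> + x n \<omega> * incr s t n \<omega>)\<^sup>2) = (\<lambda>\<omega>. (z n \<omega>)\<^sup>2 + (?u \<omega> + ?v \<omega>))"
      by (simp add: fun_eq_iff power2_eq_square algebra_simps)
    have "E (\<lambda>\<omega>. (z n \<omega> + x n \<omega> * incr s t n \<omega>)\<^sup>2) \<le> E (\<lambda>\<omega>. (z n \<omega>)\<^sup>2) + E (\<lambda>\<omega>. ?u \<omega> + ?v \<omega>)"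
      unfolding eq by (rule E_add_le[OF rvs_power2[OF Dz(2)] rvs_add[OF u v]])
    moreover have "E (\<lambda>\<omega>. ?u \<omega> + ?v \<omega>) \<le> E ?u + E ?v" by (rule E_add_le[OF u v])
    moreover have "E ?v \<le> (t - s) * E (\<lambda>\<omega>. (x n \<omega>)\<^sup>2)"
      unfolding incr_def
      by (rule E_increment_le[OF rvs_power2[OF Dx(1)] _ blip_square[OF blip_trunc] s]) (use s PG_trunc_square in auto)
    moreover have "E ?u \<le> (t - s) / real (Suc n) * E (\<lambda>\<omega>. \<bar>2 * z n \<omega> * x n \<omega>\<bar>)"
      by (rule E_mult_incr_le[OF _ s]) (intro rvs_mult rvs_scale Dz(1) Dx(1))
    moreover have "(t - s) / real (Suc n) * E (\<lambda>\<omega>. \<bar>2 * z n \<omega> * x n \<omega>\<bar>) \<le> (t - s) / real (Suc n) * (2 * Cz * Cx)"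
    proof (rule mult_left_mono)
      have "E (\<lambda>\<omega>. \<bar>2 * z n \<omega> * x n \<omega>\<bar>) \<le> n2 (\<lambda>\<omega>. 2 * z n \<omega>) * n2 (x n)"
        by (rule Cauchy_Schwarz[OF rvs_scale[OF Dz(2)] Dx(2)])
      also have "\<dots> \<le> (2 * Cz) * Cx"
        unfolding n2_scale[OF Dz(2)] using Cz Cx(1) n2_nonneg[OF Dx(2)] n2_nonneg[OF Dz(2)] by (intro mult_mono) auto
      finally show "E (\<lambda>\<omega>. \<bar>2 * z n \<omega> * x n \<omega>\<bar>) \<le> 2 * Cz * Cx" .
    qed (use s in simp)
    moreover have "(t - s) / real (Suc n) * (2 * Cz * Cx) = ?r n" by simp
    ultimately show ?thesis by linarith
  qed
  have "?r \<longlonglongrightarrow> (t - s) * (2 * Cz * Cx) * 0" by (intro tendsto_intros tendsto_inverse_Suc)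
  then have "?r \<longlonglongrightarrow> 0" by simp
  then have "(\<lambda>n. E (\<lambda>\<omega>. (z n \<omega>)\<^sup>2) + (t - s) * E (\<lambda>\<omega>. (x n \<omega>)\<^sup>2) + ?r n)
      \<longlonglongrightarrow> LE \<sigma>\<^sub>0 j (Lpow j 2 Z) + (t - s) * LE \<sigma>\<^sub>0 j (Lpow j 2 X) + 0"
    by (intro tendsto_add tendsto_mult tendsto_const LE_Lpow_lim[OF z] LE_Lpow_lim[OF x])
  from LIMSEQ_le[OF LE_Lpow_lim[OF L2app_add[OF zt A]] this] bound show ?thesis by simp
qed

lemma LE_Lpow_0: "LE \<sigma>\<^sub>0 j (Lpow j 2 0) = 0"
proof -
  have "(\<lambda>n. E (\<lambda>_. 0\<^sup>2)) \<longlonglongrightarrow> LE \<sigma>\<^sub>0 j (Lpow j 2 0)" by (rule LE_Lpow_lim[OF L2app_0])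
  then show ?thesis by (simp add: E_const LIMSEQ_const_iff)
qed

text \<open>Membership in \<open>LGp\<close> and the two moments are proved together, because the
  induction step treats the partial sum as the past of the next increment.\<close>

lemma ito_sum_moments:
  assumes "ts 0 = 0" and "\<And>i. i < m \<Longrightarrow> ts i < ts (Suc i)" and "\<And>i. i < m \<Longrightarrow> \<xi> i \<in> LGp j 2 (ts i)"
  shows "0 \<le> ts m \<and> ito_sum j m ts \<xi> \<in> LGp j 2 (ts m) \<and> LE \<sigma>\<^sub>0 j (ito_sum j m ts \<xi>) = 0 \<and>
    LE \<sigma>\<^sub>0 j (Lpow j 2 (ito_sum j m ts \<xi>)) \<le> (\<Sum>i<m. (ts (Suc i) - ts i) * LE \<sigma>\<^sub>0 j (Lpow j 2 (\<xi> i)))"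
  using assms(2-3)
proof (induction m)
  case 0
  show ?case using L2app_imp_LGp[OF L2app_0, of 0] by (simp add: assms(1) ito_sum_def LE_0 LE_Lpow_0)
next
  case (Suc m)
  have IH: "0 \<le> ts m" "ito_sum j m ts \<xi> \<in> LGp j 2 (ts m)" "LE \<sigma>\<^sub>0 j (ito_sum j m ts \<xi>) = 0"
    "LE \<sigma>\<^sub>0 j (Lpow j 2 (ito_sum j m ts \<xi>)) \<le> (\<Sum>i<m. (ts (Suc i) - ts i) * LE \<sigma>\<^sub>0 j (Lpow j 2 (\<xi> i)))"
    using Suc by simp_all
  have t: "ts m < ts (Suc m)" "0 \<le> ts (Suc m)" using Suc.prems(1)[of m] IH(1) by auto
  obtain z where z: "L2app (ts m) z (ito_sum j m ts \<xi>)" using LGp_imp_L2app[OF IH(2,1)] by metis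
  obtain x where x: "L2app (ts m) x (\<xi> m)" using LGp_imp_L2app[OF Suc.prems(2)[of m] IH(1)] by auto
  have eq: "ito_sum j (Suc m) ts \<xi> = ito_sum j m ts \<xi> + Lmult j (\<xi> m) (LB j (ts (Suc m)) - LB j (ts m))"
    by (simp add: ito_sum_def)
  have "ito_sum j (Suc m) ts \<xi> \<in> LGp j 2 (ts (Suc m))"
    unfolding eq by (rule L2app_imp_LGp[OF L2app_add[OF L2app_mono[OF z] L2app_Lmult_incr[OF x IH(1) t(1)]] t(2)]) (use t in simp)
  moreover have "LE \<sigma>\<^sub>0 j (ito_sum j (Suc m) ts \<xi>) = 0"
    unfolding eq using LE_add_Lmult_incr[OF z x IH(1) t(1)] IH(3) by simp
  moreover have "LE \<sigma>\<^sub>0 j (Lpow j 2 (ito_sum j (Suc m) ts \<xi>)) \<le> (\<Sum>i<Suc m. (ts (Suc i) - ts i) * LE \<sigma>\<^sub>0 j (Lpow j 2 (\<xi> i)))"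
    unfolding eq using LE_Lpow_add_Lmult_incr[OF z x IH(1) t(1)] IH(4) by simp
  ultimately show ?case using t(2) by blast
qed

end

section \<open>The stochastic integral\<close>

definition grid :: "real \<Rightarrow> nat \<Rightarrow> (nat \<Rightarrow> real) \<Rightarrow> bool" where
  "grid T M u \<longleftrightarrow> u 0 = 0 \<and> u M = T \<and> (\<forall>i<M. u i < u (Suc i))"

lemma grid_strict_mono: assumes "grid T M u" "i < k" "k \<le> M" shows "u i < u k"
  using assms(2,3)
proof (induction k)
  case (Suc k)
  have "u k < u (Suc k)" using assms(1) Suc.prems by (simp add: grid_def)
  then show ?case using Suc by (cases "i = k") auto
qed simp

lemma grid_mono: "grid T M u \<Longrightarrow> i \<le> k \<Longrightarrow> k \<le> M \<Longrightarrow> u i \<le> u k"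
  using grid_strict_mono[of T M u i k] by (cases "i = k") auto

lemma grid_less_iff: "grid T M u \<Longrightarrow> i \<le> M \<Longrightarrow> k \<le> M \<Longrightarrow> u i < u k \<longleftrightarrow> i < k"
  using grid_strict_mono[of T M u i k] grid_mono[of T M u k i] by (meson linorder_not_less)

lemma grid_bounds: assumes "grid T M u" "i \<le> M" shows "0 \<le> u i" "u i \<le> T"
  using grid_mono[OF assms(1) _ assms(2), of 0] grid_mono[OF assms(1,2) order_refl] assms(1) by (auto simp: grid_def)

lemma grid_cover:
  fixes u :: "nat \<Rightarrow> real"
  shows "u 0 \<le> t \<Longrightarrow> t < u n \<Longrightarrow> \<exists>i<n. t \<in> {u i..<u (Suc i)}"
proof (induction n)
  case (Suc n)
  show ?case
  proof (cases "t < u n")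
    case True
    then show ?thesis using Suc.IH[OF Suc.prems(1)] less_SucI by metis
  next
    case False
    then show ?thesis using Suc.prems by (intro exI[of _ n]) auto
  qed
qed simp

lemma grid_exists:
  assumes A: "finite A" "A \<subseteq> {0..T}" "0 \<in> A" "T \<in> A"
  obtains M u where "grid T M u" "u ` {..M} = A"
proof -
  define xs where "xs = sorted_list_of_set A"
  have xs: "sorted xs" "distinct xs" "set xs = A" using A by (simp_all add: xs_def)
  then have l: "length xs > 0" using A by auto
  have ord: "xs ! i < xs ! k" if "i < k" "k < length xs" for i k
    using that xs sorted_nth_mono[of xs i k] nth_eq_iff_index_eq[of xs i k] by force
  have at: "xs ! i \<in> A" if "i < length xs" for i using that xs(3) nth_mem by blast
  obtain i where i: "i < length xs" "xs ! i = 0" using A(3) xs(3) by (metis in_set_conv_nth)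
  obtain k where k: "k < length xs" "xs ! k = T" using A(4) xs(3) by (metis in_set_conv_nth)
  have "i = 0" using ord[of 0 i] at[OF l] A(2) i by force
  moreover have "k = length xs - 1" using ord[of k "length xs - 1"] at[of "length xs - 1"] A(2) k l by force
  ultimately have "grid T (length xs - 1) ((!) xs)" unfolding grid_def using i k ord by simp
  moreover have "(!) xs ` {..length xs - 1} = A"
  proof -
    have "{..length xs - 1} = {0..<length xs}" using l by (cases "length xs") auto
    then show ?thesis using xs(3) nth_image[of "length xs" xs] by simp
  qed
  ultimately show ?thesis by (rule that)
qed

lemma simple_process_value:
  assumes g: "grid T N ts" and i: "i < N" "t \<in> {ts i..<ts (Suc i)}"
  shows "simple_process N ts \<xi> t = \<xi> i"
proof -
  have "indicat_real {ts k..<ts (Suc k)} t *\<^sub>R \<xi> k = (if k = i then \<xi> i else 0)" if k: "k < N" for k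
  proof (cases k i rule: linorder_cases)
    case less
    then have "ts (Suc k) \<le> ts i" using grid_mono[OF g, of "Suc k" i] i by simp
    then show ?thesis using less i by simp
  next
    case greater
    then have "ts (Suc i) \<le> ts k" using grid_mono[OF g, of "Suc i" k] k by simp
    then show ?thesis using greater i by simp
  qed (use i in simp)
  then have "simple_process N ts \<xi> t = (\<Sum>k<N. if k = i then \<xi> i else 0)"
    unfolding simple_process_def by (intro sum.cong) auto
  then show ?thesis using i by simp
qed

lemma simple_process_outside:
  assumes g: "grid T N ts" and t: "t \<notin> {0..<T}" shows "simple_process N ts \<xi> t = 0"
  unfolding simple_process_def
proof (rule sum.neutral, rule ballI)
  fix i assume "i \<in> {..<N}"
  then have "0 \<le> ts i" "ts (Suc i) \<le> T" using grid_bounds[OF g] by simp_all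
  then have "t \<notin> {ts i..<ts (Suc i)}" using t by auto
  then show "indicat_real {ts i..<ts (Suc i)} t *\<^sub>R \<xi> i = 0" by simp
qed

lemma simple_process_cases:
  assumes g: "grid T N ts"
  obtains i where "i < N" "t \<in> {ts i..<ts (Suc i)}" | "t \<notin> {0..<T}"
proof (cases "t \<in> {0..<T}")
  case True
  then show ?thesis using grid_cover[of ts t N] g that(1) by (auto simp: grid_def)
qed (rule that(2))

text \<open>\<open>F 0 = 0\<close> takes care of the times outside \<open>[0, T)\<close>, among them
  \<open>T\<close> itself, where the process vanishes.\<close>

lemma simple_process_compose:
  assumes g: "grid T N ts" and F: "F 0 = 0"
  shows "F (simple_process N ts \<xi> t) = simple_process N ts (\<lambda>i. F (\<xi> i)) t"
proof (rule simple_process_cases[OF g, of t])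
  fix i assume inside: "i < N" "t \<in> {ts i..<ts (Suc i)}"
  show ?thesis unfolding simple_process_value[OF g inside] ..
next
  assume outside: "t \<notin> {0..<T}"
  show ?thesis unfolding simple_process_outside[OF g outside] by (rule F)
qed

lemma integral_simple_process:
  fixes c :: "nat \<Rightarrow> real"
  assumes g: "grid T N ts"
  shows "integral {0..T} (simple_process N ts c) = (\<Sum>i<N. (ts (Suc i) - ts i) * c i)"
proof (rule integral_unique)
  have "((\<lambda>t. indicat_real {ts i..<ts (Suc i)} t *\<^sub>R c i) has_integral (ts (Suc i) - ts i) * c i) {0..T}" if i: "i < N" for i
  proof -
    have b: "{ts i..ts (Suc i)} \<subseteq> {0..T}" using grid_bounds[OF g, of i] grid_bounds[OF g, of "Suc i"] i by auto
    have le: "ts i \<le> ts (Suc i)" using grid_mono[OF g] i by simp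
    have "((\<lambda>t. c i) has_integral (ts (Suc i) - ts i) * c i) {ts i..ts (Suc i)}"
      using has_integral_const_real[of "c i" "ts i" "ts (Suc i)"] le by simp
    then have "((\<lambda>t. if t \<in> {ts i..ts (Suc i)} then c i else 0) has_integral (ts (Suc i) - ts i) * c i) {0..T}"
      unfolding has_integral_restrict[OF b] .
    \<comment> \<open>The closed interval differs from the half-open one in its right end point
      only.\<close>
    then show ?thesis
      by (rule has_integral_spike_finite[of "{ts (Suc i)}", rotated 2]) (auto simp: indicator_def)
  qed
  then have "((\<lambda>t. \<Sum>i<N. indicat_real {ts i..<ts (Suc i)} t *\<^sub>R c i) has_integral (\<Sum>i<N. (ts (Suc i) - ts i) * c i)) {0..T}"
    by (intro has_integral_sum) auto
  then show "(simple_process N ts c has_integral (\<Sum>i<N. (ts (Suc i) - ts i) * c i)) {0..T}"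
    unfolding simple_process_def[abs_def] .
qed

lemma grid_refines:
  assumes ts: "grid T N ts" and u: "grid T M u" and sub: "ts ` {..N} \<subseteq> u ` {..M}" and k: "k < M"
  obtains i where "i < N" "ts i \<le> u k" "u (Suc k) \<le> ts (Suc i)"
proof -
  have "0 \<le> u k" using grid_bounds(1)[OF u, of k] k by simp
  moreover have "u k < T" using grid_strict_mono[OF u k] u by (simp add: grid_def)
  ultimately obtain i where i: "i < N" "u k \<in> {ts i..<ts (Suc i)}"
    using grid_cover[of ts "u k" N] ts by (auto simp: grid_def)
  have "ts (Suc i) \<in> u ` {..M}" using sub i(1) by auto
  then obtain l where l: "l \<le> M" "ts (Suc i) = u l" by auto
  then have "k < l" using grid_less_iff[OF u, of k l] i(2) k by auto
  then have "u (Suc k) \<le> ts (Suc i)" unfolding l(2) using grid_mono[OF u] l(1) by simp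
  then show ?thesis using that[OF i(1)] i(2) by simp
qed

text \<open>The new coefficients are samples of the process at the left end points. As they depend
  on the process alone, two representations of it become equal on a common refinement.\<close>

lemma simple_process_refine:
  assumes ts: "grid T N ts" and u: "grid T M u" and sub: "ts ` {..N} \<subseteq> u ` {..M}"
  shows "simple_process M u (\<lambda>k. simple_process N ts \<xi> (u k)) = simple_process N ts \<xi>"
proof
  fix t
  show "simple_process M u (\<lambda>k. simple_process N ts \<xi> (u k)) t = simple_process N ts \<xi> t"
  proof (rule simple_process_cases[OF u, of t])
    fix k assume inside: "k < M" "t \<in> {u k..<u (Suc k)}"
    obtain i where i: "i < N" "ts i \<le> u k" "u (Suc k) \<le> ts (Suc i)" using grid_refines[OF ts u sub inside(1)] .
    have "u k \<in> {ts i..<ts (Suc i)}" "t \<in> {ts i..<ts (Suc i)}" using i inside grid_strict_mono[OF u, of k "Suc k"] by auto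
    then show ?thesis unfolding simple_process_value[OF u inside] by (simp add: simple_process_value[OF ts i(1)])
  next
    assume "t \<notin> {0..<T}"
    then show ?thesis using simple_process_outside[OF u] simple_process_outside[OF ts] by metis
  qed
qed

lemma common_grid:
  assumes ts: "grid T N ts" and ts': "grid T N' ts'"
  obtains M u where "grid T M u" "ts ` {..N} \<subseteq> u ` {..M}" "ts' ` {..N'} \<subseteq> u ` {..M}"
proof -
  have 1: "finite (ts ` {..N} \<union> ts' ` {..N'})" by simp
  have 2: "ts ` {..N} \<union> ts' ` {..N'} \<subseteq> {0..T}" using grid_bounds[OF ts] grid_bounds[OF ts'] by auto
  have 3: "0 \<in> ts ` {..N} \<union> ts' ` {..N'}" using ts by (auto simp: grid_def intro!: image_eqI[of _ _ 0])
  have 4: "T \<in> ts ` {..N} \<union> ts' ` {..N'}" using ts by (auto simp: grid_def intro!: image_eqI[of _ _ N])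
  obtain M u where "grid T M u" "u ` {..M} = ts ` {..N} \<union> ts' ` {..N'}" by (rule grid_exists[OF 1 2 3 4])
  then show ?thesis by (intro that) auto
qed

lemma simple_repr_iff: "simple_repr j p T N ts \<xi> \<longleftrightarrow> grid T N ts \<and> (\<forall>i<N. \<xi> i \<in> LGp j p (ts i))"
  by (auto simp: simple_repr_def grid_def)

section \<open>The integral of simple processes\<close>

context G_expectation
begin

lemma Lmult_add_right:
  assumes x: "L2app S x X" and y: "L2app T y Y" and y': "L2app T y' Y'"
  shows "Lmult j X (Y + Y') = Lmult j X Y + Lmult j X Y'"
proof -
  note D = L2appD(2)[OF x] L2appD(2)[OF y] L2appD(2)[OF y']
  have L: "(\<lambda>n. j (\<lambda>\<omega>. x n \<omega> * (y n \<omega> + y' n \<omega>))) \<longlonglongrightarrow> Lmult j X (Y + Y')"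
    by (rule L2app_Lmult(1)[OF x L2app_add[OF y y']])
  have eq: "(\<lambda>n. j (\<lambda>\<omega>. x n \<omega> * (y n \<omega> + y' n \<omega>))) = (\<lambda>n. j (\<lambda>\<omega>. x n \<omega> * y n \<omega>) + j (\<lambda>\<omega>. x n \<omega> * y' n \<omega>))"
    unfolding j_add[OF rvs_mult[OF D(1,2)] rvs_mult[OF D(1,3)], symmetric] by (simp add: distrib_left)
  have R: "(\<lambda>n. j (\<lambda>\<omega>. x n \<omega> * y n \<omega>) + j (\<lambda>\<omega>. x n \<omega> * y' n \<omega>)) \<longlonglongrightarrow> Lmult j X Y + Lmult j X Y'"
    by (intro tendsto_add L2app_Lmult(1)[OF x y] L2app_Lmult(1)[OF x y'])
  show ?thesis by (rule LIMSEQ_unique[OF L[unfolded eq] R])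
qed

lemma Lmult_lincomb_left:
  assumes x: "L2app S x X" and x': "L2app S x' X'" and y: "L2app T y Y"
  shows "Lmult j (a *\<^sub>R X + b *\<^sub>R X') Y = a *\<^sub>R Lmult j X Y + b *\<^sub>R Lmult j X' Y"
proof -
  note D = L2appD(2)[OF x] L2appD(2)[OF x'] L2appD(2)[OF y]
  have L: "(\<lambda>n. j (\<lambda>\<omega>. (a * x n \<omega> + b * x' n \<omega>) * y n \<omega>)) \<longlonglongrightarrow> Lmult j (a *\<^sub>R X + b *\<^sub>R X') Y"
    by (rule L2app_Lmult(1)[OF L2app_lincomb[OF x x'] y])
  have eq: "(\<lambda>n. j (\<lambda>\<omega>. (a * x n \<omega> + b * x' n \<omega>) * y n \<omega>))
      = (\<lambda>n. a *\<^sub>R j (\<lambda>\<omega>. x n \<omega> * y n \<omega>) + b *\<^sub>R j (\<lambda>\<omega>. x' n \<omega> * y n \<omega>))"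
    unfolding j_linear[OF rvs_mult[OF D(1,3)] rvs_mult[OF D(2,3)], symmetric] by (simp add: algebra_simps)
  have R: "(\<lambda>n. a *\<^sub>R j (\<lambda>\<omega>. x n \<omega> * y n \<omega>) + b *\<^sub>R j (\<lambda>\<omega>. x' n \<omega> * y n \<omega>)) \<longlonglongrightarrow> a *\<^sub>R Lmult j X Y + b *\<^sub>R Lmult j X' Y"
    by (intro tendsto_intros L2app_Lmult(1)[OF x y] L2app_Lmult(1)[OF x' y])
  show ?thesis by (rule LIMSEQ_unique[OF L[unfolded eq] R])
qed

lemma Lmult_telescope:
  assumes u: "grid T M u" and X: "X \<in> LGp j 2 (u a)" and "a < b" "b \<le> M"
  shows "(\<Sum>k=a..<b. Lmult j X (LB j (u (Suc k)) - LB j (u k))) = Lmult j X (LB j (u b) - LB j (u a))"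
  using assms(3,4)
proof (induction b)
  case (Suc b)
  show ?case
  proof (cases "a = b")
    case True
    then show ?thesis by simp
  next
    case False
    then have ab: "a < b" using Suc.prems by simp
    have nn: "0 \<le> u a" "0 \<le> u b" using grid_bounds(1)[OF u] Suc.prems by auto
    have m: "u a < u b" "u b < u (Suc b)" using grid_strict_mono[OF u] ab Suc.prems by auto
    obtain x where x: "L2app (u a) x X" using LGp_imp_L2app[OF X nn(1)] by metis
    have "Lmult j X ((LB j (u b) - LB j (u a)) + (LB j (u (Suc b)) - LB j (u b)))
        = Lmult j X (LB j (u b) - LB j (u a)) + Lmult j X (LB j (u (Suc b)) - LB j (u b))"
      by (rule Lmult_add_right[OF x L2app_mono[OF L2app_incr[OF nn(1) m(1)] less_imp_le[OF m(2)]] L2app_incr[OF nn(2) m(2)]])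
    then show ?thesis using Suc.IH[OF ab] Suc.prems by simp
  qed
qed simp

text \<open>On the fine intervals within a coarse one the sampled coefficient is constant, so the
  increments telescope. In the proof \<open>f\<close> sends a coarse index to the fine index of the
  same time.\<close>

lemma ito_sum_refine:
  assumes r: "simple_repr j 2 T N ts \<xi>" and u: "grid T M u" and sub: "ts ` {..N} \<subseteq> u ` {..M}"
  shows "simple_repr j 2 T M u (\<lambda>k. simple_process N ts \<xi> (u k))" (is "simple_repr _ _ _ _ _ ?\<eta>")
    and "ito_sum j M u (\<lambda>k. simple_process N ts \<xi> (u k)) = ito_sum j N ts \<xi>"
proof -
  have ts: "grid T N ts" and \<xi>: "\<And>i. i < N \<Longrightarrow> \<xi> i \<in> LGp j 2 (ts i)" using r by (simp_all add: simple_repr_iff)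
  have "?\<eta> k \<in> LGp j 2 (u k)" if k: "k < M" for k
  proof -
    obtain i where i: "i < N" "ts i \<le> u k" "u (Suc k) \<le> ts (Suc i)" using grid_refines[OF ts u sub k] .
    have "u k \<in> {ts i..<ts (Suc i)}" using i grid_strict_mono[OF u, of k "Suc k"] k by auto
    then show ?thesis using LGp_mono[OF \<xi>[OF i(1)] grid_bounds(1)[OF ts] i(2)] i(1)
      by (simp add: simple_process_value[OF ts i(1)])
  qed
  then show "simple_repr j 2 T M u ?\<eta>" using u by (simp add: simple_repr_iff)
  have "\<forall>i\<in>{..N}. \<exists>k. k \<le> M \<and> u k = ts i"
  proof
    fix i assume "i \<in> {..N}"
    then have "ts i \<in> u ` {..M}" using sub by blast
    then show "\<exists>k. k \<le> M \<and> u k = ts i" by auto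
  qed
  then obtain f where f: "\<forall>i\<in>{..N}. f i \<le> M \<and> u (f i) = ts i" by metis
  have f0: "f 0 = 0" using grid_less_iff[OF u, of 0 "f 0"] f ts u by (auto simp: grid_def)
  have fN: "f N = M" using grid_less_iff[OF u, of "f N" M] f[THEN bspec, of N] ts u by (auto simp: grid_def)
  let ?g = "\<lambda>k. Lmult j (?\<eta> k) (LB j (u (Suc k)) - LB j (u k))"
  have "(\<Sum>k<f n. ?g k) = ito_sum j n ts \<xi>" if "n \<le> N" for n
    using that
  proof (induction n)
    case 0
    then show ?case by (simp add: f0 ito_sum_def)
  next
    case (Suc n)
    have fn: "f n \<le> M" "u (f n) = ts n" "f (Suc n) \<le> M" "u (f (Suc n)) = ts (Suc n)" using f Suc.prems by auto
    have lt: "f n < f (Suc n)" using grid_less_iff[OF u fn(1,3)] fn grid_strict_mono[OF ts, of n "Suc n"] Suc.prems by simp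
    have "(\<Sum>k=f n..<f (Suc n). ?g k) = (\<Sum>k=f n..<f (Suc n). Lmult j (\<xi> n) (LB j (u (Suc k)) - LB j (u k)))"
    proof (rule sum.cong[OF refl])
      fix k assume k: "k \<in> {f n..<f (Suc n)}"
      then have "u k \<in> {ts n..<ts (Suc n)}"
        using grid_mono[OF u, of "f n" k] grid_strict_mono[OF u, of k "f (Suc n)"] fn by simp
      then have "?\<eta> k = \<xi> n" using simple_process_value[OF ts, of n "u k"] Suc.prems by simp
      then show "?g k = Lmult j (\<xi> n) (LB j (u (Suc k)) - LB j (u k))" by simp
    qed
    also have "\<dots> = Lmult j (\<xi> n) (LB j (ts (Suc n)) - LB j (ts n))"
      using Lmult_telescope[OF u _ lt fn(3), of "\<xi> n"] \<xi>[of n] Suc.prems fn by simp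
    finally have "(\<Sum>k=f n..<f (Suc n). ?g k) = Lmult j (\<xi> n) (LB j (ts (Suc n)) - LB j (ts n))" .
    moreover have "(\<Sum>k<f (Suc n). ?g k) = (\<Sum>k<f n. ?g k) + (\<Sum>k=f n..<f (Suc n). ?g k)"
      unfolding lessThan_atLeast0 using lt by (intro sum.atLeastLessThan_concat[symmetric]) auto
    ultimately show ?case using Suc by (simp add: ito_sum_def)
  qed
  from this[of N] show "ito_sum j M u ?\<eta> = ito_sum j N ts \<xi>" by (simp add: fN ito_sum_def)
qed

text \<open>Refined to a common grid with sampled coefficients, the sums of any two representations
  coincide; so the description has the same value for all of them.\<close>

lemma ito_eq:
  assumes r: "simple_repr j 2 T N ts \<xi>" shows "ito j T (simple_process N ts \<xi>) = ito_sum j N ts \<xi>"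
  unfolding ito_def
proof (rule the_equality)
  show "\<exists>N' ts' \<xi>'. simple_repr j 2 T N' ts' \<xi>' \<and> simple_process N ts \<xi> = simple_process N' ts' \<xi>' \<and>
     ito_sum j N ts \<xi> = ito_sum j N' ts' \<xi>'" using r by blast
next
  fix Z assume "\<exists>N' ts' \<xi>'. simple_repr j 2 T N' ts' \<xi>' \<and> simple_process N ts \<xi> = simple_process N' ts' \<xi>' \<and> Z = ito_sum j N' ts' \<xi>'"
  then obtain N' ts' \<xi>' where r': "simple_repr j 2 T N' ts' \<xi>'" and eq: "simple_process N ts \<xi> = simple_process N' ts' \<xi>'"
    and Z: "Z = ito_sum j N' ts' \<xi>'" by blast
  have g: "grid T N ts" "grid T N' ts'" using r r' by (simp_all add: simple_repr_iff)
  obtain M u where u: "grid T M u" "ts ` {..N} \<subseteq> u ` {..M}" "ts' ` {..N'} \<subseteq> u ` {..M}" using common_grid[OF g] .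
  show "Z = ito_sum j N ts \<xi>"
    unfolding Z ito_sum_refine(2)[OF r u(1,2), symmetric] ito_sum_refine(2)[OF r' u(1,3), symmetric] eq ..
qed

text \<open>Both processes are sampled on a common grid, where linear combinations are formed
  coefficientwise.\<close>

lemma MGp0_lincomb:
  assumes \<eta>: "\<eta> \<in> MGp0 j 2 T" and \<zeta>: "\<zeta> \<in> MGp0 j 2 T"
  shows "(\<lambda>t. a *\<^sub>R \<eta> t + b *\<^sub>R \<zeta> t) \<in> MGp0 j 2 T"
    and "ito j T (\<lambda>t. a *\<^sub>R \<eta> t + b *\<^sub>R \<zeta> t) = a *\<^sub>R ito j T \<eta> + b *\<^sub>R ito j T \<zeta>"
proof -
  obtain N ts \<xi> where r: "simple_repr j 2 T N ts \<xi>" and \<eta>_eq: "\<eta> = simple_process N ts \<xi>" using \<eta> by (auto simp: MGp0_def)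
  obtain N' ts' \<xi>' where r': "simple_repr j 2 T N' ts' \<xi>'" and \<zeta>_eq: "\<zeta> = simple_process N' ts' \<xi>'" using \<zeta> by (auto simp: MGp0_def)
  have g: "grid T N ts" "grid T N' ts'" using r r' by (simp_all add: simple_repr_iff)
  obtain M u where u: "grid T M u" "ts ` {..N} \<subseteq> u ` {..M}" "ts' ` {..N'} \<subseteq> u ` {..M}" using common_grid[OF g] .
  have R: "simple_repr j 2 T M u (\<lambda>k. \<eta> (u k))" "simple_repr j 2 T M u (\<lambda>k. \<zeta> (u k))"
    unfolding \<eta>_eq \<zeta>_eq by (rule ito_sum_refine(1)[OF r u(1,2)], rule ito_sum_refine(1)[OF r' u(1,3)])
  have P: "simple_process M u (\<lambda>k. \<eta> (u k)) = \<eta>" "simple_process M u (\<lambda>k. \<zeta> (u k)) = \<zeta>"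
    unfolding \<eta>_eq \<zeta>_eq by (rule simple_process_refine[OF g(1) u(1,2)], rule simple_process_refine[OF g(2) u(1,3)])
  let ?\<theta> = "\<lambda>k. a *\<^sub>R \<eta> (u k) + b *\<^sub>R \<zeta> (u k)"
  have mem: "\<eta> (u k) \<in> LGp j 2 (u k)" "\<zeta> (u k) \<in> LGp j 2 (u k)" "0 \<le> u k" "u k < u (Suc k)" if "k < M" for k
    using that R grid_bounds(1)[OF u(1)] grid_strict_mono[OF u(1)] by (auto simp: simple_repr_iff)
  have R\<theta>: "simple_repr j 2 T M u ?\<theta>" using u(1) mem by (auto simp: simple_repr_iff intro!: LGp_lincomb)
  have P\<theta>: "simple_process M u ?\<theta> = (\<lambda>t. a *\<^sub>R \<eta> t + b *\<^sub>R \<zeta> t)"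
  proof
    fix t
    have "simple_process M u ?\<theta> t = a *\<^sub>R simple_process M u (\<lambda>k. \<eta> (u k)) t + b *\<^sub>R simple_process M u (\<lambda>k. \<zeta> (u k)) t"
      by (simp only: simple_process_def scaleR_add_right sum.distrib scaleR_sum_right scaleR_scaleR mult.commute)
    then show "simple_process M u ?\<theta> t = a *\<^sub>R \<eta> t + b *\<^sub>R \<zeta> t" unfolding P .
  qed
  then show "(\<lambda>t. a *\<^sub>R \<eta> t + b *\<^sub>R \<zeta> t) \<in> MGp0 j 2 T" using R\<theta> unfolding MGp0_def by (metis (mono_tags, lifting) mem_Collect_eq)
  have "ito j T (\<lambda>t. a *\<^sub>R \<eta> t + b *\<^sub>R \<zeta> t) = ito_sum j M u ?\<theta>" unfolding P\<theta>[symmetric] by (rule ito_eq[OF R\<theta>])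
  also have "\<dots> = a *\<^sub>R ito_sum j M u (\<lambda>k. \<eta> (u k)) + b *\<^sub>R ito_sum j M u (\<lambda>k. \<zeta> (u k))"
  proof -
    have "Lmult j (?\<theta> k) (LB j (u (Suc k)) - LB j (u k)) = a *\<^sub>R Lmult j (\<eta> (u k)) (LB j (u (Suc k)) - LB j (u k))
        + b *\<^sub>R Lmult j (\<zeta> (u k)) (LB j (u (Suc k)) - LB j (u k))" if k: "k < M" for k
    proof -
      obtain x where x: "L2app (u k) x (\<eta> (u k))" using LGp_imp_L2app[OF mem(1,3)[OF k]] by metis
      obtain y where y: "L2app (u k) y (\<zeta> (u k))" using LGp_imp_L2app[OF mem(2,3)[OF k]] by metis
      show ?thesis by (rule Lmult_lincomb_left[OF x y L2app_incr[OF mem(3,4)[OF k]]])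
    qed
    then show ?thesis by (simp add: ito_sum_def sum.distrib scaleR_sum_right)
  qed
  also have "\<dots> = a *\<^sub>R ito j T \<eta> + b *\<^sub>R ito j T \<zeta>" using ito_eq[OF R(1)] ito_eq[OF R(2)] unfolding P by simp
  finally show "ito j T (\<lambda>t. a *\<^sub>R \<eta> t + b *\<^sub>R \<zeta> t) = a *\<^sub>R ito j T \<eta> + b *\<^sub>R ito j T \<zeta>" .
qed

lemma MGp0_diff:
  assumes "\<eta> \<in> MGp0 j 2 T" "\<zeta> \<in> MGp0 j 2 T"
  shows "(\<lambda>t. \<eta> t - \<zeta> t) \<in> MGp0 j 2 T" and "ito j T (\<lambda>t. \<eta> t - \<zeta> t) = ito j T \<eta> - ito j T \<zeta>"
  using MGp0_lincomb[OF assms, of 1 "-1"] by simp_all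

lemma ito_moments:
  assumes \<eta>: "\<eta> \<in> MGp0 j 2 T"
  shows "ito j T \<eta> \<in> LGp j 2 T" "LE \<sigma>\<^sub>0 j (ito j T \<eta>) = 0"
    "LE \<sigma>\<^sub>0 j (Lpow j 2 (ito j T \<eta>)) \<le> integral {0..T} (\<lambda>t. LE \<sigma>\<^sub>0 j (Lpow j 2 (\<eta> t)))"
proof -
  obtain N ts \<xi> where r: "simple_repr j 2 T N ts \<xi>" and eq: "\<eta> = simple_process N ts \<xi>" using \<eta> by (auto simp: MGp0_def)
  have g: "grid T N ts" using r by (simp add: simple_repr_iff)
  have ts: "ts 0 = 0" "ts N = T" "\<And>i. i < N \<Longrightarrow> ts i < ts (Suc i)" "\<And>i. i < N \<Longrightarrow> \<xi> i \<in> LGp j 2 (ts i)"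
    using r by (simp_all add: simple_repr_def)
  note M = ito_sum_moments[of ts N \<xi>, OF ts(1,3,4)]
  have "(\<lambda>t. LE \<sigma>\<^sub>0 j (Lpow j 2 (\<eta> t))) = simple_process N ts (\<lambda>i. LE \<sigma>\<^sub>0 j (Lpow j 2 (\<xi> i)))"
    unfolding eq using simple_process_compose[OF g, of "\<lambda>X. LE \<sigma>\<^sub>0 j (Lpow j 2 X)" \<xi>] LE_Lpow_0 by (intro ext) simp
  then have I: "integral {0..T} (\<lambda>t. LE \<sigma>\<^sub>0 j (Lpow j 2 (\<eta> t))) = (\<Sum>i<N. (ts (Suc i) - ts i) * LE \<sigma>\<^sub>0 j (Lpow j 2 (\<xi> i)))"
    using integral_simple_process[OF g] by simp
  have i: "ito j T \<eta> = ito_sum j N ts \<xi>" unfolding eq by (rule ito_eq[OF r])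
  show "ito j T \<eta> \<in> LGp j 2 T" "LE \<sigma>\<^sub>0 j (ito j T \<eta>) = 0"
    "LE \<sigma>\<^sub>0 j (Lpow j 2 (ito j T \<eta>)) \<le> integral {0..T} (\<lambda>t. LE \<sigma>\<^sub>0 j (Lpow j 2 (\<eta> t)))"
    using M ts(2) unfolding I i by auto
qed

text \<open>The factor \<open>sqrt T\<close> undoes the normalisation \<open>1 / T\<close> in
  \<open>MGp_norm\<close>.\<close>

lemma LGp_norm_ito_le:
  assumes \<eta>: "\<eta> \<in> MGp0 j 2 T" and T: "T > 0"
  shows "LGp_norm \<sigma>\<^sub>0 j 2 (ito j T \<eta>) \<le> sqrt T * MGp_norm \<sigma>\<^sub>0 j 2 T \<eta>"
proof -
  let ?I = "integral {0..T} (\<lambda>t. LE \<sigma>\<^sub>0 j (Lpow j 2 (\<eta> t)))"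
  note m = ito_moments[OF \<eta>]
  obtain x where x: "L2app T x (ito j T \<eta>)" using LGp_imp_L2app[OF m(1)] T by auto
  have I: "0 \<le> ?I" using LGp_norm_lim(2)[OF x] m(3) by linarith
  have "LGp_norm \<sigma>\<^sub>0 j 2 (ito j T \<eta>) \<le> sqrt ?I" unfolding LGp_norm_lim(3)[OF x] using m(3) by simp
  also have "\<dots> = sqrt T * sqrt (1 / T * ?I)" using T by (simp flip: real_sqrt_mult)
  also have "sqrt (1 / T * ?I) = MGp_norm \<sigma>\<^sub>0 j 2 T \<eta>" unfolding MGp_norm_def using I T by (simp add: powr_half_sqrt)
  finally show ?thesis .
qed

section \<open>Extension to the completed space of integrands\<close>

context
  fixes T :: real and k :: "(real \<Rightarrow> 'l) \<Rightarrow> 'm::banach"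
  assumes T: "T > 0" and k: "is_MGp \<sigma>\<^sub>0 j 2 T k"
begin

abbreviation M0 where "M0 \<equiv> MGp0 j 2 T"

lemma k_lincomb: "\<eta> \<in> M0 \<Longrightarrow> \<zeta> \<in> M0 \<Longrightarrow> k (\<lambda>t. a *\<^sub>R \<eta> t + b *\<^sub>R \<zeta> t) = a *\<^sub>R k \<eta> + b *\<^sub>R k \<zeta>"
  and norm_k: "\<eta> \<in> M0 \<Longrightarrow> norm (k \<eta>) = MGp_norm \<sigma>\<^sub>0 j 2 T \<eta>"
  and closure_k: "closure (k ` M0) = UNIV"
  using k unfolding is_MGp_def is_completion_def by blast+

lemma LGp_norm_ito_diff_le:
  assumes "\<eta> \<in> M0" "\<zeta> \<in> M0"
  shows "LGp_norm \<sigma>\<^sub>0 j 2 (ito j T \<eta> - ito j T \<zeta>) \<le> sqrt T * norm (k \<eta> - k \<zeta>)"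
  using LGp_norm_ito_le[OF MGp0_diff(1)[OF assms] T] norm_k[OF MGp0_diff(1)[OF assms]] k_lincomb[OF assms, of 1 "-1"]
  by (simp add: MGp0_diff(2)[OF assms])

definition ito_ext :: "'m \<Rightarrow> 'l" where "ito_ext = cont_ext k M0 (ito j T)"

text \<open>The limit is taken in the norm of \<open>'l\<close>, which is dominated by the second
  moment norm; that the limit is square integrable is shown separately.\<close>

lemma ito_ext_lim:
  assumes x: "\<And>n. x n \<in> M0" "(\<lambda>n. k (x n)) \<longlonglongrightarrow> z" shows "(\<lambda>n. ito j T (x n)) \<longlonglongrightarrow> ito_ext z"
  unfolding ito_ext_def
proof (rule cont_ext_lim[where K = "sqrt T" and V = M0 and j = k and F = "ito j T" and x = x and X = z])
  fix \<eta> \<zeta> assume m: "\<eta> \<in> M0" "\<zeta> \<in> M0"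
  have "ito j T \<eta> - ito j T \<zeta> \<in> LGp j 2 T" using ito_moments(1)[OF MGp0_diff(1)[OF m]] MGp0_diff(2)[OF m] by simp
  then have "norm (ito j T \<eta> - ito j T \<zeta>) \<le> LGp_norm \<sigma>\<^sub>0 j 2 (ito j T \<eta> - ito j T \<zeta>)"
    using T by (intro norm_le_LGp_norm) auto
  then show "dist (ito j T \<eta>) (ito j T \<zeta>) \<le> sqrt T * dist (k \<eta>) (k \<zeta>)"
    using LGp_norm_ito_diff_le[OF m] unfolding dist_norm by linarith
qed (use T x in simp_all)

lemma ito_ext_k: "\<eta> \<in> M0 \<Longrightarrow> ito_ext (k \<eta>) = ito j T \<eta>"
  using ito_ext_lim[of "\<lambda>_. \<eta>" "k \<eta>"] by (simp add: LIMSEQ_const_iff)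

lemma k_sequence: obtains x where "\<And>n. x n \<in> M0" "(\<lambda>n. k (x n)) \<longlonglongrightarrow> z"
  using closure_image_sequence[of z k M0] closure_k by auto

lemma ito_ext_lincomb: "ito_ext (a *\<^sub>R z + b *\<^sub>R w) = a *\<^sub>R ito_ext z + b *\<^sub>R ito_ext w"
proof -
  obtain x where x: "\<And>n. x n \<in> M0" "(\<lambda>n. k (x n)) \<longlonglongrightarrow> z" using k_sequence by metis
  obtain y where y: "\<And>n. y n \<in> M0" "(\<lambda>n. k (y n)) \<longlonglongrightarrow> w" using k_sequence by metis
  let ?s = "\<lambda>n t. a *\<^sub>R x n t + b *\<^sub>R y n t"
  have s: "?s n \<in> M0" for n by (rule MGp0_lincomb(1)[OF x(1) y(1)])
  have "(\<lambda>n. k (?s n)) \<longlonglongrightarrow> a *\<^sub>R z + b *\<^sub>R w" unfolding k_lincomb[OF x(1) y(1)] by (intro tendsto_intros x y)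
  from ito_ext_lim[OF s this] have "(\<lambda>n. a *\<^sub>R ito j T (x n) + b *\<^sub>R ito j T (y n)) \<longlonglongrightarrow> ito_ext (a *\<^sub>R z + b *\<^sub>R w)"
    unfolding MGp0_lincomb(2)[OF x(1) y(1)] .
  moreover have "(\<lambda>n. a *\<^sub>R ito j T (x n) + b *\<^sub>R ito j T (y n)) \<longlonglongrightarrow> a *\<^sub>R ito_ext z + b *\<^sub>R ito_ext w"
    by (intro tendsto_intros ito_ext_lim x y)
  ultimately show ?thesis by (rule LIMSEQ_unique)
qed

lemma linear_ito_ext: "linear ito_ext"
proof (rule linearI)
  show "ito_ext (z + w) = ito_ext z + ito_ext w" for z w using ito_ext_lincomb[of 1 z 1 w] by simp
  show "ito_ext (a *\<^sub>R z) = a *\<^sub>R ito_ext z" for a z using ito_ext_lincomb[of a z 0 z] by simp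
qed

text \<open>The integrals along an approximating sequence are Cauchy for the second moment norm, so
  \<open>LGp_complete\<close> applies to their limit in \<open>'l\<close>.\<close>

lemma ito_ext_LGp: "ito_ext z \<in> LGp j 2 T" "LGp_norm \<sigma>\<^sub>0 j 2 (ito_ext z) \<le> sqrt T * norm z"
proof -
  obtain x where x: "\<And>n. x n \<in> M0" "(\<lambda>n. k (x n)) \<longlonglongrightarrow> z" using k_sequence by metis
  have T0: "T \<ge> 0" using T by simp
  have C: "\<exists>N. \<forall>m\<ge>N. \<forall>n\<ge>N. LGp_norm \<sigma>\<^sub>0 j 2 (ito j T (x m) - ito j T (x n)) < e" if e: "e > 0" for e
  proof -
    have "e / sqrt T > 0" using e T by simp
    then obtain N where N: "\<forall>m\<ge>N. \<forall>n\<ge>N. norm (k (x m) - k (x n)) < e / sqrt T"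
      using CauchyD[OF LIMSEQ_imp_Cauchy[OF x(2)]] by metis
    have "LGp_norm \<sigma>\<^sub>0 j 2 (ito j T (x m) - ito j T (x n)) < e" if mn: "m \<ge> N" "n \<ge> N" for m n
    proof -
      have "sqrt T * norm (k (x m) - k (x n)) < sqrt T * (e / sqrt T)" using N mn T by (intro mult_strict_left_mono) auto
      moreover have "sqrt T * (e / sqrt T) = e" using T by simp
      ultimately show ?thesis using LGp_norm_ito_diff_le[OF x(1) x(1), of m n] by linarith
    qed
    then show ?thesis by blast
  qed
  note mem = ito_moments(1)[OF x(1)]
  note L = LGp_complete[OF mem T0 ito_ext_lim[OF x] C]
  show "ito_ext z \<in> LGp j 2 T" by (rule L(1))
  have "LGp_norm \<sigma>\<^sub>0 j 2 (ito_ext z) \<le> LGp_norm \<sigma>\<^sub>0 j 2 (ito_ext z - ito j T (x n)) + sqrt T * norm (k (x n))" for n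
    using LGp_norm_triangle[OF LGp_diff[OF L(1) mem T0] mem T0, of n n] LGp_norm_ito_le[OF x(1) T, of n] norm_k[OF x(1), of n]
    by simp
  moreover have "(\<lambda>n. LGp_norm \<sigma>\<^sub>0 j 2 (ito_ext z - ito j T (x n)) + sqrt T * norm (k (x n))) \<longlonglongrightarrow> 0 + sqrt T * norm z"
    by (intro tendsto_intros L(2) x(2))
  ultimately have "LGp_norm \<sigma>\<^sub>0 j 2 (ito_ext z) \<le> 0 + sqrt T * norm z" by (intro LIMSEQ_le_const) auto
  then show "LGp_norm \<sigma>\<^sub>0 j 2 (ito_ext z) \<le> sqrt T * norm z" by simp
qed

end

end

lemma sqrt_mult_less: "T > 0 \<Longrightarrow> x < e / sqrt T \<Longrightarrow> sqrt T * x < (e::real)"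
  by (simp add: pos_less_divide_eq mult.commute)

theorem lemma30:
  fixes \<sigma>\<^sub>0 T :: real
    and j :: "(cpath \<Rightarrow> real) \<Rightarrow> 'l::banach"
    and k :: "(real \<Rightarrow> 'l) \<Rightarrow> 'm::banach"
  assumes "0 \<le> \<sigma>\<^sub>0" and "\<sigma>\<^sub>0 \<le> 1" and "T > 0"
    and "is_LG1 \<sigma>\<^sub>0 j" and "is_MGp \<sigma>\<^sub>0 j 2 T k"
  shows
    "(\<forall>N ts \<xi>. simple_repr j 2 T N ts \<xi> \<longrightarrow>
        ito j T (simple_process N ts \<xi>) = ito_sum j N ts \<xi>) \<and>
     (\<forall>\<eta>\<in>MGp0 j 2 T. ito j T \<eta> \<in> LGp j 2 T) \<and>
     (\<forall>\<eta>\<in>MGp0 j 2 T. \<forall>\<zeta>\<in>MGp0 j 2 T. \<forall>a b.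
        ito j T (\<lambda>t. a *\<^sub>R \<eta> t + b *\<^sub>R \<zeta> t) = a *\<^sub>R ito j T \<eta> + b *\<^sub>R ito j T \<zeta>) \<and>
     (\<forall>\<eta>\<in>MGp0 j 2 T. \<forall>e>0. \<exists>d>0. \<forall>\<zeta>\<in>MGp0 j 2 T.
        MGp_norm \<sigma>\<^sub>0 j 2 T (\<lambda>t. \<zeta> t - \<eta> t) < d \<longrightarrow>
        LGp_norm \<sigma>\<^sub>0 j 2 (ito j T \<zeta> - ito j T \<eta>) < e) \<and>
     (\<exists>J :: 'm \<Rightarrow> 'l. linear J \<and> (\<forall>z. J z \<in> LGp j 2 T) \<and>
        (\<forall>z. \<forall>e>0. \<exists>d>0. \<forall>w. norm (w - z) < d \<longrightarrow> LGp_norm \<sigma>\<^sub>0 j 2 (J w - J z) < e) \<and>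
        (\<forall>\<eta>\<in>MGp0 j 2 T. J (k \<eta>) = ito j T \<eta>)) \<and>
     (\<forall>\<eta>\<in>MGp0 j 2 T.
        LE \<sigma>\<^sub>0 j (ito j T \<eta>) = 0 \<and>
        LE \<sigma>\<^sub>0 j (Lpow j 2 (ito j T \<eta>)) \<le> integral {0..T} (\<lambda>t. LE \<sigma>\<^sub>0 j (Lpow j 2 (\<eta> t))))"
proof -
  interpret G_expectation \<sigma>\<^sub>0 j using assms by unfold_locales
  note T = assms(3) and k = assms(5)
  have continuous: "\<exists>d>0. \<forall>\<zeta>\<in>MGp0 j 2 T. MGp_norm \<sigma>\<^sub>0 j 2 T (\<lambda>t. \<zeta> t - \<eta> t) < d \<longrightarrow>
      LGp_norm \<sigma>\<^sub>0 j 2 (ito j T \<zeta> - ito j T \<eta>) < e" if \<eta>: "\<eta> \<in> MGp0 j 2 T" and e: "e > 0" for \<eta> e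
  proof (intro exI conjI ballI impI)
    \<comment> \<open>The integral has Lipschitz constant \<open>sqrt T\<close>, which suggests this
      \<open>d\<close>.\<close>
    show "e / sqrt T > 0" using e T by simp
    fix \<zeta> assume \<zeta>: "\<zeta> \<in> MGp0 j 2 T" and lt: "MGp_norm \<sigma>\<^sub>0 j 2 T (\<lambda>t. \<zeta> t - \<eta> t) < e / sqrt T"
    show "LGp_norm \<sigma>\<^sub>0 j 2 (ito j T \<zeta> - ito j T \<eta>) < e"
      using LGp_norm_ito_le[OF MGp0_diff(1)[OF \<zeta> \<eta>] T] sqrt_mult_less[OF T lt] unfolding MGp0_diff(2)[OF \<zeta> \<eta>] by linarith
  qed
  have "\<exists>d>0. \<forall>w. norm (w - z) < d \<longrightarrow> LGp_norm \<sigma>\<^sub>0 j 2 (ito_ext T k w - ito_ext T k z) < e" if e: "e > 0" for z e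
  proof (intro exI conjI allI impI)
    show "e / sqrt T > 0" using e T by simp
    fix w assume "norm (w - z) < e / sqrt T"
    then show "LGp_norm \<sigma>\<^sub>0 j 2 (ito_ext T k w - ito_ext T k z) < e"
      using ito_ext_LGp(2)[OF T k, of "w - z"] sqrt_mult_less[OF T] unfolding linear_diff[OF linear_ito_ext[OF T k]] by fastforce
  qed
  then have J: "\<exists>J :: 'm \<Rightarrow> 'l. linear J \<and> (\<forall>z. J z \<in> LGp j 2 T) \<and>
      (\<forall>z. \<forall>e>0. \<exists>d>0. \<forall>w. norm (w - z) < d \<longrightarrow> LGp_norm \<sigma>\<^sub>0 j 2 (J w - J z) < e) \<and>
      (\<forall>\<eta>\<in>MGp0 j 2 T. J (k \<eta>) = ito j T \<eta>)"
    using linear_ito_ext[OF T k] ito_ext_LGp(1)[OF T k] ito_ext_k[OF T k] by (intro exI[of _ "ito_ext T k"]) blast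
  show ?thesis
    by (intro conjI allI ballI impI) (rule ito_eq ito_moments MGp0_lincomb(2) continuous J; assumption)+
qed

end
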